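(* Let $R$ be an irreducible root system and let a real number $k_c$ be given for each root length $c$ of $R$. Let $\mathcal{H}=-\Delta+\sum_c a_cU_c$, where the sum is over all root lengths, $a_c=k_c(k_c-1)$ if $c$ is the length of a non-multiplicable root, and $a_c=k_c(k_c+k_{2c}-1)$ if $R$ is non-reduced and $c$ is the length of the short roots. Let $F=\prod_c|A_c|^{k_c}$. Then the subspace $F\,\mathrm{trig}(P)^W$ is dense in $L^2(A,m)$, where $A$ is the fundamental alcove and $m$ is Lebesgue measure on $A$. Moreover, if $k_c\ge 0$ for all root lengths $c$, then the operator $\mathcal{H}$ is essentially self-adjoint on the domain $F\,\mathrm{trig}(P)^W\subset L^2(A,m)$.
   Context: Let $V$ be a finite-dimensional real vector space with a positive-definite inner product $(\cdot,\cdot)$, used to identify $V$ with $V^*$; $\Delta$ is the corresponding Laplacian on $V$. For nonzero $\alpha\in V^*$ put $\breve\alpha=2\alpha/(\alpha,\alpha)$ and $s_\alpha(\beta)=\beta-(\breve\alpha,\beta)\alpha$. A root system is a finite spanning subset $R\subset V^*$ with $0\notin R$, $s_\alpha(R)\subset R$ and $(\breve\alpha,\beta)\in\mathbb{Z}$ for all $\alpha,\beta\in R$. It is reduced if the only roots proportional to a root $\alpha$ are $\pm\alpha$; an irreducible non-reduced one is of type $BC_n$, with short roots $\pm\epsilon_i$, medium roots $\pm\epsilon_i\pm\epsilon_j$ ($i\ne j$) and long roots $\pm2\epsilon_i$. A root $\alpha\in R$ is non-multiplicable if $2\alpha\notin R$. $P=\{\lambda\in V^*:(\breve\alpha,\lambda)\in\mathbb{Z}\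 \forall\alpha\in R\}$ is the weight lattice and $W$ is the Weyl group, generated by the $s_\alpha$, $\alpha\in R$. Fix an open Weyl chamber $C$; $R^+$ is the set of roots having positive inner product with all elements of $C$. A root length is a number $c=\|\alpha\|$ with $\alpha\in R$; $R_c^+=\{\alpha\in R^+:\|\alpha\|=c\}$. Put $$U_c=\frac{c^2}{4}\sum_{\alpha\in R_c^+}\csc^2\frac{\alpha}{2},\quad A_c=\prod_{\alpha\in R_c^+}\sin\frac{\alpha}{2}.$$ Elements of $V^*$ are viewed as linear functions on $V$. All functions are restricted to the fundamental alcove $A\subset V$: the connected component of $V\setminus\bigcup_{\alpha\in R}\{u:\alpha(u)\in2\pi\mathbb{Z}\}$ that is contained in $C$ (under $V\cong V^*$) and has the origin as a boundary point. $\mathrm{trig}(P)$ is the complex span of the functions $e^{i\lambda}$, $\lambda\in P$; $W$ acts by $w\cdot e^{i\lambda}=e^{iw(\lambda)}$ and $\mathrm{trig}(P)^W$ is the subspace of invariants. $F\,\mathrm{trig}(P)^W=\{F\phi:\phi\in\mathrm{trig}(P)^W\}$.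
   Formalization: For short roots of non-reduced R, a_c is k_c(k_c+2k_{2c}-1), since the printed formula fails (BC_1, k_c=k_{2c}=1/2: HF is not in L^2). Density of F trig(P)^W is stated when F is in L^2; for other real k_c, density of its intersection with L^2 is stated. *)

theory Defs
  imports "HOL-Analysis.Analysis"
begin

text \<open>
  The space \<open>V\<close> is a type \<open>'a\<close> of class \<open>euclidean_space\<close>, and \<open>V\<close> is identified with its
  dual through the inner product: a root or weight \<open>\<mu>\<close> is a vector, whose value at
  \<open>u\<close> is \<open>\<mu> \<bullet> u\<close>.
\<close>

section \<open>Root systems\<close>

definition coroot :: "'a::euclidean_space \<Rightarrow> 'a" where
  "coroot \<alpha> = (2 / (\<alpha> \<bullet> \<alpha>)) *\<^sub>R \<alpha>"

definition root_reflection :: "'a::euclidean_space \<Rightarrow> 'a \<Rightarrow> 'a" where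
  "root_reflection \<alpha> \<beta> = \<beta> - (coroot \<alpha> \<bullet> \<beta>) *\<^sub>R \<alpha>"

definition root_system :: "'a::euclidean_space set \<Rightarrow> bool" where
  "root_system R \<longleftrightarrow>
     finite R \<and> span R = UNIV \<and> 0 \<notin> R \<and>
     (\<forall>\<alpha>\<in>R. root_reflection \<alpha> ` R \<subseteq> R) \<and>
     (\<forall>\<alpha>\<in>R. \<forall>\<beta>\<in>R. coroot \<alpha> \<bullet> \<beta> \<in> \<int>)"

text \<open>\<open>R \<noteq> {}\<close> is not required separately: \<open>R\<close> spans a space of positive dimension.\<close>

definition irreducible_root_system :: "'a::euclidean_space set \<Rightarrow> bool" where
  "irreducible_root_system R \<longleftrightarrow>
     root_system R \<and>
     \<not> (\<exists>R1 R2. R1 \<noteq> {} \<and> R2 \<noteq> {} \<and> R1 \<union> R2 = R \<and> R1 \<inter> R2 = {} \<and>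
          (\<forall>\<alpha>\<in>R1. \<forall>\<beta>\<in>R2. \<alpha> \<bullet> \<beta> = 0))"

definition non_multiplicable :: "'a::euclidean_space set \<Rightarrow> 'a \<Rightarrow> bool" where
  "non_multiplicable R \<alpha> \<longleftrightarrow> \<alpha> \<in> R \<and> 2 *\<^sub>R \<alpha> \<notin> R"

text \<open>Reflections are involutions, so closing under composition with them gives a group.\<close>

inductive_set weyl_group :: "'a::euclidean_space set \<Rightarrow> ('a \<Rightarrow> 'a) set" for R where
  id: "id \<in> weyl_group R"
| refl: "\<lbrakk>w \<in> weyl_group R; \<alpha> \<in> R\<rbrakk> \<Longrightarrow> root_reflection \<alpha> \<circ> w \<in> weyl_group R"

definition weight_lattice :: "'a::euclidean_space set \<Rightarrow> 'a set" where
  "weight_lattice R = {\<mu>. \<forall>\<alpha>\<in>R. coroot \<alpha> \<bullet> \<mu> \<in> \<int>}"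

definition weyl_chamber :: "'a::euclidean_space set \<Rightarrow> 'a set \<Rightarrow> bool" where
  "weyl_chamber R C \<longleftrightarrow> C \<in> components (- (\<Union>\<alpha>\<in>R. {u. \<alpha> \<bullet> u = 0}))"

definition fundamental_alcove :: "'a::euclidean_space set \<Rightarrow> 'a set \<Rightarrow> 'a set \<Rightarrow> bool" where
  "fundamental_alcove R C A \<longleftrightarrow>
     A \<in> components (- (\<Union>\<alpha>\<in>R. {u. \<exists>n::int. \<alpha> \<bullet> u = 2 * pi * of_int n})) \<and>
     A \<subseteq> C \<and> 0 \<in> frontier A"

definition root_lengths :: "'a::euclidean_space set \<Rightarrow> real set" where
  "root_lengths R = norm ` R"

definition positive_roots :: "'a::euclidean_space set \<Rightarrow> 'a set \<Rightarrow> 'a set" where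
  "positive_roots R C = {\<alpha>\<in>R. \<forall>v\<in>C. \<alpha> \<bullet> v > 0}"

definition positive_roots_of_length ::
    "'a::euclidean_space set \<Rightarrow> 'a set \<Rightarrow> real \<Rightarrow> 'a set" where
  "positive_roots_of_length R C c = {\<alpha> \<in> positive_roots R C. norm \<alpha> = c}"


section \<open>The operator and its domain\<close>

definition U_len :: "'a::euclidean_space set \<Rightarrow> 'a set \<Rightarrow> real \<Rightarrow> 'a \<Rightarrow> real" where
  "U_len R C c u =
     c\<^sup>2 / 4 * (\<Sum>\<alpha>\<in>positive_roots_of_length R C c. 1 / (sin ((\<alpha> \<bullet> u) / 2))\<^sup>2)"

definition A_len :: "'a::euclidean_space set \<Rightarrow> 'a set \<Rightarrow> real \<Rightarrow> 'a \<Rightarrow> real" where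
  "A_len R C c u = (\<Prod>\<alpha>\<in>positive_roots_of_length R C c. sin ((\<alpha> \<bullet> u) / 2))"

definition F_fun ::
    "'a::euclidean_space set \<Rightarrow> 'a set \<Rightarrow> (real \<Rightarrow> real) \<Rightarrow> 'a \<Rightarrow> real" where
  "F_fun R C k u = (\<Prod>c\<in>root_lengths R. \<bar>A_len R C c u\<bar> powr k c)"

text \<open>
  In an irreducible \<open>R\<close> all roots of one length are conjugate under the Weyl group, so the
  second case occurs exactly when \<open>R\<close> is non-reduced and \<open>c\<close> is the length of its short
  roots; then \<open>2 * c\<close> is a root length too.

  The factor \<open>2\<close> in front of \<open>k (2 * c)\<close> is needed for \<open>F_fun R C k\<close> to be an eigenfunction of
  \<open>hamiltonian R C k\<close>. In type \<open>BC\<^sub>1\<close>, with \<open>x = \<alpha>(u) / 2\<close> for the short positive root \<open>\<alpha>\<close> and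
  \<open>F = sin(x)\<^sup>k (sin 2x)\<^sup>l\<close>, the identity \<open>cot x \<cdot> cot 2x = (csc\<^sup>2 x - 2) / 2\<close> gives
  \<open>F'' / F = k (k + 2 l - 1) csc\<^sup>2 x + 4 l (l - 1) csc\<^sup>2 2x - (k + 2 l)\<^sup>2\<close>.
  With \<open>k (k + l - 1)\<close> instead and \<open>k = l = 1/2\<close>, the image of \<open>F\<close> would be of order \<open>1 / x\<close>
  at \<open>0\<close>, hence not square integrable.
\<close>

definition coupling :: "'a::euclidean_space set \<Rightarrow> (real \<Rightarrow> real) \<Rightarrow> real \<Rightarrow> real" where
  "coupling R k c =
     (if \<exists>\<alpha>. non_multiplicable R \<alpha> \<and> norm \<alpha> = c then k c * (k c - 1)
      else k c * (k c + 2 * k (2 * c) - 1))"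

definition laplacian :: "('a::euclidean_space \<Rightarrow> complex) \<Rightarrow> 'a \<Rightarrow> complex" where
  "laplacian f u =
     (\<Sum>b\<in>Basis. vector_derivative
        (\<lambda>t. vector_derivative (\<lambda>s. f (u + s *\<^sub>R b)) (at t)) (at 0))"

definition hamiltonian ::
    "'a::euclidean_space set \<Rightarrow> 'a set \<Rightarrow> (real \<Rightarrow> real) \<Rightarrow> ('a \<Rightarrow> complex) \<Rightarrow> 'a \<Rightarrow> complex" where
  "hamiltonian R C k f u =
     - laplacian f u +
     complex_of_real (\<Sum>c\<in>root_lengths R. coupling R k c * U_len R C c u) * f u"

text \<open>
  The invariants of \<open>trig(P)\<close> for the linear action with \<open>w \<cdot> exp(i \<mu>) = exp(i w(\<mu>))\<close>. The
  exponentials are linearly independent, so the representing sum is immaterial.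
\<close>

definition trig_sum :: "'a::euclidean_space set \<Rightarrow> ('a \<Rightarrow> complex) \<Rightarrow> ('a \<Rightarrow> 'a) \<Rightarrow> 'a \<Rightarrow> complex"
  where "trig_sum S a w = (\<lambda>u. \<Sum>\<mu>\<in>S. a \<mu> * exp (\<i> * complex_of_real (w \<mu> \<bullet> u)))"

definition trig_invariants :: "'a::euclidean_space set \<Rightarrow> ('a \<Rightarrow> complex) set" where
  "trig_invariants R =
     {trig_sum S a id | S a. finite S \<and> S \<subseteq> weight_lattice R \<and>
        (\<forall>w\<in>weyl_group R. trig_sum S a w = trig_sum S a id)}"

definition F_trig ::
    "'a::euclidean_space set \<Rightarrow> 'a set \<Rightarrow> (real \<Rightarrow> real) \<Rightarrow> ('a \<Rightarrow> complex) set" where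
  "F_trig R C k = {(\<lambda>u. complex_of_real (F_fun R C k u) * \<phi> u) | \<phi>. \<phi> \<in> trig_invariants R}"


section \<open>The Hilbert space of square-integrable functions and unbounded operators\<close>

text \<open>
  Elements are represented by functions. The notions below depend only on the classes
  modulo almost-everywhere equality; in particular the closure and the adjoint of a graph
  contain all representatives of their elements.
\<close>

definition L2 :: "'a measure \<Rightarrow> ('a \<Rightarrow> complex) set" where
  "L2 M = {f \<in> borel_measurable M. integrable M (\<lambda>x. (cmod (f x))\<^sup>2)}"

definition L2_inner :: "'a measure \<Rightarrow> ('a \<Rightarrow> complex) \<Rightarrow> ('a \<Rightarrow> complex) \<Rightarrow> complex" where
  "L2_inner M f g = (LINT x|M. f x * cnj (g x))"

definition L2_norm :: "'a measure \<Rightarrow> ('a \<Rightarrow> complex) \<Rightarrow> real" where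
  "L2_norm M f = sqrt (LINT x|M. (cmod (f x))\<^sup>2)"

definition L2_subspace :: "'a measure \<Rightarrow> ('a \<Rightarrow> complex) set \<Rightarrow> bool" where
  "L2_subspace M D \<longleftrightarrow>
     D \<subseteq> L2 M \<and> (\<lambda>x. 0) \<in> D \<and>
     (\<forall>f\<in>D. \<forall>g\<in>D. (\<lambda>x. f x + g x) \<in> D) \<and>
     (\<forall>z. \<forall>f\<in>D. (\<lambda>x. z * f x) \<in> D)"

definition L2_dense :: "'a measure \<Rightarrow> ('a \<Rightarrow> complex) set \<Rightarrow> bool" where
  "L2_dense M D \<longleftrightarrow>
     D \<subseteq> L2 M \<and> (\<forall>f\<in>L2 M. \<forall>e>0. \<exists>g\<in>D. L2_norm M (\<lambda>x. f x - g x) < e)"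

definition operator_graph ::
    "(('a \<Rightarrow> complex) \<Rightarrow> 'a \<Rightarrow> complex) \<Rightarrow> ('a \<Rightarrow> complex) set \<Rightarrow>
     (('a \<Rightarrow> complex) \<times> ('a \<Rightarrow> complex)) set" where
  "operator_graph T D = {(f, T f) | f. f \<in> D}"

definition graph_closure ::
    "'a measure \<Rightarrow> (('a \<Rightarrow> complex) \<times> ('a \<Rightarrow> complex)) set \<Rightarrow>
     (('a \<Rightarrow> complex) \<times> ('a \<Rightarrow> complex)) set" where
  "graph_closure M G =
     {(f, g). f \<in> L2 M \<and> g \<in> L2 M \<and>
        (\<forall>e>0. \<exists>(f', g')\<in>G. L2_norm M (\<lambda>x. f x - f' x) < e \<and> L2_norm M (\<lambda>x. g x - g' x) < e)}"

definition graph_adjoint ::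
    "'a measure \<Rightarrow> (('a \<Rightarrow> complex) \<times> ('a \<Rightarrow> complex)) set \<Rightarrow>
     (('a \<Rightarrow> complex) \<times> ('a \<Rightarrow> complex)) set" where
  "graph_adjoint M G =
     {(f, g). f \<in> L2 M \<and> g \<in> L2 M \<and> (\<forall>(f', g')\<in>G. L2_inner M g' f = L2_inner M f' g)}"

text \<open>
  A densely defined operator is essentially self-adjoint if its closure is self-adjoint.
  The closure is then automatically (the graph of) a linear operator: the adjoint of a
  densely defined graph is a single-valued linear relation modulo null functions.
\<close>

definition essentially_self_adjoint ::
    "'a measure \<Rightarrow> (('a \<Rightarrow> complex) \<Rightarrow> 'a \<Rightarrow> complex) \<Rightarrow> ('a \<Rightarrow> complex) set \<Rightarrow> bool" where
  "essentially_self_adjoint M T D \<longleftrightarrow>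
     L2_subspace M D \<and> L2_dense M D \<and> T ` D \<subseteq> L2 M \<and>
     (let G = graph_closure M (operator_graph T D) in graph_adjoint M G = G)"

end

theory Submission
  imports Defs "HOL-Complex_Analysis.Complex_Analysis"
begin

text \<open>
  Conjugating \<open>H\<close> by \<open>F\<close> gives \<open>E - L\<close> with a constant \<open>E\<close> and
  \<open>L = \<Delta> + \<Sum>\<alpha>. k\<^sub>\<alpha> cot (\<alpha> / 2) \<partial>\<^sub>\<alpha>\<close>, the sum being over the positive roots. The potential comes
  out right because the sum of \<open>k\<^sub>\<alpha> k\<^sub>\<beta> (\<alpha>, \<beta>) cot (\<alpha> / 2) cot (\<beta> / 2)\<close> over pairs of
  non-proportional positive roots is constant: on a line in an integral direction it is a rational
  function whose residues cancel in pairs under the reflections, so Liouville's theorem applies.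

  On the orbit sum of a weight, the cotangents cancel against differences of exponentials along root
  strings. Hence \<open>L\<close> preserves the finite-dimensional space spanned by the orbit sums of the weights
  in a ball. It is symmetric with respect to \<open>F\<^sup>2 m\<close>, because \<open>F\<^sup>2 L \<phi>\<close> is the divergence of
  \<open>F\<^sup>2 \<nabla> \<phi>\<close>. A symmetric operator whose domain is dense and is a directed union of
  finite-dimensional invariant subspaces is essentially self-adjoint: the orthogonal projections
  onto these subspaces approximate the graph of the adjoint.

  For the density, the invariants separate the points of the closed alcove, since an orbit of the
  affine Weyl group meets it at most once; then the Stone-Weierstrass theorem applies.
\<close>

section \<open>Root systems and the fundamental alcove\<close>

text \<open>Separation of points depends on the lattice: the exponentials of all weights agree at
  two points exactly when these differ by \<open>2 * pi\<close> times a vector that is integral on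
  \<open>P\<close>, and such vectors must be translations of the affine Weyl group. Hence the
  integral expansions of coroots. In the density statement \<open>k\<close> may be negative, so that
  \<open>F_fun\<close> can blow up at the boundary; a high power of an invariant that vanishes on
  the walls tames it. In the self-adjointness statement the difficulty is the opposite one: where
  \<open>k\<close> is small or zero, \<open>F\<close> hardly vanishes on the walls, and the decay of
  \<open>F\<^sup>2\<close> does not remove the boundary terms of the integration by parts. They
  vanish because an invariant function has zero derivative across each wall, quantitatively because
  \<open>cot (\<alpha> / 2) * \<partial>\<^sub>\<alpha> \<phi>\<close> is bounded. Both the
  invariant subspaces and the symmetry thus have one source, the cancellation of a cotangent against
  the difference of two exponentials exchanged by a reflection.\<close>

lemma linear_root_reflection: "linear (root_reflection \<alpha>)"
  by (rule linearI) (simp_all add: root_reflection_def inner_add_right algebra_simps)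

lemma root_reflection_inner:
  assumes "\<alpha> \<noteq> 0"
  shows "root_reflection \<alpha> x \<bullet> root_reflection \<alpha> y = x \<bullet> y"
proof -
  have "\<alpha> \<bullet> \<alpha> \<noteq> 0" using assms by simp
  then show ?thesis
    by (simp add: root_reflection_def coroot_def inner_diff_left inner_diff_right inner_commute
        field_simps)
qed

lemma root_reflection_idem:
  assumes "\<alpha> \<noteq> 0"
  shows "root_reflection \<alpha> (root_reflection \<alpha> x) = x"
proof -
  have "\<alpha> \<bullet> \<alpha> \<noteq> 0" using assms by simp
  then show ?thesis
    by (simp add: root_reflection_def coroot_def inner_diff_right scaleR_left_distrib[symmetric]
        field_simps)
qed

lemma root_reflection_self: "\<alpha> \<noteq> 0 \<Longrightarrow> root_reflection \<alpha> \<alpha> = - \<alpha>"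
  by (simp add: root_reflection_def coroot_def scaleR_2)

lemma coroot_isometry:
  assumes "linear w" "w \<alpha> \<bullet> w \<alpha> = \<alpha> \<bullet> \<alpha>"
  shows "coroot (w \<alpha>) = w (coroot \<alpha>)"
  using assms by (simp add: coroot_def linear_scale)

lemma inner_coroot_self: "\<alpha> \<noteq> 0 \<Longrightarrow> \<alpha> \<bullet> coroot \<alpha> = 2"
  by (simp add: coroot_def)

section \<open>Roots, weights and the finite Weyl group\<close>

locale root_sys =
  fixes R :: "'a::euclidean_space set"
  assumes root_system: "root_system R"
begin

abbreviation "W \<equiv> weyl_group R"
abbreviation "P \<equiv> weight_lattice R"

lemma finite_R: "finite R"
  and span_R: "span R = UNIV"
  and root_nonzero: "\<alpha> \<in> R \<Longrightarrow> \<alpha> \<noteq> 0"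
  and root_reflection_root: "\<alpha> \<in> R \<Longrightarrow> \<beta> \<in> R \<Longrightarrow> root_reflection \<alpha> \<beta> \<in> R"
  and coroot_root_int: "\<alpha> \<in> R \<Longrightarrow> \<beta> \<in> R \<Longrightarrow> coroot \<alpha> \<bullet> \<beta> \<in> \<int>"
  using root_system unfolding root_system_def by auto

lemma uminus_root: "\<alpha> \<in> R \<Longrightarrow> - \<alpha> \<in> R"
  using root_reflection_root[of \<alpha> \<alpha>] root_reflection_self[of \<alpha>] root_nonzero by auto

lemma root_subset_weights: "R \<subseteq> P"
  using coroot_root_int by (auto simp: weight_lattice_def)

lemma weight_coroot_int: "\<mu> \<in> P \<Longrightarrow> \<alpha> \<in> R \<Longrightarrow> coroot \<alpha> \<bullet> \<mu> \<in> \<int>"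
  by (auto simp: weight_lattice_def)

lemma weight_zero: "0 \<in> P"
  by (simp add: weight_lattice_def)

lemma weight_add: "\<nu> \<in> P \<Longrightarrow> \<mu> \<in> P \<Longrightarrow> \<nu> + \<mu> \<in> P"
  by (simp add: weight_lattice_def inner_add_right)

lemma weight_uminus: "\<nu> \<in> P \<Longrightarrow> - \<nu> \<in> P"
  by (simp add: weight_lattice_def)

lemma weight_int_multiple: "\<nu> \<in> P \<Longrightarrow> m \<in> \<int> \<Longrightarrow> m *\<^sub>R \<nu> \<in> P"
  by (simp add: weight_lattice_def)

lemma weyl_linear: "w \<in> W \<Longrightarrow> linear w"
proof (induction rule: weyl_group.induct)
  case id
  show ?case using linear_id by (simp add: id_def)
next
  case (refl w \<alpha>)
  then show ?case using linear_compose linear_root_reflection by blast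
qed

lemma weyl_inner: "w \<in> W \<Longrightarrow> w x \<bullet> w y = x \<bullet> y"
  by (induction arbitrary: x y rule: weyl_group.induct) (auto simp: root_reflection_inner root_nonzero)

lemma weyl_norm: "w \<in> W \<Longrightarrow> norm (w x) = norm x"
  by (simp add: norm_eq_sqrt_inner weyl_inner)

lemma weyl_root: "w \<in> W \<Longrightarrow> \<alpha> \<in> R \<Longrightarrow> w \<alpha> \<in> R"
  by (induction arbitrary: \<alpha> rule: weyl_group.induct) (auto simp: root_reflection_root)

lemma weyl_comp: "w \<in> W \<Longrightarrow> w' \<in> W \<Longrightarrow> w \<circ> w' \<in> W"
  by (induction rule: weyl_group.induct) (auto simp: comp_assoc intro: weyl_group.refl)

lemma root_reflection_weyl: "\<alpha> \<in> R \<Longrightarrow> root_reflection \<alpha> \<in> W"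
  using weyl_group.refl[OF weyl_group.id] by fastforce

lemma weyl_inverse:
  assumes "w \<in> W"
  obtains w' where "w' \<in> W" "\<And>x. w (w' x) = x" "\<And>x. w' (w x) = x"
proof -
  have "\<exists>w'\<in>W. (\<forall>x. w (w' x) = x) \<and> (\<forall>x. w' (w x) = x)"
    using assms
  proof (induction rule: weyl_group.induct)
    case id
    show ?case by (rule bexI[OF _ weyl_group.id]) simp
  next
    case (refl w \<alpha>)
    then obtain w' where w': "w' \<in> W" "\<forall>x. w (w' x) = x" "\<forall>x. w' (w x) = x" by blast
    have "w' \<circ> root_reflection \<alpha> \<in> W"
      using weyl_comp[OF w'(1) root_reflection_weyl] refl by blast
    then show ?case
      by (rule bexI[rotated]) (use w' refl in \<open>auto simp: root_reflection_idem root_nonzero\<close>)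
  qed
  then show ?thesis using that by blast
qed

lemma weyl_bij: "w \<in> W \<Longrightarrow> bij w"
  by (erule weyl_inverse) (metis bijI' )

lemma weyl_image_R: "w \<in> W \<Longrightarrow> w ` R = R"
  by (intro endo_inj_surj finite_R) (auto intro: weyl_root inj_on_subset[OF bij_is_inj[OF weyl_bij]])

lemma weyl_bij_R: "w \<in> W \<Longrightarrow> bij_betw w R R"
  unfolding bij_betw_def using weyl_image_R[of w] inj_on_subset[OF bij_is_inj[OF weyl_bij]] by auto

lemma weyl_coroot: "w \<in> W \<Longrightarrow> coroot (w \<alpha>) = w (coroot \<alpha>)"
  by (rule coroot_isometry) (auto simp: weyl_inner weyl_linear)

lemma weyl_weight:
  assumes "w \<in> W" "\<nu> \<in> P"
  shows "w \<nu> \<in> P"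
  unfolding weight_lattice_def
proof safe
  fix \<alpha> assume \<alpha>: "\<alpha> \<in> R"
  obtain w' where w': "w' \<in> W" "\<And>x. w (w' x) = x" using weyl_inverse[OF assms(1)] by metis
  have "coroot \<alpha> \<bullet> w \<nu> = w (coroot (w' \<alpha>)) \<bullet> w \<nu>"
    using w' weyl_coroot[OF assms(1), of "w' \<alpha>"] by simp
  also have "\<dots> = coroot (w' \<alpha>) \<bullet> \<nu>" by (rule weyl_inner[OF assms(1)])
  finally show "coroot \<alpha> \<bullet> w \<nu> \<in> \<int>"
    using weyl_root[OF w'(1) \<alpha>] assms(2) by (simp add: weight_lattice_def)
qed

lemma bij_weyl_comp:
  assumes "w \<in> W" shows "bij_betw (\<lambda>v. v \<circ> w) W W"
proof -
  obtain w' where w': "w' \<in> W" "\<And>x. w (w' x) = x" "\<And>x. w' (w x) = x"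
    using weyl_inverse[OF assms] by blast
  show ?thesis
    by (rule bij_betw_byWitness[where f' = "\<lambda>v. v \<circ> w'"])
      (use w' assms in \<open>auto simp: fun_eq_iff intro: weyl_comp\<close>)
qed

text \<open>Elements of \<open>W\<close> are linear and \<open>R\<close> spans, so each is
  determined by the self-map that it induces on the finite set \<open>R\<close>.\<close>

lemma finite_weyl: "finite W"
proof -
  have "inj_on (\<lambda>w. restrict w R) W"
  proof (rule inj_onI)
    fix w w' assume w: "w \<in> W" "w' \<in> W" "restrict w R = restrict w' R"
    then have "\<And>x. x \<in> R \<Longrightarrow> w x = w' x" by (metis restrict_apply')
    then have "w x = w' x" for x
      using linear_eq_on_span[OF weyl_linear[OF w(1)] weyl_linear[OF w(2)], of R x] span_R by auto
    then show "w = w'" by auto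
  qed
  moreover have "(\<lambda>w. restrict w R) ` W \<subseteq> R \<rightarrow>\<^sub>E R" using weyl_root by auto
  ultimately show ?thesis
    using finite_PiE[OF finite_R, of "\<lambda>_. R"] finite_R by (meson finite_imageD finite_subset)
qed

lemma weyl_nonempty: "W \<noteq> {}"
  using weyl_group.id by blast

lemma span_coroots: "span (coroot ` R) = UNIV"
proof -
  have "R \<subseteq> span (coroot ` R)"
  proof
    fix \<alpha> assume a: "\<alpha> \<in> R"
    have "((\<alpha> \<bullet> \<alpha>) / 2) *\<^sub>R coroot \<alpha> \<in> span (coroot ` R)"
      by (intro span_scale span_base imageI a)
    then show "\<alpha> \<in> span (coroot ` R)" using root_nonzero[OF a] by (simp add: coroot_def)
  qed
  then show ?thesis using span_R by (metis span_mono span_span top.extremum_uniqueI)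
qed

lemma eq_if_coroots_eq:
  assumes "\<And>\<alpha>. \<alpha> \<in> R \<Longrightarrow> coroot \<alpha> \<bullet> x = coroot \<alpha> \<bullet> y"
  shows "x = y"
proof -
  have "coroot \<alpha> \<bullet> (x - y) = 0" if "\<alpha> \<in> R" for \<alpha> using assms[OF that] by (simp add: inner_diff_right)
  note 0 = this
  have "z \<bullet> (x - y) = 0" if "z \<in> span (coroot ` R)" for z
    using that by (induction rule: span_induct_alt) (use 0 in \<open>auto simp: inner_add_left\<close>)
  then have "(x - y) \<bullet> (x - y) = 0" using span_coroots by auto
  then show ?thesis by simp
qed

text \<open>By Cauchy-Schwarz a weight of bounded norm has finitely many possible integer products
  with each coroot, and these integers determine it. This makes the invariant subspaces
  finite-dimensional.\<close>

lemma finite_weights_ball: "finite (P \<inter> {\<mu>. norm \<mu> \<le> r})"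
proof -
  define B where "B = (\<lambda>\<alpha>::'a. {m::int. \<bar>real_of_int m\<bar> \<le> norm (coroot \<alpha>) * r})"
  have "finite (B \<alpha>)" for \<alpha>
  proof (rule finite_subset)
    show "B \<alpha> \<subseteq> {- \<lceil>norm (coroot \<alpha>) * r\<rceil> .. \<lceil>norm (coroot \<alpha>) * r\<rceil>}"
      unfolding B_def by (auto simp: abs_le_iff) linarith+
  qed simp
  then have fin: "finite (PiE R B)" by (intro finite_PiE finite_R) 
  let ?f = "\<lambda>\<mu>. restrict (\<lambda>\<alpha>. \<lfloor>coroot \<alpha> \<bullet> \<mu>\<rfloor>) R"
  have "?f ` (P \<inter> {\<mu>. norm \<mu> \<le> r}) \<subseteq> PiE R B"
  proof (rule image_subsetI, rule PiE_I)
    fix \<mu> \<alpha> assume "\<mu> \<in> P \<inter> {\<mu>. norm \<mu> \<le> r}" and h3: "\<alpha> \<in> R"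
    then have h: "\<mu> \<in> P" "norm \<mu> \<le> r" "\<alpha> \<in> R" by auto
    have "\<bar>coroot \<alpha> \<bullet> \<mu>\<bar> \<le> norm (coroot \<alpha>) * norm \<mu>" by (rule Cauchy_Schwarz_ineq2)
    also have "\<dots> \<le> norm (coroot \<alpha>) * r" by (intro mult_left_mono h) simp
    finally show "restrict (\<lambda>\<alpha>. \<lfloor>coroot \<alpha> \<bullet> \<mu>\<rfloor>) R \<alpha> \<in> B \<alpha>"
      using h weight_coroot_int[of \<mu> \<alpha>] by (auto simp: B_def elim!: Ints_cases)
  qed auto
  moreover have "inj_on ?f (P \<inter> {\<mu>. norm \<mu> \<le> r})"
  proof (rule inj_onI)
    fix x y assume h: "x \<in> P \<inter> {\<mu>. norm \<mu> \<le> r}" "y \<in> P \<inter> {\<mu>. norm \<mu> \<le> r}" "?f x = ?f y"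
    show "x = y"
    proof (rule eq_if_coroots_eq)
      fix \<alpha> assume a: "\<alpha> \<in> R"
      then have "\<lfloor>coroot \<alpha> \<bullet> x\<rfloor> = \<lfloor>coroot \<alpha> \<bullet> y\<rfloor>" using h(3) by (metis restrict_apply')
      then show "coroot \<alpha> \<bullet> x = coroot \<alpha> \<bullet> y"
        using h(1,2) a weight_coroot_int by (metis IntD1 Ints_cases floor_of_int)
    qed
  qed
  ultimately show ?thesis using fin by (meson finite_imageD finite_subset)
qed

text \<open>The two Cartan integers are \<open>2 * c\<close> and \<open>2 / c\<close>; their product
  is 4, so \<open>2 * c\<close> is a positive divisor of 4.\<close>

lemma proportional_roots:
  assumes "\<alpha> \<in> R" "c *\<^sub>R \<alpha> \<in> R" "c > 0"
  shows "c = 1 \<or> c = 2 \<or> c = 1 / 2"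
proof -
  have nz: "\<alpha> \<bullet> \<alpha> \<noteq> 0" using root_nonzero[OF assms(1)] by simp
  have "coroot \<alpha> \<bullet> (c *\<^sub>R \<alpha>) \<in> \<int>" "coroot (c *\<^sub>R \<alpha>) \<bullet> \<alpha> \<in> \<int>"
    using coroot_root_int assms by blast+
  then have "2 * c \<in> \<int>" "2 / c \<in> \<int>" using nz assms(3) by (auto simp: coroot_def field_simps)
  then obtain m n :: int where mn: "2 * c = of_int m" "2 / c = of_int n" by (auto elim!: Ints_cases)
  then have "real_of_int (m * n) = (2 * c) * (2 / c)" by simp
  also have "\<dots> = 4" using assms(3) by simp
  finally have p: "m * n = 4" by linarith
  have "m > 0" using mn(1) assms(3) by (metis mult_pos_pos of_int_0_less_iff zero_less_numeral)
  then have "n > 0" using p by (smt (verit) zero_less_mult_iff)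
  have "m \<le> 4" using p \<open>n > 0\<close> \<open>m > 0\<close> by (metis mult.right_neutral mult_le_cancel_left_pos zless_imp_add1_zle add_0)
  then consider "m = 1" | "m = 2" | "m = 3" | "m = 4" using \<open>m > 0\<close> by linarith
  moreover have "m \<noteq> 3"
  proof
    assume "m = 3"
    then have "3 * n = 4" using p by simp
    then show False by presburger
  qed
  ultimately show ?thesis using mn(1) by cases auto
qed

text \<open>The case distinction in \<open>coupling\<close> is made by root length; by this lemma it depends only on
  whether the given root can be doubled.\<close>

lemma double_root_transfer:
  assumes irr: "irreducible_root_system R"
    and ab: "\<alpha> \<in> R" "\<beta> \<in> R" "norm \<alpha> = norm \<beta>" "2 *\<^sub>R \<alpha> \<in> R"
  shows "2 *\<^sub>R \<beta> \<in> R"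
proof -
  \<comment> \<open>The roots orthogonal to the whole Weyl orbit of \<alpha>. If \<beta> were one of
    them, \<open>R1\<close> and \<open>R - R1\<close> would decompose \<open>R\<close>
    orthogonally.\<close>
  define R1 where "R1 = {\<gamma>\<in>R. \<forall>w\<in>W. w \<alpha> \<bullet> \<gamma> = 0}"
  have "\<exists>w\<in>W. w \<alpha> \<bullet> \<beta> \<noteq> 0"
  proof (rule ccontr)
    assume "\<not> ?thesis"
    then have "\<beta> \<in> R1" using ab by (auto simp: R1_def)
    then have 1: "R1 \<noteq> {}" by blast
    have "\<alpha> \<notin> R1"
    proof
      assume "\<alpha> \<in> R1"
      then have "id \<alpha> \<bullet> \<alpha> = 0" using weyl_group.id unfolding R1_def by blast
      then show False using root_nonzero[OF ab(1)] by simp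
    qed
    then have 2: "R - R1 \<noteq> {}" using ab(1) by blast
    \<comment> \<open>If \<open>w \<alpha>\<close> is not orthogonal to \<open>y\<close>, its image
      under the reflection in \<open>y\<close> is again in the orbit and differs from
      \<open>w \<alpha>\<close> by a nonzero multiple of \<open>y\<close>; \<open>x\<close> is
      orthogonal to both.\<close>
    have 3: "x \<bullet> y = 0" if "x \<in> R1" "y \<in> R - R1" for x y
    proof (rule ccontr)
      assume ne: "x \<bullet> y \<noteq> 0"
      obtain w where w: "w \<in> W" "w \<alpha> \<bullet> y \<noteq> 0" using \<open>y \<in> R - R1\<close> by (auto simp: R1_def)
      have yR: "y \<in> R" using that by auto
      have "(root_reflection y \<circ> w) \<alpha> \<bullet> x = 0"
        using that weyl_group.refl[OF w(1) yR] by (auto simp: R1_def)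
      moreover have "w \<alpha> \<bullet> x = 0" using that w by (auto simp: R1_def)
      ultimately have "(coroot y \<bullet> w \<alpha>) * (y \<bullet> x) = 0"
        by (simp add: root_reflection_def inner_diff_left)
      then show False using ne w root_nonzero[OF yR] by (auto simp: coroot_def inner_commute)
    qed
    have 4: "R1 \<union> (R - R1) = R" "R1 \<inter> (R - R1) = {}" by (auto simp: R1_def)
    have "\<forall>\<alpha>\<in>R1. \<forall>\<beta>\<in>R - R1. \<alpha> \<bullet> \<beta> = 0" using 3 by blast
    then have "\<exists>R1 R2. R1 \<noteq> {} \<and> R2 \<noteq> {} \<and> R1 \<union> R2 = R \<and> R1 \<inter> R2 = {} \<and>
          (\<forall>\<alpha>\<in>R1. \<forall>\<beta>\<in>R2. \<alpha> \<bullet> \<beta> = 0)"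
      using 1 2 4 by (intro exI conjI)
    with irr show False unfolding irreducible_root_system_def by (elim conjE notE)
  qed
  then obtain w where w: "w \<in> W" "w \<alpha> \<bullet> \<beta> \<noteq> 0" by blast
  define a where "a = w \<alpha>"
  have a: "a \<in> R" "2 *\<^sub>R a \<in> R" "norm a = norm \<beta>" "a \<bullet> \<beta> \<noteq> 0"
    using w ab weyl_root[OF w(1) ab(1)] weyl_root[OF w(1) ab(4)] weyl_norm[OF w(1), of \<alpha>]
    by (auto simp: a_def linear_scale[OF weyl_linear[OF w(1)]])
  have aa: "a \<bullet> a = \<beta> \<bullet> \<beta>" using a(3) by (simp add: norm_eq_sqrt_inner)
  have pos: "a \<bullet> a > 0" using root_nonzero[OF a(1)] by simp
  \<comment> \<open>Half of the usual Cartan integer is still integral because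
    \<open>2 *\<^sub>R a\<close> is a root. With equal lengths it is 1 or -1, the equality case of
    Cauchy-Schwarz, so \<beta> is \<open>a\<close> or \<open>- a\<close>.\<close>
  have "coroot (2 *\<^sub>R a) \<bullet> \<beta> \<in> \<int>" using coroot_root_int a ab by blast
  then obtain m :: int where m: "a \<bullet> \<beta> = of_int m * (a \<bullet> a)"
    using pos by (auto simp: coroot_def field_simps elim!: Ints_cases)
  have m0: "m \<noteq> 0" using m a(4) by auto
  have le: "\<bar>a \<bullet> \<beta>\<bar> \<le> a \<bullet> a" using Cauchy_Schwarz_ineq2[of a \<beta>] a(3)
    by (simp add: dot_square_norm power2_eq_square)
  have "\<bar>real_of_int m\<bar> * (a \<bullet> a) \<le> 1 * (a \<bullet> a)" using le m pos by (simp add: abs_mult)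
  then have "\<bar>real_of_int m\<bar> \<le> 1" using pos by (metis mult_le_cancel_right_pos)
  then have "m = 1 \<or> m = -1" using m0 by linarith
  then show ?thesis
  proof
    assume "m = 1"
    then have "(a - \<beta>) \<bullet> (a - \<beta>) = 0" using m aa by (simp add: inner_diff_left inner_diff_right inner_commute)
    then show ?thesis using a by simp
  next
    assume "m = -1"
    then have "(a + \<beta>) \<bullet> (a + \<beta>) = 0" using m aa by (simp add: inner_add_left inner_add_right inner_commute)
    then have "\<beta> = - a" by (simp add: eq_neg_iff_add_eq_0 add.commute)
    then show ?thesis using uminus_root[OF a(2)] by simp
  qed
qed

text \<open>Coroots span and the roots take integral values on them, so the rational combinations of
  coroots are dense and have rational root values.\<close>

lemma coroot_rational_approx:
  assumes "e > 0"
  shows "\<exists>t. (\<forall>\<alpha>\<in>R. \<alpha> \<bullet> t \<in> \<rat>) \<and> dist t x < e"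
proof -
  have "x \<in> span (coroot ` R)" using span_coroots by auto
  then have "\<forall>e>0. \<exists>t. (\<forall>\<alpha>\<in>R. \<alpha> \<bullet> t \<in> \<rat>) \<and> dist t x < e"
  proof (induction rule: span_induct_alt)
    case base
    show ?case by (intro allI impI exI[of _ 0]) auto
  next
    case (step c a y)
    show ?case
    proof (intro allI impI)
      fix e :: real assume e: "e > 0"
      obtain t where t: "\<forall>\<alpha>\<in>R. \<alpha> \<bullet> t \<in> \<rat>" "dist t y < e / 2"
        using step(2) e half_gt_zero by blast
      have "a \<noteq> 0" using step(1) root_nonzero by (auto simp: coroot_def)
      then obtain q where q: "q \<in> \<rat>" "c < q" "q < c + e / (2 * norm a)"
        using Rats_dense_in_real[of c "c + e / (2 * norm a)"] e by auto
      have "(q - c) * norm a < e / 2" using q \<open>a \<noteq> 0\<close> by (simp add: field_simps)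
      then have "dist (q *\<^sub>R a) (c *\<^sub>R a) < e / 2"
        using q by (simp add: dist_norm scaleR_left_diff_distrib[symmetric])
      then have "dist (q *\<^sub>R a + t) (c *\<^sub>R a + y) < e"
        using t dist_triangle_add[of "q *\<^sub>R a" t "c *\<^sub>R a" y] by linarith
      moreover have "\<alpha> \<bullet> (q *\<^sub>R a + t) \<in> \<rat>" if "\<alpha> \<in> R" for \<alpha>
      proof -
        have "\<alpha> \<bullet> a \<in> \<int>" using step(1) coroot_root_int that by (auto simp: inner_commute)
        then have "\<alpha> \<bullet> a \<in> \<rat>" using Ints_subset_Rats by blast
        then show ?thesis using that t q by (simp add: inner_add_right)
      qed
      ultimately show "\<exists>t. (\<forall>\<alpha>\<in>R. \<alpha> \<bullet> t \<in> \<rat>) \<and> dist t (c *\<^sub>R a + y) < e" by blast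
    qed
  qed
  then show ?thesis using assms by blast
qed

end

section \<open>Positive roots and the inequalities of the alcove\<close>

locale alcove = root_sys +
  fixes C A
  assumes chamber: "weyl_chamber R C"
    and alcove: "fundamental_alcove R C A"
begin

abbreviation "Rp \<equiv> positive_roots R C"

lemma finite_Rp: "finite Rp" using finite_R by (simp add: positive_roots_def)

lemma positive_root: "\<alpha> \<in> Rp \<Longrightarrow> \<alpha> \<in> R" by (simp add: positive_roots_def)

lemma alcove_subset_chamber: "A \<subseteq> C"
  using alcove by (simp add: fundamental_alcove_def)

lemma alcove_component:
  "A \<in> components (- (\<Union>\<alpha>\<in>R. {u. \<exists>n::int. \<alpha> \<bullet> u = 2 * pi * of_int n}))"
  using alcove by (simp add: fundamental_alcove_def)

lemma alcove_nonempty: "A \<noteq> {}"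
  using alcove_component in_components_nonempty by blast

text \<open>The chamber is connected and no root vanishes on it.\<close>

lemma positive_or_negative:
  assumes "\<alpha> \<in> R"
  shows "\<alpha> \<in> Rp \<or> - \<alpha> \<in> Rp"
proof -
  have C: "C \<in> components (- (\<Union>\<alpha>\<in>R. {u. \<alpha> \<bullet> u = 0}))"
    using chamber by (simp add: weyl_chamber_def)
  have "connected ((\<lambda>u. \<alpha> \<bullet> u) ` C)"
    by (intro connected_continuous_image continuous_intros in_components_connected[OF C])
  then have int: "is_interval ((\<lambda>u. \<alpha> \<bullet> u) ` C)" by (simp add: is_interval_connected_1)
  have nz: "\<alpha> \<bullet> u \<noteq> 0" if "u \<in> C" for u
    using in_components_subset[OF C] that assms by auto
  have "(\<forall>u\<in>C. \<alpha> \<bullet> u > 0) \<or> (\<forall>u\<in>C. \<alpha> \<bullet> u < 0)"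
  proof (rule ccontr)
    assume "\<not> ?thesis"
    then obtain u v where uv: "u \<in> C" "v \<in> C" "\<alpha> \<bullet> u \<le> 0" "\<alpha> \<bullet> v \<ge> 0" by force
    then have "0 \<in> (\<lambda>u. \<alpha> \<bullet> u) ` C"
      using int unfolding is_interval_1 by (meson imageI)
    then show False using nz by force
  qed
  then show ?thesis using assms uminus_root by (auto simp: positive_roots_def)
qed

lemma not_both_positive: "\<alpha> \<in> Rp \<Longrightarrow> - \<alpha> \<notin> Rp"
  using alcove_nonempty alcove_subset_chamber by (fastforce simp: positive_roots_def)

lemma sum_roots: "sum g R = (\<Sum>\<alpha>\<in>Rp. g \<alpha> + g (- \<alpha>))"
proof -
  have R: "R = Rp \<union> uminus ` Rp"
    using positive_or_negative positive_root uminus_root by (fastforce simp: image_iff)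
  have disj: "Rp \<inter> uminus ` Rp = {}" using not_both_positive by auto
  show ?thesis
    by (subst R, subst sum.union_disjoint[OF finite_Rp _ disj])
      (auto simp: finite_Rp sum.distrib sum.reindex)
qed

lemma prod_roots: "prod g R = (\<Prod>\<alpha>\<in>Rp. g \<alpha> * g (- \<alpha>))"
proof -
  have R: "R = Rp \<union> uminus ` Rp"
    using positive_or_negative positive_root uminus_root by (fastforce simp: image_iff)
  have disj: "Rp \<inter> uminus ` Rp = {}" using not_both_positive by auto
  show ?thesis
    by (subst R, subst prod.union_disjoint[OF finite_Rp _ disj])
      (auto simp: finite_Rp prod.distrib prod.reindex)
qed

text \<open>The origin is a boundary point, so each positive root takes a value below
  \<open>2 * pi\<close> somewhere in the alcove; connectedness keeps it from reaching
  \<open>2 * pi\<close>, which is a removed level.\<close>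

lemma alcove_bounds:
  assumes "\<alpha> \<in> Rp" "u \<in> A"
  shows "0 < \<alpha> \<bullet> u" "\<alpha> \<bullet> u < 2 * pi"
proof -
  show "0 < \<alpha> \<bullet> u"
    using assms alcove_subset_chamber by (auto simp: positive_roots_def)
  have "0 \<in> closure A" using alcove by (auto simp: fundamental_alcove_def frontier_def)
  then obtain v where v: "v \<in> A" "dist v 0 < 1 / norm \<alpha>"
    using root_nonzero[OF positive_root[OF assms(1)]] unfolding closure_approachable
    by (metis divide_pos_pos zero_less_norm_iff zero_less_one)
  have "\<alpha> \<bullet> v \<le> norm \<alpha> * norm v" by (rule norm_cauchy_schwarz)
  also have "\<dots> < 1" using v root_nonzero[OF positive_root[OF assms(1)]] by (simp add: field_simps)
  also have "\<dots> < 2 * pi" using pi_gt3 by simp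
  finally have v2: "\<alpha> \<bullet> v < 2 * pi" .
  have "connected ((\<lambda>u. \<alpha> \<bullet> u) ` A)"
    by (intro connected_continuous_image continuous_intros in_components_connected[OF alcove_component])
  then have int: "is_interval ((\<lambda>u. \<alpha> \<bullet> u) ` A)" by (simp add: is_interval_connected_1)
  have nz: "2 * pi \<notin> (\<lambda>u. \<alpha> \<bullet> u) ` A"
  proof
    assume "2 * pi \<in> (\<lambda>u. \<alpha> \<bullet> u) ` A"
    then obtain u where u: "u \<in> A" "\<alpha> \<bullet> u = 2 * pi * of_int 1" by auto
    then show False
      using in_components_subset[OF alcove_component] positive_root[OF assms(1)] by blast
  qed
  show "\<alpha> \<bullet> u < 2 * pi"
  proof (rule ccontr)
    assume "\<not> ?thesis"
    then show False using int nz v v2 assms(2) unfolding is_interval_1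
      by (meson imageI leI less_imp_le)
  qed
qed

text \<open>The polytope on the right is convex, avoids all removed hyperplanes and meets
  \<open>A\<close>, so it lies in the component \<open>A\<close>.\<close>

lemma alcove_eq: "A = {u. \<forall>\<alpha>\<in>Rp. 0 < \<alpha> \<bullet> u \<and> \<alpha> \<bullet> u < 2 * pi}" (is "A = ?B")
proof
  show "A \<subseteq> ?B" using alcove_bounds by blast
  have "?B = (\<Inter>\<alpha>\<in>Rp. {u. \<alpha> \<bullet> u > 0} \<inter> {u. \<alpha> \<bullet> u < 2 * pi})" by auto
  also have "convex \<dots>"
    by (intro convex_INT convex_Int convex_halfspace_gt convex_halfspace_lt)
  finally have "connected ?B" by (rule convex_connected)
  moreover have "?B \<subseteq> - (\<Union>\<alpha>\<in>R. {u. \<exists>n::int. \<alpha> \<bullet> u = 2 * pi * of_int n})"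
  proof clarsimp
    fix u \<alpha> and n :: int
    assume u: "\<forall>\<alpha>\<in>Rp. 0 < \<alpha> \<bullet> u \<and> \<alpha> \<bullet> u < 2 * pi" and a: "\<alpha> \<in> R" "\<alpha> \<bullet> u = 2 * pi * of_int n"
    have "\<exists>m::int. 0 < 2 * pi * of_int m \<and> 2 * pi * of_int m < 2 * pi"
      using positive_or_negative[OF a(1)]
    proof
      assume "\<alpha> \<in> Rp" then show ?thesis using u a by (intro exI[of _ n]) auto
    next
      assume "- \<alpha> \<in> Rp" then show ?thesis using u a by (intro exI[of _ "-n"]) fastforce
    qed
    then obtain m :: int where "0 < 2 * pi * of_int m" "2 * pi * of_int m < 2 * pi" by blast
    then have "0 < real_of_int m" "real_of_int m < 1" by (simp_all add: zero_less_mult_iff)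
    then show False by (metis of_int_0_less_iff of_int_less_1_iff zless_imp_add1_zle add_0 not_less)
  qed
  moreover have "A \<inter> ?B \<noteq> {}" using alcove_nonempty alcove_bounds by blast
  ultimately show "?B \<subseteq> A" using components_maximal[OF alcove_component, of ?B] by blast
qed

lemma open_alcove: "open A"
proof -
  have "A = (\<Inter>\<alpha>\<in>Rp. {u. \<alpha> \<bullet> u > 0} \<inter> {u. \<alpha> \<bullet> u < 2 * pi})" using alcove_eq by auto
  moreover have "open \<dots>"
    by (intro open_INT open_Int open_halfspace_gt open_halfspace_lt finite_Rp ballI)
  ultimately show ?thesis by simp
qed

lemma convex_alcove: "convex A"
proof -
  have "A = (\<Inter>\<alpha>\<in>Rp. {u. \<alpha> \<bullet> u > 0} \<inter> {u. \<alpha> \<bullet> u < 2 * pi})" using alcove_eq by auto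
  moreover have "convex \<dots>"
    by (intro convex_INT convex_Int convex_halfspace_gt convex_halfspace_lt)
  ultimately show ?thesis by simp
qed

lemma bounded_if_roots_bounded:
  assumes "\<And>\<alpha> u. \<alpha> \<in> Rp \<Longrightarrow> u \<in> S \<Longrightarrow> \<bar>\<alpha> \<bullet> u\<bar> \<le> c"
  shows "bounded S"
proof -
  have base: "\<bar>\<alpha> \<bullet> u\<bar> \<le> c" if "\<alpha> \<in> R" "u \<in> S" for \<alpha> u
    using positive_or_negative[OF that(1)] assms[of _ u] that by force
  have "\<exists>B. \<forall>u\<in>S. \<bar>x \<bullet> u\<bar> \<le> B" for x
  proof -
    have "x \<in> span R" using span_R by auto
    then show ?thesis
    proof (induction rule: span_induct_alt)
      case base
      show ?case by (intro exI[of _ 0]) auto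
    next
      case (step a \<alpha> y)
      then obtain B where "\<forall>u\<in>S. \<bar>y \<bullet> u\<bar> \<le> B" by blast
      then have "\<bar>(a *\<^sub>R \<alpha> + y) \<bullet> u\<bar> \<le> \<bar>a\<bar> * c + B" if "u \<in> S" for u
        using that base[OF step(1) that] abs_triangle_ineq[of "a * (\<alpha> \<bullet> u)" "y \<bullet> u"]
          mult_left_mono[OF base[OF step(1) that], of "\<bar>a\<bar>"]
        by (force simp: inner_add_left abs_mult)
      then show ?case by blast
    qed
  qed
  then obtain B where B: "\<And>x u. u \<in> S \<Longrightarrow> \<bar>x \<bullet> u\<bar> \<le> B x" by metis
  show ?thesis unfolding bounded_iff
  proof (intro exI ballI)
    fix u assume "u \<in> S"
    have "norm u \<le> (\<Sum>b\<in>Basis. \<bar>u \<bullet> b\<bar>)" by (rule norm_le_l1)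
    also have "\<dots> \<le> (\<Sum>b\<in>Basis. B b)" by (intro sum_mono) (metis B \<open>u \<in> S\<close> inner_commute)
    finally show "norm u \<le> (\<Sum>b\<in>Basis. B b)" .
  qed
qed

lemma bounded_alcove: "bounded A"
  by (rule bounded_if_roots_bounded[of _ "2 * pi"]) (use alcove_bounds in fastforce)

text \<open>Gives the direction of the lines used for the cotangent identity: along \<open>b\<close>
  the positive roots grow by positive integers, so their exponentials become monomials in one
  variable. A point of the open alcove is moved to one with rational root values, then denominators
  are cleared.\<close>

lemma integral_coweight_in_chamber:
  obtains b where "\<And>\<alpha>. \<alpha> \<in> Rp \<Longrightarrow> \<exists>n::nat. n > 0 \<and> \<alpha> \<bullet> b = real n"
proof -
  obtain v where v: "v \<in> A" using alcove_nonempty by blast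
  obtain e where e: "e > 0" "ball v e \<subseteq> A" using open_alcove v open_contains_ball by blast
  obtain t where t: "\<forall>\<alpha>\<in>R. \<alpha> \<bullet> t \<in> \<rat>" "dist t v < e" using coroot_rational_approx[OF e(1)] by blast
  then have tA: "t \<in> A" using e by (auto simp: dist_commute)
  have "\<exists>N::nat. N > 0 \<and> (\<forall>\<alpha>\<in>S. real N * (\<alpha> \<bullet> t) \<in> \<int>)" if "finite S" "S \<subseteq> R" for S
    using that
  proof (induction rule: finite_induct)
    case empty
    show ?case by auto
  next
    case (insert \<alpha> S)
    then obtain N :: nat where N: "N > 0" "\<forall>\<alpha>\<in>S. real N * (\<alpha> \<bullet> t) \<in> \<int>" by auto
    have "\<alpha> \<bullet> t \<in> \<rat>" using t insert by auto
    then obtain p q :: int where pq: "q > 0" "\<alpha> \<bullet> t = of_int p / of_int q"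
      by (auto elim!: Rats_cases')
    have q: "real (nat q) = of_int q" using pq by simp
    have "real (N * nat q) * (\<alpha> \<bullet> t) = of_int (int N * p)" using pq q by simp
    then have "real (N * nat q) * (\<alpha> \<bullet> t) \<in> \<int>" by (metis Ints_of_int)
    moreover have "real (N * nat q) * (\<beta> \<bullet> t) \<in> \<int>" if "\<beta> \<in> S" for \<beta>
    proof -
      have "real (N * nat q) * (\<beta> \<bullet> t) = of_int q * (real N * (\<beta> \<bullet> t))" using q by simp
      then show ?thesis using N(2) that by (metis Ints_mult Ints_of_int)
    qed
    ultimately show ?case using N pq by (intro exI[of _ "N * nat q"]) auto
  qed
  from this[OF finite_R] obtain N :: nat where N: "N > 0" "\<forall>\<alpha>\<in>R. real N * (\<alpha> \<bullet> t) \<in> \<int>" by auto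
  show ?thesis
  proof (rule that[of "real N *\<^sub>R t"])
    fix \<alpha> assume a: "\<alpha> \<in> Rp"
    obtain m :: int where m: "real N * (\<alpha> \<bullet> t) = of_int m" using N positive_root[OF a] by (auto elim!: Ints_cases)
    have "real N * (\<alpha> \<bullet> t) > 0" using N alcove_bounds[OF a tA] by simp
    then have "m > 0" using m by simp
    then show "\<exists>n::nat. n > 0 \<and> \<alpha> \<bullet> (real N *\<^sub>R t) = real n"
      using m by (intro exI[of _ "nat m"]) auto
  qed
qed

text \<open>The sine product vanishes on the boundary of the alcove, so the superlevel set is closed
  in the whole space. It will carry the support of the cut-off functions.\<close>

lemma compact_sin_superlevel:
  assumes "e > 0"
  shows "compact {u\<in>A. (\<Prod>\<alpha>\<in>Rp. sin (\<alpha> \<bullet> u / 2)) \<ge> e}" (is "compact ?K")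
proof -
  have sub: "?K = {u. (\<forall>\<alpha>\<in>Rp. 0 \<le> \<alpha> \<bullet> u \<and> \<alpha> \<bullet> u \<le> 2 * pi) \<and> (\<Prod>\<alpha>\<in>Rp. sin (\<alpha> \<bullet> u / 2)) \<ge> e}"
    (is "_ = ?L")
  proof (intro set_eqI iffI)
    fix u assume "u \<in> ?L"
    then have u: "\<And>\<alpha>. \<alpha> \<in> Rp \<Longrightarrow> 0 \<le> \<alpha> \<bullet> u \<and> \<alpha> \<bullet> u \<le> 2 * pi" "(\<Prod>\<alpha>\<in>Rp. sin (\<alpha> \<bullet> u / 2)) > 0"
      using assms by auto
    have "0 < \<alpha> \<bullet> u \<and> \<alpha> \<bullet> u < 2 * pi" if "\<alpha> \<in> Rp" for \<alpha>
    proof -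
      have "sin (\<alpha> \<bullet> u / 2) \<noteq> 0"
        using u(2) that finite_Rp prod_zero_iff[OF finite_Rp, of "\<lambda>\<alpha>. sin (\<alpha> \<bullet> u / 2)"]
        by (metis less_irrefl)
      then have "\<alpha> \<bullet> u \<noteq> 0" "\<alpha> \<bullet> u \<noteq> 2 * pi" by auto
      then show ?thesis using u(1)[OF that] by linarith
    qed
    then have "u \<in> A" using alcove_eq by auto
    then show "u \<in> ?K" using \<open>u \<in> ?L\<close> by auto
  qed (use alcove_bounds in fastforce)
  have "?L = (\<Inter>\<alpha>\<in>Rp. {u. \<alpha> \<bullet> u \<ge> 0} \<inter> {u. \<alpha> \<bullet> u \<le> 2 * pi}) \<inter> {u. (\<Prod>\<alpha>\<in>Rp. sin (\<alpha> \<bullet> u / 2)) \<ge> e}"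
    by auto
  also have "closed \<dots>"
    by (intro closed_Int closed_INT closed_halfspace_ge closed_halfspace_le closed_Collect_le
        continuous_intros ballI) auto
  finally have "closed ?K" using sub by simp
  moreover have "bounded ?K" using bounded_alcove by (rule bounded_subset) auto
  ultimately show ?thesis using compact_eq_bounded_closed by blast
qed

end

section \<open>The closed alcove meets every orbit of the affine Weyl group at most once\<close>

definition aff_reflection :: "'a::euclidean_space \<Rightarrow> int \<Rightarrow> 'a \<Rightarrow> 'a" where
  "aff_reflection \<alpha> n x = x - (\<alpha> \<bullet> x - 2 * pi * of_int n) *\<^sub>R coroot \<alpha>"

text \<open>\<open>x - r x\<close> is a normal vector of the mirror scaled by the signed height of
  \<open>x\<close>, so the sign compares the sides of \<open>x\<close> and \<open>y\<close>. Only
  the map \<open>r\<close> enters: proportional roots can share a mirror, and mirrors must be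
  counted once.\<close>

definition sep :: "('a::euclidean_space \<Rightarrow> 'a) \<Rightarrow> 'a \<Rightarrow> 'a \<Rightarrow> bool" where
  "sep r x y \<longleftrightarrow> (x - r x) \<bullet> (y - r y) < 0"

primrec act :: "('a \<Rightarrow> 'a) list \<Rightarrow> 'a \<Rightarrow> 'a" where
  "act [] x = x"
| "act (r # rs) x = r (act rs x)"

lemma act_append: "act (rs @ ss) x = act rs (act ss x)"
  by (induction rs) auto

lemma coroot_pos: "\<alpha> \<noteq> 0 \<Longrightarrow> coroot \<alpha> \<bullet> coroot \<alpha> > 0"
  by (auto simp: coroot_def)

lemma aff_reflection_fixed_iff:
  "\<alpha> \<noteq> 0 \<Longrightarrow> aff_reflection \<alpha> n x = x \<longleftrightarrow> \<alpha> \<bullet> x = 2 * pi * of_int n"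
  using coroot_pos[of \<alpha>] by (auto simp: aff_reflection_def)

lemma aff_reflection_value:
  "\<alpha> \<noteq> 0 \<Longrightarrow> \<alpha> \<bullet> aff_reflection \<alpha> n x - 2 * pi * of_int n = - (\<alpha> \<bullet> x - 2 * pi * of_int n)"
  by (simp add: aff_reflection_def inner_diff_right inner_coroot_self)

lemma aff_reflection_idem:
  assumes "\<alpha> \<noteq> 0"
  shows "aff_reflection \<alpha> n (aff_reflection \<alpha> n x) = x"
proof -
  define y where "y = aff_reflection \<alpha> n x"
  have "aff_reflection \<alpha> n y = y - (\<alpha> \<bullet> y - 2 * pi * of_int n) *\<^sub>R coroot \<alpha>"
    by (rule aff_reflection_def)
  also have "\<alpha> \<bullet> y - 2 * pi * of_int n = - (\<alpha> \<bullet> x - 2 * pi * of_int n)"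
    unfolding y_def by (rule aff_reflection_value[OF assms])
  also have "y - - (\<alpha> \<bullet> x - 2 * pi * of_int n) *\<^sub>R coroot \<alpha> = x"
    by (simp add: y_def aff_reflection_def algebra_simps)
  finally show ?thesis unfolding y_def .
qed

lemma connected_same_sign:
  fixes f :: "'a::topological_space \<Rightarrow> real"
  assumes "connected S" "continuous_on S f" "\<And>x. x \<in> S \<Longrightarrow> f x \<noteq> 0" "x \<in> S" "y \<in> S"
  shows "0 < f x * f y"
proof (rule ccontr)
  assume "\<not> ?thesis"
  then have "f x * f y < 0" using assms(3)[OF assms(4)] assms(3)[OF assms(5)]
    by (metis mult_eq_0_iff linorder_neqE_linordered_idom)
  moreover have "is_interval (f ` S)"
    using connected_continuous_image[OF assms(2,1)] by (simp add: is_interval_connected_1)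
  ultimately have "0 \<in> f ` S"
    using mem_is_interval_1_I[of "f ` S"] assms(4,5) unfolding mult_less_0_iff
    by (meson imageI less_imp_le)
  then show False using assms(3) by auto
qed

lemma aff_reflection_diff: "aff_reflection \<alpha> n x - aff_reflection \<alpha> n y = root_reflection \<alpha> (x - y)"
  by (simp add: aff_reflection_def root_reflection_def coroot_def algebra_simps inner_diff_right
      diff_divide_distrib)

lemma sep_aff_reflection:
  assumes "\<alpha> \<noteq> 0"
  shows "sep (aff_reflection \<alpha> n) x y \<longleftrightarrow>
    (\<alpha> \<bullet> x - 2 * pi * of_int n) * (\<alpha> \<bullet> y - 2 * pi * of_int n) < 0"
proof -
  have "(x - aff_reflection \<alpha> n x) \<bullet> (y - aff_reflection \<alpha> n y) =
     ((\<alpha> \<bullet> x - 2 * pi * of_int n) * (\<alpha> \<bullet> y - 2 * pi * of_int n)) * (coroot \<alpha> \<bullet> coroot \<alpha>)"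
    by (simp add: aff_reflection_def)
  moreover have "a * c < 0 \<longleftrightarrow> a < 0" if "c > 0" for a c :: real
    using that by (simp add: mult_less_0_iff)
  ultimately show ?thesis using coroot_pos[OF assms] by (simp add: sep_def)
qed

text \<open>Makes reflections, as maps, correspond to mirrors, although \<alpha>,
  \<open>- \<alpha>\<close> and \<open>2 *\<^sub>R \<alpha>\<close> may describe the same mirror
  with different levels.\<close>

lemma aff_reflection_parallel:
  assumes "\<alpha> \<noteq> 0" "c *\<^sub>R \<alpha> \<noteq> 0" "aff_reflection \<alpha> n z = z" "aff_reflection (c *\<^sub>R \<alpha>) m z = z"
  shows "aff_reflection (c *\<^sub>R \<alpha>) m = aff_reflection \<alpha> n"
proof
  fix x
  have 1: "2 * pi * of_int n = \<alpha> \<bullet> z" "2 * pi * of_int m = (c *\<^sub>R \<alpha>) \<bullet> z"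
    using assms aff_reflection_fixed_iff by metis+
  have c: "c \<noteq> 0" using assms by auto
  then have "coroot (c *\<^sub>R \<alpha>) = (1 / c) *\<^sub>R coroot \<alpha>" by (simp add: coroot_def field_simps)
  then have "((c *\<^sub>R \<alpha>) \<bullet> x - (c *\<^sub>R \<alpha>) \<bullet> z) *\<^sub>R coroot (c *\<^sub>R \<alpha>) = ((c * (\<alpha> \<bullet> x - \<alpha> \<bullet> z)) * (1 / c)) *\<^sub>R coroot \<alpha>"
    by (simp add: right_diff_distrib)
  also have "(c * (\<alpha> \<bullet> x - \<alpha> \<bullet> z)) * (1 / c) = \<alpha> \<bullet> x - \<alpha> \<bullet> z" using c by simp
  finally show "aff_reflection (c *\<^sub>R \<alpha>) m x = aff_reflection \<alpha> n x"
    unfolding aff_reflection_def 1 by simp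
qed

context root_sys
begin

definition refls :: "('a \<Rightarrow> 'a) set" where
  "refls = {aff_reflection \<alpha> n | \<alpha> n. \<alpha> \<in> R}"

lemma reflsI: "\<alpha> \<in> R \<Longrightarrow> aff_reflection \<alpha> n \<in> refls"
  by (auto simp: refls_def)

lemma reflsE:
  assumes "r \<in> refls" obtains \<alpha> n where "\<alpha> \<in> R" "\<alpha> \<noteq> 0" "r = aff_reflection \<alpha> n"
  using assms root_nonzero by (auto simp: refls_def)

lemma refl_idem: "r \<in> refls \<Longrightarrow> r (r x) = x"
  by (erule reflsE) (simp add: aff_reflection_idem)

lemma refl_inner: "r \<in> refls \<Longrightarrow> (r a - r b) \<bullet> (r c - r d) = (a - b) \<bullet> (c - d)"
  by (erule reflsE) (simp add: aff_reflection_diff root_reflection_inner)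

text \<open>The conjugate reflects in the root \<open>root_reflection \<beta> \<alpha>\<close>. Its
  level moves by \<open>m\<close> times a Cartan integer, so the integrality of the root system
  keeps levels integral.\<close>

lemma refl_conj:
  assumes "g \<in> refls" "r \<in> refls"
  shows "g \<circ> r \<circ> g \<in> refls"
proof -
  obtain \<beta> m where b: "\<beta> \<in> R" "\<beta> \<noteq> 0" "g = aff_reflection \<beta> m" by (rule reflsE[OF assms(1)])
  obtain \<alpha> n where a: "\<alpha> \<in> R" "\<alpha> \<noteq> 0" "r = aff_reflection \<alpha> n" by (rule reflsE[OF assms(2)])
  define \<alpha>' where "\<alpha>' = root_reflection \<beta> \<alpha>"
  have a': "\<alpha>' \<in> R" using root_reflection_root a b by (simp add: \<alpha>'_def)
  obtain j :: int where j: "coroot \<beta> \<bullet> \<alpha>' = of_int j"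
    using coroot_root_int[OF b(1) a'] by (auto elim: Ints_cases)
  have lin: "linear (root_reflection \<beta>)" by (rule linear_root_reflection)
  have cr: "coroot \<alpha>' = root_reflection \<beta> (coroot \<alpha>)"
    unfolding \<alpha>'_def by (rule coroot_isometry[OF lin]) (simp add: root_reflection_inner b)
  have "g (r (g x)) = aff_reflection \<alpha>' (n + m * j) x" for x
  proof -
    define y where "y = g x"
    have x: "g y = x" using assms(1) by (simp add: y_def refl_idem)
    have "g (r y) - g y = root_reflection \<beta> (r y - y)"
      unfolding b(3) by (rule aff_reflection_diff)
    also have "r y - y = (2 * pi * of_int n - \<alpha> \<bullet> y) *\<^sub>R coroot \<alpha>"
      by (simp add: a(3) aff_reflection_def algebra_simps)
    also have "root_reflection \<beta> \<dots> = (2 * pi * of_int n - \<alpha> \<bullet> y) *\<^sub>R coroot \<alpha>'"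
      unfolding cr by (rule linear_scale[OF lin])
    finally have 1: "g (r y) - g y = (2 * pi * of_int n - \<alpha> \<bullet> y) *\<^sub>R coroot \<alpha>'" .
    have "g y = root_reflection \<beta> y + (2 * pi * of_int m) *\<^sub>R coroot \<beta>"
      by (simp add: b(3) aff_reflection_def root_reflection_def coroot_def algebra_simps)
    then have "\<alpha>' \<bullet> g y = \<alpha>' \<bullet> root_reflection \<beta> y + 2 * pi * of_int m * (coroot \<beta> \<bullet> \<alpha>')"
      by (simp add: inner_add_right inner_commute)
    also have "\<alpha>' \<bullet> root_reflection \<beta> y = \<alpha> \<bullet> y"
      unfolding \<alpha>'_def by (simp add: root_reflection_inner b)
    finally have "\<alpha>' \<bullet> g y - 2 * pi * of_int (n + m * j) = - (2 * pi * of_int n - \<alpha> \<bullet> y)"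
      unfolding j by (simp add: algebra_simps)
    then have "aff_reflection \<alpha>' (n + m * j) (g y) = g y - (- (2 * pi * of_int n - \<alpha> \<bullet> y)) *\<^sub>R coroot \<alpha>'"
      unfolding aff_reflection_def by (rule arg_cong)
    also have "\<dots> = g (r y)" using 1 by (simp add: algebra_simps)
    finally show ?thesis unfolding x by (simp add: y_def)
  qed
  then have "g \<circ> r \<circ> g = aff_reflection \<alpha>' (n + m * j)" by auto
  then show ?thesis using reflsI[OF a'] by simp
qed

lemma act_rev:
  assumes "set ws \<subseteq> refls"
  shows "act (rev ws) (act ws x) = x"
  using assms by (induction ws arbitrary: x) (auto simp: act_append refl_idem)

lemma act_rev':
  assumes "set ws \<subseteq> refls"
  shows "act ws (act (rev ws) x) = x"
  using act_rev[of "rev ws" x] assms by simp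

lemma act_inner:
  "set ws \<subseteq> refls \<Longrightarrow> (act ws a - act ws b) \<bullet> (act ws c - act ws d) = (a - b) \<bullet> (c - d)"
  by (induction ws arbitrary: a b c d) (auto simp: refl_inner)

lemma act_conj:
  assumes "set ws \<subseteq> refls" "r \<in> refls"
  shows "(\<lambda>x. act ws (r (act (rev ws) x))) \<in> refls"
  using assms
proof (induction ws)
  case (Cons w ws)
  then have "w \<circ> (\<lambda>x. act ws (r (act (rev ws) x))) \<circ> w \<in> refls" by (intro refl_conj) auto
  then show ?case by (simp add: act_append comp_def)
qed (simp add: act_append)

lemma act_conj':
  assumes "set ws \<subseteq> refls" "r \<in> refls"
  shows "(\<lambda>x. act (rev ws) (r (act ws x))) \<in> refls"
  using act_conj[of "rev ws" r] assms by simp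

lemma sep_act:
  assumes "set ws \<subseteq> refls" "r \<in> refls"
  shows "sep r (act ws x) (act ws y) = sep (\<lambda>x. act (rev ws) (r (act ws x))) x y"
proof -
  have e: "act ws (act (rev ws) (r (act ws z))) = r (act ws z)" for z by (rule act_rev'[OF assms(1)])
  have "(x - act (rev ws) (r (act ws x))) \<bullet> (y - act (rev ws) (r (act ws y)))
     = (act ws x - act ws (act (rev ws) (r (act ws x)))) \<bullet> (act ws y - act ws (act (rev ws) (r (act ws y))))"
    by (rule act_inner[OF assms(1), symmetric])
  then show ?thesis unfolding sep_def e by simp
qed

definition regular :: "'a \<Rightarrow> bool" where
  "regular x \<longleftrightarrow> (\<forall>r\<in>refls. r x \<noteq> x)"

lemma regular_iff: "regular x \<longleftrightarrow> (\<forall>\<alpha>\<in>R. \<forall>n::int. \<alpha> \<bullet> x \<noteq> 2 * pi * of_int n)"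
  unfolding regular_def refls_def using aff_reflection_fixed_iff root_nonzero by blast

lemma regular_act:
  assumes "set ws \<subseteq> refls" "regular x" shows "regular (act ws x)"
  unfolding regular_def
proof (intro ballI notI)
  fix r assume r: "r \<in> refls" "r (act ws x) = act ws x"
  then have "act (rev ws) (r (act ws x)) = x" using act_rev[OF assms(1)] by simp
  then show False using act_conj'[OF assms(1) r(1)] assms(2) unfolding regular_def by fastforce
qed

lemma sep_trichotomy:
  assumes "r \<in> refls" "regular x" "regular y" "regular z"
  shows "sep r x z \<longleftrightarrow> sep r x y \<noteq> sep r y z"
proof -
  obtain \<alpha> n where a: "\<alpha> \<in> R" "\<alpha> \<noteq> 0" "r = aff_reflection \<alpha> n" by (rule reflsE[OF assms(1)])
  have nz: "\<alpha> \<bullet> u - 2 * pi * of_int n \<noteq> 0" if "regular u" for u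
    using that a(1) by (auto simp: regular_iff)
  have "a * c < 0 \<longleftrightarrow> (a * b < 0) \<noteq> (b * c < 0)" if "a \<noteq> 0" "b \<noteq> 0" "c \<noteq> 0" for a b c :: real
    using that unfolding mult_less_0_iff by (meson less_asym linorder_neqE_linordered_idom)
  then show ?thesis
    unfolding a(3) sep_aff_reflection[OF a(2)] using nz assms(2-4) by blast
qed

lemma sep_refl_self:
  assumes "r \<in> refls" "regular x"
  shows "sep r x (r x)"
proof -
  obtain \<alpha> n where a: "\<alpha> \<in> R" "\<alpha> \<noteq> 0" "r = aff_reflection \<alpha> n" by (rule reflsE[OF assms(1)])
  have "\<alpha> \<bullet> x - 2 * pi * of_int n \<noteq> 0" using assms(2) a(1) by (auto simp: regular_iff)
  moreover have "a * - a < 0" if "a \<noteq> 0" for a :: real using that by (simp add: zero_less_mult_iff linorder_neq_iff disj_commute)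
  ultimately show ?thesis
    unfolding a(3) sep_aff_reflection[OF a(2)] aff_reflection_value[OF a(2)] by blast
qed

text \<open>A mirror of \<alpha> between \<open>x\<close> and \<open>y\<close> has its level between
  the values of \<alpha> at the two points. The cardinality is the distance on which
  \<open>walls_transitive\<close> is proved by induction.\<close>

lemma finite_separators: "finite {r\<in>refls. sep r x y}"
proof -
  define B where "B = (\<lambda>\<alpha>. {n::int. \<bar>real_of_int n\<bar> \<le> \<bar>\<alpha> \<bullet> x\<bar> + \<bar>\<alpha> \<bullet> y\<bar>})"
  have fin: "finite (B \<alpha>)" for \<alpha>
  proof (rule finite_subset)
    show "B \<alpha> \<subseteq> {- \<lceil>\<bar>\<alpha> \<bullet> x\<bar> + \<bar>\<alpha> \<bullet> y\<bar>\<rceil> .. \<lceil>\<bar>\<alpha> \<bullet> x\<bar> + \<bar>\<alpha> \<bullet> y\<bar>\<rceil>}"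
      unfolding B_def by (auto simp: abs_le_iff) linarith+
  qed simp
  have "{r\<in>refls. sep r x y} \<subseteq> (\<lambda>(\<alpha>, n). aff_reflection \<alpha> n) ` (SIGMA \<alpha>:R. B \<alpha>)"
  proof safe
    fix r assume r: "r \<in> refls" "sep r x y"
    obtain \<alpha> n where a: "\<alpha> \<in> R" "\<alpha> \<noteq> 0" "r = aff_reflection \<alpha> n" by (rule reflsE[OF r(1)])
    have "(\<alpha> \<bullet> x - 2 * pi * of_int n) * (\<alpha> \<bullet> y - 2 * pi * of_int n) < 0"
      using r(2) sep_aff_reflection[OF a(2)] a(3) by simp
    then have "\<bar>2 * pi * of_int n\<bar> \<le> \<bar>\<alpha> \<bullet> x\<bar> + \<bar>\<alpha> \<bullet> y\<bar>"
      by (auto simp: mult_less_0_iff)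
    moreover have "1 * \<bar>real_of_int n\<bar> \<le> (2 * pi) * \<bar>real_of_int n\<bar>"
      by (intro mult_right_mono) (use pi_gt3 in auto)
    ultimately have "n \<in> B \<alpha>" unfolding B_def by (auto simp: abs_mult)
    then show "r \<in> (\<lambda>(\<alpha>, n). aff_reflection \<alpha> n) ` (SIGMA \<alpha>:R. B \<alpha>)" using a by force
  qed
  then show ?thesis by (rule finite_subset) (intro finite_imageI finite_SigmaI finite_R fin)
qed

end

section \<open>Points in general position\<close>

lemma negligible_countable_hyperplanes:
  assumes "countable I" "\<And>i. i \<in> I \<Longrightarrow> \<nu> i \<noteq> 0"
  shows "negligible (\<Union>i\<in>I. {x::'a::euclidean_space. \<nu> i \<bullet> x = c i})"
  by (rule negligible_countable_Union) (use assms in \<open>auto intro!: negligible_hyperplane\<close>)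

text \<open>Countably many hyperplanes form a null set, and a nonempty open set is not one. The
  requirements of general position below are put in the form of values \<open>c i\<close> to be
  avoided by functionals \<open>\<nu> i\<close>.\<close>

lemma generic_point:
  assumes "countable I" "\<And>i. i \<in> I \<Longrightarrow> \<nu> i \<noteq> 0" "open S" "S \<noteq> {}"
  obtains x :: "'a::euclidean_space" where "x \<in> S" "\<And>i. i \<in> I \<Longrightarrow> \<nu> i \<bullet> x \<noteq> c i"
proof -
  have "\<not> negligible S" using assms open_not_negligible by blast
  moreover have "negligible (\<Union>i\<in>I. {x. \<nu> i \<bullet> x = c i})"
    by (rule negligible_countable_hyperplanes[OF assms(1,2)])
  ultimately have "\<not> S \<subseteq> (\<Union>i\<in>I. {x. \<nu> i \<bullet> x = c i})"
    using negligible_subset by blast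
  then show ?thesis using that by blast
qed

text \<open>The bound is the distance to the next integer in the direction of \<open>k\<close>,
  divided by the speed. The integers \<open>\<lfloor>y\<rfloor> + 1\<close> and
  \<open>\<lceil>y\<rceil> - 1\<close> are strictly beyond \<open>y\<close> even when
  \<open>y\<close> is an integer.\<close>

lemma small_shift_not_int:
  fixes y k :: real
  assumes "k \<noteq> 0"
  shows "\<exists>e>0. \<forall>s. 0 < s \<and> s < e \<longrightarrow> y + s * k \<notin> \<int>"
proof (cases "k > 0")
  case True
  show ?thesis
  proof (intro exI conjI allI impI)
    show "(of_int (\<lfloor>y\<rfloor> + 1) - y) / k > 0" using True by (intro divide_pos_pos) linarith+
    fix s assume s: "0 < s \<and> s < (of_int (\<lfloor>y\<rfloor> + 1) - y) / k"
    then have 1: "y < y + s * k" "y + s * k < of_int (\<lfloor>y\<rfloor> + 1)" using True by (auto simp: field_simps)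
    show "y + s * k \<notin> \<int>"
    proof
      assume "y + s * k \<in> \<int>"
      then obtain j :: int where "y + s * k = of_int j" by (auto elim: Ints_cases)
      then have "j < \<lfloor>y\<rfloor> + 1" "y < of_int j" using 1 by (simp_all only: of_int_less_iff)
      then have "j \<le> \<lfloor>y\<rfloor>" by linarith
      then show False using \<open>y < of_int j\<close> by (simp add: le_floor_iff)
    qed
  qed
next
  case False
  then have k: "k < 0" using assms by simp
  show ?thesis
  proof (intro exI conjI allI impI)
    show "(of_int (\<lceil>y\<rceil> - 1) - y) / k > 0" using k by (intro divide_neg_neg) linarith+
    fix s assume s: "0 < s \<and> s < (of_int (\<lceil>y\<rceil> - 1) - y) / k"
    then have 1: "y + s * k < y" "of_int (\<lceil>y\<rceil> - 1) < y + s * k"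
      using k by (auto simp: field_simps mult_less_0_iff)
    show "y + s * k \<notin> \<int>"
    proof
      assume "y + s * k \<in> \<int>"
      then obtain j :: int where "y + s * k = of_int j" by (auto elim: Ints_cases)
      then have "\<lceil>y\<rceil> - 1 < j" "of_int j < y" using 1 by (simp_all only: of_int_less_iff)
      then have "\<lceil>y\<rceil> \<le> j" by linarith
      then show False using \<open>of_int j < y\<close> by (simp add: ceiling_le_iff)
    qed
  qed
qed

lemma not_parallel_combination:
  fixes \<alpha> \<beta> :: "'a::real_vector"
  assumes "\<And>c. \<beta> \<noteq> c *\<^sub>R \<alpha>" "p \<noteq> 0"
  shows "p *\<^sub>R \<beta> - q *\<^sub>R \<alpha> \<noteq> 0"
proof
  assume "p *\<^sub>R \<beta> - q *\<^sub>R \<alpha> = 0"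
  then have "\<beta> = (q / p) *\<^sub>R \<alpha>" using assms(2) by (simp add: vector_fraction_eq_iff eq_vector_fraction_iff)
  then show False using assms(1) by blast
qed

section \<open>Walls, galleries and the exchange argument\<close>

context alcove
begin

lemma alcove_regular: "p \<in> A \<Longrightarrow> regular p"
  unfolding regular_iff
  using in_components_subset[OF alcove_component] by blast

lemma alcove_not_sep:
  assumes "r \<in> refls" "p \<in> A" "q \<in> A"
  shows "\<not> sep r p q"
proof -
  obtain \<alpha> n where a: "\<alpha> \<in> R" "\<alpha> \<noteq> 0" "r = aff_reflection \<alpha> n" by (rule reflsE[OF assms(1)])
  have "0 < (\<alpha> \<bullet> p - 2 * pi * of_int n) * (\<alpha> \<bullet> q - 2 * pi * of_int n)"
    by (rule connected_same_sign[where f = "\<lambda>u. \<alpha> \<bullet> u - 2 * pi * of_int n", OF convex_connected[OF convex_alcove] _ _ assms(2,3)])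
      (use alcove_regular a(1) in \<open>auto simp: regular_iff intro!: continuous_intros\<close>)
  then show ?thesis using sep_aff_reflection[OF a(2)] a(3) by simp
qed

lemma in_alcove_if_same_sides:
  assumes "p \<in> A"
    and "\<And>\<alpha> n. \<alpha> \<in> R \<Longrightarrow> (\<alpha> \<bullet> p - 2 * pi * of_int n) * (\<alpha> \<bullet> q - 2 * pi * of_int n) > 0"
  shows "q \<in> A"
proof -
  have "0 < \<alpha> \<bullet> q \<and> \<alpha> \<bullet> q < 2 * pi" if a: "\<alpha> \<in> Rp" for \<alpha>
    using assms(2)[OF positive_root[OF a], of 0] assms(2)[OF positive_root[OF a], of 1]
      alcove_bounds[OF a assms(1)] by (auto simp: zero_less_mult_iff)
  then show ?thesis using alcove_eq by auto
qed

lemma in_alcove_if_not_sep: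
  assumes "p \<in> A" "regular q" "\<And>r. r \<in> refls \<Longrightarrow> \<not> sep r p q"
  shows "q \<in> A"
proof (rule in_alcove_if_same_sides[OF assms(1)])
  fix \<alpha> and n :: int assume a: "\<alpha> \<in> R"
  then have "\<not> (\<alpha> \<bullet> p - 2 * pi * of_int n) * (\<alpha> \<bullet> q - 2 * pi * of_int n) < 0"
    using assms(3)[OF reflsI[OF a]] sep_aff_reflection[OF root_nonzero[OF a]] by blast
  moreover have "\<alpha> \<bullet> p - 2 * pi * of_int n \<noteq> 0" "\<alpha> \<bullet> q - 2 * pi * of_int n \<noteq> 0"
    using a alcove_regular[OF assms(1)] assms(2) by (auto simp: regular_iff)
  ultimately show "(\<alpha> \<bullet> p - 2 * pi * of_int n) * (\<alpha> \<bullet> q - 2 * pi * of_int n) > 0"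
    by (metis less_linear mult_eq_0_iff)
qed

lemma closure_alcove_side:
  assumes "r \<in> refls" "p \<in> A" "u \<in> closure A"
  shows "(p - r p) \<bullet> (u - r u) \<ge> 0"
proof -
  have "continuous_on UNIV r"
    by (rule reflsE[OF assms(1)]) (auto simp: aff_reflection_def intro!: continuous_intros)
  then have "closed {u. (p - r p) \<bullet> (u - r u) \<ge> 0}"
    by (intro closed_Collect_le continuous_intros)
  moreover have "A \<subseteq> {u. (p - r p) \<bullet> (u - r u) \<ge> 0}"
    using alcove_not_sep[OF assms(1,2)] by (auto simp: sep_def not_less)
  ultimately show ?thesis using assms(3) closure_minimal by blast
qed

text \<open>A facet is certified by one point of the closed alcove that lies on this mirror and on
  no other. This replaces a description of facets by dimension.\<close>

definition wall :: "('a \<Rightarrow> 'a) \<Rightarrow> bool" where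
  "wall r \<longleftrightarrow> r \<in> refls \<and> (\<exists>z\<in>closure A. r z = z \<and> (\<forall>r'\<in>refls. r' z = z \<longrightarrow> r' = r))"

lemma wall_refl: "wall r \<Longrightarrow> r \<in> refls"
  by (simp add: wall_def)

text \<open>The witness \<open>z\<close> of the wall is strictly on one side of any other mirror.
  Both \<open>p\<close> and \<open>r p\<close> are weakly on that side: \<open>p\<close> because
  \<open>z\<close> is in the closure of \<open>A\<close>, and \<open>r p\<close> because
  \<open>z = r z\<close> is in the closure of the reflected alcove.\<close>

lemma wall_only_separator:
  assumes "wall r" "p \<in> A" "r' \<in> refls" "sep r' p (r p)"
  shows "r' = r"
proof (rule ccontr)
  assume ne: "r' \<noteq> r"
  have r: "r \<in> refls" using assms(1) by (rule wall_refl)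
  obtain z where z: "z \<in> closure A" "r z = z" "\<And>r'. r' \<in> refls \<Longrightarrow> r' z = z \<Longrightarrow> r' = r"
    using assms(1) unfolding wall_def by blast
  obtain \<alpha> n where a: "\<alpha> \<in> R" "\<alpha> \<noteq> 0" "r' = aff_reflection \<alpha> n" by (rule reflsE[OF assms(3)])
  define f where "f = (\<lambda>x. \<alpha> \<bullet> x - 2 * pi * of_int n)"
  have val: "(x - r' x) \<bullet> (y - r' y) = (f x * f y) * (coroot \<alpha> \<bullet> coroot \<alpha>)" for x y
    by (simp add: a(3) aff_reflection_def f_def)
  note c = coroot_pos[OF a(2)]
  have fz: "f z \<noteq> 0" using z(3)[OF assms(3)] ne a aff_reflection_fixed_iff[OF a(2)] by (auto simp: f_def)
  have 1: "f p * f z \<ge> 0"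
    using closure_alcove_side[OF assms(3,2) z(1)] c unfolding val by (simp add: zero_le_mult_iff)
  \<comment> \<open>Turns the position of \<open>r p\<close> and \<open>z\<close> relative to
    \<open>r'\<close> into that of \<open>p\<close> and \<open>z\<close> relative to a conjugate
    reflection, to which \<open>closure_alcove_side\<close> applies.\<close>
  define r'' where "r'' = r \<circ> r' \<circ> r"
  have r'': "r'' \<in> refls" unfolding r''_def by (rule refl_conj[OF r assms(3)])
  have rr: "r (r'' x) = r' (r x)" for x by (simp add: r''_def refl_idem[OF r])
  have "(p - r'' p) \<bullet> (z - r'' z) = (r p - r (r'' p)) \<bullet> (r z - r (r'' z))"
    by (rule refl_inner[OF r, symmetric])
  also have "\<dots> = (f (r p) * f z) * (coroot \<alpha> \<bullet> coroot \<alpha>)"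
    using val[of "r p" "r z"] unfolding rr z(2) .
  finally have 2: "f (r p) * f z \<ge> 0"
    using closure_alcove_side[OF r'' assms(2) z(1)] c by (simp add: zero_le_mult_iff)
  have "f p * f (r p) < 0" using assms(4) sep_aff_reflection[OF a(2)] a(3) by (simp add: f_def)
  then show False using 1 2 fz by (auto simp: mult_less_0_iff zero_le_mult_iff)
qed

text \<open>The first mirror met on the way from a generic point \<open>p\<close> of the alcove to
  \<open>q\<close> is a wall: up to there the segment stays in \<open>A\<close>, and by genericity
  only one mirror passes through the crossing point.\<close>

lemma separating_wall:
  assumes "regular q" "q \<notin> A"
  shows "\<exists>r. wall r \<and> (\<forall>p\<in>A. sep r p q)"
proof -
  define I where "I = {(\<alpha>, \<beta>, n::int, m::int). \<alpha> \<in> R \<and> \<beta> \<in> R \<and> (\<forall>c. \<beta> \<noteq> c *\<^sub>R \<alpha>)}"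
  have "I \<subseteq> R \<times> R \<times> UNIV \<times> UNIV" by (auto simp: I_def)
  then have cI: "countable I"
    using finite_R countable_finite by (meson countable_SIGMA countable_subset countableI_type)
  \<comment> \<open>If the mirrors \<open>n\<close> of \<alpha> and \<open>m\<close> of \<beta> meet
    the segment in the same point, then \<open>\<alpha> \<bullet> q - 2 * pi * n\<close> and
    \<open>\<beta> \<bullet> q - 2 * pi * m\<close> are the same multiple of
    \<open>\<alpha> \<bullet> (q - p)\<close> and \<open>\<beta> \<bullet> (q - p)\<close>, which
    makes \<open>\<nu> i \<bullet> (q - p)\<close> vanish.\<close>
  define \<nu> where "\<nu> = (\<lambda>(\<alpha>, \<beta>, n::int, m::int).
     (\<alpha> \<bullet> q - 2 * pi * of_int n) *\<^sub>R \<beta> - (\<beta> \<bullet> q - 2 * pi * of_int m) *\<^sub>R \<alpha>)"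
  have "\<nu> i \<noteq> 0" if i: "i \<in> I" for i
  proof -
    obtain \<alpha> \<beta> n m where i': "i = (\<alpha>, \<beta>, n, m)" by (metis prod_cases4)
    have "\<alpha> \<in> R" "\<And>c. \<beta> \<noteq> c *\<^sub>R \<alpha>" using i by (auto simp: I_def i')
    then show ?thesis
      unfolding i' \<nu>_def prod.case using assms(1) by (intro not_parallel_combination) (auto simp: regular_iff)
  qed
  then obtain p where p: "p \<in> A" "\<And>i. i \<in> I \<Longrightarrow> \<nu> i \<bullet> p \<noteq> \<nu> i \<bullet> q"
    using generic_point[OF cI _ open_alcove alcove_nonempty, of \<nu> "\<lambda>i. \<nu> i \<bullet> q"] by blast
  define S where "S = {(\<alpha>, n::int). \<alpha> \<in> R \<and> (\<alpha> \<bullet> p - 2 * pi * of_int n) * (\<alpha> \<bullet> q - 2 * pi * of_int n) < 0}"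
  \<comment> \<open>The time at which the segment crosses the mirror of \<open>r\<close>; it is
    unique for the separating reflections, and only these are compared.\<close>
  define T where "T = (\<lambda>r. (THE t. r (p + t *\<^sub>R (q - p)) = p + t *\<^sub>R (q - p)))"
  have T: "T (aff_reflection \<alpha> n) = (\<alpha> \<bullet> p - 2 * pi * of_int n) / (\<alpha> \<bullet> p - \<alpha> \<bullet> q)"
    if "\<alpha> \<in> R" "sep (aff_reflection \<alpha> n) p q" for \<alpha> n
  proof -
    have "\<alpha> \<bullet> p \<noteq> \<alpha> \<bullet> q"
      using that sep_aff_reflection[OF root_nonzero[OF that(1)]] by (auto simp: mult_less_0_iff)
    then have "\<alpha> \<bullet> (p + t *\<^sub>R (q - p)) = 2 * pi * of_int n \<longleftrightarrow>
        t = (\<alpha> \<bullet> p - 2 * pi * of_int n) / (\<alpha> \<bullet> p - \<alpha> \<bullet> q)" for t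
      by (simp add: inner_add_right inner_diff_right eq_divide_eq algebra_simps) linarith
    then show ?thesis unfolding T_def aff_reflection_fixed_iff[OF root_nonzero[OF that(1)]] by simp
  qed
  have ne: "{r\<in>refls. sep r p q} \<noteq> {}"
    using in_alcove_if_not_sep[OF p(1) assms(1)] assms(2) by blast
  define r where "r = arg_min_on T {r\<in>refls. sep r p q}"
  have r: "r \<in> refls" "sep r p q" and rmin: "\<And>r'. r' \<in> refls \<Longrightarrow> sep r' p q \<Longrightarrow> T r \<le> T r'"
    using arg_min_if_finite[OF finite_separators ne, of T] unfolding r_def
    by (auto simp: not_less[symmetric])
  obtain \<alpha> n where a: "\<alpha> \<in> R" "\<alpha> \<noteq> 0" "r = aff_reflection \<alpha> n" by (rule reflsE[OF r(1)])
  define t where "t = T r"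
  have t: "t = (\<alpha> \<bullet> p - 2 * pi * of_int n) / (\<alpha> \<bullet> p - \<alpha> \<bullet> q)"
    using T[OF a(1)] r a(3) by (simp add: t_def)
  have fpq: "(\<alpha> \<bullet> p - 2 * pi * of_int n) * (\<alpha> \<bullet> q - 2 * pi * of_int n) < 0"
    using r(2) sep_aff_reflection[OF a(2)] a(3) by simp
  then have pq: "\<alpha> \<bullet> p \<noteq> \<alpha> \<bullet> q" by (auto simp: mult_less_0_iff)
  have t01: "0 < t" "t < 1"
    using fpq unfolding t by (auto simp: mult_less_0_iff divide_simps)
  define z where "z = p + t *\<^sub>R (q - p)"
  have az: "\<alpha> \<bullet> z = 2 * pi * of_int n"
  proof -
    have "t * (\<alpha> \<bullet> p - \<alpha> \<bullet> q) = \<alpha> \<bullet> p - 2 * pi * of_int n" using pq by (simp add: t)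
    then show ?thesis by (simp add: z_def inner_add_right inner_diff_right algebra_simps)
  qed
  \<comment> \<open>Before time \<open>t\<close> no mirror has been crossed: one that separates
    \<open>p\<close> from \<open>q\<close> is crossed at \<open>t\<close> at the earliest, and for
    any other one the affine function \<open>g\<close> keeps its sign between \<open>p\<close> and
    \<open>q\<close>.\<close>
  have inA: "p + s *\<^sub>R (q - p) \<in> A" if s: "0 \<le> s" "s < t" for s
  proof (rule in_alcove_if_same_sides[OF p(1)])
    fix \<beta> and m :: int assume b: "\<beta> \<in> R"
    define g where "g = (\<lambda>x. \<beta> \<bullet> x - 2 * pi * of_int m)"
    have gp: "g p \<noteq> 0" and gq: "g q \<noteq> 0"
      using alcove_regular[OF p(1)] assms(1) b by (auto simp: regular_iff g_def)
    have gs: "g (p + s *\<^sub>R (q - p)) = (1 - s) * g p + s * g q"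
      by (simp add: g_def inner_add_right inner_diff_right algebra_simps)
    have "g p * g (p + s *\<^sub>R (q - p)) > 0"
    proof (cases "g p * g q < 0")
      case True
      then have "sep (aff_reflection \<beta> m) p q"
        using sep_aff_reflection[OF root_nonzero[OF b]] by (simp add: g_def)
      then have "t \<le> g p / (g p - g q)"
        using rmin[OF reflsI[OF b]] T[OF b] unfolding t_def g_def by fastforce
      then have s': "s < g p / (g p - g q)" using s by simp
      have "g p * (g p - g q) > 0" using True gp
        by (auto simp: mult_less_0_iff zero_less_mult_iff)
      from mult_strict_right_mono[OF s' this]
      have "s * (g p * (g p - g q)) < (g p / (g p - g q)) * (g p * (g p - g q))" .
      also have "\<dots> = g p * g p" using \<open>g p * (g p - g q) > 0\<close> by auto
      finally have "s * (g p * (g p - g q)) < g p * g p" .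
      then show ?thesis unfolding gs by (simp add: algebra_simps)
    next
      case False
      then have pos: "g p * g q > 0" using gp gq by (metis less_linear mult_eq_0_iff)
      have "(1 - s) * (g p * g p) + s * (g p * g q) > 0"
      proof (rule add_pos_nonneg)
        have "g p * g p > 0" using gp by (metis linorder_neqE_linordered_idom mult_neg_neg mult_pos_pos)
        then show "(1 - s) * (g p * g p) > 0" using s t01 by simp
        show "s * (g p * g q) \<ge> 0" using s pos by simp
      qed
      then show ?thesis unfolding gs by (simp add: algebra_simps)
    qed
    then show "(\<beta> \<bullet> p - 2 * pi * of_int m) * (\<beta> \<bullet> (p + s *\<^sub>R (q - p)) - 2 * pi * of_int m) > 0"
      by (simp add: g_def)
  qed
  have "((\<lambda>s. p + s *\<^sub>R (q - p)) \<longlongrightarrow> z) (at_left t)"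
    unfolding z_def by (intro tendsto_intros)
  moreover have "eventually (\<lambda>s. p + s *\<^sub>R (q - p) \<in> closure A) (at_left t)"
    using eventually_at_left_real[OF t01(1)]
  proof eventually_elim
    case (elim s)
    then have "p + s *\<^sub>R (q - p) \<in> A" by (intro inA) auto
    then show ?case by (rule subsetD[OF closure_subset])
  qed
  ultimately have zA: "z \<in> closure A"
    by (intro Lim_in_closed_set[OF closed_closure _ _]) auto
  have "r' = r" if r': "r' \<in> refls" "r' z = z" for r'
  proof -
    obtain \<beta> m where b: "\<beta> \<in> R" "\<beta> \<noteq> 0" "r' = aff_reflection \<beta> m" by (rule reflsE[OF r'(1)])
    have bz: "\<beta> \<bullet> z = 2 * pi * of_int m" using r' b aff_reflection_fixed_iff by metis
    have "\<exists>c. \<beta> = c *\<^sub>R \<alpha>"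
    proof (rule ccontr)
      assume "\<not> ?thesis"
      then have i: "(\<alpha>, \<beta>, n, m) \<in> I" using a b by (auto simp: I_def)
      have q: "q = z + (1 - t) *\<^sub>R (q - p)" by (simp add: z_def algebra_simps)
      have "\<alpha> \<bullet> q - 2 * pi * of_int n = (1 - t) * (\<alpha> \<bullet> (q - p))"
        using az arg_cong[OF q, of "\<lambda>x. \<alpha> \<bullet> x"] by (simp add: inner_add_right)
      moreover have "\<beta> \<bullet> q - 2 * pi * of_int m = (1 - t) * (\<beta> \<bullet> (q - p))"
        using bz arg_cong[OF q, of "\<lambda>x. \<beta> \<bullet> x"] by (simp add: inner_add_right)
      ultimately have "\<nu> (\<alpha>, \<beta>, n, m) \<bullet> (q - p) = 0"
        by (simp add: \<nu>_def inner_diff_left)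
      then show False using p(2)[OF i] by (simp add: inner_diff_right)
    qed
    then obtain c where c: "\<beta> = c *\<^sub>R \<alpha>" by blast
    show ?thesis
      using aff_reflection_parallel[OF a(2), of c n z m] b r' az aff_reflection_fixed_iff[OF a(2)] a(3)
      unfolding c by blast
  qed
  then have "wall r"
    unfolding wall_def using r(1) zA az a(2,3) aff_reflection_fixed_iff[OF a(2)] by blast
  moreover have "sep r p' q" if "p' \<in> A" for p'
    using sep_trichotomy[OF r(1) alcove_regular[OF that] alcove_regular[OF p(1)] assms(1)]
      alcove_not_sep[OF r(1) that p(1)] r(2) by simp
  ultimately show ?thesis by blast
qed

text \<open>Induction on the number of mirrors between \<open>p\<close> and \<open>q\<close>. A
  separating wall \<open>r\<close> is the only mirror between \<open>p\<close> and
  \<open>r p\<close>, so conjugation by \<open>r\<close> maps the mirrors between \<open>p\<close>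
  and \<open>r q\<close> injectively to those between \<open>p\<close> and \<open>q\<close>, and
  misses \<open>r\<close> itself.\<close>

lemma walls_transitive:
  assumes "regular q"
  shows "\<exists>ws. (\<forall>w\<in>set ws. wall w) \<and> act ws q \<in> A"
proof -
  obtain p where p: "p \<in> A" using alcove_nonempty by blast
  show ?thesis using assms
  proof (induction "card {r\<in>refls. sep r p q}" arbitrary: q rule: less_induct)
    case less
    show ?case
    proof (cases "q \<in> A")
      case True
      then show ?thesis by (intro exI[of _ "[]"]) auto
    next
      case False
      then obtain r where r: "wall r" "sep r p q" using separating_wall[OF less(2)] p by blast
      have rr: "r \<in> refls" by (rule wall_refl[OF r(1)])
      have reg: "regular (r x)" if "regular x" for x using regular_act[of "[r]" x] rr that by simp
      note regp = alcove_regular[OF p]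
      let ?c = "\<lambda>r'. r \<circ> r' \<circ> r"
      have sub: "?c ` {r'\<in>refls. sep r' p (r q)} \<subseteq> {r'\<in>refls. sep r' p q} - {r}"
      proof (rule image_subsetI)
        fix r' assume "r' \<in> {r' \<in> refls. sep r' p (r q)}"
        then have r': "r' \<in> refls" "sep r' p (r q)" by auto
        have c: "?c r' \<in> refls" by (rule refl_conj[OF rr r'(1)])
        have "sep r' (r (r p)) (r q)" using r' by (simp add: refl_idem[OF rr])
        then have s: "sep (?c r') (r p) q"
          using sep_act[of "[r]" r' "r p" q] rr r'(1) by (simp add: comp_def)
        have nr: "?c r' \<noteq> r"
        proof
          assume "?c r' = r"
          then have "sep r (r p) q" using s by simp
          then show False
            using sep_trichotomy[OF rr regp reg[OF regp] less(2)] r(2) sep_refl_self[OF rr regp] by simp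
        qed
        then have "\<not> sep (?c r') p (r p)" using wall_only_separator[OF r(1) p c] by blast
        then have "sep (?c r') p q"
          using sep_trichotomy[OF c regp reg[OF regp] less(2)] s by simp
        then show "?c r' \<in> {r' \<in> refls. sep r' p q} - {r}" using c nr by blast
      qed
      have "inj_on ?c {r'\<in>refls. sep r' p (r q)}"
        by (rule inj_on_inverseI[where g = ?c]) (auto simp: fun_eq_iff refl_idem[OF rr])
      then have "card {r'\<in>refls. sep r' p (r q)} \<le> card ({r'\<in>refls. sep r' p q} - {r})"
        using sub finite_separators by (intro card_inj_on_le) auto
      also have "\<dots> < card {r'\<in>refls. sep r' p q}"
        using r(2) rr finite_separators by (intro psubset_card_mono) auto
      finally obtain ws where "\<forall>w\<in>set ws. wall w" "act ws (r q) \<in> A"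
        using less(1)[of "r q"] reg[OF less(2)] by blast
      then show ?thesis using r(1) by (intro exI[of _ "ws @ [r]"]) (auto simp: act_append)
    qed
  qed
qed

text \<open>From a point \<open>z\<close> that lies on the mirror of \<open>r\<close> alone, step
  off the mirror into an alcove. A wall word that brings this alcove to \<open>A\<close> brings
  \<open>z\<close> to the closed alcove, where the transported mirror is a wall \<open>w\<close>; so
  \<open>r\<close> is conjugate to \<open>w\<close> by a wall word.\<close>

lemma refl_from_walls:
  assumes "r \<in> refls"
  shows "\<exists>ws. (\<forall>w\<in>set ws. wall w) \<and> (\<forall>x. r x = act ws x)"
proof -
  obtain \<alpha> n where a: "\<alpha> \<in> R" "\<alpha> \<noteq> 0" "r = aff_reflection \<alpha> n" by (rule reflsE[OF assms])
  have aa: "\<alpha> \<bullet> \<alpha> > 0" using a by simp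
  define I where "I = {(\<beta>, m::int). \<beta> \<in> R \<and> (\<forall>c. \<beta> \<noteq> c *\<^sub>R \<alpha>)}"
  have "I \<subseteq> R \<times> UNIV" by (auto simp: I_def)
  then have cI: "countable I"
    using finite_R countable_finite by (meson countable_SIGMA countable_subset countableI_type)
  \<comment> \<open>The point \<open>z\<close> below is the orthogonal projection of
    \<open>x\<close> to the mirror of \<open>r\<close>, and \<open>\<nu> i \<bullet> x = c i\<close>
    says that \<open>z\<close> also lies on mirror \<open>m\<close> of \<beta>. The scalar 1 fits
    the shape of \<open>not_parallel_combination\<close>.\<close>
  define \<nu> where "\<nu> = (\<lambda>(\<beta>, m::int). 1 *\<^sub>R \<beta> - (\<alpha> \<bullet> \<beta> / (\<alpha> \<bullet> \<alpha>)) *\<^sub>R \<alpha>)"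
  define c where "c = (\<lambda>(\<beta>, m::int). 2 * pi * of_int m - (2 * pi * of_int n / (\<alpha> \<bullet> \<alpha>)) * (\<alpha> \<bullet> \<beta>))"
  have "\<nu> i \<noteq> 0" if i: "i \<in> I" for i
  proof -
    obtain \<beta> m where i': "i = (\<beta>, m)" by (metis surj_pair)
    have "\<And>c. \<beta> \<noteq> c *\<^sub>R \<alpha>" using i by (auto simp: I_def i')
    then show ?thesis unfolding i' \<nu>_def prod.case by (intro not_parallel_combination) auto
  qed
  then obtain x where x: "\<And>i. i \<in> I \<Longrightarrow> \<nu> i \<bullet> x \<noteq> c i"
    using generic_point[OF cI _ open_UNIV UNIV_not_empty, of \<nu> c] by metis
  define z where "z = x - ((\<alpha> \<bullet> x - 2 * pi * of_int n) / (\<alpha> \<bullet> \<alpha>)) *\<^sub>R \<alpha>"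
  have az: "\<alpha> \<bullet> z = 2 * pi * of_int n" using aa by (simp add: z_def inner_diff_right)
  have generic: "\<exists>c. \<beta> = c *\<^sub>R \<alpha>" if "\<beta> \<in> R" "\<beta> \<bullet> z = 2 * pi * of_int m" for \<beta> m
  proof (rule ccontr)
    assume "\<not> ?thesis"
    then have "(\<beta>, m) \<in> I" using that by (auto simp: I_def)
    from x[OF this] show False using that(2) aa
      by (simp add: \<nu>_def c_def z_def inner_diff_left inner_diff_right inner_commute field_simps)
  qed
  have only: "r' = r" if r': "r' \<in> refls" "r' z = z" for r'
  proof -
    obtain \<beta> m where b: "\<beta> \<in> R" "\<beta> \<noteq> 0" "r' = aff_reflection \<beta> m" by (rule reflsE[OF r'(1)])
    have "\<beta> \<bullet> z = 2 * pi * of_int m" using r' b aff_reflection_fixed_iff by metis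
    then obtain c where c: "\<beta> = c *\<^sub>R \<alpha>" using generic b by blast
    show ?thesis
      using aff_reflection_parallel[OF a(2), of c n z m] b r' az aff_reflection_fixed_iff[OF a(2)] a(3)
      unfolding c by blast
  qed
  have "\<exists>e>0. \<forall>s. 0 < s \<and> s < e \<longrightarrow> (\<forall>m::int. \<beta> \<bullet> (z + s *\<^sub>R \<alpha>) \<noteq> 2 * pi * of_int m)" if b: "\<beta> \<in> R" for \<beta>
  proof (cases "\<beta> \<bullet> \<alpha> = 0")
    case True
    have "\<beta> \<bullet> z \<noteq> 2 * pi * of_int m" for m
      using generic[OF b, of m] True root_nonzero[OF b] aa by auto
    then show ?thesis using True by (intro exI[of _ 1]) (auto simp: inner_add_right)
  next
    case False
    then obtain e where e: "e > 0" "\<And>s. 0 < s \<Longrightarrow> s < e \<Longrightarrow> \<beta> \<bullet> z / (2 * pi) + s * (\<beta> \<bullet> \<alpha> / (2 * pi)) \<notin> \<int>"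
      using small_shift_not_int[of "\<beta> \<bullet> \<alpha> / (2 * pi)" "\<beta> \<bullet> z / (2 * pi)"] by auto
    have "\<beta> \<bullet> (z + s *\<^sub>R \<alpha>) \<noteq> 2 * pi * of_int m" if "0 < s" "s < e" for s m
    proof
      assume "\<beta> \<bullet> (z + s *\<^sub>R \<alpha>) = 2 * pi * of_int m"
      then have "\<beta> \<bullet> z / (2 * pi) + s * (\<beta> \<bullet> \<alpha> / (2 * pi)) = of_int m"
        by (simp add: inner_add_right field_simps)
      then show False using e(2)[OF that] by (metis Ints_of_int)
    qed
    then show ?thesis using e(1) by blast
  qed
  then have "\<forall>\<beta>\<in>R. eventually (\<lambda>s. \<forall>m::int. \<beta> \<bullet> (z + s *\<^sub>R \<alpha>) \<noteq> 2 * pi * of_int m) (at_right 0)"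
    unfolding eventually_at_right_field by meson
  then have "eventually (\<lambda>s. \<forall>\<beta>\<in>R. \<forall>m::int. \<beta> \<bullet> (z + s *\<^sub>R \<alpha>) \<noteq> 2 * pi * of_int m) (at_right 0)"
    by (rule eventually_ball_finite[OF finite_R])
  then obtain e where e: "e > 0" "\<And>s. 0 < s \<Longrightarrow> s < e \<Longrightarrow> regular (z + s *\<^sub>R \<alpha>)"
    unfolding eventually_at_right_field regular_iff by auto
  define q where "q = z + (e / 2) *\<^sub>R \<alpha>"
  have regq: "regular q" unfolding q_def using e by auto
  obtain ws where ws: "\<forall>w\<in>set ws. wall w" "act ws q \<in> A" using walls_transitive[OF regq] by blast
  have wsr: "set ws \<subseteq> refls" using ws(1) wall_refl by blast
  \<comment> \<open>For \<open>0 < s < e\<close> no root reaches a level, so this open segment stays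
    in the alcove of \<open>q\<close>, which the word maps into \<open>A\<close>.\<close>
  have seg: "act ws (z + s *\<^sub>R \<alpha>) \<in> A" if s: "0 < s" "s < e" for s
  proof (rule in_alcove_if_not_sep[OF ws(2) regular_act[OF wsr e(2)[OF s]]])
    fix r' assume r': "r' \<in> refls"
    define r'' where "r'' = (\<lambda>x. act (rev ws) (r' (act ws x)))"
    have "r'' \<in> refls" unfolding r''_def by (rule act_conj'[OF wsr r'])
    then obtain \<beta> m where b: "\<beta> \<in> R" "\<beta> \<noteq> 0" "r'' = aff_reflection \<beta> m" by (rule reflsE)
    define g where "g = (\<lambda>s. \<beta> \<bullet> (z + s *\<^sub>R \<alpha>) - 2 * pi * of_int m)"
    have "0 < g (e / 2) * g s"
    proof (rule connected_same_sign[of "{0<..<e}" g])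
      show "g x \<noteq> 0" if "x \<in> {0<..<e}" for x
        using e(2)[of x] b(1) that by (auto simp: regular_iff g_def)
    qed (use s e(1) in \<open>auto simp: g_def intro!: continuous_intros\<close>)
    then have "\<not> sep r'' q (z + s *\<^sub>R \<alpha>)"
      unfolding b(3) sep_aff_reflection[OF b(2)] q_def g_def by simp
    then show "\<not> sep r' (act ws q) (act ws (z + s *\<^sub>R \<alpha>))"
      using sep_act[OF wsr r'] by (simp add: r''_def)
  qed
  have cont: "continuous_on UNIV (act us)" if "set us \<subseteq> refls" for us
    using that
  proof (induction us)
    case Nil
    then show ?case by simp
  next
    case (Cons w us)
    obtain \<beta> m where b: "w = aff_reflection \<beta> m" using Cons(2) by (auto simp: refls_def)
    show ?case using Cons unfolding b by (auto simp: aff_reflection_def intro!: continuous_intros)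
  qed
  have "((\<lambda>s. z + s *\<^sub>R \<alpha>) \<longlongrightarrow> z + 0 *\<^sub>R \<alpha>) (at_right 0)" by (intro tendsto_intros)
  then have "((\<lambda>s. act ws (z + s *\<^sub>R \<alpha>)) \<longlongrightarrow> act ws z) (at_right 0)"
    using continuous_on_tendsto_compose[OF cont[OF wsr], of "\<lambda>s. z + s *\<^sub>R \<alpha>" z "at_right 0"] by simp
  moreover have "eventually (\<lambda>s. act ws (z + s *\<^sub>R \<alpha>) \<in> closure A) (at_right 0)"
    using eventually_at_right_real[OF e(1)] by eventually_elim (use seg closure_subset in auto)
  ultimately have zA: "act ws z \<in> closure A"
    by (intro Lim_in_closed_set[OF closed_closure _ _]) auto
  \<comment> \<open>The word carries \<open>z\<close>, which lies on the mirror of \<open>r\<close>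
    alone, to a point of the closed alcove on the mirror of \<open>w\<close> alone; this is the
    witness for \<open>wall w\<close>.\<close>
  define w where "w = (\<lambda>x. act ws (r (act (rev ws) x)))"
  have w: "w \<in> refls" unfolding w_def by (rule act_conj[OF wsr assms])
  have rz: "r z = z" using az a aff_reflection_fixed_iff by metis
  have "wall w" unfolding wall_def
  proof (intro conjI w bexI[OF _ zA] ballI impI)
    show "w (act ws z) = act ws z" by (simp add: w_def act_rev[OF wsr] rz)
    fix r' assume r': "r' \<in> refls" "r' (act ws z) = act ws z"
    have "(\<lambda>x. act (rev ws) (r' (act ws x))) = r"
      by (rule only[OF act_conj'[OF wsr r'(1)]]) (simp add: r' act_rev[OF wsr])
    then have "r x = act (rev ws) (r' (act ws x))" for x by metis
    then show "r' = w" by (auto simp: w_def act_rev'[OF wsr] fun_eq_iff)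
  qed
  moreover have "r x = act (rev ws @ [w] @ ws) x" for x
    by (simp add: act_append w_def act_rev[OF wsr])
  ultimately show ?thesis using ws(1) by (intro exI[of _ "rev ws @ [w] @ ws"]) auto
qed

text \<open>The exchange argument: either the gallery of the word crosses its first wall a second time,
  and the word can be shortened, or the common point lies on that wall.\<close>

lemma wall_word_fixes:
  assumes "\<forall>w\<in>set ws. wall w" "u \<in> closure A" "act ws u \<in> closure A"
  shows "act ws u = u"
  using assms
proof (induction "length ws" arbitrary: ws rule: less_induct)
  case less
  obtain p where p: "p \<in> A" using alcove_nonempty by blast
  note regp = alcove_regular[OF p]
  show ?case
  proof (cases ws)
    case Nil
    then show ?thesis by simp
  next
    case (Cons w rest)
    have ww: "wall w" and wr: "w \<in> refls" and wsr: "set ws \<subseteq> refls" and restr: "set rest \<subseteq> refls"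
      using less(2) wall_refl unfolding Cons by auto
    show ?thesis
    proof (cases "sep w p (act ws p)")
      \<comment> \<open>\<open>A\<close> and its image under the word lie on different sides of the
        mirror of \<open>w\<close>, and their closures share \<open>v\<close>. Hence
        \<open>v\<close> is on that mirror, and dropping \<open>w\<close> does not move it.\<close>
      case True
      define v where "v = act ws u"
      obtain \<alpha> n where a: "\<alpha> \<in> R" "\<alpha> \<noteq> 0" "w = aff_reflection \<alpha> n" by (rule reflsE[OF wr])
      define f where "f = (\<lambda>x. \<alpha> \<bullet> x - 2 * pi * of_int n)"
      have val: "(x - w x) \<bullet> (y - w y) = (f x * f y) * (coroot \<alpha> \<bullet> coroot \<alpha>)" for x y
        by (simp add: a(3) aff_reflection_def f_def)
      note c = coroot_pos[OF a(2)]
      have 1: "f p * f v \<ge> 0"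
        using closure_alcove_side[OF wr p less(4)] c unfolding val v_def by (simp add: zero_le_mult_iff)
      define w' where "w' = (\<lambda>x. act (rev ws) (w (act ws x)))"
      have w': "w' \<in> refls" unfolding w'_def by (rule act_conj'[OF wsr wr])
      have "act ws (w' x) = w (act ws x)" for x by (simp add: w'_def act_rev'[OF wsr])
      then have "(p - w' p) \<bullet> (u - w' u) = (act ws p - w (act ws p)) \<bullet> (v - w v)"
        using act_inner[OF wsr, of p "w' p" u "w' u"] by (simp add: v_def)
      also have "\<dots> = (f (act ws p) * f v) * (coroot \<alpha> \<bullet> coroot \<alpha>)" by (rule val)
      finally have 2: "f (act ws p) * f v \<ge> 0"
        using closure_alcove_side[OF w' p less(3)] c by (simp add: zero_le_mult_iff)
      have "f p * f (act ws p) < 0" using True sep_aff_reflection[OF a(2)] a(3) by (simp add: f_def)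
      then have "f v = 0" using 1 2 by (auto simp: mult_less_0_iff zero_le_mult_iff)
      then have "w v = v" using aff_reflection_fixed_iff[OF a(2)] a(3) by (simp add: f_def)
      moreover have "act rest u = w v" by (simp add: v_def Cons refl_idem[OF wr])
      ultimately have "act rest u = v" by simp
      moreover have "act rest u = u"
      proof (rule less(1))
        show "length rest < length ws" "\<forall>w\<in>set rest. wall w" using less(2) by (simp_all add: Cons)
        show "act rest u \<in> closure A" using less(4) \<open>act rest u = v\<close> by (simp add: v_def)
      qed (rule less(3))
      ultimately show ?thesis by (simp add: v_def)
    next
      case False
      \<comment> \<open>The gallery is beyond the mirror of \<open>w\<close> after its first letter
        and no longer so at the end, so some letter \<open>y\<close> brings it back.\<close>
      have "\<exists>xs y ys. us = xs @ y # ys \<and> sep w p (act (w # xs) p) \<and> \<not> sep w p (act (w # xs @ [y]) p)"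
        if "\<not> sep w p (act (w # us) p)" for us
        using that
      proof (induction us rule: rev_induct)
        case Nil
        then show ?case using sep_refl_self[OF wr regp] by simp
      next
        case (snoc y us)
        show ?case
        proof (cases "sep w p (act (w # us) p)")
          case True
          then show ?thesis using snoc(2) by (intro exI[of _ us] exI[of _ y] exI[of _ "[]"]) auto
        next
          case False
          from snoc(1)[OF this] obtain xs y' ys where
            "us = xs @ y' # ys" "sep w p (act (w # xs) p)" "\<not> sep w p (act (w # xs @ [y']) p)" by blast
          then show ?thesis by (intro exI[of _ xs] exI[of _ y'] exI[of _ "ys @ [y]"]) auto
        qed
      qed
      from this[of rest] False obtain xs y ys where d: "rest = xs @ y # ys"
        "sep w p (act (w # xs) p)" "\<not> sep w p (act (w # xs @ [y]) p)" unfolding Cons by blast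
      have yw: "wall y" and yr: "y \<in> refls" and gr: "set (w # xs) \<subseteq> refls" and xr: "set xs \<subseteq> refls"
        using less(2) wall_refl d(1) unfolding Cons by auto
      have regyp: "regular (y p)" using regular_act[of "[y]" p] yr regp by simp
      have "sep w (act (w # xs) p) (act (w # xs) (y p))"
        using sep_trichotomy[OF wr regp regular_act[OF gr regp] regular_act[OF gr regyp]] d(2,3)
        by (simp add: act_append)
      then have "sep (\<lambda>x. act (rev (w # xs)) (w (act (w # xs) x))) p (y p)"
        using sep_act[OF gr wr] by blast
      then have eq: "(\<lambda>x. act (rev (w # xs)) (w (act (w # xs) x))) = y"
        using wall_only_separator[OF yw p act_conj'[OF gr wr]] by blast
      \<comment> \<open>By \<open>eq\<close>, \<open>y\<close> is the conjugate of \<open>w\<close>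
        by the word \<open>w # xs\<close>. Moved to the front it cancels the first letter, so two
        letters can be deleted.\<close>
      have "act (w # xs) (y x) = act xs x" for x
        unfolding fun_cong[OF eq, symmetric] using act_rev'[OF gr, of "w (act (w # xs) x)"]
        by (simp add: refl_idem[OF wr])
      then have "act ws x = act (xs @ ys) x" for x by (simp add: Cons d(1) act_append)
      then show ?thesis using less(1)[of "xs @ ys"] less(2,3,4) unfolding Cons d(1) by auto
    qed
  qed
qed

section \<open>Simple coroots and the dual of the weight lattice\<close>

inductive_set coroot_lattice :: "'a set" where
  zero: "0 \<in> coroot_lattice"
| add: "x \<in> coroot_lattice \<Longrightarrow> \<alpha> \<in> R \<Longrightarrow> x + coroot \<alpha> \<in> coroot_lattice"

lemma coroot_lattice_add: "x \<in> coroot_lattice \<Longrightarrow> y \<in> coroot_lattice \<Longrightarrow> x + y \<in> coroot_lattice"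
proof (induction rule: coroot_lattice.induct)
  case (add x \<alpha>)
  then have "(x + y) + coroot \<alpha> \<in> coroot_lattice" by (intro coroot_lattice.add) auto
  then show ?case by (simp add: algebra_simps)
qed simp

lemma coroot_lattice_coroot: "\<alpha> \<in> R \<Longrightarrow> coroot \<alpha> \<in> coroot_lattice"
  using coroot_lattice.add[OF coroot_lattice.zero] by fastforce

lemma coroot_uminus: "coroot (- \<alpha>) = - coroot \<alpha>"
  by (simp add: coroot_def)

lemma coroot_lattice_uminus: "x \<in> coroot_lattice \<Longrightarrow> - x \<in> coroot_lattice"
proof (induction rule: coroot_lattice.induct)
  case (add x \<alpha>)
  then show ?case
    using coroot_lattice.add[OF add(3) uminus_root[OF add(2)]] by (simp add: coroot_uminus)
qed (simp add: coroot_lattice.zero)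

lemma coroot_lattice_int_multiple:
  assumes "x \<in> coroot_lattice" "c \<in> \<int>"
  shows "c *\<^sub>R x \<in> coroot_lattice"
proof -
  have nat: "real n *\<^sub>R x \<in> coroot_lattice" for n :: nat
    by (induction n) (auto simp: scaleR_left_distrib coroot_lattice.zero intro: coroot_lattice_add assms)
  obtain m :: int where m: "c = of_int m" using assms(2) by (auto elim: Ints_cases)
  show ?thesis
  proof (cases "m \<ge> 0")
    case True
    then show ?thesis using nat[of "nat m"] m by simp
  next
    case False
    then show ?thesis using coroot_lattice_uminus[OF nat[of "nat (- m)"]] m by simp
  qed
qed

text \<open>The indecomposable positive coroots, a base of the dual root system. If \<alpha> is
  positive and \<open>2 *\<^sub>R \<alpha>\<close> is a root, then \<open>coroot \<alpha>\<close> is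
  twice the coroot of \<open>2 *\<^sub>R \<alpha>\<close> and is excluded by the case
  \<open>y = z\<close>.\<close>

definition simple_coroots :: "'a set" where
  "simple_coroots = {x \<in> coroot ` Rp. \<not> (\<exists>y\<in>coroot ` Rp. \<exists>z\<in>coroot ` Rp. x = y + z)}"

lemma coroot_difference:
  assumes "\<alpha> \<in> R" "\<beta> \<in> R" "coroot \<alpha> \<bullet> \<beta> = 1"
  shows "\<exists>\<gamma>\<in>R. coroot \<gamma> = coroot \<alpha> - coroot \<beta>"
proof
  show "root_reflection \<beta> \<alpha> \<in> R" by (rule root_reflection_root[OF assms(2,1)])
  have b: "\<beta> \<noteq> 0" "\<alpha> \<noteq> 0" using assms root_nonzero by auto
  have "coroot (root_reflection \<beta> \<alpha>) = root_reflection \<beta> (coroot \<alpha>)"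
    by (rule coroot_isometry[OF linear_root_reflection]) (simp add: root_reflection_inner b)
  also have "\<dots> = coroot \<alpha> - (coroot \<alpha> \<bullet> \<beta>) *\<^sub>R coroot \<beta>"
    by (simp add: root_reflection_def coroot_def inner_commute)
  finally show "coroot (root_reflection \<beta> \<alpha>) = coroot \<alpha> - coroot \<beta>" using assms(3) by simp
qed

text \<open>A positive product makes both Cartan integers positive, and their product is at most 4.
  If one of them is 1, the difference of the two coroots is itself a coroot, so one of the two
  decomposes; otherwise both are 2, which gives \<open>\<alpha> = \<beta>\<close>.\<close>

lemma simple_coroots_obtuse:
  assumes "x \<in> simple_coroots" "y \<in> simple_coroots" "x \<noteq> y"
  shows "x \<bullet> y \<le> 0"
proof (rule ccontr)
  assume "\<not> ?thesis"
  then have pos: "x \<bullet> y > 0" by simp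
  obtain \<alpha> \<beta> where ab: "\<alpha> \<in> Rp" "x = coroot \<alpha>" "\<beta> \<in> Rp" "y = coroot \<beta>"
    using assms unfolding simple_coroots_def by blast
  have abR: "\<alpha> \<in> R" "\<beta> \<in> R" using ab positive_root by auto
  have nz: "\<alpha> \<bullet> \<alpha> > 0" "\<beta> \<bullet> \<beta> > 0" using root_nonzero abR by auto
  obtain m :: int where m: "coroot \<alpha> \<bullet> \<beta> = of_int m"
    using coroot_root_int[OF abR] by (auto elim: Ints_cases)
  obtain n :: int where n: "coroot \<beta> \<bullet> \<alpha> = of_int n"
    using coroot_root_int[OF abR(2,1)] by (auto elim: Ints_cases)
  have x: "x \<bullet> y = (coroot \<alpha> \<bullet> \<beta>) * (2 / (\<beta> \<bullet> \<beta>))" "x \<bullet> y = (coroot \<beta> \<bullet> \<alpha>) * (2 / (\<alpha> \<bullet> \<alpha>))"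
    by (simp_all add: ab coroot_def inner_commute)
  have mpos: "m > 0"
    using zero_less_mult_pos2[OF pos[unfolded x(1)]] nz by (simp add: m)
  have npos: "n > 0"
    using zero_less_mult_pos2[OF pos[unfolded x(2)]] nz by (simp add: n)
  have m': "2 * (\<alpha> \<bullet> \<beta>) = of_int m * (\<alpha> \<bullet> \<alpha>)" and n': "2 * (\<alpha> \<bullet> \<beta>) = of_int n * (\<beta> \<bullet> \<beta>)"
    using m n nz by (simp_all add: coroot_def field_simps inner_commute)
  have "(2 * (\<alpha> \<bullet> \<beta>)) * (2 * (\<alpha> \<bullet> \<beta>)) \<le> 4 * ((\<alpha> \<bullet> \<alpha>) * (\<beta> \<bullet> \<beta>))"
    using Cauchy_Schwarz_ineq[of \<alpha> \<beta>] by (simp add: power2_eq_square)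
  then have "(of_int m * of_int n) * ((\<alpha> \<bullet> \<alpha>) * (\<beta> \<bullet> \<beta>)) \<le> 4 * ((\<alpha> \<bullet> \<alpha>) * (\<beta> \<bullet> \<beta>))"
    using m' n' by (metis mult.assoc mult.left_commute)
  then have "real_of_int m * of_int n \<le> 4" using nz by simp
  then have mn: "m * n \<le> 4" by (metis of_int_le_numeral_iff of_int_mult)
  have diff: False if "\<gamma> \<in> R" "coroot \<gamma> = x - y \<or> coroot \<gamma> = y - x" for \<gamma>
  proof -
    have "\<exists>\<delta>\<in>Rp. coroot \<delta> = x - y \<or> coroot \<delta> = y - x"
      using positive_or_negative[OF that(1)] that(2) coroot_uminus[of \<gamma>] by (metis minus_diff_eq)
    then obtain \<delta> where d: "\<delta> \<in> Rp" "x = coroot \<delta> + y \<or> y = coroot \<delta> + x"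
      by (auto simp: algebra_simps)
    then show False using assms(1,2) ab unfolding simple_coroots_def by blast
  qed
  show False
  proof (cases "m = 1 \<or> n = 1")
    case True
    then show False
      using coroot_difference[OF abR] coroot_difference[OF abR(2,1)] m n diff ab by auto
  next
    case False
    then have "m \<ge> 2" "n \<ge> 2" using mpos npos by auto
    moreover have "m * 2 \<le> m * n" "2 * n \<le> m * n"
      using \<open>m \<ge> 2\<close> \<open>n \<ge> 2\<close> by (auto intro!: mult_left_mono mult_right_mono)
    ultimately have "m = 2" "n = 2" using mn by linarith+
    then have "(\<alpha> - \<beta>) \<bullet> (\<alpha> - \<beta>) = 0"
      using m' n' by (simp add: inner_diff_left inner_diff_right inner_commute)
    then show False using ab assms(3) by simp
  qed
qed

text \<open>The product with a point \<open>p\<close> of the alcove serves as height. The summands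
  of a decomposable coroot are lower, and the induction counts the positive coroots of smaller
  height.\<close>

lemma positive_coroot_expansion:
  assumes "x \<in> coroot ` Rp"
  shows "\<exists>c. (\<forall>d. c d \<in> \<int>) \<and> x = (\<Sum>d\<in>simple_coroots. c d *\<^sub>R d)"
proof -
  obtain p where p: "p \<in> A" using alcove_nonempty by blast
  have pos: "y \<bullet> p > 0" if y: "y \<in> coroot ` Rp" for y
  proof -
    obtain \<alpha> where a: "\<alpha> \<in> Rp" "y = coroot \<alpha>" using y by blast
    then show ?thesis
      using alcove_bounds[OF a(1) p] root_nonzero[OF positive_root[OF a(1)]] by (simp add: coroot_def)
  qed
  have fin: "finite (coroot ` Rp)" using finite_Rp by simp
  have fins: "finite simple_coroots" using fin by (simp add: simple_coroots_def)
  show ?thesis using assms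
  proof (induction "card {y \<in> coroot ` Rp. y \<bullet> p < x \<bullet> p}" arbitrary: x rule: less_induct)
    case less
    show ?case
    proof (cases "x \<in> simple_coroots")
      case True
      have "(\<Sum>d\<in>simple_coroots. (if d = x then 1 else 0) *\<^sub>R d) = (\<Sum>d\<in>simple_coroots. if d = x then d else 0)"
        by (rule sum.cong) auto
      also have "\<dots> = x" using True fins by (simp add: sum.delta)
      finally show ?thesis by (intro exI[of _ "\<lambda>d. if d = x then 1 else 0"]) auto
    next
      case False
      then obtain y z where yz: "y \<in> coroot ` Rp" "z \<in> coroot ` Rp" "x = y + z"
        using less(2) unfolding simple_coroots_def by blast
      have lt: "y \<bullet> p < x \<bullet> p" "z \<bullet> p < x \<bullet> p"
        using pos[OF yz(1)] pos[OF yz(2)] by (auto simp: yz(3) inner_add_left)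
      have c: "card {v \<in> coroot ` Rp. v \<bullet> p < u \<bullet> p} < card {v \<in> coroot ` Rp. v \<bullet> p < x \<bullet> p}"
        if "u \<in> coroot ` Rp" "u \<bullet> p < x \<bullet> p" for u
      proof (rule psubset_card_mono)
        show "{v \<in> coroot ` Rp. v \<bullet> p < u \<bullet> p} \<subset> {v \<in> coroot ` Rp. v \<bullet> p < x \<bullet> p}"
        proof (rule psubsetI)
          show "{v \<in> coroot ` Rp. v \<bullet> p < u \<bullet> p} \<subseteq> {v \<in> coroot ` Rp. v \<bullet> p < x \<bullet> p}"
            using that by auto
          have "u \<in> {v \<in> coroot ` Rp. v \<bullet> p < x \<bullet> p}" "u \<notin> {v \<in> coroot ` Rp. v \<bullet> p < u \<bullet> p}"
            using that by auto
          then show "{v \<in> coroot ` Rp. v \<bullet> p < u \<bullet> p} \<noteq> {v \<in> coroot ` Rp. v \<bullet> p < x \<bullet> p}" by metis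
        qed
      qed (use fin in simp)
      obtain a where a: "\<forall>d. a d \<in> \<int>" "y = (\<Sum>d\<in>simple_coroots. a d *\<^sub>R d)"
        using less(1)[OF c[OF yz(1) lt(1)] yz(1)] by blast
      obtain b where b: "\<forall>d. b d \<in> \<int>" "z = (\<Sum>d\<in>simple_coroots. b d *\<^sub>R d)"
        using less(1)[OF c[OF yz(2) lt(2)] yz(2)] by blast
      show ?thesis
      proof (intro exI conjI allI)
        show "a d + b d \<in> \<int>" for d using a(1) b(1) by auto
        show "x = (\<Sum>d\<in>simple_coroots. (a d + b d) *\<^sub>R d)"
          unfolding yz(3) a(2) b(2) by (simp add: scaleR_left_distrib sum.distrib)
      qed
    qed
  qed
qed

text \<open>Vectors in an open half-space with pairwise nonpositive products are independent:
  separating positive from nonpositive coefficients in a relation gives a vector \<open>v\<close>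
  with \<open>v \<bullet> v \<le> 0\<close>, and pairing \<open>v = 0\<close> with \<open>p\<close>
  kills the coefficients on either side.\<close>

lemma independent_simple_coroots: "independent simple_coroots"
proof -
  obtain p where p: "p \<in> A" using alcove_nonempty by blast
  have pos: "y \<bullet> p > 0" if y: "y \<in> simple_coroots" for y
  proof -
    obtain \<alpha> where a: "\<alpha> \<in> Rp" "y = coroot \<alpha>" using y by (auto simp: simple_coroots_def)
    then show ?thesis
      using alcove_bounds[OF a(1) p] root_nonzero[OF positive_root[OF a(1)]] by (simp add: coroot_def)
  qed
  have fin: "finite simple_coroots" using finite_Rp by (simp add: simple_coroots_def)
  show ?thesis
  proof
    assume "dependent simple_coroots"
    then obtain c where c: "\<exists>d\<in>simple_coroots. c d \<noteq> 0" "(\<Sum>d\<in>simple_coroots. c d *\<^sub>R d) = 0"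
      using dependent_finite[OF fin] by blast
    define I where "I = {d\<in>simple_coroots. c d > 0}"
    define J where "J = {d\<in>simple_coroots. c d \<le> 0}"
    have IJ: "simple_coroots = I \<union> J" "I \<inter> J = {}" "finite I" "finite J"
      using fin by (auto simp: I_def J_def)
    define v where "v = (\<Sum>d\<in>I. c d *\<^sub>R d)"
    have "v + (\<Sum>d\<in>J. c d *\<^sub>R d) = 0"
      using c(2) unfolding v_def IJ(1) by (subst (asm) sum.union_disjoint) (use IJ in auto)
    then have v: "v = (\<Sum>d\<in>J. (- c d) *\<^sub>R d)" by (simp add: sum_negf eq_neg_iff_add_eq_0)
    have "v \<bullet> v = (\<Sum>d\<in>I. \<Sum>e\<in>J. c d * (- c e) * (d \<bullet> e))"
    proof -
      have "v \<bullet> v = (\<Sum>d\<in>I. c d *\<^sub>R d) \<bullet> (\<Sum>d\<in>J. (- c d) *\<^sub>R d)"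
        unfolding v[symmetric] by (simp add: v_def)
      then show ?thesis
        by (simp only: inner_sum_left, simp only: inner_sum_right) (simp add: mult.assoc mult.left_commute)
    qed
    also have "\<dots> \<le> 0"
    proof (intro sum_nonpos mult_nonneg_nonpos)
      fix d e assume "d \<in> I" "e \<in> J"
      then show "d \<bullet> e \<le> 0" using IJ simple_coroots_obtuse[of d e] by blast
      show "0 \<le> c d * (- c e)" using \<open>d \<in> I\<close> \<open>e \<in> J\<close> by (auto simp: I_def J_def mult_nonneg_nonpos)
    qed
    finally have v0: "v = 0" using inner_ge_zero[of v] by (metis inner_eq_zero_iff order_antisym)
    have "(\<Sum>d\<in>I. c d * (d \<bullet> p)) = v \<bullet> p" by (simp add: v_def inner_sum_left)
    then have "(\<Sum>d\<in>I. c d * (d \<bullet> p)) = 0" using v0 by simp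
    moreover have posI: "0 < c d * (d \<bullet> p)" if "d \<in> I" for d
      using that pos by (auto simp: I_def)
    ultimately have I0: "I = {}"
      using sum_pos[OF IJ(3), of "\<lambda>d. c d * (d \<bullet> p)"] by force
    have "(\<Sum>d\<in>J. (- c d) * (d \<bullet> p)) = v \<bullet> p" by (simp add: v inner_sum_left)
    then have sJ: "(\<Sum>d\<in>J. (- c d) * (d \<bullet> p)) = 0" using v0 by simp
    have nnJ: "0 \<le> (- c d) * (d \<bullet> p)" if "d \<in> J" for d
      by (rule mult_nonneg_nonneg) (use that pos[of d] in \<open>auto simp: J_def\<close>)
    have "c d = 0" if "d \<in> J" for d
    proof -
      have "(- c d) * (d \<bullet> p) = 0"
        using sum_nonneg_0[OF IJ(4) nnJ sJ that] .
      then show ?thesis using pos[of d] that by (auto simp: J_def)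
    qed
    then show False using c(1) I0 IJ by blast
  qed
qed

lemma coroot_expansion:
  assumes "\<alpha> \<in> R"
  shows "\<exists>c. (\<forall>d. c d \<in> \<int>) \<and> coroot \<alpha> = (\<Sum>d\<in>simple_coroots. c d *\<^sub>R d)"
  using positive_or_negative[OF assms]
proof
  assume "\<alpha> \<in> Rp"
  then show ?thesis using positive_coroot_expansion by blast
next
  assume "- \<alpha> \<in> Rp"
  then obtain c where c: "\<forall>d. c d \<in> \<int>" "coroot (- \<alpha>) = (\<Sum>d\<in>simple_coroots. c d *\<^sub>R d)"
    using positive_coroot_expansion[of "coroot (- \<alpha>)"] by blast
  show ?thesis
  proof (intro exI conjI allI)
    show "- c d \<in> \<int>" for d using c by auto
    have "coroot \<alpha> = - coroot (- \<alpha>)" by (simp add: coroot_uminus)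
    then show "coroot \<alpha> = (\<Sum>d\<in>simple_coroots. (- c d) *\<^sub>R d)" unfolding c(2) by (simp add: sum_negf)
  qed
qed

text \<open>Pairing with the basis dual to the simple coroots reads off coordinates. The dual
  vectors are weights because every coroot is an integral combination of simple ones, so the
  coordinates of \<open>x\<close> are integers.\<close>

theorem coroot_lattice_dual:
  assumes "\<And>\<mu>. \<mu> \<in> P \<Longrightarrow> \<mu> \<bullet> x \<in> \<int>"
  shows "x \<in> coroot_lattice"
proof -
  have fin: "finite simple_coroots" using finite_Rp by (simp add: simple_coroots_def)
  have "coroot ` R \<subseteq> span simple_coroots"
  proof
    fix y assume "y \<in> coroot ` R"
    then obtain c where "y = (\<Sum>d\<in>simple_coroots. c d *\<^sub>R d)" using coroot_expansion by blast
    then show "y \<in> span simple_coroots" by (simp, intro span_sum span_scale span_base)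
  qed
  then have "span simple_coroots = UNIV"
    using span_coroots by (metis span_mono span_span top.extremum_uniqueI)
  then have "x \<in> span simple_coroots" by simp
  then obtain c where c: "x = (\<Sum>d\<in>simple_coroots. c d *\<^sub>R d)" using span_finite[OF fin] by auto
  have "c e \<in> \<int>" if e: "e \<in> simple_coroots" for e
  proof -
    obtain g :: "'a \<Rightarrow> real" where g: "linear g" "\<forall>d\<in>simple_coroots. g d = (if d = e then 1 else 0)"
      using linear_independent_extend[OF independent_simple_coroots, of "\<lambda>d. if d = e then 1 else (0::real)"] by blast
    \<comment> \<open>\<open>adjoint g 1\<close> is the vector representing the coordinate
      functional of \<open>e\<close>, that is, a fundamental weight.\<close>
    define \<omega> where "\<omega> = adjoint g 1"
    have om: "y \<bullet> \<omega> = g y" for y using adjoint_works[OF g(1), of y 1] by (simp add: \<omega>_def)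
    have coef: "(\<Sum>d\<in>simple_coroots. a d *\<^sub>R d) \<bullet> \<omega> = a e" for a
    proof -
      have "(\<Sum>d\<in>simple_coroots. a d *\<^sub>R d) \<bullet> \<omega> = (\<Sum>d\<in>simple_coroots. if d = e then a d else 0)"
        unfolding inner_sum_left by (rule sum.cong) (use om g in \<open>auto simp: linear_scale\<close>)
      then show ?thesis using e fin by (simp add: sum.delta)
    qed
    have "\<omega> \<in> P" unfolding weight_lattice_def
    proof safe
      fix \<alpha> assume "\<alpha> \<in> R"
      then obtain a where a: "\<forall>d. a d \<in> \<int>" "coroot \<alpha> = (\<Sum>d\<in>simple_coroots. a d *\<^sub>R d)"
        using coroot_expansion by blast
      then show "coroot \<alpha> \<bullet> \<omega> \<in> \<int>" using coef by simp
    qed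
    then have "\<omega> \<bullet> x \<in> \<int>" by (rule assms)
    then show ?thesis using coef[of c] c by (simp add: inner_commute)
  qed
  moreover have "d \<in> coroot_lattice" if "d \<in> simple_coroots" for d
    using that coroot_lattice_coroot positive_root by (auto simp: simple_coroots_def)
  moreover have "(\<Sum>d\<in>S. f d) \<in> coroot_lattice"
    if "finite S" "\<And>d. d \<in> S \<Longrightarrow> f d \<in> coroot_lattice" for f and S :: "'a set"
    using that by (induction rule: finite_induct) (auto intro: coroot_lattice.zero coroot_lattice_add)
  ultimately show ?thesis unfolding c using fin by (simp add: coroot_lattice_int_multiple)
qed

text \<open>Both \<open>w\<close> and the translation are products of affine reflections:
  \<open>w\<close> uses level 0, and the translation by \<open>2 * pi\<close> times a coroot is a
  product of the reflections of levels 1 and 0. Once rewritten in walls, the word is subject to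
  \<open>wall_word_fixes\<close>.\<close>

theorem alcove_fundamental:
  assumes "u \<in> closure A" "v \<in> closure A" "w \<in> W" "x \<in> coroot_lattice" "v = w u + (2 * pi) *\<^sub>R x"
  shows "u = v"
proof -
  have words: "\<exists>ws. (\<forall>w\<in>set ws. wall w) \<and> (\<forall>x. act rs x = act ws x)" if "set rs \<subseteq> refls" for rs
    using that
  proof (induction rs)
    case Nil
    show ?case by (rule exI[of _ "[]"]) auto
  next
    case (Cons r rs)
    then obtain ws vs where "\<forall>w\<in>set ws. wall w" "\<forall>x. act rs x = act ws x"
      "\<forall>w\<in>set vs. wall w" "\<forall>x. r x = act vs x" using refl_from_walls[of r] by auto
    then show ?case by (intro exI[of _ "vs @ ws"]) (auto simp: act_append)
  qed
  have "\<exists>rs. set rs \<subseteq> refls \<and> (\<forall>y. w y = act rs y)"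
    using assms(3)
  proof (induction rule: weyl_group.induct)
    case id
    show ?case by (rule exI[of _ "[]"]) auto
  next
    case (refl w \<alpha>)
    then obtain rs where "set rs \<subseteq> refls" "\<forall>y. w y = act rs y" by blast
    then show ?case
      using reflsI[OF refl(2), of 0]
      by (intro exI[of _ "aff_reflection \<alpha> 0 # rs"])
        (auto simp: aff_reflection_def root_reflection_def coroot_def)
  qed
  then obtain rs where rs: "set rs \<subseteq> refls" "\<And>y. w y = act rs y" by blast
  have "\<exists>ts. set ts \<subseteq> refls \<and> (\<forall>y. y + (2 * pi) *\<^sub>R x = act ts y)"
    using assms(4)
  proof (induction rule: coroot_lattice.induct)
    case zero
    show ?case by (rule exI[of _ "[]"]) auto
  next
    case (add x \<alpha>)
    then obtain ts where ts: "set ts \<subseteq> refls" "\<And>y. y + (2 * pi) *\<^sub>R x = act ts y" by blast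
    have "aff_reflection \<alpha> 1 (aff_reflection \<alpha> 0 y) = y + (2 * pi) *\<^sub>R coroot \<alpha>" for y
      using inner_coroot_self[OF root_nonzero[OF add(2)]]
      by (simp add: aff_reflection_def inner_diff_right algebra_simps)
    then show ?case
      using reflsI[OF add(2)] ts
      by (intro exI[of _ "aff_reflection \<alpha> 1 # aff_reflection \<alpha> 0 # ts"])
        (auto simp: ts(2)[symmetric] algebra_simps)
  qed
  then obtain ts where ts: "set ts \<subseteq> refls" "\<And>y. y + (2 * pi) *\<^sub>R x = act ts y" by blast
  have v: "v = act (ts @ rs) u" using assms(5) rs(2) ts(2) by (simp add: act_append)
  have "set (ts @ rs) \<subseteq> refls" using rs ts by simp
  then obtain ws where ws: "\<forall>w\<in>set ws. wall w" "\<forall>x. act (ts @ rs) x = act ws x"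
    using words by blast
  have "v = act ws u" using v ws(2) by blast
  then show ?thesis using wall_word_fixes[OF ws(1) assms(1)] assms(2) by metis
qed

end

section \<open>The cotangent identity\<close>

lemma cot_exp: "\<i> * (exp (\<i> * of_real t) + 1) / (exp (\<i> * of_real t) - 1) = complex_of_real (cot (t / 2))"
proof -
  define e where "e = exp (\<i> * complex_of_real (t / 2))"
  have e0: "e \<noteq> 0" by (simp add: e_def)
  have ee: "exp (\<i> * of_real t) = e * e" by (simp add: e_def exp_add[symmetric])
  have ei: "inverse e = exp (- (\<i> * complex_of_real (t / 2)))" by (simp add: e_def exp_minus)
  have c: "of_real (cos (t / 2)) = (e + inverse e) / 2"
    using cos_exp_eq[of "complex_of_real (t / 2)"] unfolding cos_of_real ei[symmetric] e_def[symmetric] .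
  have s: "of_real (sin (t / 2)) = (e - inverse e) / (2 * \<i>)"
    using sin_exp_eq[of "complex_of_real (t / 2)"] unfolding sin_of_real ei[symmetric] e_def[symmetric] .
  have "e * e + 1 = e * (2 * of_real (cos (t / 2)))" unfolding c using e0 by (simp add: field_simps)
  moreover have "e * e - 1 = e * (2 * \<i> * of_real (sin (t / 2)))" unfolding s using e0 by (simp add: field_simps)
  ultimately show ?thesis unfolding ee using e0 by (simp add: cot_def)
qed

text \<open>Holds at the poles as well, where \<open>cot\<close> has the value 0 by division by
  zero; the sums over roots at a point of a mirror contain such terms.\<close>

lemma cot_add_int_pi: "cot (x + of_int j * pi) = cot (x::real)"
proof -
  have s: "sin (of_int j * pi) = 0" by (simp add: sin_zero_iff_int2)
  then have "cos (of_int j * pi) \<noteq> 0" by (metis sin_zero_norm_cos_one norm_zero zero_neq_one)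
  then show ?thesis by (simp add: cot_def sin_add cos_add s)
qed

lemma cot_uminus_real: "cot (- x) = - cot (x::real)"
  by (simp add: cot_def)

lemma Liouville_removable:
  fixes h :: "complex \<Rightarrow> complex"
  assumes "finite Z" "h holomorphic_on - Z" "\<And>z. z \<in> Z \<Longrightarrow> \<exists>l. (h \<longlongrightarrow> l) (at z)"
    and "(h \<longlongrightarrow> l) at_infinity" "z \<notin> Z"
  shows "h z = l"
proof -
  define g where "g = (\<lambda>q. if q \<in> Z then Lim (at q) h else h q)"
  have near: "eventually (\<lambda>q. h q = g q) (at q0)" for q0
  proof -
    have "eventually (\<lambda>q. q \<notin> Z - {q0}) (nhds q0)"
    proof -
      have "open (- (Z - {q0}))" using finite_imp_closed[of "Z - {q0}"] assms(1) by (intro open_Compl) auto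
      from eventually_nhds_in_open[OF this, of q0] show ?thesis by (simp add: disj_commute imp_conv_disj)
    qed
    then have "eventually (\<lambda>q. q \<notin> Z - {q0}) (at q0)" 
      unfolding eventually_at_filter by (rule eventually_mono) auto
    moreover have "eventually (\<lambda>q. q \<noteq> q0) (at q0)" by (simp add: eventually_neq_at_within)
    ultimately show ?thesis by eventually_elim (auto simp: g_def)
  qed
  have "g holomorphic_on UNIV"
  proof (rule no_isolated_singularity'[OF _ _ open_UNIV assms(1)])
    fix q assume q: "q \<in> Z"
    then obtain m where m: "(h \<longlongrightarrow> m) (at q)" using assms(3) by blast
    then have "g q = m" using q tendsto_Lim[OF _ m] by (simp add: g_def)
    then show "(g \<longlongrightarrow> g q) (at q)" using Lim_transform_eventually[OF m near] by simp
  next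
    have "h holomorphic_on UNIV - Z" using assms(2) by (simp add: Compl_eq_Diff_UNIV)
    then show "g holomorphic_on UNIV - Z" by (rule holomorphic_transform) (auto simp: g_def)
  qed
  moreover have "eventually (\<lambda>q. h q = g q) at_infinity"
  proof -
    obtain B where B: "\<And>q. q \<in> Z \<Longrightarrow> norm q \<le> B"
      using finite_imp_bounded[OF assms(1)] by (auto simp: bounded_iff)
    have "eventually (\<lambda>q. norm q \<ge> B + 1) (at_infinity :: complex filter)"
      by (auto simp: eventually_at_infinity)
    then show ?thesis by eventually_elim (use B in \<open>force simp: g_def\<close>)
  qed
  then have "(g \<longlongrightarrow> l) at_infinity" using Lim_transform_eventually[OF assms(4)] by blast
  ultimately have "g z = l" by (rule Liouville_weak)
  then show ?thesis using assms(5) by (simp add: g_def)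
qed

section \<open>Poles and residues of the sum of cotangent products\<close>

context alcove
begin

definition nonparallel :: "'a \<Rightarrow> 'a \<Rightarrow> bool" where
  "nonparallel \<alpha> \<beta> \<longleftrightarrow> (\<forall>c. \<beta> \<noteq> c *\<^sub>R \<alpha>)"

lemma nonparallel_sym: "\<alpha> \<in> R \<Longrightarrow> \<beta> \<in> R \<Longrightarrow> nonparallel \<alpha> \<beta> \<Longrightarrow> nonparallel \<beta> \<alpha>"
  unfolding nonparallel_def
  by (metis root_nonzero scaleR_scaleR scaleR_zero_left right_inverse scaleR_one mult.commute)

text \<open>Proportional pairs are left out: their cotangent products are not constant and give rise
  to the potential.\<close>

definition pair_weight :: "(real \<Rightarrow> real) \<Rightarrow> 'a \<Rightarrow> 'a \<Rightarrow> real" where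
  "pair_weight k \<alpha> \<beta> = (if nonparallel \<alpha> \<beta> then k (norm \<alpha>) * k (norm \<beta>) * (\<alpha> \<bullet> \<beta>) else 0)"

lemma pair_weight_sym:
  assumes "\<alpha> \<in> R" "\<beta> \<in> R" shows "pair_weight k \<alpha> \<beta> = pair_weight k \<beta> \<alpha>"
  using nonparallel_sym[OF assms] nonparallel_sym[OF assms(2,1)]
  by (auto simp: pair_weight_def inner_commute)

text \<open>Up to a factor this is the residue at a pole of the cotangent of \<alpha>. On the mirror
  of \<alpha> the reflection moves \<open>\<beta> \<bullet> y / 2\<close> by a multiple of
  \<open>pi\<close> and keeps the length of \<beta>, but changes the sign of
  \<open>\<alpha> \<bullet> \<beta>\<close>, so the sum over all roots equals its negative.\<close>

lemma cot_residue_vanishes: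
  assumes "\<alpha> \<in> Rp" "\<alpha> \<bullet> y = 2 * pi * of_int n"
  shows "(\<Sum>\<beta>\<in>Rp. pair_weight k \<alpha> \<beta> * cot (\<beta> \<bullet> y / 2)) = 0"
proof -
  define f where "f = (\<lambda>\<beta>. pair_weight k \<alpha> \<beta> * cot (\<beta> \<bullet> y / 2))"
  have aR: "\<alpha> \<in> R" and a0: "\<alpha> \<noteq> 0" using assms positive_root root_nonzero by auto
  let ?s = "root_reflection \<alpha>"
  have neg: "nonparallel \<alpha> (- \<beta>) \<longleftrightarrow> nonparallel \<alpha> \<beta>" for \<beta>
    unfolding nonparallel_def by (metis add.inverse_inverse scaleR_minus_left)
  have "f (- \<beta>) = f \<beta>" for \<beta>
    using cot_uminus_real[of "\<beta> \<bullet> y / 2"] by (simp add: f_def pair_weight_def neg)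
  then have 1: "sum f R = 2 * sum f Rp" unfolding sum_roots by (simp add: sum_distrib_left)
  have "f (?s \<beta>) = - f \<beta>" if b: "\<beta> \<in> R" for \<beta>
  proof -
    obtain m :: int where m: "coroot \<alpha> \<bullet> \<beta> = of_int m"
      using coroot_root_int[OF aR b] by (auto elim: Ints_cases)
    have s: "?s \<beta> = \<beta> - of_int m *\<^sub>R \<alpha>" by (simp add: root_reflection_def m)
    have "nonparallel \<alpha> (?s \<beta>) \<longleftrightarrow> nonparallel \<alpha> \<beta>"
      unfolding nonparallel_def s
      by (metis (no_types, opaque_lifting) add_diff_cancel diff_add_cancel scaleR_left.diff scaleR_left.add)
    moreover have "norm (?s \<beta>) = norm \<beta>"
      by (simp add: norm_eq_sqrt_inner root_reflection_inner a0)
    moreover have "\<alpha> \<bullet> ?s \<beta> = - (\<alpha> \<bullet> \<beta>)"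
      using root_reflection_inner[OF a0, of "?s \<alpha>" \<beta>] root_reflection_self[OF a0]
        root_reflection_idem[OF a0, of \<alpha>] by (metis inner_minus_left root_reflection_inner a0)
    ultimately have w: "pair_weight k \<alpha> (?s \<beta>) = - pair_weight k \<alpha> \<beta>" by (simp add: pair_weight_def)
    have "?s \<beta> \<bullet> y / 2 = \<beta> \<bullet> y / 2 + of_int (- m * n) * pi"
      by (simp add: s inner_diff_left assms(2) field_simps)
    then have "cot (?s \<beta> \<bullet> y / 2) = cot (\<beta> \<bullet> y / 2)" using cot_add_int_pi by metis
    then show ?thesis by (simp add: f_def w)
  qed
  then have "sum (\<lambda>\<beta>. f (?s \<beta>)) R = - sum f R" by (simp add: sum_negf)
  moreover have "sum (\<lambda>\<beta>. f (?s \<beta>)) R = sum f R"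
    by (rule sum.reindex_bij_betw[OF weyl_bij_R[OF root_reflection_weyl[OF aR]]])
  ultimately have "sum f R = 0" by simp
  then show ?thesis using 1 by (simp add: f_def)
qed

text \<open>On a line \<open>u + z b\<close> in an integral direction, the sum is a rational function of
  \<open>q = exp (\<i> z)\<close> that is finite at infinity. If the line meets the walls one at a time, its poles
  are simple, and they are removable because the residues vanish.\<close>

lemma cot_sum_generic:
  assumes u: "u \<in> A" and b: "\<And>\<alpha>. \<alpha> \<in> Rp \<Longrightarrow> N \<alpha> > 0 \<and> \<alpha> \<bullet> b = real (N \<alpha>)"
    and generic: "\<And>\<alpha> \<beta> n m z. \<alpha> \<in> Rp \<Longrightarrow> \<beta> \<in> Rp \<Longrightarrow> nonparallel \<alpha> \<beta> \<Longrightarrow>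
      \<alpha> \<bullet> (u + z *\<^sub>R b) = 2 * pi * of_int n \<Longrightarrow> \<beta> \<bullet> (u + z *\<^sub>R b) \<noteq> 2 * pi * of_int m"
  shows "(\<Sum>\<alpha>\<in>Rp. \<Sum>\<beta>\<in>Rp. pair_weight k \<alpha> \<beta> * (cot (\<alpha> \<bullet> u / 2) * cot (\<beta> \<bullet> u / 2)))
       = - (\<Sum>\<alpha>\<in>Rp. \<Sum>\<beta>\<in>Rp. pair_weight k \<alpha> \<beta>)"
proof -
  \<comment> \<open>For \<open>q = exp (\<i> * z)\<close>, \<open>x \<alpha> q\<close> is the
    exponential of \<alpha> at \<open>u + z *\<^sub>R b\<close>, and \<open>c \<alpha> q\<close> is
    the cotangent there by \<open>cot_exp\<close>.\<close>
  define x where "x = (\<lambda>\<alpha> q. exp (\<i> * complex_of_real (\<alpha> \<bullet> u)) * q ^ N \<alpha>)"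
  define c where "c = (\<lambda>\<alpha> q. \<i> * (x \<alpha> q + 1) / (x \<alpha> q - 1))"
  define Z where "Z = {q. \<exists>\<alpha>\<in>Rp. x \<alpha> q = 1}"
  define h where "h = (\<lambda>q. \<Sum>\<alpha>\<in>Rp. \<Sum>\<beta>\<in>Rp. of_real (pair_weight k \<alpha> \<beta>) * (c \<alpha> q * c \<beta> q))"
  have N: "N \<alpha> > 0" "\<alpha> \<bullet> b = real (N \<alpha>)" if "\<alpha> \<in> Rp" for \<alpha> using b[OF that] by auto
  have root: "q ^ N \<alpha> = exp (- (\<i> * complex_of_real (\<alpha> \<bullet> u)))" if "x \<alpha> q = 1" for \<alpha> q
    using that by (simp add: x_def exp_minus field_simps)
  have finZ: "finite Z"
  proof -
    have "Z \<subseteq> (\<Union>\<alpha>\<in>Rp. {q. q ^ N \<alpha> = exp (- (\<i> * complex_of_real (\<alpha> \<bullet> u)))})"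
      using root by (auto simp: Z_def)
    then show ?thesis by (rule finite_subset) (use finite_Rp N in \<open>auto intro!: finite_nth_roots\<close>)
  qed
  have holx: "x \<alpha> holomorphic_on S" for \<alpha> S unfolding x_def by (intro holomorphic_intros)
  have holc: "c \<alpha> holomorphic_on S" if "\<And>q. q \<in> S \<Longrightarrow> x \<alpha> q \<noteq> 1" for \<alpha> S
    unfolding c_def by (intro holomorphic_intros holx) (use that in auto)
  have holh: "h holomorphic_on - Z"
    unfolding h_def by (intro holomorphic_intros holc) (auto simp: Z_def)
  have circle: "c \<alpha> (exp (\<i> * of_real z)) = of_real (cot (\<alpha> \<bullet> (u + z *\<^sub>R b) / 2))" if "\<alpha> \<in> Rp" for \<alpha> z
  proof -
    have "x \<alpha> (exp (\<i> * of_real z)) = exp (\<i> * of_real (\<alpha> \<bullet> (u + z *\<^sub>R b)))"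
      using N(2)[OF that]
      by (simp add: x_def exp_of_nat_mult[symmetric] exp_add[symmetric] inner_add_right algebra_simps)
    then show ?thesis unfolding c_def by (simp only: cot_exp)
  qed
  \<comment> \<open>Each \<open>c \<alpha>\<close> tends to \<open>\<i>\<close>, so every product of
    two cotangents tends to -1. This is the origin of the constant.\<close>
  have inf: "(h \<longlongrightarrow> (\<Sum>\<alpha>\<in>Rp. \<Sum>\<beta>\<in>Rp. of_real (pair_weight k \<alpha> \<beta>) * (\<i> * \<i>))) at_infinity"
  proof -
    have "(c \<alpha> \<longlongrightarrow> \<i>) at_infinity" if a: "\<alpha> \<in> Rp" for \<alpha>
    proof -
      have "filterlim (\<lambda>q::complex. q ^ N \<alpha>) at_infinity at_infinity"
        using N[OF a] by (intro filterlim_power_at_infinity filterlim_ident) auto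
      then have xinf: "filterlim (x \<alpha>) at_infinity at_infinity"
        unfolding x_def by (intro tendsto_mult_filterlim_at_infinity[OF tendsto_const]) auto
      then have "filterlim (\<lambda>q. x \<alpha> q + (- 1)) at_infinity at_infinity"
        using tendsto_add_filterlim_at_infinity'[OF _ tendsto_const] by blast
      then have "((\<lambda>q. 2 / (x \<alpha> q + (- 1))) \<longlongrightarrow> 0) at_infinity"
        by (intro tendsto_divide_0[OF tendsto_const])
      then have "((\<lambda>q. \<i> * (1 + 2 / (x \<alpha> q + (- 1)))) \<longlongrightarrow> \<i> * (1 + 0)) at_infinity"
        by (intro tendsto_intros)
      moreover have "eventually (\<lambda>q. \<i> * (1 + 2 / (x \<alpha> q + (- 1))) = c \<alpha> q) at_infinity"
      proof -
        have "eventually (\<lambda>q. x \<alpha> q \<noteq> 1) at_infinity"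
          using xinf eventually_not_equal_at_infinity[of 1] by (auto simp: filterlim_iff)
        then show ?thesis by eventually_elim (simp add: c_def field_simps)
      qed
      ultimately show ?thesis using Lim_transform_eventually by fastforce
    qed
    then show ?thesis unfolding h_def by (intro tendsto_intros)
  qed
  have lims: "\<exists>l. (h \<longlongrightarrow> l) (at q0)" if q0: "q0 \<in> Z" for q0
  proof -
    define S where "S = {\<alpha>\<in>Rp. x \<alpha> q0 = 1}"
    obtain \<alpha>0 where a0: "\<alpha>0 \<in> Rp" "x \<alpha>0 q0 = 1" using q0 by (auto simp: Z_def)
    \<comment> \<open>A pole has modulus 1, so it comes from a real parameter \<open>z\<close>, and
      its residue can be computed at the real point \<open>y\<close>.\<close>
    have "norm (q0 ^ N \<alpha>0) = 1" using root[OF a0(2)] by (metis norm_exp_i_times exp_minus norm_inverse inverse_1)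
    then have "norm q0 ^ N \<alpha>0 = 1" by (simp add: norm_power)
    then have q1: "norm q0 = 1" using power_eq_imp_eq_base[of "norm q0" "N \<alpha>0" 1] N(1)[OF a0(1)] by simp
    then have "q0 \<noteq> 0" by auto
    then obtain z where z: "q0 = exp (\<i> * of_real z)"
      using rcis_cmod_Arg[of q0] q1 by (metis rcis_def cis_conv_exp mult_1 of_real_1)
    define y where "y = u + z *\<^sub>R b"
    have onwall: "\<exists>n::int. \<alpha> \<bullet> y = 2 * pi * of_int n" if "\<alpha> \<in> S" for \<alpha>
    proof -
      have a: "\<alpha> \<in> Rp" "x \<alpha> q0 = 1" using that by (auto simp: S_def)
      have "exp (\<i> * of_real (\<alpha> \<bullet> y)) = 1"
        using a(2) N(2)[OF a(1)] unfolding z y_def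
        by (simp add: x_def exp_of_nat_mult[symmetric] exp_add[symmetric] inner_add_right algebra_simps)
      then obtain n :: int where "\<alpha> \<bullet> y = of_int (2 * n) * pi"
        unfolding exp_eq_1 by auto
      then show ?thesis by (intro exI[of _ n]) simp
    qed
    \<comment> \<open>All roots that are singular at \<open>q0\<close> are proportional by
      genericity, so no double pole occurs.\<close>
    have SS: "pair_weight k \<alpha> \<beta> = 0" if "\<alpha> \<in> S" "\<beta> \<in> S" for \<alpha> \<beta>
    proof -
      have "\<not> nonparallel \<alpha> \<beta>"
        using onwall[OF that(1)] onwall[OF that(2)] generic[of \<alpha> \<beta> z] that unfolding y_def S_def by blast
      then show ?thesis by (simp add: pair_weight_def)
    qed
    have fS: "finite S" "S \<subseteq> Rp" using finite_Rp by (auto simp: S_def)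
    define T where "T = (\<lambda>\<alpha> q. \<Sum>\<beta>\<in>Rp - S. of_real (pair_weight k \<alpha> \<beta>) * c \<beta> q)"
    define h1 where "h1 = (\<lambda>q. \<Sum>\<alpha>\<in>Rp - S. \<Sum>\<beta>\<in>Rp - S. of_real (pair_weight k \<alpha> \<beta>) * (c \<alpha> q * c \<beta> q))"
    \<comment> \<open>\<open>h1\<close> collects the regular terms. A mixed pair occurs in both
      orders, and \<open>pair_weight\<close> is symmetric, hence the factor 2.\<close>
    have h: "h q = h1 q + 2 * (\<Sum>\<alpha>\<in>S. c \<alpha> q * T \<alpha> q)" for q
    proof -
      let ?f = "\<lambda>\<alpha> \<beta>. of_real (pair_weight k \<alpha> \<beta>) * (c \<alpha> q * c \<beta> q)"
      have split: "sum g Rp = sum g (Rp - S) + sum g S" for g :: "'a \<Rightarrow> complex"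
        by (rule sum.subset_diff[OF fS(2) finite_Rp])
      have "h q = (\<Sum>\<alpha>\<in>Rp - S. sum (?f \<alpha>) (Rp - S) + sum (?f \<alpha>) S) + (\<Sum>\<alpha>\<in>S. sum (?f \<alpha>) (Rp - S) + sum (?f \<alpha>) S)"
        unfolding h_def split ..
      also have "(\<Sum>\<alpha>\<in>S. sum (?f \<alpha>) (Rp - S) + sum (?f \<alpha>) S) = (\<Sum>\<alpha>\<in>S. c \<alpha> q * T \<alpha> q)"
      proof (rule sum.cong[OF HOL.refl])
        fix \<alpha> assume "\<alpha> \<in> S"
        then have "sum (?f \<alpha>) S = 0" using SS by (intro sum.neutral) auto
        then show "sum (?f \<alpha>) (Rp - S) + sum (?f \<alpha>) S = c \<alpha> q * T \<alpha> q"
          by (simp add: T_def sum_distrib_left mult_ac)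
      qed
      also have "(\<Sum>\<alpha>\<in>Rp - S. sum (?f \<alpha>) (Rp - S) + sum (?f \<alpha>) S) = h1 q + (\<Sum>\<alpha>\<in>Rp - S. sum (?f \<alpha>) S)"
        by (simp add: h1_def sum.distrib)
      also have "(\<Sum>\<alpha>\<in>Rp - S. sum (?f \<alpha>) S) = (\<Sum>\<beta>\<in>S. \<Sum>\<alpha>\<in>Rp - S. ?f \<alpha> \<beta>)" by (rule sum.swap)
      also have "\<dots> = (\<Sum>\<beta>\<in>S. c \<beta> q * T \<beta> q)"
      proof (rule sum.cong[OF HOL.refl])
        fix \<beta> assume "\<beta> \<in> S"
        then have "pair_weight k \<alpha> \<beta> = pair_weight k \<beta> \<alpha>" if "\<alpha> \<in> Rp - S" for \<alpha>
          using that fS(2) positive_root by (intro pair_weight_sym) auto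
        then show "(\<Sum>\<alpha>\<in>Rp - S. ?f \<alpha> \<beta>) = c \<beta> q * T \<beta> q"
          unfolding T_def sum_distrib_left by (intro sum.cong HOL.refl) (simp add: mult_ac)
      qed
      finally show ?thesis by simp
    qed
    define G where "G = {q. \<forall>\<beta>\<in>Rp - S. x \<beta> q \<noteq> 1}"
    have "G = - (\<Union>\<beta>\<in>Rp - S. x \<beta> -` {1})" by (auto simp: G_def)
    moreover have "closed (x \<beta> -` {1})" for \<beta>
      by (rule closed_vimage) (auto simp: x_def intro!: continuous_intros)
    ultimately have openG: "open G" using finite_Rp by (auto intro!: closed_UN)
    have q0G: "q0 \<in> G" by (auto simp: G_def S_def)
    have holc': "c \<beta> holomorphic_on G" if "\<beta> \<in> Rp - S" for \<beta>
      by (rule holc) (use that in \<open>auto simp: G_def\<close>)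
    have "h1 holomorphic_on G" unfolding h1_def by (intro holomorphic_intros holc')
    then have "(h1 \<longlongrightarrow> h1 q0) (at q0)"
      using openG q0G by (meson continuous_on_eq_continuous_at holomorphic_on_imp_continuous_on isContD)
    moreover have "\<exists>l. ((\<lambda>q. c \<alpha> q * T \<alpha> q) \<longlongrightarrow> l) (at q0)" if a: "\<alpha> \<in> S" for \<alpha>
    proof -
      obtain n :: int where n: "\<alpha> \<bullet> y = 2 * pi * of_int n" using onwall[OF a] by blast
      have aRp: "\<alpha> \<in> Rp" and xa: "x \<alpha> q0 = 1" using a by (auto simp: S_def)
      \<comment> \<open>\<open>T \<alpha>\<close> is the factor of the singular cotangent of
        \<alpha>. Its value at \<open>q0\<close> is the residue sum, which vanishes and so
        compensates the simple zero of \<open>x \<alpha> - 1\<close>.\<close>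
      have "(\<Sum>\<beta>\<in>Rp. pair_weight k \<alpha> \<beta> * cot (\<beta> \<bullet> y / 2)) = (\<Sum>\<beta>\<in>Rp - S. pair_weight k \<alpha> \<beta> * cot (\<beta> \<bullet> y / 2))"
        by (rule sum.mono_neutral_right[OF finite_Rp]) (use SS[OF a] in auto)
      then have "(\<Sum>\<beta>\<in>Rp - S. pair_weight k \<alpha> \<beta> * cot (\<beta> \<bullet> y / 2)) = 0"
        using cot_residue_vanishes[OF aRp n] by simp
      moreover have "T \<alpha> q0 = of_real (\<Sum>\<beta>\<in>Rp - S. pair_weight k \<alpha> \<beta> * cot (\<beta> \<bullet> y / 2))"
        unfolding T_def of_real_sum z by (intro sum.cong HOL.refl) (simp add: circle y_def)
      ultimately have T0: "T \<alpha> q0 = 0" by simp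
      have "T \<alpha> holomorphic_on G" unfolding T_def by (intro holomorphic_intros holc')
      then obtain T' where "(T \<alpha> has_field_derivative T') (at q0)"
        using openG q0G holomorphic_derivI by blast
      then have T': "((\<lambda>q. T \<alpha> q / (q - q0)) \<longlongrightarrow> T') (at q0)" by (simp add: has_field_derivative_iff T0)
      define x' where "x' = exp (\<i> * complex_of_real (\<alpha> \<bullet> u)) * (of_nat (N \<alpha>) * q0 ^ (N \<alpha> - 1))"
      have "(x \<alpha> has_field_derivative x') (at q0)"
        unfolding x_def x'_def by (auto intro!: derivative_eq_intros)
      then have x': "((\<lambda>q. (x \<alpha> q - 1) / (q - q0)) \<longlongrightarrow> x') (at q0)" by (simp add: has_field_derivative_iff xa)
      have x'0: "x' \<noteq> 0" using N(1)[OF aRp] q1 by (auto simp: x'_def)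
      have "isCont (x \<alpha>) q0" unfolding x_def by (intro continuous_intros)
      then have "((\<lambda>q. \<i> * (x \<alpha> q + 1)) \<longlongrightarrow> \<i> * (1 + 1)) (at q0)"
        using xa by (intro tendsto_intros) (auto simp: isCont_def)
      then have "((\<lambda>q. \<i> * (x \<alpha> q + 1) * (T \<alpha> q / (q - q0)) / ((x \<alpha> q - 1) / (q - q0)))
          \<longlongrightarrow> \<i> * (1 + 1) * T' / x') (at q0)"
        by (rule tendsto_divide[OF tendsto_mult[OF _ T'] x' x'0])
      moreover have "eventually (\<lambda>q. \<i> * (x \<alpha> q + 1) * (T \<alpha> q / (q - q0)) / ((x \<alpha> q - 1) / (q - q0))
          = c \<alpha> q * T \<alpha> q) (at q0)"
      proof -
        have "a * (t / d) / (w / d) = a / w * t" if "d \<noteq> 0" for a t w d :: complex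
          using that by (cases "w = 0") (auto simp: field_simps)
        then show ?thesis
          using eventually_neq_at_within[of q0 q0] unfolding c_def by (rule eventually_mono[rotated]) simp
      qed
      ultimately have "((\<lambda>q. c \<alpha> q * T \<alpha> q) \<longlongrightarrow> \<i> * (1 + 1) * T' / x') (at q0)"
        by (rule Lim_transform_eventually)
      then show ?thesis ..
    qed
    then have "\<forall>\<alpha>\<in>S. \<exists>l. ((\<lambda>q. c \<alpha> q * T \<alpha> q) \<longlongrightarrow> l) (at q0)" by blast
    from bchoice[OF this] obtain l where
      "\<forall>\<alpha>\<in>S. ((\<lambda>q. c \<alpha> q * T \<alpha> q) \<longlongrightarrow> l \<alpha>) (at q0)" by blast
    then have "\<And>\<alpha>. \<alpha> \<in> S \<Longrightarrow> ((\<lambda>q. c \<alpha> q * T \<alpha> q) \<longlongrightarrow> l \<alpha>) (at q0)" by blast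
    ultimately have "((\<lambda>q. h1 q + 2 * (\<Sum>\<alpha>\<in>S. c \<alpha> q * T \<alpha> q)) \<longlongrightarrow> h1 q0 + 2 * (\<Sum>\<alpha>\<in>S. l \<alpha>)) (at q0)"
      by (intro tendsto_intros)
    then show ?thesis unfolding h[symmetric] by blast
  qed
  \<comment> \<open>\<open>q = 1\<close> is the parameter of the given point \<open>u\<close>, which
    is on no mirror.\<close>
  have one: "1 \<notin> Z"
  proof
    assume "1 \<in> Z"
    then obtain \<alpha> where a: "\<alpha> \<in> Rp" "x \<alpha> 1 = 1" by (auto simp: Z_def)
    then have "exp (\<i> * of_real (\<alpha> \<bullet> u)) = 1" by (simp add: x_def)
    then obtain n :: int where "\<alpha> \<bullet> u = of_int (2 * n) * pi"
      unfolding exp_eq_1 by auto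
    then have "\<alpha> \<bullet> u = 2 * pi * of_int n" by simp
    then show False using alcove_regular[OF u] positive_root[OF a(1)] by (auto simp: regular_iff)
  qed
  have "h 1 = (\<Sum>\<alpha>\<in>Rp. \<Sum>\<beta>\<in>Rp. of_real (pair_weight k \<alpha> \<beta>) * (\<i> * \<i>))"
    by (rule Liouville_removable[OF finZ holh lims inf one])
  moreover have "h 1 = of_real (\<Sum>\<alpha>\<in>Rp. \<Sum>\<beta>\<in>Rp. pair_weight k \<alpha> \<beta> * (cot (\<alpha> \<bullet> u / 2) * cot (\<beta> \<bullet> u / 2)))"
  proof -
    have "c \<alpha> 1 = of_real (cot (\<alpha> \<bullet> u / 2))" if "\<alpha> \<in> Rp" for \<alpha>
      using circle[OF that, of 0] by simp
    then show ?thesis by (simp add: h_def)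
  qed
  ultimately have "complex_of_real (\<Sum>\<alpha>\<in>Rp. \<Sum>\<beta>\<in>Rp. pair_weight k \<alpha> \<beta> * (cot (\<alpha> \<bullet> u / 2) * cot (\<beta> \<bullet> u / 2)))
      = of_real (- (\<Sum>\<alpha>\<in>Rp. \<Sum>\<beta>\<in>Rp. pair_weight k \<alpha> \<beta>))"
    by (simp add: sum_negf)
  then show ?thesis by (simp only: of_real_eq_iff)
qed

text \<open>The sum is continuous on the open alcove, so a failure would persist on an open set, and
  that contains a point in general position with respect to the direction \<open>b\<close>.\<close>

theorem cot_sum_constant:
  assumes "u \<in> A"
  shows "(\<Sum>\<alpha>\<in>Rp. \<Sum>\<beta>\<in>Rp. pair_weight k \<alpha> \<beta> * (cot (\<alpha> \<bullet> u / 2) * cot (\<beta> \<bullet> u / 2)))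
       = - (\<Sum>\<alpha>\<in>Rp. \<Sum>\<beta>\<in>Rp. pair_weight k \<alpha> \<beta>)" (is "?S u = ?c")
proof (rule ccontr)
  assume ne: "?S u \<noteq> ?c"
  obtain b where "\<And>\<alpha>. \<alpha> \<in> Rp \<Longrightarrow> \<exists>n::nat. n > 0 \<and> \<alpha> \<bullet> b = real n"
    using integral_coweight_in_chamber by blast
  then obtain N where N: "\<And>\<alpha>. \<alpha> \<in> Rp \<Longrightarrow> N \<alpha> > (0::nat) \<and> \<alpha> \<bullet> b = real (N \<alpha>)" by metis
  have "sin (\<alpha> \<bullet> v / 2) \<noteq> 0" if "\<alpha> \<in> Rp" "v \<in> A" for \<alpha> v
    using alcove_bounds[OF that] sin_gt_zero[of "\<alpha> \<bullet> v / 2"] by auto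
  then have "continuous_on A ?S" unfolding cot_def by (intro continuous_intros) auto
  then have "open (A \<inter> ?S -` (- {?c}))"
    by (rule continuous_open_preimage[OF _ open_alcove]) auto
  moreover have "A \<inter> ?S -` (- {?c}) \<noteq> {}" using assms ne by blast
  moreover define I where "I = {(\<alpha>, \<beta>, n::int, m::int). \<alpha> \<in> Rp \<and> \<beta> \<in> Rp \<and> nonparallel \<alpha> \<beta>}"
  moreover have "I \<subseteq> Rp \<times> Rp \<times> UNIV \<times> UNIV" by (auto simp: I_def)
  then have cI: "countable I"
    using finite_Rp countable_finite by (meson countable_SIGMA countable_subset countableI_type)
  \<comment> \<open>Eliminating \<open>z\<close> from the equations of mirror \<open>n\<close> of
    \<alpha> and mirror \<open>m\<close> of \<beta> on the line \<open>v + z *\<^sub>R b\<close>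
    leaves \<open>\<nu> i \<bullet> v = c i\<close>.\<close>
  define \<nu> where "\<nu> = (\<lambda>(\<alpha>, \<beta>, n::int, m::int). (\<alpha> \<bullet> b) *\<^sub>R \<beta> - (\<beta> \<bullet> b) *\<^sub>R \<alpha>)"
  define c where "c = (\<lambda>(\<alpha>, \<beta>, n::int, m::int). (\<alpha> \<bullet> b) * (2 * pi * of_int m) - (\<beta> \<bullet> b) * (2 * pi * of_int n))"
  have "\<nu> i \<noteq> 0" if i: "i \<in> I" for i
  proof -
    obtain \<alpha> \<beta> n m where i': "i = (\<alpha>, \<beta>, n, m)" by (metis prod_cases4)
    have "\<alpha> \<in> Rp" "\<And>c. \<beta> \<noteq> c *\<^sub>R \<alpha>" using i by (auto simp: I_def i' nonparallel_def)
    then show ?thesis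
      unfolding i' \<nu>_def prod.case using N by (intro not_parallel_combination) auto
  qed
  ultimately obtain v where v: "v \<in> A" "?S v \<noteq> ?c" "\<And>i. i \<in> I \<Longrightarrow> \<nu> i \<bullet> v \<noteq> c i"
    using generic_point[OF cI, of \<nu> "A \<inter> ?S -` (- {?c})" c] by blast
  have "?S v = ?c"
  proof (rule cot_sum_generic[OF v(1) N])
    fix \<alpha> \<beta> z and n m :: int
    assume h: "\<alpha> \<in> Rp" "\<beta> \<in> Rp" "nonparallel \<alpha> \<beta>" "\<alpha> \<bullet> (v + z *\<^sub>R b) = 2 * pi * of_int n"
    show "\<beta> \<bullet> (v + z *\<^sub>R b) \<noteq> 2 * pi * of_int m"
    proof
      assume h': "\<beta> \<bullet> (v + z *\<^sub>R b) = 2 * pi * of_int m"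
      have "(\<alpha>, \<beta>, n, m) \<in> I" using h by (auto simp: I_def)
      moreover have "\<nu> (\<alpha>, \<beta>, n, m) \<bullet> v = c (\<alpha>, \<beta>, n, m)"
        unfolding \<nu>_def c_def prod.case h'[symmetric] h(4)[symmetric]
        by (simp add: inner_diff_left inner_add_right algebra_simps)
      ultimately show False using v(3) by blast
    qed
  qed
  then show False using v(2) by simp
qed

end

section \<open>Invariant trigonometric polynomials\<close>

inductive_set fspan :: "('a \<Rightarrow> complex) set \<Rightarrow> ('a \<Rightarrow> complex) set" for B where
  fspan_zero: "(\<lambda>u. 0) \<in> fspan B"
| fspan_step: "f \<in> fspan B \<Longrightarrow> b \<in> B \<Longrightarrow> (\<lambda>u. f u + c * b u) \<in> fspan B"

lemma fspan_base: "b \<in> B \<Longrightarrow> b \<in> fspan B"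
  using fspan_step[OF fspan_zero, of b B 1] by simp

lemma fspan_add: "f \<in> fspan B \<Longrightarrow> g \<in> fspan B \<Longrightarrow> (\<lambda>u. f u + g u) \<in> fspan B"
proof (induction rule: fspan.induct)
  case (fspan_step f b c)
  then have "(\<lambda>u. (f u + g u) + c * b u) \<in> fspan B" by (intro fspan.fspan_step) auto
  then show ?case by (simp add: algebra_simps)
qed simp

lemma fspan_scale: "f \<in> fspan B \<Longrightarrow> (\<lambda>u. z * f u) \<in> fspan B"
proof (induction rule: fspan.induct)
  case (fspan_step f b c)
  then have "(\<lambda>u. z * f u + (z * c) * b u) \<in> fspan B" by (intro fspan.fspan_step) auto
  then show ?case by (simp add: algebra_simps)
qed (simp add: fspan_zero)

lemma fspan_sum: "(\<And>i. i \<in> I \<Longrightarrow> f i \<in> fspan B) \<Longrightarrow> (\<lambda>u. \<Sum>i\<in>I. f i u) \<in> fspan B"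
  by (induction I rule: infinite_finite_induct) (auto intro: fspan_zero fspan_add)

lemma fspan_induct_subset:
  assumes "f \<in> fspan B" "\<And>b. b \<in> B \<Longrightarrow> b \<in> fspan B'"
  shows "f \<in> fspan B'"
  using assms(1)
proof (induction rule: fspan.induct)
  case fspan_zero
  show ?case by (rule fspan.fspan_zero)
next
  case (fspan_step f b c)
  show ?case by (rule fspan_add[OF fspan_step(3) fspan_scale[OF assms(2)[OF fspan_step(2)]]])
qed

lemma fspan_mono: "B \<subseteq> B' \<Longrightarrow> fspan B \<subseteq> fspan B'"
  by (intro subsetI, erule fspan_induct_subset) (auto intro: fspan_base)

definition wave :: "'a::euclidean_space \<Rightarrow> 'a \<Rightarrow> complex" where
  "wave \<mu> u = exp (\<i> * complex_of_real (\<mu> \<bullet> u))"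

lemma wave_add: "wave (\<mu> + \<nu>) u = wave \<mu> u * wave \<nu> u"
  by (simp add: wave_def exp_add[symmetric] inner_add_left algebra_simps)

lemma wave_zero: "wave 0 u = 1"
  by (simp add: wave_def)

lemma cnj_wave: "cnj (wave \<mu> u) = wave (- \<mu>) u"
  by (simp add: wave_def exp_cnj)

lemma norm_wave: "norm (wave \<mu> u) = 1"
  by (simp add: wave_def)

definition dderiv :: "'a::euclidean_space \<Rightarrow> ('a \<Rightarrow> complex) \<Rightarrow> 'a \<Rightarrow> complex" where
  "dderiv v f u = vector_derivative (\<lambda>t. f (u + t *\<^sub>R v)) (at 0)"

definition has_dderiv :: "('a::euclidean_space \<Rightarrow> complex) \<Rightarrow> 'a \<Rightarrow> ('a \<Rightarrow> complex) \<Rightarrow> bool" where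
  "has_dderiv f v g \<longleftrightarrow> (\<forall>u. ((\<lambda>t. f (u + t *\<^sub>R v)) has_vector_derivative g u) (at 0))"

lemma dderivI: "has_dderiv f v g \<Longrightarrow> dderiv v f = g"
  by (auto simp: has_dderiv_def dderiv_def vector_derivative_at)

lemma has_dderiv_wave: "has_dderiv (wave \<mu>) v (\<lambda>u. \<i> * of_real (\<mu> \<bullet> v) * wave \<mu> u)"
  unfolding has_dderiv_def
proof
  fix u
  have "((\<lambda>z. exp (\<i> * of_real (\<mu> \<bullet> u) + \<i> * of_real (\<mu> \<bullet> v) * z)) has_field_derivative
      \<i> * of_real (\<mu> \<bullet> v) * wave \<mu> u) (at (of_real 0))"
    by (auto intro!: derivative_eq_intros simp: wave_def)
  from has_vector_derivative_real_field[OF this]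
  show "((\<lambda>t. wave \<mu> (u + t *\<^sub>R v)) has_vector_derivative \<i> * of_real (\<mu> \<bullet> v) * wave \<mu> u) (at 0)"
    by (simp add: wave_def inner_add_right algebra_simps)
qed

lemma has_dderiv_step:
  "has_dderiv f v f' \<Longrightarrow> has_dderiv g v g' \<Longrightarrow> has_dderiv (\<lambda>u. f u + c * g u) v (\<lambda>u. f' u + c * g' u)"
  unfolding has_dderiv_def by (auto intro!: derivative_intros)

section \<open>Trigonometric polynomials and their Weyl invariants\<close>

context root_sys
begin

definition TP :: "('a \<Rightarrow> complex) set" where
  "TP = fspan (wave ` P)"

lemma wave_TP: "\<mu> \<in> P \<Longrightarrow> wave \<mu> \<in> TP"
  by (simp add: TP_def fspan_base)

lemma TP_add: "f \<in> TP \<Longrightarrow> g \<in> TP \<Longrightarrow> (\<lambda>u. f u + g u) \<in> TP"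
  by (simp add: TP_def fspan_add)

lemma TP_scale: "f \<in> TP \<Longrightarrow> (\<lambda>u. z * f u) \<in> TP"
  by (simp add: TP_def fspan_scale)

lemma TP_sum: "(\<And>i. i \<in> I \<Longrightarrow> f i \<in> TP) \<Longrightarrow> (\<lambda>u. \<Sum>i\<in>I. f i u) \<in> TP"
  by (simp add: TP_def fspan_sum)

lemma TP_induct [consumes 1, case_names zero step]:
  assumes "f \<in> TP" "Q (\<lambda>u. 0)"
    and "\<And>f \<mu> c. f \<in> TP \<Longrightarrow> \<mu> \<in> P \<Longrightarrow> Q f \<Longrightarrow> Q (\<lambda>u. f u + c * wave \<mu> u)"
  shows "Q f"
  using assms(1) unfolding TP_def
  by (induction rule: fspan.induct) (use assms in \<open>auto simp: TP_def\<close>)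

lemma TP_const: "(\<lambda>u. z) \<in> TP"
proof -
  have "(\<lambda>u. z * wave 0 u) \<in> TP" by (rule TP_scale[OF wave_TP[OF weight_zero]])
  then show ?thesis by (simp add: wave_zero)
qed

lemma TP_mult:
  assumes "f \<in> TP" "g \<in> TP"
  shows "(\<lambda>u. f u * g u) \<in> TP"
  using assms(1)
proof (induction rule: TP_induct)
  case zero
  show ?case using TP_const[of 0] by simp
next
  case (step f \<mu> c)
  have "(\<lambda>u. wave \<mu> u * g u) \<in> TP"
    using assms(2)
  proof (induction rule: TP_induct)
    case zero
    show ?case using TP_const[of 0] by simp
  next
    case (step g \<nu> d)
    have "(\<lambda>u. wave \<mu> u * g u + d * wave (\<mu> + \<nu>) u) \<in> TP"
      by (intro TP_add TP_scale wave_TP weight_add step \<open>\<mu> \<in> P\<close>)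
    then show ?case by (simp add: wave_add algebra_simps)
  qed
  then have "(\<lambda>u. f u * g u + c * (wave \<mu> u * g u)) \<in> TP" by (intro TP_add TP_scale step)
  then show ?case by (simp add: algebra_simps)
qed

lemma TP_prod: "(\<And>i. i \<in> I \<Longrightarrow> f i \<in> TP) \<Longrightarrow> (\<lambda>u. \<Prod>i\<in>I. f i u) \<in> TP"
  by (induction I rule: infinite_finite_induct) (auto intro: TP_const TP_mult)

lemma TP_cnj: "f \<in> TP \<Longrightarrow> (\<lambda>u. cnj (f u)) \<in> TP"
proof (induction rule: TP_induct)
  case zero
  show ?case using TP_const[of 0] by simp
next
  case (step f \<mu> c)
  then have "(\<lambda>u. cnj (f u) + cnj c * wave (- \<mu>) u) \<in> TP"
    by (intro TP_add TP_scale wave_TP weight_uminus)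
  then show ?case by (simp add: cnj_wave)
qed

lemma continuous_TP: "f \<in> TP \<Longrightarrow> continuous_on S f"
  by (induction rule: TP_induct) (auto simp: wave_def intro!: continuous_intros)

lemma bounded_TP: "f \<in> TP \<Longrightarrow> \<exists>B. \<forall>u. norm (f u) \<le> B"
proof (induction rule: TP_induct)
  case (step f \<mu> c)
  then obtain B where "\<forall>u. norm (f u) \<le> B" by blast
  then have "norm (f u + c * wave \<mu> u) \<le> B + norm c" for u
    using norm_triangle_ineq[of "f u" "c * wave \<mu> u"] by (simp add: norm_mult norm_wave) (meson add_right_mono order_trans)
  then show ?case by blast
qed auto

lemma has_dderiv_TP:
  assumes "f \<in> TP"
  shows "has_dderiv f v (dderiv v f)" "dderiv v f \<in> TP"
proof -
  have "\<exists>g\<in>TP. has_dderiv f v g" using assms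
  proof (induction rule: TP_induct)
    case zero
    show ?case by (rule bexI[OF _ TP_const[of 0]]) (simp add: has_dderiv_def)
  next
    case (step f \<mu> c)
    then obtain g where g: "g \<in> TP" "has_dderiv f v g" by blast
    have "has_dderiv (\<lambda>u. f u + c * wave \<mu> u) v (\<lambda>u. g u + c * (\<i> * of_real (\<mu> \<bullet> v) * wave \<mu> u))"
      by (rule has_dderiv_step[OF g(2) has_dderiv_wave])
    moreover have "(\<lambda>u. g u + c * (\<i> * of_real (\<mu> \<bullet> v) * wave \<mu> u)) \<in> TP"
      by (intro TP_add TP_scale g wave_TP step)
    ultimately show ?case by blast
  qed
  then show "has_dderiv f v (dderiv v f)" "dderiv v f \<in> TP" using dderivI by metis+
qed

lemma dderiv_step:
  "f \<in> TP \<Longrightarrow> g \<in> TP \<Longrightarrow> dderiv v (\<lambda>u. f u + c * g u) = (\<lambda>u. dderiv v f u + c * dderiv v g u)"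
  by (intro dderivI has_dderiv_step has_dderiv_TP)

lemma dderiv_zero: "dderiv v (\<lambda>u. 0) = (\<lambda>u. 0)"
  by (rule dderivI) (simp add: has_dderiv_def)

lemma dderiv_wave: "dderiv v (wave \<mu>) = (\<lambda>u. \<i> * of_real (\<mu> \<bullet> v) * wave \<mu> u)"
  by (rule dderivI[OF has_dderiv_wave])

lemma dderiv_linear:
  assumes "f \<in> TP"
  shows "dderiv v f u = (\<Sum>b\<in>Basis. of_real (v \<bullet> b) * dderiv b f u)"
  using assms
proof (induction rule: TP_induct)
  case zero
  show ?case by (simp add: dderiv_zero)
next
  case (step f \<mu> c)
  have "\<mu> \<bullet> v = (\<Sum>b\<in>Basis. (v \<bullet> b) * (\<mu> \<bullet> b))"
    by (subst inner_commute) (rule euclidean_inner)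
  then have "complex_of_real (\<mu> \<bullet> v) = (\<Sum>b\<in>Basis. of_real (v \<bullet> b) * of_real (\<mu> \<bullet> b))" by simp
  then have "c * (\<i> * of_real (\<mu> \<bullet> v) * wave \<mu> u) = (\<Sum>b\<in>Basis. of_real (v \<bullet> b) * (c * (\<i> * of_real (\<mu> \<bullet> b) * wave \<mu> u)))"
    by (simp add: sum_distrib_left sum_distrib_right mult_ac)
  then show ?case
    by (simp only: dderiv_step[OF step(1) wave_TP[OF step(2)]] dderiv_wave step(3) distrib_left sum.distrib)
qed

lemma weyl_inv:
  assumes "w \<in> W"
  shows "inv w \<in> W" "w (inv w x) = x" "inv w (w x) = x"
proof -
  show "w (inv w x) = x" "inv w (w x) = x"
    using weyl_bij[OF assms] by (simp_all add: bij_is_surj surj_f_inv_f bij_is_inj)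
  obtain w' where "w' \<in> W" "\<And>x. w (w' x) = x" "\<And>x. w' (w x) = x"
    using weyl_inverse[OF assms] by blast
  then have "inv w = w'" by (intro inv_equality) auto
  then show "inv w \<in> W" using \<open>w' \<in> W\<close> by simp
qed

lemma weyl_move: "w \<in> W \<Longrightarrow> \<mu> \<bullet> w u = inv w \<mu> \<bullet> u"
  using weyl_inner[of w "inv w \<mu>" u] weyl_inv(2)[of w \<mu>] by simp

lemma wave_weyl: "w \<in> W \<Longrightarrow> wave \<mu> (w u) = wave (inv w \<mu>) u"
  by (simp add: wave_def weyl_move)

lemma TP_weyl: "f \<in> TP \<Longrightarrow> w \<in> W \<Longrightarrow> (\<lambda>u. f (w u)) \<in> TP"
proof (induction rule: TP_induct)
  case zero
  show ?case using TP_const[of 0] by simp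
next
  case (step f \<mu> c)
  then have "(\<lambda>u. f (w u) + c * wave (inv w \<mu>) u) \<in> TP"
    by (intro TP_add TP_scale wave_TP weyl_weight[OF weyl_inv(1)[OF step(4)]])
  then show ?case by (simp add: wave_weyl[OF step(4)])
qed

lemma trig_sum_TP: "finite S \<Longrightarrow> S \<subseteq> P \<Longrightarrow> trig_sum S a id \<in> TP"
  unfolding trig_sum_def id_apply wave_def[symmetric]
  by (intro TP_sum TP_scale wave_TP) auto

lemma TP_trig_sum: "f \<in> TP \<Longrightarrow> \<exists>S a. finite S \<and> S \<subseteq> P \<and> f = trig_sum S a id"
proof (induction rule: TP_induct)
  case zero
  show ?case by (intro exI[of _ "{}"]) (auto simp: trig_sum_def)
next
  case (step f \<mu> c)
  then obtain S a where S: "finite S" "S \<subseteq> P" "f = trig_sum S a id" by blast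
  \<comment> \<open>\<open>\<mu>\<close> may already belong to \<open>S\<close>, in which case the
    two coefficients are added.\<close>
  define a' where "a' = (\<lambda>\<nu>. (if \<nu> \<in> S then a \<nu> else 0) + (if \<nu> = \<mu> then c else 0))"
  have eq: "trig_sum (insert \<mu> S) a' id u = f u + c * wave \<mu> u" for u
  proof -
    have "trig_sum (insert \<mu> S) a' id u =
        (\<Sum>\<nu>\<in>insert \<mu> S. (if \<nu> \<in> S then a \<nu> * wave \<nu> u else 0) + (if \<nu> = \<mu> then c * wave \<mu> u else 0))"
      unfolding trig_sum_def a'_def by (intro sum.cong HOL.refl) (auto simp: wave_def distrib_right)
    also have "\<dots> = (\<Sum>\<nu>\<in>insert \<mu> S. if \<nu> \<in> S then a \<nu> * wave \<nu> u else 0) + c * wave \<mu> u"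
      using S(1) by (simp add: sum.distrib sum.delta)
    also have "(\<Sum>\<nu>\<in>insert \<mu> S. if \<nu> \<in> S then a \<nu> * wave \<nu> u else 0) = (\<Sum>\<nu>\<in>S. a \<nu> * wave \<nu> u)"
      by (rule sum.mono_neutral_cong_right) (use S(1) in auto)
    finally show ?thesis by (simp add: S(3) trig_sum_def wave_def)
  qed
  show ?case
  proof (intro exI conjI)
    show "(\<lambda>u. f u + c * wave \<mu> u) = trig_sum (insert \<mu> S) a' id" by (rule ext) (simp only: eq)
  qed (use S step in auto)
qed

text \<open>\<open>trig_sum S a w\<close> is \<open>trig_sum S a id\<close> composed with the
  inverse of \<open>w\<close>, so invariance of the exponents amounts to plain invariance under the
  action on points. Later arguments use this pointwise form.\<close>

lemma trig_invariants_iff: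
  "f \<in> trig_invariants R \<longleftrightarrow> f \<in> TP \<and> (\<forall>w\<in>W. \<forall>u. f (w u) = f u)"
proof -
  have *: "trig_sum S a w u = trig_sum S a id (inv w u)" if "w \<in> W" for S a w u
    using weyl_inner[OF that, of _ "inv w u"] weyl_inv(2)[OF that, of u] by (simp add: trig_sum_def)
  show ?thesis
  proof
    assume "f \<in> trig_invariants R"
    then obtain S a where S: "f = trig_sum S a id" "finite S" "S \<subseteq> P"
      "\<forall>w\<in>W. trig_sum S a w = trig_sum S a id" by (auto simp: trig_invariants_def)
    have "f (w u) = f u" if "w \<in> W" for w u
    proof -
      have "f (w u) = trig_sum S a w (w u)" using S(4) that unfolding S(1) by metis
      also have "\<dots> = f u" unfolding *[OF that] weyl_inv(3)[OF that] S(1) ..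
      finally show ?thesis .
    qed
    then show "f \<in> TP \<and> (\<forall>w\<in>W. \<forall>u. f (w u) = f u)" using S trig_sum_TP by blast
  next
    assume f: "f \<in> TP \<and> (\<forall>w\<in>W. \<forall>u. f (w u) = f u)"
    then have "f \<in> TP" by blast
    then obtain S a where S: "finite S" "S \<subseteq> P" "f = trig_sum S a id" using TP_trig_sum[of f] by blast
    have "trig_sum S a w = trig_sum S a id" if "w \<in> W" for w
    proof
      fix u
      have "trig_sum S a w u = f (inv w u)" unfolding *[OF that] S(3) ..
      also have "\<dots> = f u" using f weyl_inv(1)[OF that] by blast
      finally show "trig_sum S a w u = trig_sum S a id u" unfolding S(3) .
    qed
    then show "f \<in> trig_invariants R" using S by (auto simp: trig_invariants_def)
  qed
qed

text \<open>Summed over the group, not over the orbit: an exponential is repeated by the order of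
  the stabilizer, and translating by a group element is simply a bijection of the index set.\<close>

definition orbit_sum :: "'a \<Rightarrow> 'a \<Rightarrow> complex" where
  "orbit_sum \<mu> u = (\<Sum>w\<in>W. wave \<mu> (w u))"

lemma weyl_average:
  assumes "f \<in> fspan (wave ` X)"
  shows "(\<lambda>u. \<Sum>w\<in>W. f (w u)) \<in> fspan (orbit_sum ` X)"
  using assms
proof (induction rule: fspan.induct)
  case fspan_zero
  show ?case by (simp add: fspan.fspan_zero)
next
  case (fspan_step f b c)
  then obtain \<mu> where \<mu>: "\<mu> \<in> X" "b = wave \<mu>" by blast
  have "(\<lambda>u. (\<Sum>w\<in>W. f (w u)) + c * orbit_sum \<mu> u) \<in> fspan (orbit_sum ` X)"
    using fspan_step \<mu> by (intro fspan.fspan_step) auto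
  then show ?case by (simp add: \<mu>(2) orbit_sum_def[of \<mu>] sum.distrib sum_distrib_left)
qed

lemma orbit_sum_invariant:
  assumes "\<mu> \<in> P" shows "orbit_sum \<mu> \<in> trig_invariants R"
  unfolding trig_invariants_iff
proof (intro conjI ballI allI)
  show "orbit_sum \<mu> \<in> TP" unfolding orbit_sum_def[abs_def] by (rule TP_sum[OF TP_weyl[OF wave_TP[OF assms]]])
  fix v u assume v: "v \<in> W"
  show "orbit_sum \<mu> (v u) = orbit_sum \<mu> u"
    unfolding orbit_sum_def
    using sum.reindex_bij_betw[OF bij_weyl_comp[OF v], of "\<lambda>w. wave \<mu> (w u)"] by simp
qed

lemma trig_invariants_TP: "f \<in> trig_invariants R \<Longrightarrow> f \<in> TP"
  by (simp add: trig_invariants_iff)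

lemma trig_invariants_add:
  "f \<in> trig_invariants R \<Longrightarrow> g \<in> trig_invariants R \<Longrightarrow> (\<lambda>u. f u + g u) \<in> trig_invariants R"
  by (auto simp: trig_invariants_iff TP_add)

lemma trig_invariants_scale: "f \<in> trig_invariants R \<Longrightarrow> (\<lambda>u. z * f u) \<in> trig_invariants R"
  by (auto simp: trig_invariants_iff TP_scale)

lemma trig_invariants_mult:
  "f \<in> trig_invariants R \<Longrightarrow> g \<in> trig_invariants R \<Longrightarrow> (\<lambda>u. f u * g u) \<in> trig_invariants R"
  by (auto simp: trig_invariants_iff TP_mult)

lemma trig_invariants_const: "(\<lambda>u. z) \<in> trig_invariants R"
  by (auto simp: trig_invariants_iff TP_const)

lemma trig_invariants_cnj: "f \<in> trig_invariants R \<Longrightarrow> (\<lambda>u. cnj (f u)) \<in> trig_invariants R"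
  by (auto simp: trig_invariants_iff TP_cnj)

lemma trig_invariants_average:
  assumes "f \<in> TP" shows "(\<lambda>u. \<Sum>w\<in>W. f (w u)) \<in> trig_invariants R"
  unfolding trig_invariants_iff
proof (intro conjI ballI allI)
  show "(\<lambda>u. \<Sum>w\<in>W. f (w u)) \<in> TP" by (rule TP_sum[OF TP_weyl[OF assms]])
  fix v u assume v: "v \<in> W"
  show "(\<Sum>w\<in>W. f (w (v u))) = (\<Sum>w\<in>W. f (w u))"
    using sum.reindex_bij_betw[OF bij_weyl_comp[OF v], of "\<lambda>w. f (w u)"] by simp
qed

text \<open>Averaging over \<open>W\<close> multiplies an invariant by \<open>card W\<close> and
  turns exponentials into orbit sums.\<close>

lemma trig_invariants_fspan: "trig_invariants R = fspan (orbit_sum ` P)"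
proof
  show "trig_invariants R \<subseteq> fspan (orbit_sum ` P)"
  proof
    fix f assume f: "f \<in> trig_invariants R"
    have c: "of_nat (card W) \<noteq> (0::complex)" using finite_weyl weyl_nonempty by simp
    have "(\<lambda>u. \<Sum>w\<in>W. f (w u)) \<in> fspan (orbit_sum ` P)"
      using f by (intro weyl_average) (simp add: trig_invariants_iff TP_def)
    then have "(\<lambda>u. (1 / of_nat (card W)) * (\<Sum>w\<in>W. f (w u))) \<in> fspan (orbit_sum ` P)"
      by (rule fspan_scale)
    moreover have "(\<Sum>w\<in>W. f (w u)) = of_nat (card W) * f u" for u
      using f by (simp add: trig_invariants_iff)
    ultimately show "f \<in> fspan (orbit_sum ` P)" using c by simp
  qed
  have "f \<in> trig_invariants R" if "f \<in> fspan (orbit_sum ` P)" for f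
    using that
    by (induction rule: fspan.induct)
      (auto intro!: trig_invariants_const trig_invariants_add trig_invariants_scale orbit_sum_invariant)
  then show "fspan (orbit_sum ` P) \<subseteq> trig_invariants R" by blast
qed

section \<open>The filtration by the norm of weights; cotangents and root strings\<close>

definition low_degree :: "real \<Rightarrow> ('a \<Rightarrow> complex) set" where
  "low_degree r = fspan (orbit_sum ` (P \<inter> {\<mu>. norm \<mu> \<le> r}))"

lemma low_degree_mono: "r \<le> s \<Longrightarrow> low_degree r \<subseteq> low_degree s"
  unfolding low_degree_def by (intro fspan_mono image_mono) auto

lemma low_degree_invariant: "low_degree r \<subseteq> trig_invariants R"
  unfolding low_degree_def trig_invariants_fspan by (intro fspan_mono image_mono) auto

lemma trig_invariants_low_degree: "f \<in> trig_invariants R \<Longrightarrow> \<exists>r. f \<in> low_degree r"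
  unfolding trig_invariants_fspan
proof (induction rule: fspan.induct)
  case fspan_zero
  show ?case by (auto simp: low_degree_def fspan.fspan_zero)
next
  case (fspan_step f b c)
  then obtain r \<mu> where r: "f \<in> low_degree r" "\<mu> \<in> P" "b = orbit_sum \<mu>" by blast
  have "f \<in> low_degree (max r (norm \<mu>))" using r(1) low_degree_mono[of r "max r (norm \<mu>)"] by auto
  then have "(\<lambda>u. f u + c * b u) \<in> low_degree (max r (norm \<mu>))"
    unfolding low_degree_def using r by (intro fspan.fspan_step) auto
  then show ?case by blast
qed

text \<open>\<open>\<i> root_string \<alpha> \<mu> u\<close> is \<open>cot (\<alpha> \<bullet> u / 2)\<close> times the difference of the exponentials at \<open>\<mu>\<close>
  and at its mirror image under \<open>\<alpha>\<close>.\<close>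

definition root_string :: "'a \<Rightarrow> 'a \<Rightarrow> 'a \<Rightarrow> complex" where
  "root_string \<alpha> \<mu> u = (let \<sigma> = sgn (coroot \<alpha> \<bullet> \<mu>) in
     of_real \<sigma> * (\<Sum>j<nat \<lfloor>\<bar>coroot \<alpha> \<bullet> \<mu>\<bar>\<rfloor>.
       wave (\<mu> - (\<sigma> * real j) *\<^sub>R \<alpha>) u + wave (\<mu> - (\<sigma> * real (Suc j)) *\<^sub>R \<alpha>) u))"

text \<open>With the exponential at the midpoint \<open>\<nu> - \<alpha> / 2\<close> factored out,
  the difference is \<open>2 * \<i> * sin s\<close> and the sum is \<open>2 * cos s\<close>, where
  \<open>s = \<alpha> \<bullet> u / 2\<close>. The sign -1 is the same fact for
  \<open>\<nu> + \<alpha>\<close>.\<close>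

lemma cot_wave_difference:
  assumes "sin (\<alpha> \<bullet> u / 2) \<noteq> 0" "\<sigma> = 1 \<or> \<sigma> = (-1::real)"
  shows "of_real (cot (\<alpha> \<bullet> u / 2)) * (wave \<nu> u - wave (\<nu> - \<sigma> *\<^sub>R \<alpha>) u) =
     \<i> * of_real \<sigma> * (wave \<nu> u + wave (\<nu> - \<sigma> *\<^sub>R \<alpha>) u)"
proof -
  have *: "of_real (cot (\<alpha> \<bullet> u / 2)) * (wave \<nu> u - wave (\<nu> - \<alpha>) u) = \<i> * (wave \<nu> u + wave (\<nu> - \<alpha>) u)" for \<nu>
  proof -
    define s where "s = \<alpha> \<bullet> u / 2"
    define h where "h = (1/2) *\<^sub>R \<alpha>"
    have hh: "\<alpha> = h + h" by (simp add: h_def scaleR_left_distrib[symmetric])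
    have hu: "h \<bullet> u = s" by (simp add: h_def s_def)
    define m where "m = wave (\<nu> - h) u"
    have "wave (\<nu> - h + h) u = m * cis s"
      unfolding wave_add m_def by (simp add: wave_def cis_conv_exp hu)
    then have 1: "wave \<nu> u = m * cis s" by simp
    have "wave (\<nu> - h + - h) u = m * cis (- s)"
      unfolding wave_add m_def by (simp add: wave_def cis_conv_exp hu)
    moreover have "\<nu> - h + - h = \<nu> - \<alpha>" by (simp add: hh)
    ultimately have 2: "wave (\<nu> - \<alpha>) u = m * cis (- s)" by (simp only:)
    have d: "cis s - cis (- s) = 2 * \<i> * of_real (sin s)" "cis s + cis (- s) = 2 * of_real (cos s)"
      by (simp_all add: complex_eq_iff)
    have "of_real (cot s) * of_real (sin s) = (of_real (cos s) :: complex)"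
      using assms(1) by (simp add: s_def cot_def)
    then have "of_real (cot s) * (m * (cis s - cis (- s))) = \<i> * (m * (cis s + cis (- s)))"
      unfolding d by (simp add: mult_ac)
    then show ?thesis unfolding 1 2 s_def[symmetric] by (simp add: algebra_simps)
  qed
  from assms(2) show ?thesis
  proof
    assume "\<sigma> = 1"
    then show ?thesis using * by simp
  next
    assume "\<sigma> = -1"
    then show ?thesis using *[of "\<nu> + \<alpha>"] by (simp add: algebra_simps)
  qed
qed

text \<open>The difference telescopes along the string from \<mu> to its mirror image, and each step
  absorbs the cotangent. If \<mu> is orthogonal to \<alpha>, then \<sigma> is 0 and the string is
  empty.\<close>

lemma cot_root_string:
  assumes "sin (\<alpha> \<bullet> u / 2) \<noteq> 0" "\<alpha> \<in> R" "\<mu> \<in> P"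
  shows "of_real (cot (\<alpha> \<bullet> u / 2)) * (wave \<mu> u - wave (root_reflection \<alpha> \<mu>) u) = \<i> * root_string \<alpha> \<mu> u"
proof -
  define \<sigma> where "\<sigma> = sgn (coroot \<alpha> \<bullet> \<mu>)"
  define J where "J = nat \<lfloor>\<bar>coroot \<alpha> \<bullet> \<mu>\<bar>\<rfloor>"
  have J: "real J = \<bar>coroot \<alpha> \<bullet> \<mu>\<bar>"
    using weight_coroot_int[OF assms(3,2)] by (auto simp: J_def elim!: Ints_cases)
  have refl: "root_reflection \<alpha> \<mu> = \<mu> - (\<sigma> * real J) *\<^sub>R \<alpha>"
    by (simp add: root_reflection_def J \<sigma>_def sgn_mult_abs)
  show ?thesis
  proof (cases "J = 0")
    case True
    then show ?thesis unfolding root_string_def refl J_def[symmetric] by (simp add: Let_def)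
  next
    case False
    then have s: "\<sigma> = 1 \<or> \<sigma> = -1" using J by (auto simp: \<sigma>_def sgn_if)
    have "wave \<mu> u - wave (root_reflection \<alpha> \<mu>) u =
      (\<Sum>j<J. wave (\<mu> - (\<sigma> * real j) *\<^sub>R \<alpha>) u - wave (\<mu> - (\<sigma> * real (Suc j)) *\<^sub>R \<alpha>) u)"
      unfolding refl by (subst sum_lessThan_telescope') simp
    then have "of_real (cot (\<alpha> \<bullet> u / 2)) * (wave \<mu> u - wave (root_reflection \<alpha> \<mu>) u) =
      (\<Sum>j<J. of_real (cot (\<alpha> \<bullet> u / 2)) * (wave (\<mu> - (\<sigma> * real j) *\<^sub>R \<alpha>) u - wave (\<mu> - (\<sigma> * real (Suc j)) *\<^sub>R \<alpha>) u))"
      by (simp add: sum_distrib_left)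
    also have "\<dots> = (\<Sum>j<J. \<i> * of_real \<sigma> * (wave (\<mu> - (\<sigma> * real j) *\<^sub>R \<alpha>) u + wave (\<mu> - (\<sigma> * real (Suc j)) *\<^sub>R \<alpha>) u))"
    proof (rule sum.cong[OF HOL.refl])
      fix j
      have "\<mu> - (\<sigma> * real (Suc j)) *\<^sub>R \<alpha> = \<mu> - (\<sigma> * real j) *\<^sub>R \<alpha> - \<sigma> *\<^sub>R \<alpha>" by (simp add: algebra_simps)
      then show "of_real (cot (\<alpha> \<bullet> u / 2)) * (wave (\<mu> - (\<sigma> * real j) *\<^sub>R \<alpha>) u - wave (\<mu> - (\<sigma> * real (Suc j)) *\<^sub>R \<alpha>) u)
        = \<i> * of_real \<sigma> * (wave (\<mu> - (\<sigma> * real j) *\<^sub>R \<alpha>) u + wave (\<mu> - (\<sigma> * real (Suc j)) *\<^sub>R \<alpha>) u)"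
        using cot_wave_difference[OF assms(1) s] by metis
    qed
    also have "\<dots> = \<i> * root_string \<alpha> \<mu> u"
      unfolding root_string_def Let_def \<sigma>_def[symmetric] J_def[symmetric] by (simp only: sum_distrib_left mult.assoc)
    finally show ?thesis .
  qed
qed

text \<open>The string lies on the segment from \<mu> to its mirror image, which has the same norm,
  and balls are convex. This is why the filtration goes by the norm.\<close>

lemma root_string_span:
  assumes "\<alpha> \<in> R" "\<mu> \<in> P"
  shows "root_string \<alpha> \<mu> \<in> fspan (wave ` (P \<inter> {\<nu>. norm \<nu> \<le> norm \<mu>}))"
proof -
  define \<sigma> where "\<sigma> = sgn (coroot \<alpha> \<bullet> \<mu>)"
  define J where "J = nat \<lfloor>\<bar>coroot \<alpha> \<bullet> \<mu>\<bar>\<rfloor>"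
  have J: "real J = \<bar>coroot \<alpha> \<bullet> \<mu>\<bar>"
    using weight_coroot_int[OF assms(2,1)] by (auto simp: J_def elim!: Ints_cases)
  have refl: "root_reflection \<alpha> \<mu> = \<mu> - (\<sigma> * real J) *\<^sub>R \<alpha>"
    by (simp add: root_reflection_def J \<sigma>_def sgn_mult_abs)
  have nr: "norm (root_reflection \<alpha> \<mu>) = norm \<mu>"
    by (simp add: norm_eq_sqrt_inner root_reflection_inner root_nonzero assms)
  have \<sigma>int: "\<sigma> \<in> \<int>" by (auto simp: \<sigma>_def sgn_if)
  have mem: "\<mu> - (\<sigma> * real j) *\<^sub>R \<alpha> \<in> P \<inter> {\<nu>. norm \<nu> \<le> norm \<mu>}" if "j \<le> J" for j
  proof -
    have "\<mu> + (- (\<sigma> * real j)) *\<^sub>R \<alpha> \<in> P"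
      using root_subset_weights assms \<sigma>int by (intro weight_add weight_int_multiple) auto
    then have 1: "\<mu> - (\<sigma> * real j) *\<^sub>R \<alpha> \<in> P" by simp
    have "norm (\<mu> - (\<sigma> * real j) *\<^sub>R \<alpha>) \<le> norm \<mu>"
    proof (cases "J = 0")
      case True
      then show ?thesis using that by simp
    next
      case False
      define t where "t = real j / real J"
      have t: "0 \<le> t" "t \<le> 1" using that False by (auto simp: t_def)
      have "\<mu> - (\<sigma> * real j) *\<^sub>R \<alpha> = (1 - t) *\<^sub>R \<mu> + t *\<^sub>R root_reflection \<alpha> \<mu>"
        using False by (simp add: refl t_def algebra_simps)
      then have "norm (\<mu> - (\<sigma> * real j) *\<^sub>R \<alpha>) \<le> (1 - t) * norm \<mu> + t * norm (root_reflection \<alpha> \<mu>)"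
        using norm_triangle_ineq[of "(1 - t) *\<^sub>R \<mu>" "t *\<^sub>R root_reflection \<alpha> \<mu>"] t by simp
      then show ?thesis by (simp add: nr algebra_simps)
    qed
    then show ?thesis using 1 by simp
  qed
  have "(\<lambda>u. of_real \<sigma> * (\<Sum>j<J. wave (\<mu> - (\<sigma> * real j) *\<^sub>R \<alpha>) u + wave (\<mu> - (\<sigma> * real (Suc j)) *\<^sub>R \<alpha>) u))
      \<in> fspan (wave ` (P \<inter> {\<nu>. norm \<nu> \<le> norm \<mu>}))"
    by (intro fspan_scale fspan_sum fspan_add fspan_base imageI mem) auto
  then show ?thesis
    unfolding root_string_def[abs_def] Let_def \<sigma>_def[symmetric] J_def[symmetric] .
qed

lemma root_string_weyl:
  assumes "w \<in> W"
  shows "root_string (w \<alpha>) \<mu> (w u) = root_string \<alpha> (inv w \<mu>) u"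
proof -
  have c: "coroot (w \<alpha>) \<bullet> \<mu> = coroot \<alpha> \<bullet> inv w \<mu>"
    using weyl_coroot[OF assms, of \<alpha>] weyl_move[OF assms, of \<mu> "coroot \<alpha>"] by (simp add: inner_commute)
  have "wave (\<mu> - c *\<^sub>R w \<alpha>) (w u) = wave (inv w \<mu> - c *\<^sub>R \<alpha>) u" for c
  proof -
    have "inv w (\<mu> - c *\<^sub>R w \<alpha>) = inv w \<mu> - c *\<^sub>R \<alpha>"
      using weyl_linear[OF weyl_inv(1)[OF assms]] weyl_inv(3)[OF assms]
      by (simp add: linear_diff linear_scale)
    then show ?thesis by (simp add: wave_weyl[OF assms])
  qed
  then show ?thesis by (simp add: root_string_def c)
qed

lemma orbit_sum_eq: "orbit_sum \<mu> u = (\<Sum>w\<in>W. wave (inv w \<mu>) u)"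
  by (simp add: orbit_sum_def wave_weyl)

lemma has_dderiv_sum:
  "(\<And>i. i \<in> I \<Longrightarrow> has_dderiv (f i) v (g i)) \<Longrightarrow> has_dderiv (\<lambda>u. \<Sum>i\<in>I. f i u) v (\<lambda>u. \<Sum>i\<in>I. g i u)"
  unfolding has_dderiv_def by (auto intro!: has_vector_derivative_sum)

lemma dderiv_orbit_sum:
  "dderiv v (orbit_sum \<mu>) = (\<lambda>u. \<Sum>w\<in>W. \<i> * of_real (inv w \<mu> \<bullet> v) * wave (inv w \<mu>) u)"
  unfolding orbit_sum_eq[abs_def] by (intro dderivI has_dderiv_sum has_dderiv_wave)

lemma laplacian_orbit_sum:
  "(\<Sum>b\<in>Basis. dderiv b (dderiv b (orbit_sum \<mu>)) u) = - of_real ((norm \<mu>)\<^sup>2) * orbit_sum \<mu> u"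
proof -
  have sc: "has_dderiv (\<lambda>u. c * f u) v (\<lambda>u. c * g u)" if "has_dderiv f v g" for c f v g
    using has_dderiv_step[of "\<lambda>u. 0" v "\<lambda>u. 0" f g c] that by (simp add: has_dderiv_def)
  have "dderiv b (dderiv b (orbit_sum \<mu>)) u =
      (\<Sum>w\<in>W. \<i> * of_real (inv w \<mu> \<bullet> b) * (\<i> * of_real (inv w \<mu> \<bullet> b) * wave (inv w \<mu>) u))" for b
    unfolding dderiv_orbit_sum by (subst dderivI[OF has_dderiv_sum[OF sc[OF has_dderiv_wave]]]) simp
  then have "(\<Sum>b\<in>Basis. dderiv b (dderiv b (orbit_sum \<mu>)) u) =
      (\<Sum>b\<in>Basis. \<Sum>w\<in>W. - of_real ((inv w \<mu> \<bullet> b) * (inv w \<mu> \<bullet> b)) * wave (inv w \<mu>) u)"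
    by (simp add: algebra_simps)
  also have "\<dots> = (\<Sum>w\<in>W. - of_real (\<Sum>b\<in>Basis. (inv w \<mu> \<bullet> b) * (inv w \<mu> \<bullet> b)) * wave (inv w \<mu>) u)"
    by (subst sum.swap) (simp add: sum_distrib_right sum_negf)
  also have "\<dots> = (\<Sum>w\<in>W. - of_real ((norm \<mu>)\<^sup>2) * wave (inv w \<mu>) u)"
  proof (rule sum.cong[OF HOL.refl])
    fix w assume w: "w \<in> W"
    have "(\<Sum>b\<in>Basis. (inv w \<mu> \<bullet> b) * (inv w \<mu> \<bullet> b)) = inv w \<mu> \<bullet> inv w \<mu>"
      by (rule euclidean_inner[symmetric])
    also have "\<dots> = (norm \<mu>)\<^sup>2" using weyl_norm[OF weyl_inv(1)[OF w]] by (simp add: dot_square_norm)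
    finally show "- of_real (\<Sum>b\<in>Basis. (inv w \<mu> \<bullet> b) * (inv w \<mu> \<bullet> b)) * wave (inv w \<mu>) u
      = - of_real ((norm \<mu>)\<^sup>2) * wave (inv w \<mu>) u" by simp
  qed
  finally show ?thesis by (simp add: orbit_sum_eq sum_distrib_left)
qed

text \<open>Reindexing by the reflection in \<alpha> flips the sign of the coefficient
  \<open>inv w \<mu> \<bullet> \<alpha>\<close>, so the exponentials combine into differences to
  which \<open>cot_root_string\<close> applies. Each term is used twice, hence the factor
  1/2.\<close>

lemma cot_dderiv_orbit_sum:
  assumes "\<alpha> \<in> R" "\<mu> \<in> P" "sin (\<alpha> \<bullet> u / 2) \<noteq> 0"
  shows "of_real (cot (\<alpha> \<bullet> u / 2)) * dderiv \<alpha> (orbit_sum \<mu>) u =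
     (\<Sum>w\<in>W. of_real (- (inv w \<mu> \<bullet> \<alpha>) / 2) * root_string \<alpha> (inv w \<mu>) u)"
proof -
  let ?s = "root_reflection \<alpha>"
  define G where "G = (\<lambda>\<nu>. of_real (cot (\<alpha> \<bullet> u / 2)) * (\<i> * of_real (\<nu> \<bullet> \<alpha>) * wave \<nu> u))"
  have a0: "\<alpha> \<noteq> 0" and s: "?s \<in> W" using assms root_nonzero root_reflection_weyl by auto
  have invs: "inv (w \<circ> ?s) \<nu> = ?s (inv w \<nu>)" if "w \<in> W" for w \<nu>
  proof -
    have "(w \<circ> ?s) (?s (inv w \<nu>)) = \<nu>" by (simp add: root_reflection_idem[OF a0] weyl_inv(2)[OF that])
    then show ?thesis using weyl_inv(3)[OF weyl_comp[OF that s]] by metis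
  qed
  have "(\<Sum>w\<in>W. G (inv w \<mu>)) = (\<Sum>w\<in>W. G (inv (w \<circ> ?s) \<mu>))"
    by (rule sum.reindex_bij_betw[OF bij_weyl_comp[OF s], symmetric])
  also have "\<dots> = (\<Sum>w\<in>W. G (?s (inv w \<mu>)))" by (intro sum.cong HOL.refl) (simp add: invs)
  finally have "2 * (\<Sum>w\<in>W. G (inv w \<mu>)) = (\<Sum>w\<in>W. G (inv w \<mu>) + G (?s (inv w \<mu>)))"
    by (simp add: sum.distrib)
  also have "\<dots> = (\<Sum>w\<in>W. - of_real (inv w \<mu> \<bullet> \<alpha>) * root_string \<alpha> (inv w \<mu>) u)"
  proof (rule sum.cong[OF HOL.refl])
    fix w assume w: "w \<in> W"
    define \<nu> where "\<nu> = inv w \<mu>"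
    have \<nu>: "\<nu> \<in> P" unfolding \<nu>_def by (rule weyl_weight[OF weyl_inv(1)[OF w] assms(2)])
    have "?s \<nu> \<bullet> \<alpha> = - (\<nu> \<bullet> \<alpha>)"
      using root_reflection_inner[OF a0, of \<nu> "?s \<alpha>"] root_reflection_self[OF a0]
        root_reflection_idem[OF a0, of \<alpha>] by (metis inner_minus_right root_reflection_inner a0)
    then have "G \<nu> + G (?s \<nu>) = \<i> * of_real (\<nu> \<bullet> \<alpha>) * (of_real (cot (\<alpha> \<bullet> u / 2)) * (wave \<nu> u - wave (?s \<nu>) u))"
      by (simp add: G_def algebra_simps)
    also have "\<dots> = - of_real (\<nu> \<bullet> \<alpha>) * root_string \<alpha> \<nu> u"
      unfolding cot_root_string[OF assms(3,1) \<nu>] by (simp add: algebra_simps)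
    finally show "G (inv w \<mu>) + G (?s (inv w \<mu>)) = - of_real (inv w \<mu> \<bullet> \<alpha>) * root_string \<alpha> (inv w \<mu>) u"
      by (simp add: \<nu>_def)
  qed
  finally have "2 * (\<Sum>w\<in>W. G (inv w \<mu>)) = 2 * (\<Sum>w\<in>W. of_real (- (inv w \<mu> \<bullet> \<alpha>) / 2) * root_string \<alpha> (inv w \<mu>) u)"
    by (simp add: sum_distrib_left)
  from mult_left_cancel[THEN iffD1, OF _ this]
  have "(\<Sum>w\<in>W. G (inv w \<mu>)) = (\<Sum>w\<in>W. of_real (- (inv w \<mu> \<bullet> \<alpha>) / 2) * root_string \<alpha> (inv w \<mu>) u)"
    by simp
  then show ?thesis by (simp only: dderiv_orbit_sum G_def sum_distrib_left)
qed

end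

section \<open>The conjugated operator on orbit sums\<close>

context alcove
begin

lemma alcove_sin_pos: "\<alpha> \<in> Rp \<Longrightarrow> u \<in> A \<Longrightarrow> sin (\<alpha> \<bullet> u / 2) > 0"
  using alcove_bounds[of \<alpha> u] by (intro sin_gt_zero) auto

lemma alcove_sin_nonzero: "\<alpha> \<in> R \<Longrightarrow> u \<in> A \<Longrightarrow> sin (\<alpha> \<bullet> u / 2) \<noteq> 0"
  using positive_or_negative[of \<alpha>] alcove_sin_pos[of \<alpha> u] alcove_sin_pos[of "- \<alpha>" u] by auto

text \<open>Serves the symmetry proof, where the cotangent terms must be bounded up to the walls one
  root at a time. A single root breaks the invariance, so \<open>h\<close> is only a trigonometric
  polynomial.\<close>

lemma cot_dderiv_TP:
  assumes "\<alpha> \<in> R" "f \<in> trig_invariants R"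
  shows "\<exists>h\<in>TP. \<forall>u\<in>A. of_real (cot (\<alpha> \<bullet> u / 2)) * dderiv \<alpha> f u = h u"
  using assms(2) unfolding trig_invariants_fspan
proof (induction rule: fspan.induct)
  case fspan_zero
  show ?case by (rule bexI[OF _ TP_const[of 0]]) (simp add: dderiv_zero)
next
  case (fspan_step f b c)
  obtain h where h: "h \<in> TP" "\<forall>u\<in>A. of_real (cot (\<alpha> \<bullet> u / 2)) * dderiv \<alpha> f u = h u"
    using fspan_step by blast
  obtain \<mu> where \<mu>: "\<mu> \<in> P" "b = orbit_sum \<mu>" using fspan_step by blast
  define g where "g = (\<lambda>u. \<Sum>w\<in>W. of_real (- (inv w \<mu> \<bullet> \<alpha>) / 2) * root_string \<alpha> (inv w \<mu>) u)"
  have rs: "root_string \<alpha> \<nu> \<in> TP" if "\<nu> \<in> P" for \<nu>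
    using root_string_span[OF assms(1) that] fspan_mono[of "wave ` (P \<inter> {\<mu>. norm \<mu> \<le> norm \<nu>})" "wave ` P"]
    by (auto simp: TP_def)
  have g: "g \<in> TP"
    unfolding g_def by (intro TP_sum TP_scale rs weyl_weight[OF weyl_inv(1) \<mu>(1)])
  have fT: "f \<in> TP" using fspan_step(1) trig_invariants_fspan trig_invariants_TP by blast
  have bT: "orbit_sum \<mu> \<in> TP" by (rule trig_invariants_TP[OF orbit_sum_invariant[OF \<mu>(1)]])
  show ?case
  proof (rule bexI[of _ "\<lambda>u. h u + c * g u"])
    show "(\<lambda>u. h u + c * g u) \<in> TP" by (intro TP_add TP_scale h g)
    show "\<forall>u\<in>A. of_real (cot (\<alpha> \<bullet> u / 2)) * dderiv \<alpha> (\<lambda>u. f u + c * b u) u = h u + c * g u"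
      using h(2) cot_dderiv_orbit_sum[OF assms(1) \<mu>(1) alcove_sin_nonzero[OF assms(1)]]
      by (auto simp: dderiv_step[OF fT bT] distrib_left g_def \<mu>(2) mult.left_commute)
  qed
qed

definition Lop :: "(real \<Rightarrow> real) \<Rightarrow> ('a \<Rightarrow> complex) \<Rightarrow> 'a \<Rightarrow> complex" where
  "Lop k f u = (\<Sum>b\<in>Basis. dderiv b (dderiv b f) u) +
     (\<Sum>\<alpha>\<in>Rp. of_real (k (norm \<alpha>)) * (of_real (cot (\<alpha> \<bullet> u / 2)) * dderiv \<alpha> f u))"

lemma Lop_step:
  assumes "f \<in> TP" "g \<in> TP"
  shows "Lop k (\<lambda>u. f u + c * g u) u = Lop k f u + c * Lop k g u"
  using assms has_dderiv_TP
  by (simp add: Lop_def dderiv_step sum.distrib sum_distrib_left algebra_simps)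

text \<open>Only the sum over all roots is invariant: reindexing the roots by \<open>w\<close>
  presents it as the Weyl average of \<open>N\<close>, and an average of exponentials from the ball
  is a combination of orbit sums from the ball.\<close>

lemma Lop_orbit_sum:
  assumes "\<mu> \<in> P"
  shows "\<exists>h\<in>low_degree (norm \<mu>). \<forall>u\<in>A. Lop k (orbit_sum \<mu>) u = h u"
proof -
  \<comment> \<open>One factor 1/2 comes from \<open>cot_dderiv_orbit_sum\<close>, the other from
    summing over all roots and not just the positive ones.\<close>
  define N where "N = (\<lambda>u. \<Sum>\<beta>\<in>R. of_real (- k (norm \<beta>) * (\<mu> \<bullet> \<beta>) / 4) * root_string \<beta> \<mu> u)"
  have "N \<in> fspan (wave ` (P \<inter> {\<nu>. norm \<nu> \<le> norm \<mu>}))"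
    unfolding N_def by (intro fspan_sum fspan_scale root_string_span assms)
  then have avg: "(\<lambda>u. \<Sum>w\<in>W. N (w u)) \<in> low_degree (norm \<mu>)"
    unfolding low_degree_def by (rule weyl_average)
  have os: "orbit_sum \<mu> \<in> low_degree (norm \<mu>)"
    unfolding low_degree_def using assms by (intro fspan_base) auto
  let ?h = "\<lambda>u. - of_real ((norm \<mu>)\<^sup>2) * orbit_sum \<mu> u + (\<Sum>w\<in>W. N (w u))"
  have "?h \<in> low_degree (norm \<mu>)"
    using avg os unfolding low_degree_def by (intro fspan_add fspan_scale)
  moreover have "Lop k (orbit_sum \<mu>) u = ?h u" if u: "u \<in> A" for u
  proof -
    define g where "g = (\<lambda>\<alpha>. of_real (k (norm \<alpha>)) * (of_real (cot (\<alpha> \<bullet> u / 2)) * dderiv \<alpha> (orbit_sum \<mu>) u))"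
    have "g (- \<alpha>) = g \<alpha>" for \<alpha>
    proof -
      have "dderiv (- \<alpha>) (orbit_sum \<mu>) u = - dderiv \<alpha> (orbit_sum \<mu>) u"
        by (simp add: dderiv_orbit_sum sum_negf)
      then show ?thesis by (simp add: g_def cot_def)
    qed
    then have "sum g R = 2 * sum g Rp" unfolding sum_roots by (simp add: sum_distrib_left)
    then have "sum g Rp = sum g R / 2" by simp
    also have "sum g R = (\<Sum>\<alpha>\<in>R. \<Sum>w\<in>W. of_real (k (norm \<alpha>) * - (inv w \<mu> \<bullet> \<alpha>) / 2) * root_string \<alpha> (inv w \<mu>) u)"
      unfolding g_def using cot_dderiv_orbit_sum[OF _ assms alcove_sin_nonzero[OF _ u]]
      by (intro sum.cong HOL.refl) (simp add: sum_distrib_left mult.assoc)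
    also have "\<dots> = (\<Sum>w\<in>W. \<Sum>\<alpha>\<in>R. of_real (k (norm \<alpha>) * - (inv w \<mu> \<bullet> \<alpha>) / 2) * root_string \<alpha> (inv w \<mu>) u)"
      by (rule sum.swap)
    also have "\<dots> = (\<Sum>w\<in>W. 2 * N (w u))"
    proof (rule sum.cong[OF HOL.refl])
      fix w assume w: "w \<in> W"
      have "N (w u) = (\<Sum>\<alpha>\<in>R. of_real (- k (norm (w \<alpha>)) * (\<mu> \<bullet> w \<alpha>) / 4) * root_string (w \<alpha>) \<mu> (w u))"
        unfolding N_def by (rule sum.reindex_bij_betw[OF weyl_bij_R[OF w], symmetric])
      then show "(\<Sum>\<alpha>\<in>R. of_real (k (norm \<alpha>) * - (inv w \<mu> \<bullet> \<alpha>) / 2) * root_string \<alpha> (inv w \<mu>) u) = 2 * N (w u)"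
        by (simp add: root_string_weyl[OF w] weyl_norm[OF w] weyl_move[OF w] sum_distrib_left mult_ac)
    qed
    finally have "sum g Rp = (\<Sum>w\<in>W. N (w u))" by (simp add: sum_distrib_left[symmetric])
    then show ?thesis by (simp add: Lop_def laplacian_orbit_sum g_def)
  qed
  ultimately show ?thesis by (intro bexI[of _ ?h]) auto
qed

theorem Lop_low_degree:
  assumes "f \<in> low_degree r"
  shows "\<exists>h\<in>low_degree r. \<forall>u\<in>A. Lop k f u = h u"
  using assms unfolding low_degree_def
proof (induction rule: fspan.induct)
  case fspan_zero
  show ?case by (rule bexI[OF _ fspan.fspan_zero]) (simp add: Lop_def dderiv_zero)
next
  case (fspan_step f b c)
  let ?D = "fspan (orbit_sum ` (P \<inter> {\<mu>. norm \<mu> \<le> r}))"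
  obtain h where h: "h \<in> ?D" "\<forall>u\<in>A. Lop k f u = h u" using fspan_step by blast
  obtain \<mu> where \<mu>: "\<mu> \<in> P" "norm \<mu> \<le> r" "b = orbit_sum \<mu>" using fspan_step by blast
  obtain g where g: "g \<in> low_degree (norm \<mu>)" "\<forall>u\<in>A. Lop k b u = g u"
    using Lop_orbit_sum[OF \<mu>(1)] \<mu>(3) by blast
  have g': "g \<in> ?D" using g(1) low_degree_mono[OF \<mu>(2)] by (auto simp: low_degree_def)
  have fT: "f \<in> TP" using fspan_step(1) low_degree_invariant trig_invariants_TP by (fastforce simp: low_degree_def)
  have bT: "b \<in> TP" unfolding \<mu>(3) by (rule trig_invariants_TP[OF orbit_sum_invariant[OF \<mu>(1)]])
  show ?case
    by (rule bexI[of _ "\<lambda>u. h u + c * g u"])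
      (use h g g' in \<open>auto simp: Lop_step[OF fT bT] intro!: fspan_add fspan_scale\<close>)
qed

end

section \<open>The conjugated operator\<close>

definition deriv_on :: "'a::euclidean_space set \<Rightarrow> 'a \<Rightarrow> ('a \<Rightarrow> complex) \<Rightarrow> ('a \<Rightarrow> complex) \<Rightarrow> bool" where
  "deriv_on S b f g \<longleftrightarrow> (\<forall>u\<in>S. ((\<lambda>t. f (u + t *\<^sub>R b)) has_vector_derivative g u) (at 0))"

lemma deriv_on_mult:
  "deriv_on S b f f' \<Longrightarrow> deriv_on S b g g' \<Longrightarrow> deriv_on S b (\<lambda>u. f u * g u) (\<lambda>u. f u * g' u + f' u * g u)"
  unfolding deriv_on_def by (auto dest!: bspec intro: has_vector_derivative_mult[THEN has_vector_derivative_eq_rhs])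

lemma deriv_on_add:
  "deriv_on S b f f' \<Longrightarrow> deriv_on S b g g' \<Longrightarrow> deriv_on S b (\<lambda>u. f u + g u) (\<lambda>u. f' u + g' u)"
  unfolding deriv_on_def by (auto intro!: derivative_intros)

lemma deriv_on_diff:
  "deriv_on S b f f' \<Longrightarrow> deriv_on S b g g' \<Longrightarrow> deriv_on S b (\<lambda>u. f u - g u) (\<lambda>u. f' u - g' u)"
  unfolding deriv_on_def by (auto intro!: derivative_intros)

lemma deriv_on_real:
  assumes "\<And>u. u \<in> S \<Longrightarrow> ((\<lambda>t. f (u + t *\<^sub>R b)) has_real_derivative g u) (at 0)"
  shows "deriv_on S b (\<lambda>u. of_real (f u)) (\<lambda>u. of_real (g u))"
  unfolding deriv_on_def
  using assms bounded_linear.has_vector_derivative[OF bounded_linear_of_real]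
  by (auto simp: has_real_derivative_iff_has_vector_derivative)

lemma eventually_in_open_line:
  fixes u b :: "'a::real_normed_vector"
  assumes "open S" "u + t *\<^sub>R b \<in> S"
  shows "eventually (\<lambda>s. u + s *\<^sub>R b \<in> S) (nhds t)"
proof -
  have "open ((\<lambda>s. u + s *\<^sub>R b) -` S)" by (intro open_vimage assms(1) continuous_intros)
  then show ?thesis using eventually_nhds_in_open[of "(\<lambda>s. u + s *\<^sub>R b) -` S" t] assms(2) by simp
qed

lemma has_vector_derivative_cong_ev:
  assumes "eventually (\<lambda>x. f x = g x) (nhds (t::real))"
  shows "(f has_vector_derivative D) (at t) \<longleftrightarrow> (g has_vector_derivative D) (at t)"
proof -
  have *: "(g has_vector_derivative D) (at t)"
    if "(f has_vector_derivative D) (at t)" "eventually (\<lambda>x. f x = g x) (nhds t)" for f g :: "real \<Rightarrow> 'a"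
    using that eventually_nhds_x_imp_x[OF that(2)] unfolding has_vector_derivative_def
    by (intro has_derivative_transform_eventually[of f _ t UNIV g])
      (auto simp: eventually_at_filter elim: eventually_mono)
  show ?thesis using *[of f g] *[of g f] assms by (auto simp: eq_commute)
qed

lemma deriv_on_shift:
  assumes "deriv_on S b f g" "u + t *\<^sub>R b \<in> S"
  shows "((\<lambda>s. f (u + s *\<^sub>R b)) has_vector_derivative g (u + t *\<^sub>R b)) (at t)"
proof -
  have "((\<lambda>s. f ((u + t *\<^sub>R b) + s *\<^sub>R b)) has_vector_derivative g (u + t *\<^sub>R b)) (at 0)"
    using assms unfolding deriv_on_def by blast
  then have "((\<lambda>s. f ((u + t *\<^sub>R b) + s *\<^sub>R b)) \<circ> (\<lambda>s. s - t) has_vector_derivative 1 *\<^sub>R g (u + t *\<^sub>R b)) (at t)"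
    by (intro vector_diff_chain_at) (auto intro!: derivative_eq_intros)
  then show ?thesis by (simp add: comp_def algebra_simps)
qed

text \<open>The outer derivative requires the inner one on a neighbourhood of 0, where openness
  keeps the line inside \<open>S\<close>.\<close>

lemma second_derivative_on:
  assumes "open S" "deriv_on S b f g" "deriv_on S b g h" "u \<in> S"
  shows "vector_derivative (\<lambda>t. vector_derivative (\<lambda>s. f (u + s *\<^sub>R b)) (at t)) (at 0) = h u"
proof (rule vector_derivative_at)
  have "eventually (\<lambda>t. u + t *\<^sub>R b \<in> S) (nhds 0)"
    using eventually_in_open_line[OF assms(1), of u 0 b] assms(4) by simp
  then have "eventually (\<lambda>t. vector_derivative (\<lambda>s. f (u + s *\<^sub>R b)) (at t) = g (u + t *\<^sub>R b)) (nhds 0)"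
    by (rule eventually_mono) (rule vector_derivative_at[OF deriv_on_shift[OF assms(2)]])
  then show "((\<lambda>t. vector_derivative (\<lambda>s. f (u + s *\<^sub>R b)) (at t)) has_vector_derivative h u) (at 0)"
    using assms(3,4) by (subst has_vector_derivative_cong_ev) (auto simp: deriv_on_def)
qed

section \<open>The logarithmic derivative of \<open>F_fun\<close> and the potential\<close>

context alcove
begin

lemma F_fun_alcove:
  assumes "u \<in> A"
  shows "F_fun R C k u = (\<Prod>\<alpha>\<in>Rp. sin (\<alpha> \<bullet> u / 2) powr k (norm \<alpha>))"
proof -
  have "\<bar>A_len R C c u\<bar> powr k c = (\<Prod>\<alpha>\<in>{\<alpha>\<in>Rp. norm \<alpha> = c}. sin (\<alpha> \<bullet> u / 2) powr k (norm \<alpha>))" for c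
  proof -
    have "A_len R C c u = (\<Prod>\<alpha>\<in>{\<alpha>\<in>Rp. norm \<alpha> = c}. sin (\<alpha> \<bullet> u / 2))"
      by (simp add: A_len_def positive_roots_of_length_def)
    moreover have "\<dots> > 0" by (intro prod_pos ballI) (use alcove_sin_pos assms in auto)
    ultimately have "\<bar>A_len R C c u\<bar> powr k c = (\<Prod>\<alpha>\<in>{\<alpha>\<in>Rp. norm \<alpha> = c}. sin (\<alpha> \<bullet> u / 2)) powr k c"
      by simp
    also have "\<dots> = (\<Prod>\<alpha>\<in>{\<alpha>\<in>Rp. norm \<alpha> = c}. sin (\<alpha> \<bullet> u / 2) powr k c)"
      by (rule prod_powr_distrib)
    also have "\<dots> = (\<Prod>\<alpha>\<in>{\<alpha>\<in>Rp. norm \<alpha> = c}. sin (\<alpha> \<bullet> u / 2) powr k (norm \<alpha>))"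
      by (rule prod.cong) auto
    finally show ?thesis .
  qed
  then have "F_fun R C k u = (\<Prod>c\<in>root_lengths R. \<Prod>\<alpha>\<in>{\<alpha>\<in>Rp. norm \<alpha> = c}. sin (\<alpha> \<bullet> u / 2) powr k (norm \<alpha>))"
    by (simp add: F_fun_def)
  also have "\<dots> = (\<Prod>\<alpha>\<in>Rp. sin (\<alpha> \<bullet> u / 2) powr k (norm \<alpha>))"
    by (rule prod.group[OF finite_Rp]) (use finite_R positive_root in \<open>auto simp: root_lengths_def\<close>)
  finally show ?thesis .
qed

lemma F_fun_exp:
  assumes "u \<in> A"
  shows "F_fun R C k u = exp (\<Sum>\<alpha>\<in>Rp. k (norm \<alpha>) * ln (sin (\<alpha> \<bullet> u / 2)))"
  unfolding F_fun_alcove[OF assms] exp_sum[OF finite_Rp]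
proof (rule prod.cong[OF HOL.refl])
  fix \<alpha> assume "\<alpha> \<in> Rp"
  then show "sin (\<alpha> \<bullet> u / 2) powr k (norm \<alpha>) = exp (k (norm \<alpha>) * ln (sin (\<alpha> \<bullet> u / 2)))"
    using alcove_sin_pos[OF _ assms, of \<alpha>] by (simp add: powr_def)
qed

lemma F_fun_pos: "u \<in> A \<Longrightarrow> F_fun R C k u > 0"
  by (simp add: F_fun_exp)

lemma continuous_F_fun: "continuous_on A (F_fun R C k)"
proof -
  have "continuous_on A (\<lambda>u. exp (\<Sum>\<alpha>\<in>Rp. k (norm \<alpha>) * ln (sin (\<alpha> \<bullet> u / 2))))"
    by (intro continuous_intros ballI alcove_sin_nonzero positive_root) simp_all
  then show ?thesis by (rule continuous_on_eq) (simp add: F_fun_exp)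
qed

definition log_deriv :: "(real \<Rightarrow> real) \<Rightarrow> 'a \<Rightarrow> 'a \<Rightarrow> real" where
  "log_deriv k b u = (\<Sum>\<alpha>\<in>Rp. k (norm \<alpha>) * cot (\<alpha> \<bullet> u / 2) * (\<alpha> \<bullet> b)) / 2"

definition log_deriv2 :: "(real \<Rightarrow> real) \<Rightarrow> 'a \<Rightarrow> 'a \<Rightarrow> real" where
  "log_deriv2 k b u = - (\<Sum>\<alpha>\<in>Rp. k (norm \<alpha>) * (\<alpha> \<bullet> b)\<^sup>2 / (sin (\<alpha> \<bullet> u / 2))\<^sup>2) / 4"

lemma F_fun_derivative:
  assumes "u \<in> A"
  shows "((\<lambda>t. F_fun R C k (u + t *\<^sub>R b)) has_real_derivative F_fun R C k u * log_deriv k b u) (at 0)"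
proof -
  have pos: "sin (\<alpha> \<bullet> u / 2) > 0" if "\<alpha> \<in> Rp" for \<alpha> using alcove_sin_pos[OF that assms] .
  have "((\<lambda>t. ln (sin (\<alpha> \<bullet> (u + t *\<^sub>R b) / 2))) has_real_derivative cot (\<alpha> \<bullet> u / 2) * (\<alpha> \<bullet> b) / 2) (at 0)"
    if "\<alpha> \<in> Rp" for \<alpha>
    using pos[OF that] unfolding inner_add_right inner_scaleR_right
    by (auto intro!: derivative_eq_intros simp: cot_def field_simps)
  then have "((\<lambda>t. \<Sum>\<alpha>\<in>Rp. k (norm \<alpha>) * ln (sin (\<alpha> \<bullet> (u + t *\<^sub>R b) / 2))) has_real_derivative
      (\<Sum>\<alpha>\<in>Rp. k (norm \<alpha>) * (cot (\<alpha> \<bullet> u / 2) * (\<alpha> \<bullet> b) / 2))) (at 0)"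
    by (intro DERIV_sum DERIV_cmult)
  moreover have "(\<Sum>\<alpha>\<in>Rp. k (norm \<alpha>) * (cot (\<alpha> \<bullet> u / 2) * (\<alpha> \<bullet> b) / 2)) = log_deriv k b u"
    by (simp add: log_deriv_def sum_divide_distrib mult.assoc)
  ultimately have D: "((\<lambda>t. exp (\<Sum>\<alpha>\<in>Rp. k (norm \<alpha>) * ln (sin (\<alpha> \<bullet> (u + t *\<^sub>R b) / 2)))) has_real_derivative
      exp (\<Sum>\<alpha>\<in>Rp. k (norm \<alpha>) * ln (sin (\<alpha> \<bullet> u / 2))) * log_deriv k b u) (at 0)"
    using DERIV_fun_exp by fastforce
  have "eventually (\<lambda>t. u + t *\<^sub>R b \<in> A) (nhds 0)"
    using eventually_in_open_line[OF open_alcove, of u 0 b] assms by simp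
  then have ev: "eventually (\<lambda>t. F_fun R C k (u + t *\<^sub>R b) =
      exp (\<Sum>\<alpha>\<in>Rp. k (norm \<alpha>) * ln (sin (\<alpha> \<bullet> (u + t *\<^sub>R b) / 2)))) (nhds 0)"
    by (rule eventually_mono) (rule F_fun_exp)
  show ?thesis
    unfolding DERIV_cong_ev[OF HOL.refl ev HOL.refl] F_fun_exp[OF assms] by (rule D)
qed

lemma log_deriv_derivative:
  assumes "u \<in> A"
  shows "((\<lambda>t. log_deriv k b (u + t *\<^sub>R b)) has_real_derivative log_deriv2 k b u) (at 0)"
proof -
  have nz: "sin (\<alpha> \<bullet> u / 2) \<noteq> 0" if "\<alpha> \<in> Rp" for \<alpha> using alcove_sin_pos[OF that assms] by simp
  have "((\<lambda>t. cot (\<alpha> \<bullet> (u + t *\<^sub>R b) / 2)) has_real_derivative - (\<alpha> \<bullet> b) / 2 / (sin (\<alpha> \<bullet> u / 2))\<^sup>2) (at 0)"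
    if "\<alpha> \<in> Rp" for \<alpha>
  proof -
    have "(cot has_real_derivative - inverse ((sin (\<alpha> \<bullet> (u + 0 *\<^sub>R b) / 2))\<^sup>2)) (at (\<alpha> \<bullet> (u + 0 *\<^sub>R b) / 2))"
      using nz[OF that] by (intro DERIV_cot) simp
    moreover have "((\<lambda>t. \<alpha> \<bullet> (u + t *\<^sub>R b) / 2) has_real_derivative \<alpha> \<bullet> b / 2) (at 0)"
      unfolding inner_add_right inner_scaleR_right by (auto intro!: derivative_eq_intros)
    ultimately have "((\<lambda>t. cot (\<alpha> \<bullet> (u + t *\<^sub>R b) / 2)) has_real_derivative
        - inverse ((sin (\<alpha> \<bullet> (u + 0 *\<^sub>R b) / 2))\<^sup>2) * (\<alpha> \<bullet> b / 2)) (at 0)"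
      by (rule DERIV_chain2)
    then show ?thesis by (simp add: field_simps)
  qed
  then have "((\<lambda>t. (\<Sum>\<alpha>\<in>Rp. (k (norm \<alpha>) * (\<alpha> \<bullet> b) / 2) * cot (\<alpha> \<bullet> (u + t *\<^sub>R b) / 2))) has_real_derivative
      (\<Sum>\<alpha>\<in>Rp. (k (norm \<alpha>) * (\<alpha> \<bullet> b) / 2) * (- (\<alpha> \<bullet> b) / 2 / (sin (\<alpha> \<bullet> u / 2))\<^sup>2))) (at 0)"
    by (intro DERIV_sum DERIV_cmult)
  moreover have "(\<Sum>\<alpha>\<in>Rp. (k (norm \<alpha>) * (\<alpha> \<bullet> b) / 2) * (- (\<alpha> \<bullet> b) / 2 / (sin (\<alpha> \<bullet> u / 2))\<^sup>2)) = log_deriv2 k b u"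
    by (simp add: log_deriv2_def sum_divide_distrib sum_negf power2_eq_square mult_ac)
  moreover have "(\<Sum>\<alpha>\<in>Rp. (k (norm \<alpha>) * (\<alpha> \<bullet> b) / 2) * cot (\<alpha> \<bullet> v / 2)) = log_deriv k b v" for v
    by (simp add: log_deriv_def sum_divide_distrib mult_ac)
  ultimately show ?thesis by simp
qed

lemma deriv_on_F: "deriv_on A b (\<lambda>u. of_real (F_fun R C k u)) (\<lambda>u. of_real (F_fun R C k u) * of_real (log_deriv k b u))"
  using deriv_on_real[of A "F_fun R C k" b, OF F_fun_derivative] by simp

lemma deriv_on_log_deriv: "deriv_on A b (\<lambda>u. of_real (log_deriv k b u)) (\<lambda>u. of_real (log_deriv2 k b u))"
  by (rule deriv_on_real[OF log_deriv_derivative])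

lemma deriv_on_TP: "f \<in> TP \<Longrightarrow> deriv_on S b f (dderiv b f)"
  using has_dderiv_TP(1)[of f b] by (simp add: deriv_on_def has_dderiv_def)

lemma log_deriv_dderiv:
  assumes f: "f \<in> TP"
  shows "(\<Sum>b\<in>Basis. 2 * of_real (log_deriv k b u) * dderiv b f u) =
      (\<Sum>\<alpha>\<in>Rp. of_real (k (norm \<alpha>)) * (of_real (cot (\<alpha> \<bullet> u / 2)) * dderiv \<alpha> f u))"
proof -
  have "(\<Sum>b\<in>Basis. 2 * of_real (log_deriv k b u) * dderiv b f u) = (\<Sum>b\<in>Basis. \<Sum>\<alpha>\<in>Rp.
      of_real (k (norm \<alpha>)) * of_real (cot (\<alpha> \<bullet> u / 2)) * (of_real (\<alpha> \<bullet> b) * dderiv b f u))"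
  proof (rule sum.cong[OF HOL.refl])
    fix b :: 'a
    have "2 * complex_of_real (log_deriv k b u) = (\<Sum>\<alpha>\<in>Rp. of_real (k (norm \<alpha>)) * of_real (cot (\<alpha> \<bullet> u / 2)) * of_real (\<alpha> \<bullet> b))"
      by (simp add: log_deriv_def)
    then show "2 * of_real (log_deriv k b u) * dderiv b f u = (\<Sum>\<alpha>\<in>Rp.
        of_real (k (norm \<alpha>)) * of_real (cot (\<alpha> \<bullet> u / 2)) * (of_real (\<alpha> \<bullet> b) * dderiv b f u))"
      by (simp add: sum_distrib_right mult.assoc)
  qed
  also have "\<dots> = (\<Sum>\<alpha>\<in>Rp. \<Sum>b\<in>Basis.
      of_real (k (norm \<alpha>)) * of_real (cot (\<alpha> \<bullet> u / 2)) * (of_real (\<alpha> \<bullet> b) * dderiv b f u))"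
    by (rule sum.swap)
  also have "\<dots> = (\<Sum>\<alpha>\<in>Rp. of_real (k (norm \<alpha>)) * of_real (cot (\<alpha> \<bullet> u / 2)) * dderiv \<alpha> f u)"
  proof (rule sum.cong[OF HOL.refl])
    fix \<alpha> :: 'a
    show "(\<Sum>b\<in>Basis. of_real (k (norm \<alpha>)) * of_real (cot (\<alpha> \<bullet> u / 2)) * (of_real (\<alpha> \<bullet> b) * dderiv b f u))
      = of_real (k (norm \<alpha>)) * of_real (cot (\<alpha> \<bullet> u / 2)) * dderiv \<alpha> f u"
      unfolding dderiv_linear[OF f, of \<alpha> u] sum_distrib_left ..
  qed
  finally show ?thesis by (simp add: mult.assoc)
qed

text \<open>If \<open>F' = F * p\<close> and \<open>p' = q\<close> along a line, then the second
  derivative of \<open>F * f\<close> is \<open>F * (f'' + 2 * p * f' + (p\<^sup>2 + q) * f)\<close>.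
  The cross term supplies the cotangent part of \<open>Lop\<close>.\<close>

lemma laplacian_F:
  assumes f: "f \<in> TP" and u: "u \<in> A"
  shows "laplacian (\<lambda>u. of_real (F_fun R C k u) * f u) u = of_real (F_fun R C k u) *
    (Lop k f u + of_real (\<Sum>b\<in>Basis. (log_deriv k b u)\<^sup>2 + log_deriv2 k b u) * f u)"
proof -
  define F where "F = (\<lambda>u. complex_of_real (F_fun R C k u))"
  define p where "p = (\<lambda>b u. complex_of_real (log_deriv k b u))"
  define q where "q = (\<lambda>b u. complex_of_real (log_deriv2 k b u))"
  have F: "deriv_on A b F (\<lambda>u. F u * p b u)" for b unfolding F_def p_def by (rule deriv_on_F)
  have p: "deriv_on A b (p b) (q b)" for b unfolding p_def q_def by (rule deriv_on_log_deriv)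
  note d = deriv_on_TP[OF f]
  note dd = deriv_on_TP[OF has_dderiv_TP(2)[OF f]]
  have 1: "deriv_on A b (\<lambda>u. F u * f u) (\<lambda>u. F u * dderiv b f u + (F u * p b u) * f u)" for b
    by (rule deriv_on_mult[OF F d])
  have 2: "deriv_on A b (\<lambda>u. F u * dderiv b f u + (F u * p b u) * f u)
     (\<lambda>u. (F u * dderiv b (dderiv b f) u + (F u * p b u) * dderiv b f u) +
       ((F u * p b u) * dderiv b f u + (F u * q b u + (F u * p b u) * p b u) * f u))" for b
    by (intro deriv_on_add deriv_on_mult F p d dd)
  have "laplacian (\<lambda>u. F u * f u) u = (\<Sum>b\<in>Basis.
      (F u * dderiv b (dderiv b f) u + (F u * p b u) * dderiv b f u) +
       ((F u * p b u) * dderiv b f u + (F u * q b u + (F u * p b u) * p b u) * f u))"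
    unfolding laplacian_def by (intro sum.cong HOL.refl second_derivative_on[OF open_alcove 1 2 u])
  also have "\<dots> = F u * ((\<Sum>b\<in>Basis. dderiv b (dderiv b f) u) + (\<Sum>b\<in>Basis. 2 * p b u * dderiv b f u)
      + (\<Sum>b\<in>Basis. (p b u * p b u + q b u)) * f u)"
    by (simp add: sum.distrib sum_distrib_left sum_distrib_right algebra_simps)
  also have "(\<Sum>b\<in>Basis. 2 * p b u * dderiv b f u) =
      (\<Sum>\<alpha>\<in>Rp. of_real (k (norm \<alpha>)) * (of_real (cot (\<alpha> \<bullet> u / 2)) * dderiv \<alpha> f u))"
    using log_deriv_dderiv[OF f, of k u] by (simp add: p_def)
  also have "(\<Sum>b\<in>Basis. (p b u * p b u + q b u)) = of_real (\<Sum>b\<in>Basis. (log_deriv k b u)\<^sup>2 + log_deriv2 k b u)"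
    by (simp add: p_def q_def power2_eq_square)
  finally show ?thesis by (simp add: F_def Lop_def)
qed

lemma double_positive: "\<alpha> \<in> Rp \<Longrightarrow> 2 *\<^sub>R \<alpha> \<in> R \<Longrightarrow> 2 *\<^sub>R \<alpha> \<in> Rp"
  by (auto simp: positive_roots_def)

lemma parallel_positive:
  assumes "\<alpha> \<in> Rp" "\<beta> \<in> Rp" "\<not> nonparallel \<alpha> \<beta>"
  shows "\<beta> = \<alpha> \<or> \<beta> = 2 *\<^sub>R \<alpha> \<or> \<alpha> = 2 *\<^sub>R \<beta>"
proof -
  obtain c where c: "\<beta> = c *\<^sub>R \<alpha>" using assms(3) by (auto simp: nonparallel_def)
  obtain p where p: "p \<in> A" using alcove_nonempty by blast
  have "c * (\<alpha> \<bullet> p) > 0" using alcove_bounds(1)[OF assms(2) p] by (simp add: c)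
  then have "c > 0" using alcove_bounds(1)[OF assms(1) p] by (simp add: zero_less_mult_iff)
  then have "c = 1 \<or> c = 2 \<or> c = 1 / 2"
    using proportional_roots positive_root assms c by blast
  then show ?thesis using c by (elim disjE) simp_all
qed

text \<open>The squared norm of half the sum of \<open>k (norm \<alpha>) *\<^sub>R \<alpha>\<close>
  over the positive roots. It is split into nonproportional pairs, equal pairs and pairs of ratio 2,
  since each kind enters through a different identity.\<close>

definition ground_energy :: "(real \<Rightarrow> real) \<Rightarrow> real" where
  "ground_energy k = (\<Sum>\<alpha>\<in>Rp. \<Sum>\<beta>\<in>Rp. pair_weight k \<alpha> \<beta>) / 4 + (\<Sum>\<alpha>\<in>Rp. (k (norm \<alpha>))\<^sup>2 * (norm \<alpha>)\<^sup>2
     + (if 2 *\<^sub>R \<alpha> \<in> R then 4 * k (norm \<alpha>) * k (2 * norm \<alpha>) * (norm \<alpha>)\<^sup>2 else 0)) / 4"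

text \<open>The left-hand side is the Laplacian of \<open>F_fun\<close> divided by
  \<open>F_fun\<close>. In the squared gradient the nonproportional pairs add up to a constant,
  equal pairs use \<open>cot\<^sup>2 x = csc\<^sup>2 x - 1\<close>, and pairs of ratio 2 use
  \<open>cot x * cot (2 * x) = csc\<^sup>2 x / 2 - 1\<close>.\<close>

lemma sum_log_deriv:
  assumes irr: "irreducible_root_system R" and u: "u \<in> A"
  shows "(\<Sum>b\<in>Basis. (log_deriv k b u)\<^sup>2 + log_deriv2 k b u) =
     (\<Sum>c\<in>root_lengths R. coupling R k c * U_len R C c u) - ground_energy k"
proof -
  define s where "s = (\<lambda>\<alpha>. 1 / (sin (\<alpha> \<bullet> u / 2))\<^sup>2)"
  define ct where "ct = (\<lambda>\<alpha>. cot (\<alpha> \<bullet> u / 2))"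
  define g where "g = (\<lambda>\<alpha> \<beta>. k (norm \<alpha>) * k (norm \<beta>) * (\<alpha> \<bullet> \<beta>) * (ct \<alpha> * ct \<beta>))"
  have nz: "sin (\<alpha> \<bullet> u / 2) \<noteq> 0" if "\<alpha> \<in> Rp" for \<alpha> using alcove_sin_pos[OF that u] by simp
  have "(\<Sum>b\<in>Basis. (log_deriv k b u)\<^sup>2) = (\<Sum>b\<in>Basis. \<Sum>\<alpha>\<in>Rp. \<Sum>\<beta>\<in>Rp.
      k (norm \<alpha>) * k (norm \<beta>) * (ct \<alpha> * ct \<beta>) * ((\<alpha> \<bullet> b) * (\<beta> \<bullet> b)) / 4)"
    by (simp add: log_deriv_def power2_eq_square sum_product sum_divide_distrib ct_def mult_ac)
  also have "\<dots> = (\<Sum>\<alpha>\<in>Rp. \<Sum>\<beta>\<in>Rp. \<Sum>b\<in>Basis.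
      k (norm \<alpha>) * k (norm \<beta>) * (ct \<alpha> * ct \<beta>) * ((\<alpha> \<bullet> b) * (\<beta> \<bullet> b)) / 4)"
    by (rule trans[OF sum.swap]) (rule sum.cong[OF HOL.refl sum.swap])
  also have "\<dots> = (\<Sum>\<alpha>\<in>Rp. \<Sum>\<beta>\<in>Rp. g \<alpha> \<beta> / 4)"
  proof (intro sum.cong HOL.refl)
    fix \<alpha> \<beta> :: 'a
    have "g \<alpha> \<beta> / 4 = (k (norm \<alpha>) * k (norm \<beta>) * (ct \<alpha> * ct \<beta>) / 4) * (\<alpha> \<bullet> \<beta>)"
      by (simp add: g_def)
    also have "\<alpha> \<bullet> \<beta> = (\<Sum>b\<in>Basis. (\<alpha> \<bullet> b) * (\<beta> \<bullet> b))" by (rule euclidean_inner)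
    finally show "(\<Sum>b\<in>Basis. k (norm \<alpha>) * k (norm \<beta>) * (ct \<alpha> * ct \<beta>) * ((\<alpha> \<bullet> b) * (\<beta> \<bullet> b)) / 4) = g \<alpha> \<beta> / 4"
      by (simp add: sum_distrib_left)
  qed
  finally have p2: "(\<Sum>b\<in>Basis. (log_deriv k b u)\<^sup>2) = (\<Sum>\<alpha>\<in>Rp. \<Sum>\<beta>\<in>Rp. g \<alpha> \<beta>) / 4"
    by (simp add: sum_divide_distrib)
  have "(\<Sum>b\<in>Basis. log_deriv2 k b u) = (\<Sum>b\<in>Basis. \<Sum>\<alpha>\<in>Rp. - (k (norm \<alpha>) * s \<alpha> * ((\<alpha> \<bullet> b) * (\<alpha> \<bullet> b))) / 4)"
    by (simp add: log_deriv2_def s_def power2_eq_square sum_divide_distrib sum_negf mult_ac)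
  also have "\<dots> = (\<Sum>\<alpha>\<in>Rp. \<Sum>b\<in>Basis. - (k (norm \<alpha>) * s \<alpha> * ((\<alpha> \<bullet> b) * (\<alpha> \<bullet> b))) / 4)"
    by (rule sum.swap)
  also have "\<dots> = (\<Sum>\<alpha>\<in>Rp. - (k (norm \<alpha>) * s \<alpha> * (norm \<alpha>)\<^sup>2) / 4)"
  proof (rule sum.cong[OF HOL.refl])
    fix \<alpha> :: 'a
    have "(norm \<alpha>)\<^sup>2 = (\<Sum>b\<in>Basis. (\<alpha> \<bullet> b) * (\<alpha> \<bullet> b))"
      using euclidean_inner[of \<alpha> \<alpha>] by (simp add: dot_square_norm)
    then show "(\<Sum>b\<in>Basis. - (k (norm \<alpha>) * s \<alpha> * ((\<alpha> \<bullet> b) * (\<alpha> \<bullet> b))) / 4) = - (k (norm \<alpha>) * s \<alpha> * (norm \<alpha>)\<^sup>2) / 4"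
      by (simp add: sum_distrib_left sum_negf sum_divide_distrib)
  qed
  finally have q: "(\<Sum>b\<in>Basis. log_deriv2 k b u) = (\<Sum>\<alpha>\<in>Rp. - (k (norm \<alpha>) * s \<alpha> * (norm \<alpha>)\<^sup>2) / 4)" .
  define d where "d = (\<lambda>\<alpha>. if 2 *\<^sub>R \<alpha> \<in> Rp then g \<alpha> (2 *\<^sub>R \<alpha>) else 0)"
  \<comment> \<open>A positive root proportional to \<alpha> is \<alpha>, its double or its half,
    and these cases exclude each other.\<close>
  have split: "g \<alpha> \<beta> = pair_weight k \<alpha> \<beta> * (ct \<alpha> * ct \<beta>) + (if \<beta> = \<alpha> then g \<alpha> \<beta> else 0)
      + (if \<beta> = 2 *\<^sub>R \<alpha> then g \<alpha> \<beta> else 0) + (if \<alpha> = 2 *\<^sub>R \<beta> then g \<alpha> \<beta> else 0)"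
    if ab: "\<alpha> \<in> Rp" "\<beta> \<in> Rp" for \<alpha> \<beta>
  proof -
    have a0: "\<alpha> \<noteq> 0" "\<beta> \<noteq> 0" using ab positive_root root_nonzero by auto
    show ?thesis
    proof (cases "nonparallel \<alpha> \<beta>")
      case True
      then have "\<beta> \<noteq> 1 *\<^sub>R \<alpha>" "\<beta> \<noteq> 2 *\<^sub>R \<alpha>" "\<beta> \<noteq> (1/2) *\<^sub>R \<alpha>" unfolding nonparallel_def by blast+
      then have "\<beta> \<noteq> \<alpha>" "\<beta> \<noteq> 2 *\<^sub>R \<alpha>" "\<alpha> \<noteq> 2 *\<^sub>R \<beta>" by auto
      then show ?thesis using True by (simp add: g_def pair_weight_def)
    next
      case False
      have 4: "\<gamma> \<noteq> 2 *\<^sub>R \<gamma>" "\<gamma> \<noteq> 2 *\<^sub>R (2 *\<^sub>R \<gamma>)" if "\<gamma> \<noteq> 0" for \<gamma> :: 'a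
        using that scaleR_right_imp_eq[of \<gamma> 1 2] scaleR_right_imp_eq[of \<gamma> 1 4] by auto
      show ?thesis
        using parallel_positive[OF ab False] False 4[OF a0(1)] 4[OF a0(2)]
        by (elim disjE) (auto simp: pair_weight_def)
    qed
  qed
  have sym: "g \<alpha> \<beta> = g \<beta> \<alpha>" for \<alpha> \<beta> by (simp add: g_def inner_commute mult_ac)
  have "(\<Sum>\<alpha>\<in>Rp. \<Sum>\<beta>\<in>Rp. g \<alpha> \<beta>) = (\<Sum>\<alpha>\<in>Rp. \<Sum>\<beta>\<in>Rp. pair_weight k \<alpha> \<beta> * (ct \<alpha> * ct \<beta>))
      + (\<Sum>\<alpha>\<in>Rp. \<Sum>\<beta>\<in>Rp. if \<beta> = \<alpha> then g \<alpha> \<beta> else 0)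
      + (\<Sum>\<alpha>\<in>Rp. \<Sum>\<beta>\<in>Rp. if \<beta> = 2 *\<^sub>R \<alpha> then g \<alpha> \<beta> else 0)
      + (\<Sum>\<alpha>\<in>Rp. \<Sum>\<beta>\<in>Rp. if \<alpha> = 2 *\<^sub>R \<beta> then g \<alpha> \<beta> else 0)"
    unfolding sum.distrib[symmetric] by (intro sum.cong HOL.refl split)
  also have "(\<Sum>\<alpha>\<in>Rp. \<Sum>\<beta>\<in>Rp. pair_weight k \<alpha> \<beta> * (ct \<alpha> * ct \<beta>)) = - (\<Sum>\<alpha>\<in>Rp. \<Sum>\<beta>\<in>Rp. pair_weight k \<alpha> \<beta>)"
    unfolding ct_def by (rule cot_sum_constant[OF u])
  also have "(\<Sum>\<alpha>\<in>Rp. \<Sum>\<beta>\<in>Rp. if \<beta> = \<alpha> then g \<alpha> \<beta> else 0) = (\<Sum>\<alpha>\<in>Rp. g \<alpha> \<alpha>)"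
    by (intro sum.cong HOL.refl) (simp add: sum.delta finite_Rp)
  also have "(\<Sum>\<alpha>\<in>Rp. \<Sum>\<beta>\<in>Rp. if \<beta> = 2 *\<^sub>R \<alpha> then g \<alpha> \<beta> else 0) = (\<Sum>\<alpha>\<in>Rp. d \<alpha>)"
    unfolding d_def by (intro sum.cong HOL.refl) (simp add: sum.delta finite_Rp)
  also have "(\<Sum>\<alpha>\<in>Rp. \<Sum>\<beta>\<in>Rp. if \<alpha> = 2 *\<^sub>R \<beta> then g \<alpha> \<beta> else 0) = (\<Sum>\<alpha>\<in>Rp. d \<alpha>)"
    by (subst sum.swap, unfold d_def, intro sum.cong HOL.refl) (simp add: sum.delta finite_Rp sym[of "2 *\<^sub>R \<alpha>" \<alpha> for \<alpha>])
  finally have total: "(\<Sum>\<alpha>\<in>Rp. \<Sum>\<beta>\<in>Rp. g \<alpha> \<beta>) = - (\<Sum>\<alpha>\<in>Rp. \<Sum>\<beta>\<in>Rp. pair_weight k \<alpha> \<beta>) + (\<Sum>\<alpha>\<in>Rp. g \<alpha> \<alpha> + 2 * d \<alpha>)"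
    by (simp add: sum.distrib sum_distrib_left[symmetric])
  \<comment> \<open>An equal pair and the second derivative together give
    \<open>k * (k - 1)\<close>. A pair of ratio 2 occurs in both orders and, credited to its shorter
    member, adds \<open>2 * k (norm \<alpha>) * k (2 * norm \<alpha>)\<close>.\<close>
  have point: "(g \<alpha> \<alpha> + 2 * d \<alpha>) / 4 - k (norm \<alpha>) * s \<alpha> * (norm \<alpha>)\<^sup>2 / 4 =
      coupling R k (norm \<alpha>) * ((norm \<alpha>)\<^sup>2 / 4 * s \<alpha>) - ((k (norm \<alpha>))\<^sup>2 * (norm \<alpha>)\<^sup>2
     + (if 2 *\<^sub>R \<alpha> \<in> R then 4 * k (norm \<alpha>) * k (2 * norm \<alpha>) * (norm \<alpha>)\<^sup>2 else 0)) / 4"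
    if a: "\<alpha> \<in> Rp" for \<alpha>
  proof -
    define x where "x = \<alpha> \<bullet> u / 2"
    have sx: "sin x \<noteq> 0" using nz[OF a] by (simp add: x_def)
    have "(cot x)\<^sup>2 = (1 - (sin x)\<^sup>2) / (sin x)\<^sup>2"
      by (simp add: cot_def power_divide cos_squared_eq)
    also have "\<dots> = s \<alpha> - 1" using sx by (simp add: s_def x_def diff_divide_distrib)
    finally have ct2: "ct \<alpha> * ct \<alpha> = s \<alpha> - 1" by (simp add: ct_def x_def power2_eq_square)
    have gaa: "g \<alpha> \<alpha> = (k (norm \<alpha>))\<^sup>2 * (norm \<alpha>)\<^sup>2 * (s \<alpha> - 1)"
      by (simp add: g_def ct2 dot_square_norm power2_eq_square)
    show ?thesis
    proof (cases "2 *\<^sub>R \<alpha> \<in> R")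
      case True
      \<comment> \<open>\<open>coupling\<close> asks for some non-multiplicable root of this length,
        not about \<alpha> itself; irreducibility makes the two agree.\<close>
      have m: "\<not> (\<exists>\<beta>. non_multiplicable R \<beta> \<and> norm \<beta> = norm \<alpha>)"
        using double_root_transfer[OF irr positive_root[OF a] _ _ True] by (auto simp: non_multiplicable_def)
      have "sin (2 * x) \<noteq> 0" using nz[OF double_positive[OF a True]] by (simp add: x_def)
      then have cx: "cos x \<noteq> 0" by (auto simp: sin_double)
      have "cot x * cot (2 * x) = (cos x * (1 - 2 * (sin x)\<^sup>2)) / (sin x * (2 * sin x * cos x))"
        by (simp add: cot_def sin_double cos_double_sin)
      also have "\<dots> = (1 - 2 * (sin x)\<^sup>2) / (2 * (sin x)\<^sup>2)" using cx by (simp add: power2_eq_square)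
      also have "\<dots> = s \<alpha> / 2 - 1" using sx by (simp add: s_def x_def diff_divide_distrib)
      finally have "ct \<alpha> * ct (2 *\<^sub>R \<alpha>) = s \<alpha> / 2 - 1" by (simp add: ct_def x_def)
      then have dv: "d \<alpha> = k (norm \<alpha>) * k (2 * norm \<alpha>) * (2 * (norm \<alpha>)\<^sup>2) * (s \<alpha> / 2 - 1)"
        using double_positive[OF a True] by (simp add: d_def g_def dot_square_norm)
      have cp: "coupling R k (norm \<alpha>) = k (norm \<alpha>) * (k (norm \<alpha>) + 2 * k (2 * norm \<alpha>) - 1)"
        unfolding coupling_def by (rule if_not_P[OF m])
      show ?thesis using True unfolding gaa dv cp
        by (simp add: algebra_simps power2_eq_square add_divide_distrib diff_divide_distrib)
    next
      case False
      have m: "\<exists>\<beta>. non_multiplicable R \<beta> \<and> norm \<beta> = norm \<alpha>"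
        using False positive_root[OF a] by (auto simp: non_multiplicable_def)
      have "d \<alpha> = 0" using False positive_root by (auto simp: d_def)
      then show ?thesis using False m gaa
        by (simp add: coupling_def algebra_simps power2_eq_square add_divide_distrib diff_divide_distrib)
    qed
  qed
  have "(\<Sum>c\<in>root_lengths R. coupling R k c * U_len R C c u) =
      (\<Sum>c\<in>root_lengths R. \<Sum>\<alpha>\<in>{\<alpha>\<in>Rp. norm \<alpha> = c}. coupling R k (norm \<alpha>) * ((norm \<alpha>)\<^sup>2 / 4 * s \<alpha>))"
    by (intro sum.cong HOL.refl)
      (simp add: U_len_def positive_roots_of_length_def s_def sum_distrib_left)
  also have "\<dots> = (\<Sum>\<alpha>\<in>Rp. coupling R k (norm \<alpha>) * ((norm \<alpha>)\<^sup>2 / 4 * s \<alpha>))"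
    by (rule sum.group[OF finite_Rp]) (use finite_R positive_root in \<open>auto simp: root_lengths_def\<close>)
  finally have V: "(\<Sum>c\<in>root_lengths R. coupling R k c * U_len R C c u) =
      (\<Sum>\<alpha>\<in>Rp. coupling R k (norm \<alpha>) * ((norm \<alpha>)\<^sup>2 / 4 * s \<alpha>))" .
  have "(\<Sum>b\<in>Basis. (log_deriv k b u)\<^sup>2 + log_deriv2 k b u) =
     - (\<Sum>\<alpha>\<in>Rp. \<Sum>\<beta>\<in>Rp. pair_weight k \<alpha> \<beta>) / 4 +
     (\<Sum>\<alpha>\<in>Rp. (g \<alpha> \<alpha> + 2 * d \<alpha>) / 4 - k (norm \<alpha>) * s \<alpha> * (norm \<alpha>)\<^sup>2 / 4)"
  proof -
    have "(\<Sum>\<alpha>\<in>Rp. (g \<alpha> \<alpha> + 2 * d \<alpha>) / 4 - k (norm \<alpha>) * s \<alpha> * (norm \<alpha>)\<^sup>2 / 4) =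
        (\<Sum>\<alpha>\<in>Rp. g \<alpha> \<alpha> + 2 * d \<alpha>) / 4 + (\<Sum>\<alpha>\<in>Rp. - (k (norm \<alpha>) * s \<alpha> * (norm \<alpha>)\<^sup>2) / 4)"
      unfolding sum_divide_distrib sum.distrib[symmetric] by (intro sum.cong HOL.refl) simp
    then show ?thesis unfolding sum.distrib[of _ _ Basis] p2 q total by simp
  qed
  also have "(\<Sum>\<alpha>\<in>Rp. (g \<alpha> \<alpha> + 2 * d \<alpha>) / 4 - k (norm \<alpha>) * s \<alpha> * (norm \<alpha>)\<^sup>2 / 4) =
     (\<Sum>\<alpha>\<in>Rp. coupling R k (norm \<alpha>) * ((norm \<alpha>)\<^sup>2 / 4 * s \<alpha>)) - (\<Sum>\<alpha>\<in>Rp. (k (norm \<alpha>))\<^sup>2 * (norm \<alpha>)\<^sup>2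
     + (if 2 *\<^sub>R \<alpha> \<in> R then 4 * k (norm \<alpha>) * k (2 * norm \<alpha>) * (norm \<alpha>)\<^sup>2 else 0)) / 4"
    unfolding sum_divide_distrib sum_subtractf[symmetric] by (intro sum.cong HOL.refl point)
  finally show ?thesis unfolding V by (simp add: ground_energy_def)
qed

theorem hamiltonian_F:
  assumes "irreducible_root_system R" "f \<in> trig_invariants R" "u \<in> A"
  shows "hamiltonian R C k (\<lambda>u. of_real (F_fun R C k u) * f u) u =
    of_real (F_fun R C k u) * (of_real (ground_energy k) * f u - Lop k f u)"
  unfolding hamiltonian_def laplacian_F[OF trig_invariants_TP[OF assms(2)] assms(3)]
    sum_log_deriv[OF assms(1,3)]
  by (simp add: algebra_simps)

end

section \<open>Symmetry of the conjugated operator\<close>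

text \<open>By translation invariance the difference quotients of \<open>Y\<close> have integral 0.
  They converge to \<open>G\<close>, are bounded by \<open>B\<close> through the mean value
  inequality and live on one ball, so dominated convergence applies; the measurability of
  \<open>G\<close> comes from the limit.\<close>

lemma integral_deriv_zero:
  fixes Y G :: "'a::euclidean_space \<Rightarrow> complex"
  assumes Y: "continuous_on UNIV Y" and d: "deriv_on UNIV b Y G" and B: "\<And>u. norm (G u) \<le> B"
    and r: "\<And>u. r < norm u \<Longrightarrow> Y u = 0"
  shows "integrable lborel G" "integral\<^sup>L lborel G = 0"
proof -
  have B0: "B \<ge> 0" using B[of 0] norm_ge_zero order_trans by blast
  have Ymeas[measurable]: "Y \<in> borel_measurable borel" by (rule borel_measurable_continuous_onI[OF Y])
  have "integrable lborel (\<lambda>u. indicator (cball 0 r) u *\<^sub>R Y u)"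
    by (intro borel_integrable_compact compact_cball continuous_on_subset[OF Y]) auto
  moreover have "(\<lambda>u. indicator (cball 0 r) u *\<^sub>R Y u) = Y"
    using r by (auto simp: fun_eq_iff indicator_def not_le)
  ultimately have Yint: "integrable lborel Y" by simp
  define t where "t = (\<lambda>n. 1 / real (Suc n))"
  have t: "0 < t n" "t n \<le> 1" for n by (auto simp: t_def)
  have t0: "t \<longlonglongrightarrow> 0" unfolding t_def by (rule LIMSEQ_Suc[OF lim_1_over_n])
  define h where "h = (\<lambda>n u. (Y (t n *\<^sub>R b + u) - Y u) /\<^sub>R t n)"
  have hmeas[measurable]: "h n \<in> borel_measurable borel" for n
    unfolding h_def by measurable
  have trans: "integrable lborel (\<lambda>u. Y (c + u))" "integral\<^sup>L lborel (\<lambda>u. Y (c + u)) = integral\<^sup>L lborel Y" for c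
  proof -
    have "integrable (distr lborel borel ((+) c)) Y" unfolding lborel_distr_plus by (rule Yint)
    then show "integrable lborel (\<lambda>u. Y (c + u))" by (subst (asm) integrable_distr_eq) auto
    have "integral\<^sup>L (distr lborel borel ((+) c)) Y = integral\<^sup>L lborel (\<lambda>u. Y (c + u))"
      by (rule integral_distr) auto
    then show "integral\<^sup>L lborel (\<lambda>u. Y (c + u)) = integral\<^sup>L lborel Y" unfolding lborel_distr_plus by simp
  qed
  have h0: "integral\<^sup>L lborel (h n) = 0" for n
    unfolding h_def using trans Yint by simp
  have lip: "norm (h n u) \<le> B" for n u
  proof -
    have "\<exists>x\<in>{0<..<t n}. norm (Y (u + t n *\<^sub>R b) - Y (u + 0 *\<^sub>R b)) \<le> norm ((t n - 0) *\<^sub>R G (u + x *\<^sub>R b))"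
    proof (rule mvt_general[where f' = "\<lambda>x y. y *\<^sub>R G (u + x *\<^sub>R b)"])
      show "continuous_on {0..t n} (\<lambda>s. Y (u + s *\<^sub>R b))"
        by (intro continuous_on_compose2[OF Y] continuous_intros) auto
      show "((\<lambda>s. Y (u + s *\<^sub>R b)) has_derivative (\<lambda>y. y *\<^sub>R G (u + x *\<^sub>R b))) (at x)" for x
        using deriv_on_shift[OF d, of u x] by (simp add: has_vector_derivative_def)
    qed (rule t)
    then obtain x where "norm (Y (u + t n *\<^sub>R b) - Y u) \<le> t n * norm (G (u + x *\<^sub>R b))"
      using t(1)[of n] by auto
    also have "\<dots> \<le> t n * B" using t(1)[of n] B by (intro mult_left_mono) auto
    finally have "norm (Y (u + t n *\<^sub>R b) - Y u) / t n \<le> B" using t(1)[of n] by (simp add: field_simps)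
    moreover have "norm (h n u) = norm (Y (u + t n *\<^sub>R b) - Y u) / t n"
      using t(1)[of n] by (simp add: h_def add.commute divide_inverse mult.commute)
    ultimately show ?thesis by simp
  qed
  \<comment> \<open>The steps \<open>t n\<close> are at most 1, so enlarging the radius by
    \<open>norm b\<close> covers all shifted supports.\<close>
  have supp: "h n u = 0" if "norm u > r + norm b" for n u
  proof -
    have "norm u \<le> norm (t n *\<^sub>R b + u) + norm (t n *\<^sub>R b)" 
      using norm_triangle_ineq4[of "t n *\<^sub>R b + u" "t n *\<^sub>R b"] by simp
    moreover have "norm (t n *\<^sub>R b) \<le> 1 * norm b" using t[of n] by (simp add: mult_left_le_one_le)
    ultimately have "norm (t n *\<^sub>R b + u) > r" using that by simp
    moreover have "norm u > r" using that norm_ge_zero[of b] by linarith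
    ultimately show ?thesis using r by (simp add: h_def)
  qed
  have lim: "(\<lambda>n. h n u) \<longlonglongrightarrow> G u" for u
  proof -
    have "((\<lambda>s. Y (u + s *\<^sub>R b)) has_derivative (\<lambda>y. y *\<^sub>R G u)) (at 0)"
      using d unfolding deriv_on_def has_vector_derivative_def by auto
    then have "(\<lambda>s. norm (Y (u + s *\<^sub>R b) - Y u - s *\<^sub>R G u) / norm s) \<midarrow>0\<rightarrow> 0"
      by (simp add: has_derivative_at)
    moreover have "filterlim t (at 0) sequentially"
      unfolding filterlim_at using t0 t(1) by (auto simp: less_imp_neq[THEN not_sym])
    ultimately have "(\<lambda>n. norm (Y (u + t n *\<^sub>R b) - Y u - t n *\<^sub>R G u) / norm (t n)) \<longlonglongrightarrow> 0"
      by (rule filterlim_compose)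
    moreover have "norm (Y (u + t n *\<^sub>R b) - Y u - t n *\<^sub>R G u) / norm (t n) = norm (h n u - G u)" for n
    proof -
      have "h n u - G u = (Y (u + t n *\<^sub>R b) - Y u - t n *\<^sub>R G u) /\<^sub>R t n"
        using t(1)[of n] by (simp add: h_def scaleR_diff_right add.commute)
      then show ?thesis using t(1)[of n] by (simp add: divide_inverse mult.commute)
    qed
    ultimately have "(\<lambda>n. norm (h n u - G u)) \<longlonglongrightarrow> 0" by simp
    then show ?thesis by (rule LIM_zero_cancel[OF tendsto_norm_zero_cancel])
  qed
  have Gmeas: "G \<in> borel_measurable lborel"
    by (rule borel_measurable_LIMSEQ_metric[of h]) (use lim in auto)
  define w where "w = (\<lambda>u. B * indicator (cball (0::'a) (r + norm b)) u)"
  have wint: "integrable lborel w"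
    unfolding w_def by (intro integrable_mult_right integrable_real_indicator) (use emeasure_compact_finite[OF compact_cball, of 0 "r + norm b"] in auto)
  have dom: "AE u in lborel. norm (h n u) \<le> w u" for n
    using lip supp by (intro AE_I2) (auto simp: w_def indicator_def not_le)
  have ae: "AE u in lborel. (\<lambda>n. h n u) \<longlonglongrightarrow> G u" using lim by simp
  show "integrable lborel G"
    by (rule integrable_dominated_convergence[OF Gmeas _ wint ae dom]) simp
  have "(\<lambda>n. integral\<^sup>L lborel (h n)) \<longlonglongrightarrow> integral\<^sup>L lborel G"
    by (rule integral_dominated_convergence[OF Gmeas _ wint ae dom]) simp
  then show "integral\<^sup>L lborel G = 0" using h0 by (simp add: LIMSEQ_const_iff)
qed

text \<open>Vanishes for \<open>n * t \<le> 1\<close> and tends to 1 for each \<open>t > 0\<close>.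
  The square smooths the corner at the threshold, and the profile \<open>1 - 1 / (n * t)\<close>
  keeps \<open>t\<close> times the derivative bounded uniformly in \<open>n\<close>, with limit
  0.\<close>

definition cutoff :: "nat \<Rightarrow> real \<Rightarrow> real" where
  "cutoff n t = (max 0 (1 - 1 / (real n * t)))\<^sup>2"

definition cutoff_deriv :: "nat \<Rightarrow> real \<Rightarrow> real" where
  "cutoff_deriv n t = 2 * max 0 (1 - 1 / (real n * t)) * (1 / (real n * t\<^sup>2))"

lemma max_square_derivative: "((\<lambda>x::real. (max 0 x)\<^sup>2) has_real_derivative 2 * max 0 x) (at x)"
proof -
  consider "x > 0" | "x < 0" | "x = 0" by linarith
  then show ?thesis
  proof cases
    case 1
    have "((\<lambda>x::real. x\<^sup>2) has_real_derivative 2 * max 0 x) (at x)"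
      using 1 by (auto intro!: derivative_eq_intros)
    then show ?thesis
      by (rule has_field_derivative_transform_within_open[of _ _ _ "{0<..}"]) (use 1 in auto)
  next
    case 2
    have "((\<lambda>x::real. 0) has_real_derivative 2 * max 0 x) (at x)"
      using 2 by (auto intro!: derivative_eq_intros)
    then show ?thesis
      by (rule has_field_derivative_transform_within_open[of _ _ _ "{..<0}"]) (use 2 in auto)
  next
    case 3
    have "((\<lambda>h::real. (max 0 h)\<^sup>2 / h) \<longlongrightarrow> 0) (at 0)"
    proof (rule Lim_null_comparison)
      show "eventually (\<lambda>h::real. norm ((max 0 h)\<^sup>2 / h) \<le> \<bar>h\<bar>) (at 0)"
        by (rule always_eventually) (auto simp: max_def power2_eq_square)
      show "((\<lambda>h::real. \<bar>h\<bar>) \<longlongrightarrow> 0) (at 0)" by (rule tendsto_rabs_zero) (rule tendsto_ident_at)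
    qed
    then show ?thesis unfolding 3 by (simp add: DERIV_def)
  qed
qed

lemma cutoff_derivative:
  assumes "n > 0" "t > 0"
  shows "(cutoff n has_real_derivative cutoff_deriv n t) (at t)"
proof -
  have "((\<lambda>t. 1 - 1 / (real n * t)) has_real_derivative 1 / (real n * t\<^sup>2)) (at t)"
    using assms by (auto intro!: derivative_eq_intros simp: power2_eq_square)
  from DERIV_chain2[OF max_square_derivative this]
  show ?thesis unfolding cutoff_def[abs_def] cutoff_deriv_def .
qed

lemma cutoff_bounds: "t > 0 \<Longrightarrow> 0 \<le> cutoff n t" "t > 0 \<Longrightarrow> cutoff n t \<le> 1"
proof -
  show "0 \<le> cutoff n t" by (simp add: cutoff_def)
  assume "t > 0"
  then have "max 0 (1 - 1 / (real n * t)) \<le> 1" by simp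
  then show "cutoff n t \<le> 1" unfolding cutoff_def by (intro power_le_one) auto
qed

lemma cutoff_deriv_bound:
  assumes "t > 0" shows "\<bar>cutoff_deriv n t * t\<bar> \<le> 2"
proof -
  define y where "y = 1 / (real n * t)"
  have y: "y \<ge> 0" using assms by (simp add: y_def)
  have e: "cutoff_deriv n t * t = 2 * (max 0 (1 - y) * y)"
    using assms by (simp add: cutoff_deriv_def y_def power2_eq_square)
  have "0 \<le> max 0 (1 - y) * y" "max 0 (1 - y) * y \<le> 1"
    using y by (auto simp: max_def intro!: mult_le_one)
  then show ?thesis unfolding e by simp
qed

lemma cutoff_zero: "t > 0 \<Longrightarrow> real n * t \<le> 1 \<Longrightarrow> n > 0 \<Longrightarrow> cutoff n t = 0 \<and> cutoff_deriv n t = 0"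
  by (simp add: cutoff_def cutoff_deriv_def max_def field_simps)

lemma cutoff_limits:
  assumes "t > 0"
  shows "(\<lambda>n. cutoff (Suc n) t) \<longlonglongrightarrow> 1" "(\<lambda>n. cutoff_deriv (Suc n) t * t) \<longlonglongrightarrow> 0"
proof -
  have "(\<lambda>n. inverse (real (Suc n)) * (1 / t)) \<longlonglongrightarrow> 0 * (1 / t)"
    by (intro tendsto_intros LIMSEQ_inverse_real_of_nat)
  then have y: "(\<lambda>n. 1 / (real (Suc n) * t)) \<longlonglongrightarrow> 0" by (simp add: divide_inverse mult.commute del: of_nat_Suc)
  have "(\<lambda>n. (max 0 (1 - 1 / (real (Suc n) * t)))\<^sup>2) \<longlonglongrightarrow> (max 0 (1 - 0))\<^sup>2"
    by (intro tendsto_intros y)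
  then show "(\<lambda>n. cutoff (Suc n) t) \<longlonglongrightarrow> 1" by (simp add: cutoff_def del: of_nat_Suc)
  have "(\<lambda>n. 2 * max 0 (1 - 1 / (real (Suc n) * t)) * (1 / (real (Suc n) * t))) \<longlonglongrightarrow> 2 * max 0 (1 - 0) * 0"
    by (intro tendsto_intros y)
  moreover have "cutoff_deriv (Suc n) t * t = 2 * max 0 (1 - 1 / (real (Suc n) * t)) * (1 / (real (Suc n) * t))" for n
    using assms by (simp add: cutoff_deriv_def power2_eq_square del: of_nat_Suc)
  ultimately show "(\<lambda>n. cutoff_deriv (Suc n) t * t) \<longlonglongrightarrow> 0" by simp
qed

section \<open>Integration by parts on the alcove\<close>

context alcove
begin

lemma F_fun_le_1:
  assumes "\<And>c. c \<in> root_lengths R \<Longrightarrow> k c \<ge> 0" "u \<in> A"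
  shows "F_fun R C k u \<le> 1"
  unfolding F_fun_alcove[OF assms(2)]
proof (rule prod_le_1)
  fix \<alpha> assume a: "\<alpha> \<in> Rp"
  have "k (norm \<alpha>) \<ge> 0" using a positive_root by (intro assms(1)) (auto simp: root_lengths_def)
  then show "0 \<le> sin (\<alpha> \<bullet> u / 2) powr k (norm \<alpha>) \<and> sin (\<alpha> \<bullet> u / 2) powr k (norm \<alpha>) \<le> 1"
    using alcove_sin_pos[OF a assms(2)] powr_le1[of "k (norm \<alpha>)" "sin (\<alpha> \<bullet> u / 2)"] by simp
qed

lemma alcove_lebesgue: "A \<in> sets lebesgue" "A \<in> sets borel"
  using open_alcove by auto

lemma finite_measure_alcove: "finite_measure (lebesgue_on A)"
  by (intro finite_measure_lebesgue_on bounded_set_imp_lmeasurable bounded_alcove alcove_lebesgue)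

lemma continuous_measurable_alcove:
  "continuous_on A f \<Longrightarrow> f \<in> borel_measurable (lebesgue_on A)"
  by (rule continuous_imp_measurable_on_sets_lebesgue[OF _ alcove_lebesgue(1)])

lemma continuous_log_deriv: "continuous_on A (log_deriv k b)"
  unfolding log_deriv_def[abs_def] cot_def
  by (intro continuous_intros ballI alcove_sin_nonzero positive_root) simp_all

text \<open>The Weyl denominator \<open>\<delta>\<close> vanishes on the walls, so cutting off where \<open>\<delta> < 1 / n\<close> leaves no
  boundary terms. The gradient of the cutoff pairs with an invariant function through
  \<open>cot (\<alpha> / 2) \<partial>\<^sub>\<alpha>\<close>, which is bounded, and it disappears in the limit.\<close>

theorem Lop_symmetric:
  assumes k: "\<And>c. c \<in> root_lengths R \<Longrightarrow> k c \<ge> 0"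
    and f: "f \<in> trig_invariants R" and g: "g \<in> trig_invariants R"
  shows "(LINT u|lebesgue_on A. of_real ((F_fun R C k u)\<^sup>2) * (g u * Lop k f u - f u * Lop k g u)) = 0"
proof -
  let ?M = "lebesgue_on A"
  interpret M: finite_measure ?M by (rule finite_measure_alcove)
  define F where "F = (\<lambda>u. complex_of_real (F_fun R C k u))"
  define \<delta> where "\<delta> = F_fun R C (\<lambda>_. 1)"
  define p where "p = (\<lambda>b u. complex_of_real (log_deriv k b u))"
  define p1 where "p1 = (\<lambda>b u. complex_of_real (log_deriv (\<lambda>_. 1) b u))"
  note fT = trig_invariants_TP[OF f] and gT = trig_invariants_TP[OF g]
  have \<delta>pos: "\<delta> u > 0" if "u \<in> A" for u unfolding \<delta>_def by (rule F_fun_pos[OF that])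
  have \<delta>eq: "\<delta> u = (\<Prod>\<alpha>\<in>Rp. sin (\<alpha> \<bullet> u / 2))" if "u \<in> A" for u
    unfolding \<delta>_def F_fun_alcove[OF that] using alcove_sin_pos[OF _ that]
    by (intro prod.cong) (auto simp: less_imp_le abs_of_pos)
  obtain lf where lf: "lf \<in> TP" "\<And>u. u \<in> A \<Longrightarrow> Lop k f u = lf u"
    using Lop_low_degree trig_invariants_low_degree[OF f] low_degree_invariant trig_invariants_TP by (metis subsetD)
  obtain lg where lg: "lg \<in> TP" "\<And>u. u \<in> A \<Longrightarrow> Lop k g u = lg u"
    using Lop_low_degree trig_invariants_low_degree[OF g] low_degree_invariant trig_invariants_TP by (metis subsetD)
  have "\<forall>\<alpha>\<in>Rp. \<exists>h\<in>TP. \<forall>u\<in>A. of_real (cot (\<alpha> \<bullet> u / 2)) * dderiv \<alpha> f u = h u"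
    using cot_dderiv_TP[OF _ f] positive_root by blast
  then obtain cf where cf: "\<And>\<alpha>. \<alpha> \<in> Rp \<Longrightarrow> cf \<alpha> \<in> TP"
    "\<And>\<alpha> u. \<alpha> \<in> Rp \<Longrightarrow> u \<in> A \<Longrightarrow> of_real (cot (\<alpha> \<bullet> u / 2)) * dderiv \<alpha> f u = cf \<alpha> u" by metis
  have "\<forall>\<alpha>\<in>Rp. \<exists>h\<in>TP. \<forall>u\<in>A. of_real (cot (\<alpha> \<bullet> u / 2)) * dderiv \<alpha> g u = h u"
    using cot_dderiv_TP[OF _ g] positive_root by blast
  then obtain cg where cg: "\<And>\<alpha>. \<alpha> \<in> Rp \<Longrightarrow> cg \<alpha> \<in> TP"
    "\<And>\<alpha> u. \<alpha> \<in> Rp \<Longrightarrow> u \<in> A \<Longrightarrow> of_real (cot (\<alpha> \<bullet> u / 2)) * dderiv \<alpha> g u = cg \<alpha> u" by metis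
  define J where "J = (\<lambda>u. g u * lf u + (- 1) * (f u * lg u))"
  \<comment> \<open>The logarithmic gradient of \<delta> consists of the cotangents with the factor
    1/2; \<open>cf\<close> and \<open>cg\<close> are their bounded products with the derivatives of
    \<open>f\<close> and \<open>g\<close>.\<close>
  define H where "H = (\<lambda>u. (1 / 2) * (\<Sum>\<alpha>\<in>Rp. g u * cf \<alpha> u + (- 1) * (f u * cg \<alpha> u)))"
  have JT: "J \<in> TP" unfolding J_def by (intro TP_add TP_scale TP_mult fT gT lf lg)
  have HT: "H \<in> TP" unfolding H_def by (intro TP_add TP_scale TP_sum TP_mult fT gT cf cg)
  \<comment> \<open>On the alcove this is the divergence of the cut-off field
    \<open>\<zeta> * F\<^sup>2 * (g \<nabla>f - f \<nabla>g)\<close>; the second summand comes from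
    the gradient of the cutoff.\<close>
  define S where "S = (\<lambda>n u. of_real (cutoff n (\<delta> u)) * (F u * F u) * J u +
     of_real (cutoff_deriv n (\<delta> u) * \<delta> u) * (F u * F u) * H u)"
  have contF: "continuous_on A F" unfolding F_def by (intro continuous_intros continuous_F_fun)
  have cont\<delta>: "continuous_on A \<delta>" unfolding \<delta>_def by (rule continuous_F_fun)
  have Fle: "norm (F u * F u) \<le> 1" if "u \<in> A" for u
    using F_fun_le_1[OF k that] F_fun_pos[OF that, of k] unfolding F_def by (simp add: norm_mult mult_le_one)
  have contcut: "continuous_on A (\<lambda>u. complex_of_real (cutoff n (\<delta> u)))"
    "continuous_on A (\<lambda>u. complex_of_real (cutoff_deriv n (\<delta> u)))" if n: "n > 0" for n
  proof -
    have "real n * \<delta> u \<noteq> 0" "real n * (\<delta> u)\<^sup>2 \<noteq> 0" if "u \<in> A" for u using \<delta>pos[OF that] n by auto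
    then show "continuous_on A (\<lambda>u. complex_of_real (cutoff n (\<delta> u)))"
      "continuous_on A (\<lambda>u. complex_of_real (cutoff_deriv n (\<delta> u)))"
      unfolding cutoff_def cutoff_deriv_def by (intro continuous_intros cont\<delta>; blast)+
  qed
  have zero: "(LINT u|?M. S n u) = 0" if n: "n > 0" for n
  proof -
    define \<zeta> where "\<zeta> = (\<lambda>u. complex_of_real (cutoff n (\<delta> u)))"
    define \<zeta>' where "\<zeta>' = (\<lambda>b u. of_real (cutoff_deriv n (\<delta> u)) * (of_real (\<delta> u) * p1 b u))"
    \<comment> \<open>The component of the cut-off field along \<open>b\<close>; \<open>X'\<close>
      is its derivative by the product rule.\<close>
    define X where "X = (\<lambda>b u. \<zeta> u * ((F u * F u) * (g u * dderiv b f u - f u * dderiv b g u)))"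
    define X' where "X' = (\<lambda>b u. \<zeta> u * ((F u * F u) * ((g u * dderiv b (dderiv b f) u + dderiv b g u * dderiv b f u)
        - (f u * dderiv b (dderiv b g) u + dderiv b f u * dderiv b g u))
        + (F u * (F u * p b u) + (F u * p b u) * F u) * (g u * dderiv b f u - f u * dderiv b g u))
        + \<zeta>' b u * ((F u * F u) * (g u * dderiv b f u - f u * dderiv b g u)))"
    \<comment> \<open>The extension by zero is continuous and differentiable along \<open>b\<close>
      everywhere, since \<open>X b\<close> vanishes on \<open>A\<close> outside the compact set
      \<open>K\<close>, and the open sets \<open>A\<close> and \<open>- K\<close> cover the
      space.\<close>
    define Y where "Y = (\<lambda>b u. if u \<in> A then X b u else 0)"
    define G where "G = (\<lambda>b u. if u \<in> A then X' b u else 0)"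
    define K where "K = {u\<in>A. (\<Prod>\<alpha>\<in>Rp. sin (\<alpha> \<bullet> u / 2)) \<ge> 1 / real n}"
    have K: "compact K" "K \<subseteq> A" unfolding K_def using compact_sin_superlevel[of "1 / real n"] n by auto
    have off: "\<zeta> u = 0" "\<zeta>' b u = 0" if "u \<in> A" "u \<notin> K" for u b
    proof -
      have "\<delta> u < 1 / real n" using that \<delta>eq[OF that(1)] by (auto simp: K_def)
      then have "real n * \<delta> u \<le> 1" using n by (simp add: field_simps)
      then show "\<zeta> u = 0" "\<zeta>' b u = 0"
        using cutoff_zero[OF \<delta>pos[OF that(1)] _ n] by (auto simp: \<zeta>_def \<zeta>'_def)
    qed
    have offY: "Y b u = 0" "G b u = 0" if "u \<notin> K" for u b
      using off that by (auto simp: Y_def G_def X_def X'_def)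
    have d\<zeta>: "deriv_on A b \<zeta> (\<zeta>' b)" for b
    proof -
      have "((\<lambda>t. cutoff n (\<delta> (u + t *\<^sub>R b))) has_real_derivative
          cutoff_deriv n (\<delta> u) * (\<delta> u * log_deriv (\<lambda>_. 1) b u)) (at 0)" if "u \<in> A" for u
      proof (rule DERIV_chain2[where f = "cutoff n"])
        show "(cutoff n has_real_derivative cutoff_deriv n (\<delta> u)) (at (\<delta> (u + 0 *\<^sub>R b)))"
          using cutoff_derivative[OF n \<delta>pos[OF that]] by simp
        show "((\<lambda>t. \<delta> (u + t *\<^sub>R b)) has_real_derivative \<delta> u * log_deriv (\<lambda>_. 1) b u) (at 0)"
          unfolding \<delta>_def by (rule F_fun_derivative[OF that])
      qed
      from deriv_on_real[OF this] show ?thesis by (simp add: \<zeta>_def \<zeta>'_def p1_def)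
    qed
    have dF: "deriv_on A b F (\<lambda>u. F u * p b u)" for b unfolding F_def p_def by (rule deriv_on_F)
    have dX: "deriv_on A b (X b) (X' b)" for b
    proof -
      have "deriv_on A b (\<lambda>u. g u * dderiv b f u) (\<lambda>u. g u * dderiv b (dderiv b f) u + dderiv b g u * dderiv b f u)"
        by (rule deriv_on_mult[OF deriv_on_TP[OF gT] deriv_on_TP[OF has_dderiv_TP(2)[OF fT]]])
      moreover have "deriv_on A b (\<lambda>u. f u * dderiv b g u) (\<lambda>u. f u * dderiv b (dderiv b g) u + dderiv b f u * dderiv b g u)"
        by (rule deriv_on_mult[OF deriv_on_TP[OF fT] deriv_on_TP[OF has_dderiv_TP(2)[OF gT]]])
      ultimately show ?thesis
        unfolding X_def X'_def
        by (rule deriv_on_mult[OF d\<zeta> deriv_on_mult[OF deriv_on_mult[OF dF dF] deriv_on_diff]])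
    qed
    have contp: "continuous_on A (p b)" "continuous_on A (p1 b)" for b
      unfolding p_def p1_def by (rule continuous_on_of_real[OF continuous_log_deriv])+
    have cont\<zeta>: "continuous_on A \<zeta>" unfolding \<zeta>_def by (rule contcut(1)[OF n])
    have cont\<zeta>': "continuous_on A (\<zeta>' b)" for b
      unfolding \<zeta>'_def
      by (rule continuous_on_mult[OF contcut(2)[OF n] continuous_on_mult[OF continuous_on_of_real[OF cont\<delta>] contp(2)]])
    note cTP = continuous_TP[OF fT] continuous_TP[OF gT] continuous_TP[OF has_dderiv_TP(2)[OF fT]]
      continuous_TP[OF has_dderiv_TP(2)[OF gT]] continuous_TP[OF has_dderiv_TP(2)[OF has_dderiv_TP(2)[OF fT]]]
      continuous_TP[OF has_dderiv_TP(2)[OF has_dderiv_TP(2)[OF gT]]]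
    have contX: "continuous_on A (X b)" for b
      unfolding X_def by (intro continuous_on_mult continuous_on_diff cont\<zeta> contF cTP)
    have contX': "continuous_on A (X' b)" for b
      unfolding X'_def
      by (intro continuous_on_mult continuous_on_diff continuous_on_add cont\<zeta> cont\<zeta>' contp contF cTP)
    have opK: "open (- K)" using K(1) compact_imp_closed by blast
    have cover: "A \<union> - K = UNIV" using K(2) by auto
    have contY: "continuous_on UNIV (Y b)" for b
    proof -
      have "continuous_on A (Y b)" by (rule continuous_on_eq[OF contX[of b]]) (simp add: Y_def)
      moreover have "continuous_on (- K) (Y b)"
        by (rule continuous_on_eq[OF continuous_on_const[of _ 0]]) (simp add: offY)
      ultimately have "continuous_on (A \<union> - K) (Y b)"
        by (rule continuous_on_open_Un[OF open_alcove opK])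
      then show ?thesis unfolding cover .
    qed
    have dY: "deriv_on UNIV b (Y b) (G b)" for b
      unfolding deriv_on_def
    proof
      fix u
      show "((\<lambda>t. Y b (u + t *\<^sub>R b)) has_vector_derivative G b u) (at 0)"
      proof (cases "u \<in> A")
        case True
        have "eventually (\<lambda>t. u + t *\<^sub>R b \<in> A) (nhds 0)"
          using eventually_in_open_line[OF open_alcove, of u 0 b] True by simp
        then have "eventually (\<lambda>t. Y b (u + t *\<^sub>R b) = X b (u + t *\<^sub>R b)) (nhds 0)"
          by (rule eventually_mono) (simp add: Y_def)
        then show ?thesis
          using dX True by (subst has_vector_derivative_cong_ev) (auto simp: deriv_on_def G_def)
      next
        case False
        then have uK: "u \<in> - K" using K(2) by auto
        have "eventually (\<lambda>t. u + t *\<^sub>R b \<in> - K) (nhds 0)"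
          using eventually_in_open_line[OF opK, of u 0 b] uK by simp
        then have "eventually (\<lambda>t. Y b (u + t *\<^sub>R b) = 0) (nhds 0)"
          by (rule eventually_mono) (simp add: offY)
        then show ?thesis
          using False by (subst has_vector_derivative_cong_ev) (auto simp: G_def)
      qed
    qed
    obtain r where r: "\<And>u. u \<in> K \<Longrightarrow> norm u \<le> r"
      using compact_imp_bounded[OF K(1)] by (auto simp: bounded_iff)
    have Gint: "integrable lborel (G b)" "integral\<^sup>L lborel (G b) = 0" for b
    proof -
      have "bounded (X' b ` K)"
        by (intro compact_imp_bounded compact_continuous_image continuous_on_subset[OF contX'] K)
      then obtain B where B: "\<And>u. u \<in> K \<Longrightarrow> norm (X' b u) \<le> B" by (auto simp: bounded_iff)
      have "norm (G b u) \<le> max B 0" for u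
      proof (cases "u \<in> K")
        case True
        then show ?thesis using B[OF True] K(2) by (auto simp: G_def)
      qed (simp add: offY)
      moreover have "Y b u = 0" if "r < norm u" for u using r that offY(1) by force
      ultimately show "integrable lborel (G b)" "integral\<^sup>L lborel (G b) = 0"
        using integral_deriv_zero[OF contY dY] by blast+
    qed
    \<comment> \<open>The mixed products of first derivatives cancel, and the logarithmic derivative
      \<open>p\<close>, doubled because \<open>F\<close> enters squared, completes the Laplacian to
      \<open>Lop\<close>.\<close>
    have sumG: "(\<Sum>b\<in>Basis. G b u) = S n u" if u: "u \<in> A" for u
    proof -
      have pp: "(\<Sum>b\<in>Basis. 2 * p b u * dderiv b h u) =
        (\<Sum>\<alpha>\<in>Rp. of_real (k (norm \<alpha>)) * (of_real (cot (\<alpha> \<bullet> u / 2)) * dderiv \<alpha> h u))" if "h \<in> TP" for h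
        unfolding p_def by (rule log_deriv_dderiv[OF that])
      have pp1: "(\<Sum>b\<in>Basis. 2 * p1 b u * dderiv b h u) =
        (\<Sum>\<alpha>\<in>Rp. of_real (cot (\<alpha> \<bullet> u / 2)) * dderiv \<alpha> h u)" if "h \<in> TP" for h
        unfolding p1_def log_deriv_dderiv[OF that] by simp
      let ?z = "of_real (cutoff_deriv n (\<delta> u) * \<delta> u)"
      have "(\<Sum>b\<in>Basis. G b u) = (\<Sum>b\<in>Basis. \<zeta> u * (F u * F u) *
          (g u * (dderiv b (dderiv b f) u + 2 * p b u * dderiv b f u) - f u * (dderiv b (dderiv b g) u + 2 * p b u * dderiv b g u))
          + ?z * (F u * F u) * ((1 / 2) * (g u * (2 * p1 b u * dderiv b f u) - f u * (2 * p1 b u * dderiv b g u))))"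
        using u by (intro sum.cong HOL.refl) (simp add: G_def X'_def \<zeta>'_def algebra_simps)
      also have "\<dots> = \<zeta> u * (F u * F u) *
          (g u * ((\<Sum>b\<in>Basis. dderiv b (dderiv b f) u) + (\<Sum>b\<in>Basis. 2 * p b u * dderiv b f u))
          - f u * ((\<Sum>b\<in>Basis. dderiv b (dderiv b g) u) + (\<Sum>b\<in>Basis. 2 * p b u * dderiv b g u)))
          + ?z * (F u * F u) * ((1 / 2) * (g u * (\<Sum>b\<in>Basis. 2 * p1 b u * dderiv b f u) - f u * (\<Sum>b\<in>Basis. 2 * p1 b u * dderiv b g u)))"
        by (simp only: sum.distrib sum_subtractf sum_distrib_left[symmetric])
      also have "\<dots> = \<zeta> u * (F u * F u) * (g u * Lop k f u - f u * Lop k g u)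
          + ?z * (F u * F u) * ((1 / 2) * (g u * (\<Sum>\<alpha>\<in>Rp. cf \<alpha> u) - f u * (\<Sum>\<alpha>\<in>Rp. cg \<alpha> u)))"
        unfolding pp[OF fT] pp[OF gT] pp1[OF fT] pp1[OF gT] Lop_def using cf(2)[OF _ u] cg(2)[OF _ u] by simp
      also have "\<dots> = S n u"
        unfolding lf(2)[OF u] lg(2)[OF u]
        by (simp add: S_def J_def H_def \<zeta>_def sum.distrib sum_subtractf sum_distrib_left algebra_simps)
      finally show ?thesis .
    qed
    define GG where "GG = (\<lambda>u. \<Sum>b\<in>Basis. G b u)"
    have GGint: "integrable lborel GG" unfolding GG_def by (intro Bochner_Integration.integrable_sum Gint)
    have "(LINT u|?M. S n u) = (LINT u|?M. GG u)"
      by (rule Bochner_Integration.integral_cong[OF HOL.refl]) (simp add: GG_def sumG)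
    also have "\<dots> = (LINT u|lebesgue. indicator A u *\<^sub>R GG u)"
      by (rule integral_restrict_space) (use alcove_lebesgue in simp)
    also have "(\<lambda>u. indicator A u *\<^sub>R GG u) = GG"
      by (auto simp: fun_eq_iff GG_def G_def indicator_def)
    also have "(LINT u|lebesgue. GG u) = (LINT u|lborel. GG u)"
      using GGint by (intro integral_completion) auto
    also have "\<dots> = (\<Sum>b\<in>Basis. integral\<^sup>L lborel (G b))"
      unfolding GG_def by (rule Bochner_Integration.integral_sum[OF Gint(1)])
    finally show ?thesis by (simp add: Gint)
  qed
  obtain BJ where BJ: "\<And>u. norm (J u) \<le> BJ" using bounded_TP[OF JT] by blast
  obtain BH where BH: "\<And>u. norm (H u) \<le> BH" using bounded_TP[OF HT] by blast
  define L where "L = (\<lambda>u. (F u * F u) * J u)"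
  have cL: "continuous_on A L" unfolding L_def by (intro continuous_on_mult contF continuous_TP[OF JT])
  have cS: "continuous_on A (S (Suc n))" for n
    unfolding S_def of_real_mult
    by (intro continuous_on_mult continuous_on_add contF contcut continuous_on_of_real[OF cont\<delta>]
        continuous_TP[OF JT] continuous_TP[OF HT]) auto
  \<comment> \<open>All multiplicities are nonnegative, so \<open>F\<^sup>2 \<le> 1\<close> and a
    constant dominates on the bounded alcove. The gradient term tends to 0 pointwise.\<close>
  have "(\<lambda>n. LINT u|?M. S (Suc n) u) \<longlonglongrightarrow> (LINT u|?M. L u)"
  proof (rule integral_dominated_convergence[where w = "\<lambda>_. BJ + 2 * BH"])
    show "L \<in> borel_measurable ?M" by (rule continuous_measurable_alcove[OF cL])
    show "S (Suc n) \<in> borel_measurable ?M" for n by (rule continuous_measurable_alcove[OF cS])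
    show "integrable ?M (\<lambda>_. BJ + 2 * BH)" by simp
    show "AE u in ?M. (\<lambda>n. S (Suc n) u) \<longlonglongrightarrow> L u"
    proof (rule AE_I2)
      fix u assume "u \<in> space ?M"
      then have u: "u \<in> A" by simp
      have "(\<lambda>n. S (Suc n) u) \<longlonglongrightarrow> of_real 1 * (F u * F u) * J u + of_real 0 * (F u * F u) * H u"
        unfolding S_def by (intro tendsto_intros cutoff_limits \<delta>pos u)
      then show "(\<lambda>n. S (Suc n) u) \<longlonglongrightarrow> L u" by (simp add: L_def)
    qed
    show "AE u in ?M. norm (S (Suc n) u) \<le> BJ + 2 * BH" for n
    proof (rule AE_I2)
      fix u assume "u \<in> space ?M"
      then have u: "u \<in> A" by simp
      have 1: "norm (of_real (cutoff (Suc n) (\<delta> u)) * (F u * F u) * J u) \<le> 1 * 1 * BJ"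
        unfolding norm_mult[of _ "J u"] norm_mult[of _ "F u * F u"]
        using cutoff_bounds[OF \<delta>pos[OF u], of "Suc n"] Fle[OF u] BJ[of u]
        by (intro mult_mono) (auto intro: order_trans[OF norm_ge_zero])
      have 2: "norm (of_real (cutoff_deriv (Suc n) (\<delta> u) * \<delta> u) * (F u * F u) * H u) \<le> 2 * 1 * BH"
        unfolding norm_mult[of _ "H u"] norm_mult[of _ "F u * F u"] norm_of_real
        using cutoff_deriv_bound[OF \<delta>pos[OF u], of "Suc n"] Fle[OF u] BH[of u]
        by (intro mult_mono) (auto intro: order_trans[OF norm_ge_zero])
      show "norm (S (Suc n) u) \<le> BJ + 2 * BH"
        unfolding S_def using norm_triangle_mono[OF 1 2] by simp
    qed
  qed
  then have "(LINT u|?M. L u) = 0" using zero by (simp add: LIMSEQ_const_iff)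
  moreover have "(LINT u|?M. of_real ((F_fun R C k u)\<^sup>2) * (g u * Lop k f u - f u * Lop k g u)) = (LINT u|?M. L u)"
    by (rule Bochner_Integration.integral_cong[OF HOL.refl])
      (simp add: L_def J_def F_def lf lg power2_eq_square)
  ultimately show ?thesis by simp
qed

end

section \<open>Essential self-adjointness from finite-dimensional invariant subspaces\<close>

lemma L2_measurable: "f \<in> L2 M \<Longrightarrow> f \<in> borel_measurable M"
  and L2_integrable: "f \<in> L2 M \<Longrightarrow> integrable M (\<lambda>x. (cmod (f x))\<^sup>2)"
  by (simp_all add: L2_def)

lemma norm_mult_le_squares: "norm (a * cnj b) \<le> t * (cmod a)\<^sup>2 / 2 + (cmod b)\<^sup>2 / t / 2" if "t > 0"
proof -
  have "0 \<le> (t * cmod a - cmod b)\<^sup>2" by simp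
  then have "2 * (t * cmod a) * cmod b \<le> (t * cmod a)\<^sup>2 + (cmod b)\<^sup>2" by (simp add: power2_diff)
  then have "2 * (cmod a * cmod b) \<le> t * (cmod a)\<^sup>2 + (cmod b)\<^sup>2 / t"
    using that by (simp add: field_simps power2_eq_square)
  then show ?thesis by (simp add: norm_mult)
qed

lemma L2_mult_integrable:
  assumes "f \<in> L2 M" "g \<in> L2 M"
  shows "integrable M (\<lambda>x. f x * cnj (g x))"
proof (rule Bochner_Integration.integrable_bound)
  show "integrable M (\<lambda>x. 1 * (cmod (f x))\<^sup>2 / 2 + (cmod (g x))\<^sup>2 / 1 / 2)"
    by (intro Bochner_Integration.integrable_add integrable_divide integrable_mult_right L2_integrable assms)
  show "(\<lambda>x. f x * cnj (g x)) \<in> borel_measurable M"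
  proof -
    have [measurable]: "f \<in> borel_measurable M" "g \<in> borel_measurable M"
      by (rule L2_measurable[OF assms(1)], rule L2_measurable[OF assms(2)])
    have [measurable]: "cnj \<in> borel_measurable borel"
      by (intro borel_measurable_continuous_onI continuous_on_cnj continuous_on_id)
    show ?thesis by measurable
  qed
  show "AE x in M. norm (f x * cnj (g x)) \<le> norm (1 * (cmod (f x))\<^sup>2 / 2 + (cmod (g x))\<^sup>2 / 1 / 2)"
    using norm_mult_le_squares[of 1] by (intro AE_I2) (smt (verit) real_norm_def zero_le_power2 divide_nonneg_pos)
qed

lemma L2_add:
  assumes "f \<in> L2 M" "g \<in> L2 M" shows "(\<lambda>x. f x + g x) \<in> L2 M"
proof -
  have "integrable M (\<lambda>x. (cmod (f x + g x))\<^sup>2)"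
  proof (rule Bochner_Integration.integrable_bound)
    show "integrable M (\<lambda>x. 2 * (cmod (f x))\<^sup>2 + 2 * (cmod (g x))\<^sup>2)"
      by (intro Bochner_Integration.integrable_add integrable_mult_right L2_integrable assms)
    have [measurable]: "f \<in> borel_measurable M" "g \<in> borel_measurable M"
      by (rule L2_measurable[OF assms(1)], rule L2_measurable[OF assms(2)])
    show "(\<lambda>x. (cmod (f x + g x))\<^sup>2) \<in> borel_measurable M" by measurable
    show "AE x in M. norm ((cmod (f x + g x))\<^sup>2) \<le> norm (2 * (cmod (f x))\<^sup>2 + 2 * (cmod (g x))\<^sup>2)"
    proof (rule AE_I2)
      fix x
      have "(cmod (f x + g x))\<^sup>2 \<le> (cmod (f x) + cmod (g x))\<^sup>2"
        by (intro power_mono norm_triangle_ineq) auto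
      moreover have "0 \<le> (cmod (f x) - cmod (g x))\<^sup>2" by simp
      ultimately show "norm ((cmod (f x + g x))\<^sup>2) \<le> norm (2 * (cmod (f x))\<^sup>2 + 2 * (cmod (g x))\<^sup>2)"
        by (simp add: power2_sum power2_diff)
    qed
  qed
  then show ?thesis using assms L2_measurable unfolding L2_def by (auto intro: borel_measurable_add)
qed

lemma L2_scale:
  assumes "f \<in> L2 M" shows "(\<lambda>x. z * f x) \<in> L2 M"
  using assms unfolding L2_def by (auto simp: norm_mult power_mult_distrib intro: borel_measurable_times)

lemma L2_zero: "(\<lambda>x. 0) \<in> L2 M"
  by (simp add: L2_def)

lemma L2_diff:
  assumes "f \<in> L2 M" "g \<in> L2 M" shows "(\<lambda>x. f x - g x) \<in> L2 M"
  using L2_add[OF assms(1) L2_scale[OF assms(2), of "-1"]] by simp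

lemma L2_cong:
  assumes "\<And>x. x \<in> space M \<Longrightarrow> f x = g x" "g \<in> L2 M" shows "f \<in> L2 M"
  using assms unfolding L2_def
  by (auto cong: measurable_cong Bochner_Integration.integrable_cong)

lemma L2_inner_add_left:
  "f \<in> L2 M \<Longrightarrow> g \<in> L2 M \<Longrightarrow> h \<in> L2 M \<Longrightarrow> L2_inner M (\<lambda>x. f x + g x) h = L2_inner M f h + L2_inner M g h"
  unfolding L2_inner_def distrib_right by (intro Bochner_Integration.integral_add L2_mult_integrable)

lemma L2_inner_scale_left: "L2_inner M (\<lambda>x. z * f x) h = z * L2_inner M f h"
  unfolding L2_inner_def by (simp add: mult.assoc)

lemma L2_inner_diff_left:
  "f \<in> L2 M \<Longrightarrow> g \<in> L2 M \<Longrightarrow> h \<in> L2 M \<Longrightarrow> L2_inner M (\<lambda>x. f x - g x) h = L2_inner M f h - L2_inner M g h"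
  unfolding L2_inner_def left_diff_distrib by (intro Bochner_Integration.integral_diff L2_mult_integrable)

lemma L2_inner_cnj: "L2_inner M f g = cnj (L2_inner M g f)"
proof -
  have "cnj (L2_inner M g f) = (LINT x|M. cnj (g x * cnj (f x)))"
    unfolding L2_inner_def by (rule Bochner_Integration.integral_cnj[symmetric])
  then show ?thesis by (simp add: L2_inner_def mult.commute)
qed

lemma L2_inner_diff_right:
  "f \<in> L2 M \<Longrightarrow> g \<in> L2 M \<Longrightarrow> h \<in> L2 M \<Longrightarrow> L2_inner M h (\<lambda>x. f x - g x) = L2_inner M h f - L2_inner M h g"
  using L2_inner_diff_left[of f M g h] L2_inner_cnj[of M h] by (metis complex_cnj_diff)

lemma L2_inner_cong:
  "(\<And>x. x \<in> space M \<Longrightarrow> f x = f' x) \<Longrightarrow> (\<And>x. x \<in> space M \<Longrightarrow> g x = g' x) \<Longrightarrow> L2_inner M f g = L2_inner M f' g'"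
  unfolding L2_inner_def by (intro Bochner_Integration.integral_cong) auto

lemma L2_inner_self: "L2_inner M f f = of_real ((L2_norm M f)\<^sup>2)"
proof -
  have "L2_inner M f f = (LINT x|M. complex_of_real ((cmod (f x))\<^sup>2))"
    unfolding L2_inner_def complex_norm_square ..
  also have "\<dots> = of_real (LINT x|M. (cmod (f x))\<^sup>2)" by (rule integral_complex_of_real)
  also have "(LINT x|M. (cmod (f x))\<^sup>2) = (L2_norm M f)\<^sup>2" by (simp add: L2_norm_def)
  finally show ?thesis .
qed

lemma L2_norm_nonneg: "L2_norm M f \<ge> 0"
  by (simp add: L2_norm_def)

text \<open>The optimal weight in \<open>norm_mult_le_squares\<close> is \<open>b / a\<close>; its
  perturbation \<open>(b + d) / (a + d)\<close> covers vanishing norms as well, at the price of an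
  error \<open>e\<close>.\<close>

lemma L2_cauchy_schwarz:
  assumes f: "f \<in> L2 M" and g: "g \<in> L2 M"
  shows "norm (L2_inner M f g) \<le> L2_norm M f * L2_norm M g"
proof (rule field_le_epsilon)
  define a b where "a = L2_norm M f" and "b = L2_norm M g"
  have ab: "a \<ge> 0" "b \<ge> 0" by (simp_all add: a_def b_def L2_norm_nonneg)
  have sq: "(LINT x|M. (cmod (f x))\<^sup>2) = a\<^sup>2" "(LINT x|M. (cmod (g x))\<^sup>2) = b\<^sup>2"
    by (simp_all add: a_def b_def L2_norm_def)
  have t: "norm (L2_inner M f g) \<le> t * a\<^sup>2 / 2 + b\<^sup>2 / t / 2" if "t > 0" for t
  proof -
    have "norm (L2_inner M f g) \<le> (LINT x|M. norm (f x * cnj (g x)))"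
      unfolding L2_inner_def by (rule integral_norm_bound)
    also have "\<dots> \<le> (LINT x|M. t * (cmod (f x))\<^sup>2 / 2 + (cmod (g x))\<^sup>2 / t / 2)"
      by (intro integral_mono norm_mult_le_squares that integrable_norm L2_mult_integrable f g
          Bochner_Integration.integrable_add integrable_divide integrable_mult_right L2_integrable)
    also have "\<dots> = t * a\<^sup>2 / 2 + b\<^sup>2 / t / 2"
      using L2_integrable[OF f] L2_integrable[OF g] by (simp add: sq)
    finally show ?thesis .
  qed
  fix e :: real assume e: "e > 0"
  define d where "d = e / (a + b + 1)"
  have d: "d > 0" using e ab by (simp add: d_def)
  have "norm (L2_inner M f g) \<le> (b + d) / (a + d) * a\<^sup>2 / 2 + b\<^sup>2 / ((b + d) / (a + d)) / 2"
    using d ab by (intro t) (simp add: add_nonneg_pos)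
  also have "(b + d) / (a + d) * a\<^sup>2 = (b + d) * a * (a / (a + d))" by (simp add: power2_eq_square)
  also have "\<dots> \<le> (b + d) * a * 1" using ab d by (intro mult_left_mono) auto
  also have "b\<^sup>2 / ((b + d) / (a + d)) = (a + d) * b * (b / (b + d))" by (simp add: power2_eq_square)
  also have "\<dots> \<le> (a + d) * b * 1" using ab d by (intro mult_left_mono) auto
  finally have "norm (L2_inner M f g) \<le> (b + d) * a * 1 / 2 + (a + d) * b * 1 / 2" by simp
  also have "\<dots> = a * b + d * (a + b) / 2" by (simp add: field_simps)
  also have "d * (a + b) / 2 \<le> e"
  proof -
    have "d * (a + b) \<le> d * (a + b + 1)" using d by simp
    also have "\<dots> = e" using ab by (simp add: d_def)
    finally show ?thesis using e by linarith
  qed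
  finally show "norm (L2_inner M f g) \<le> L2_norm M f * L2_norm M g + e" by (simp add: a_def b_def)
qed

lemma fspan_L2: "E \<subseteq> L2 M \<Longrightarrow> f \<in> fspan E \<Longrightarrow> f \<in> L2 M"
proof -
  assume E: "E \<subseteq> L2 M"
  assume "f \<in> fspan E"
  then show ?thesis
  proof (induction rule: fspan.induct)
    case (fspan_step f b c)
    then show ?case using E by (intro L2_add L2_scale) auto
  qed (rule L2_zero)
qed

lemma orthogonal_fspan:
  assumes "E \<subseteq> L2 M" "h \<in> L2 M" "\<And>e. e \<in> E \<Longrightarrow> L2_inner M h e = 0" "f \<in> fspan E"
  shows "L2_inner M h f = 0"
  using assms(4)
proof (induction rule: fspan.induct)
  case fspan_zero
  show ?case by (simp add: L2_inner_def)
next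
  case (fspan_step f b c)
  have L: "f \<in> L2 M" "b \<in> L2 M" using fspan_L2 assms(1) fspan_step by auto
  have "L2_inner M (\<lambda>x. f x + c * b x) h = L2_inner M f h + c * L2_inner M b h"
    using L2_inner_add_left[OF L(1) L2_scale[OF L(2)] assms(2)] by (simp add: L2_inner_scale_left)
  also have "\<dots> = 0"
    using fspan_step(3) assms(3)[OF fspan_step(2)] L2_inner_cnj[of M f h] L2_inner_cnj[of M b h] by simp
  finally show ?case using L2_inner_cnj[of M h] by simp
qed

text \<open>Gram-Schmidt: the new direction is \<open>e\<close> minus its projection to the earlier
  span.\<close>

lemma L2_projection:
  assumes "finite E" "E \<subseteq> L2 M" "f \<in> L2 M"
  shows "\<exists>g\<in>fspan E. \<forall>e\<in>E. L2_inner M (\<lambda>x. f x - g x) e = 0"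
  using assms
proof (induction arbitrary: f rule: finite_induct)
  case empty
  show ?case by (intro bexI[of _ "\<lambda>x. 0"]) (auto intro: fspan.fspan_zero)
next
  case (insert e E)
  have EL: "E \<subseteq> L2 M" and eL: "e \<in> L2 M" using insert by auto
  obtain p where p: "p \<in> fspan E" "\<forall>d\<in>E. L2_inner M (\<lambda>x. f x - p x) d = 0" using insert by blast
  obtain q where q: "q \<in> fspan E" "\<forall>d\<in>E. L2_inner M (\<lambda>x. e x - q x) d = 0" using insert by blast
  define e' where "e' = (\<lambda>x. e x - q x)"
  have pL: "p \<in> L2 M" and qL: "q \<in> L2 M" using fspan_L2[OF EL] p q by auto
  have e'L: "e' \<in> L2 M" unfolding e'_def by (rule L2_diff[OF eL qL])
  have sub: "fspan E \<subseteq> fspan (insert e E)" by (rule fspan_mono) auto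
  have e'E: "L2_inner M e' d = 0" if "d \<in> fspan E" for d
    using orthogonal_fspan[OF EL e'L _ that] q(2) by (simp add: e'_def)
  have fp: "L2_inner M (\<lambda>x. f x - p x) d = 0" if "d \<in> fspan E" for d
    using orthogonal_fspan[OF EL L2_diff[OF insert(5) pL] _ that] p(2) by simp
  have split: "L2_inner M h e = L2_inner M h e' + L2_inner M h q" if "h \<in> L2 M" for h
    using L2_inner_diff_right[OF eL qL that] by (simp add: e'_def)
  show ?case
  proof (cases "L2_norm M e' = 0")
    \<comment> \<open>Elements are functions, so \<open>e'\<close> may be a null function without
      being zero. It is then orthogonal to everything, and \<open>p\<close> already works.\<close>
    case True
    have "L2_inner M h e' = 0" if "h \<in> L2 M" for h
      using L2_cauchy_schwarz[OF that e'L] True by simp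
    then have "L2_inner M (\<lambda>x. f x - p x) e = 0"
      using split[OF L2_diff[OF insert(5) pL]] fp[OF q(1)] L2_diff[OF insert(5) pL] by simp
    then show ?thesis using p sub by (intro bexI[of _ p]) auto
  next
    case False
    define z where "z = L2_inner M f e' / L2_inner M e' e'"
    have ee: "L2_inner M e' e' \<noteq> 0" using False by (simp add: L2_inner_self)
    define g where "g = (\<lambda>x. p x + z * e' x)"
    have gL: "g \<in> L2 M" unfolding g_def by (intro L2_add L2_scale pL e'L)
    have "(\<lambda>x. (p x + (- z) * q x) + z * e x) \<in> fspan (insert e E)"
      using p q sub by (intro fspan.fspan_step fspan_add fspan_scale) auto
    then have gs: "g \<in> fspan (insert e E)" by (simp add: g_def e'_def algebra_simps)
    have inner: "L2_inner M (\<lambda>x. f x - g x) h = L2_inner M (\<lambda>x. f x - p x) h - z * L2_inner M e' h"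
      if "h \<in> L2 M" for h
    proof -
      have "(\<lambda>x. f x - g x) = (\<lambda>x. (f x - p x) - z * e' x)" by (auto simp: g_def)
      then show ?thesis
        using L2_inner_diff_left[OF L2_diff[OF insert(5) pL] L2_scale[OF e'L] that]
        by (simp add: L2_inner_scale_left)
    qed
    have "L2_inner M (\<lambda>x. f x - g x) d = 0" if "d \<in> fspan E" for d
      using inner[OF fspan_L2[OF EL that]] fp[OF that] e'E[OF that] by simp
    moreover have "L2_inner M (\<lambda>x. f x - g x) e' = 0"
    proof -
      have "L2_inner M p e' = 0" using e'E[OF p(1)] L2_inner_cnj[of M p e'] by simp
      then show ?thesis
        using inner[OF e'L] ee L2_inner_diff_left[OF insert(5) pL e'L] by (simp add: z_def)
    qed
    ultimately have "L2_inner M (\<lambda>x. f x - g x) e = 0"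
      using split[OF L2_diff[OF insert(5) gL]] q(1) by simp
    then show ?thesis
      using gs \<open>\<And>d. d \<in> fspan E \<Longrightarrow> L2_inner M (\<lambda>x. f x - g x) d = 0\<close> fspan_base
      by (intro bexI[of _ g]) auto
  qed
qed

text \<open>Pythagoras: the error \<open>f - g\<close> is orthogonal to \<open>g - d\<close>, which
  lies in the span.\<close>

lemma L2_best_approximation:
  assumes E: "E \<subseteq> L2 M" and f: "f \<in> L2 M" and g: "g \<in> fspan E" and d: "d \<in> fspan E"
    and orth: "\<And>e. e \<in> E \<Longrightarrow> L2_inner M (\<lambda>x. f x - g x) e = 0"
  shows "L2_norm M (\<lambda>x. f x - g x) \<le> L2_norm M (\<lambda>x. f x - d x)"
proof -
  define a where "a = (\<lambda>x. f x - g x)"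
  define b where "b = (\<lambda>x. g x - d x)"
  have gL: "g \<in> L2 M" and dL: "d \<in> L2 M" using fspan_L2[OF E] g d by auto
  have aL: "a \<in> L2 M" and bL: "b \<in> L2 M" unfolding a_def b_def by (intro L2_diff f gL dL)+
  have "(\<lambda>x. g x + (-1) * d x) \<in> fspan E" by (intro fspan_add fspan_scale g d)
  then have "b \<in> fspan E" by (simp add: b_def)
  then have ab: "L2_inner M a b = 0" using orthogonal_fspan[OF E aL] orth by (simp add: a_def)
  then have ba: "L2_inner M b a = 0" using L2_inner_cnj[of M b a] by simp
  have fd: "(\<lambda>x. f x - d x) = (\<lambda>x. a x + b x)" by (auto simp: a_def b_def)
  have s: "(\<lambda>x. a x + b x) \<in> L2 M" by (rule L2_add[OF aL bL])
  have right: "L2_inner M h (\<lambda>x. a x + b x) = L2_inner M h a + L2_inner M h b" if "h \<in> L2 M" for h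
    using L2_inner_add_left[OF aL bL that] L2_inner_cnj[of M h] by (metis complex_cnj_add)
  have "L2_inner M (\<lambda>x. a x + b x) (\<lambda>x. a x + b x) = L2_inner M a a + L2_inner M b b"
    unfolding L2_inner_add_left[OF aL bL s] right[OF aL] right[OF bL] ab ba by simp
  then have "complex_of_real ((L2_norm M (\<lambda>x. a x + b x))\<^sup>2) = of_real ((L2_norm M a)\<^sup>2 + (L2_norm M b)\<^sup>2)"
    by (simp add: L2_inner_self)
  then have "(L2_norm M (\<lambda>x. a x + b x))\<^sup>2 = (L2_norm M a)\<^sup>2 + (L2_norm M b)\<^sup>2"
    by (simp only: of_real_eq_iff)
  then have "(L2_norm M a)\<^sup>2 \<le> (L2_norm M (\<lambda>x. a x + b x))\<^sup>2" by simp
  then show ?thesis unfolding fd a_def[symmetric] by (rule power2_le_imp_le[OF _ L2_norm_nonneg])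
qed

text \<open>Let \<open>(f, g)\<close> be in the adjoint and \<open>p\<close> the projection of
  \<open>f\<close> to the invariant span of \<open>E\<close>. For \<open>d\<close> in
  \<open>E\<close>, symmetry gives \<open><T p, d> = <p, T d> = <f, T d> = <g, d>\<close>, so
  \<open>T p\<close> is the projection of \<open>g\<close>. If the span also contains good
  approximations \<open>d1\<close> of \<open>f\<close> and \<open>d2\<close> of \<open>g\<close>,
  then \<open>(p, T p)\<close> is close to \<open>(f, g)\<close>; therefore \<open>inv\<close> is
  about two elements at a time.\<close>

theorem essentially_self_adjointI:
  assumes sub: "L2_subspace M D" and dense: "L2_dense M D"
    and inv: "\<And>f g. f \<in> D \<Longrightarrow> g \<in> D \<Longrightarrow> \<exists>E. finite E \<and> E \<subseteq> D \<and> f \<in> fspan E \<and> g \<in> fspan E \<and>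
        (\<forall>d\<in>fspan E. \<exists>h\<in>fspan E. \<forall>x\<in>space M. T d x = h x)"
    and sym: "\<And>f g. f \<in> D \<Longrightarrow> g \<in> D \<Longrightarrow> L2_inner M (T f) g = L2_inner M f (T g)"
  shows "essentially_self_adjoint M T D"
proof -
  have DL: "D \<subseteq> L2 M" using sub by (simp add: L2_subspace_def)
  have spanD: "d \<in> D" if "d \<in> fspan E" "E \<subseteq> D" for d E
    using that(1)
  proof (induction rule: fspan.induct)
    case fspan_zero
    show ?case using sub by (simp add: L2_subspace_def)
  next
    case (fspan_step f b c)
    then have "b \<in> D" using that(2) by blast
    then show ?case using fspan_step(3) sub by (simp add: L2_subspace_def)
  qed
  have TL: "T d \<in> L2 M" if d: "d \<in> D" for d
  proof -
    obtain E where E: "E \<subseteq> D" "d \<in> fspan E" "\<forall>d\<in>fspan E. \<exists>h\<in>fspan E. \<forall>x\<in>space M. T d x = h x"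
      using inv[OF d d] by blast
    obtain h where h: "h \<in> fspan E" "\<And>x. x \<in> space M \<Longrightarrow> T d x = h x"
      using bspec[OF E(3) E(2)] by blast
    have "h \<in> L2 M" using spanD[OF h(1) E(1)] DL by blast
    then show ?thesis by (intro L2_cong[of M "T d" h] h(2))
  qed
  define G where "G = graph_closure M (operator_graph T D)"
  have base: "(d, T d) \<in> G" if "d \<in> D" for d
  proof -
    have "L2_norm M (\<lambda>x. d x - d x) = 0" "L2_norm M (\<lambda>x. T d x - T d x) = 0" by (simp_all add: L2_norm_def)
    then have "\<forall>e>0. \<exists>(f', g')\<in>operator_graph T D. L2_norm M (\<lambda>x. d x - f' x) < e \<and> L2_norm M (\<lambda>x. T d x - g' x) < e"
      using that by (intro allI impI bexI[of _ "(d, T d)"]) (auto simp: operator_graph_def)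
    moreover have "d \<in> L2 M" "T d \<in> L2 M" using DL TL that by auto
    ultimately show ?thesis unfolding G_def graph_closure_def by blast
  qed
  have "graph_adjoint M G \<subseteq> G"
  proof
    fix y assume y: "y \<in> graph_adjoint M G"
    obtain f g where y': "y = (f, g)" by (cases y)
    have f: "f \<in> L2 M" and g: "g \<in> L2 M" and adj: "\<And>d. d \<in> D \<Longrightarrow> L2_inner M (T d) f = L2_inner M d g"
      using y base unfolding y' graph_adjoint_def by blast+
    have "\<exists>(f', g')\<in>operator_graph T D. L2_norm M (\<lambda>x. f x - f' x) < e \<and> L2_norm M (\<lambda>x. g x - g' x) < e"
      if e: "e > 0" for e
    proof -
      obtain d1 where d1: "d1 \<in> D" "L2_norm M (\<lambda>x. f x - d1 x) < e"
        using dense f e unfolding L2_dense_def by blast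
      obtain d2 where d2: "d2 \<in> D" "L2_norm M (\<lambda>x. g x - d2 x) < e"
        using dense g e unfolding L2_dense_def by blast
      obtain E where E: "finite E" "E \<subseteq> D" "d1 \<in> fspan E" "d2 \<in> fspan E"
        "\<And>d. d \<in> fspan E \<Longrightarrow> \<exists>h\<in>fspan E. \<forall>x\<in>space M. T d x = h x"
        using inv[OF d1(1) d2(1)] by blast
      have EL: "E \<subseteq> L2 M" using E DL by blast
      obtain p where p: "p \<in> fspan E" "\<forall>e\<in>E. L2_inner M (\<lambda>x. f x - p x) e = 0"
        using L2_projection[OF E(1) EL f] by blast
      have pD: "p \<in> D" by (rule spanD[OF p(1) E(2)])
      have pL: "p \<in> L2 M" using pD DL by blast
      obtain h where h: "h \<in> fspan E" "\<And>x. x \<in> space M \<Longrightarrow> T p x = h x" using E(5)[OF p(1)] by blast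
      have hL: "h \<in> L2 M" using fspan_L2[OF EL h(1)] .
      have "L2_inner M (\<lambda>x. g x - h x) d = 0" if dE: "d \<in> E" for d
      proof -
        have dD: "d \<in> D" and dL: "d \<in> L2 M" using that E(2) DL by auto
        obtain h' where h': "h' \<in> fspan E" "\<And>x. x \<in> space M \<Longrightarrow> T d x = h' x"
          using E(5)[OF fspan_base[OF dE]] by blast
        have h'L: "h' \<in> L2 M" using fspan_L2[OF EL h'(1)] .
        have "L2_inner M h d = L2_inner M (T p) d" by (rule L2_inner_cong) (simp_all add: h)
        also have "\<dots> = L2_inner M p (T d)" by (rule sym[OF pD dD])
        also have "\<dots> = L2_inner M p h'" by (rule L2_inner_cong) (simp_all add: h')
        also have "\<dots> = L2_inner M f h'"
          using orthogonal_fspan[OF EL L2_diff[OF f pL] _ h'(1)] p(2) L2_inner_diff_left[OF f pL h'L] by simp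
        also have "\<dots> = L2_inner M f (T d)" by (rule L2_inner_cong) (simp_all add: h')
        also have "\<dots> = L2_inner M g d"
          using adj[OF dD] L2_inner_cnj[of M f "T d"] L2_inner_cnj[of M g d] by simp
        finally show ?thesis using L2_inner_diff_left[OF g hL dL] by simp
      qed
      then have "L2_norm M (\<lambda>x. g x - h x) \<le> L2_norm M (\<lambda>x. g x - d2 x)"
        by (rule L2_best_approximation[OF EL g h(1) E(4)])
      moreover have "L2_norm M (\<lambda>x. g x - T p x) = L2_norm M (\<lambda>x. g x - h x)"
        unfolding L2_norm_def by (intro arg_cong[of _ _ sqrt] Bochner_Integration.integral_cong) (simp_all add: h)
      moreover have "L2_norm M (\<lambda>x. f x - p x) \<le> L2_norm M (\<lambda>x. f x - d1 x)"
        by (rule L2_best_approximation[OF EL f p(1) E(3)]) (use p(2) in blast)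
      ultimately have "L2_norm M (\<lambda>x. f x - p x) < e" "L2_norm M (\<lambda>x. g x - T p x) < e"
        using d1(2) d2(2) by linarith+
      then show ?thesis using pD by (intro bexI[of _ "(p, T p)"]) (auto simp: operator_graph_def)
    qed
    then show "y \<in> G" unfolding y' G_def graph_closure_def using f g by blast
  qed
  moreover have "G \<subseteq> graph_adjoint M G"
  proof
    fix y assume y: "y \<in> G"
    obtain f g where y': "y = (f, g)" by (cases y)
    have GE: "\<exists>a\<in>D. L2_norm M (\<lambda>x. f x - a x) < e \<and> L2_norm M (\<lambda>x. g x - T a x) < e"
      "f \<in> L2 M" "g \<in> L2 M" if "(f, g) \<in> G" "e > 0" for f g e
      using that unfolding G_def graph_closure_def operator_graph_def by blast+
    have fg: "f \<in> L2 M" "g \<in> L2 M" using GE(2,3)[of f g 1] y y' by auto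
    have "L2_inner M g' f = L2_inner M f' g" if y2: "(f', g') \<in> G" for f' g'
    proof -
      have fg': "f' \<in> L2 M" "g' \<in> L2 M" using GE(2,3)[of f' g' 1] y2 by auto
      \<comment> \<open>The summand 2 pays for the two products of remainders, each at most
        \<open>e * e \<le> e\<close>.\<close>
      define K where "K = L2_norm M f + L2_norm M g' + L2_norm M g + L2_norm M f' + 2"
      have K: "K > 0" unfolding K_def using L2_norm_nonneg[of M] by (simp add: add_nonneg_pos)
      \<comment> \<open>Symmetry passes from \<open>T\<close> to the closure by replacing both pairs
        by nearby elements of the graph; \<open>r1\<close> to \<open>r4\<close> are the four
        errors.\<close>
      have small: "norm (L2_inner M g' f - L2_inner M f' g) \<le> e * K" if e: "0 < e" "e \<le> 1" for e
      proof -
        obtain a where a: "a \<in> D" "L2_norm M (\<lambda>x. f x - a x) < e" "L2_norm M (\<lambda>x. g x - T a x) < e"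
          using GE(1)[of f g e] y y' e by blast
        obtain a' where a': "a' \<in> D" "L2_norm M (\<lambda>x. f' x - a' x) < e" "L2_norm M (\<lambda>x. g' x - T a' x) < e"
          using GE(1)[OF y2 e(1)] by blast
        have aL: "a \<in> L2 M" "a' \<in> L2 M" "T a \<in> L2 M" "T a' \<in> L2 M" using a a' DL TL by auto
        define r1 where "r1 = (\<lambda>x. f x - a x)"
        define r2 where "r2 = (\<lambda>x. g x - T a x)"
        define r3 where "r3 = (\<lambda>x. f' x - a' x)"
        define r4 where "r4 = (\<lambda>x. g' x - T a' x)"
        have rL: "r1 \<in> L2 M" "r2 \<in> L2 M" "r3 \<in> L2 M" "r4 \<in> L2 M"
          unfolding r1_def r2_def r3_def r4_def by (intro L2_diff fg fg' aL)+
        have rn: "L2_norm M r1 \<le> e" "L2_norm M r2 \<le> e" "L2_norm M r3 \<le> e" "L2_norm M r4 \<le> e"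
          using a a' by (simp_all add: r1_def r2_def r3_def r4_def)
        have 1: "L2_inner M r4 f = L2_inner M g' f - L2_inner M (T a') f"
          unfolding r4_def by (rule L2_inner_diff_left[OF fg'(2) aL(4) fg(1)])
        have 2: "L2_inner M r4 r1 = L2_inner M g' r1 - L2_inner M (T a') r1"
          unfolding r4_def by (rule L2_inner_diff_left[OF fg'(2) aL(4) rL(1)])
        have 3: "L2_inner M (T a') r1 = L2_inner M (T a') f - L2_inner M (T a') a"
          unfolding r1_def by (rule L2_inner_diff_right[OF fg(1) aL(1) aL(4)])
        have 4: "L2_inner M r3 g = L2_inner M f' g - L2_inner M a' g"
          unfolding r3_def by (rule L2_inner_diff_left[OF fg'(1) aL(2) fg(2)])
        have 5: "L2_inner M r3 r2 = L2_inner M f' r2 - L2_inner M a' r2"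
          unfolding r3_def by (rule L2_inner_diff_left[OF fg'(1) aL(2) rL(2)])
        have 6: "L2_inner M a' r2 = L2_inner M a' g - L2_inner M a' (T a)"
          unfolding r2_def by (rule L2_inner_diff_right[OF fg(2) aL(3) aL(2)])
        have s: "L2_inner M (T a') a = L2_inner M a' (T a)" by (rule sym[OF a'(1) a(1)])
        have "L2_inner M g' f - L2_inner M f' g =
          L2_inner M r4 f + L2_inner M g' r1 - L2_inner M r4 r1 - L2_inner M r3 g - L2_inner M f' r2 + L2_inner M r3 r2"
        proof -
          have "L2_inner M g' f = L2_inner M r4 f + ((L2_inner M g' r1 - L2_inner M r4 r1) + L2_inner M a' (T a))"
            using 1 2 3 s by simp
          moreover have "L2_inner M f' g = L2_inner M r3 g + ((L2_inner M f' r2 - L2_inner M r3 r2) + L2_inner M a' (T a))"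
            using 4 5 6 by simp
          ultimately show ?thesis by simp
        qed
        then have "norm (L2_inner M g' f - L2_inner M f' g) \<le> norm (L2_inner M r4 f) + norm (L2_inner M g' r1)
            + norm (L2_inner M r4 r1) + norm (L2_inner M r3 g) + norm (L2_inner M f' r2) + norm (L2_inner M r3 r2)"
          by (metis (no_types, opaque_lifting) norm_triangle_le norm_triangle_le_diff add_right_mono order_refl)
        moreover have "norm (L2_inner M r4 f) \<le> e * L2_norm M f"
          by (rule order_trans[OF L2_cauchy_schwarz[OF rL(4) fg(1)] mult_right_mono[OF rn(4) L2_norm_nonneg]])
        moreover have "norm (L2_inner M g' r1) \<le> L2_norm M g' * e"
          by (rule order_trans[OF L2_cauchy_schwarz[OF fg'(2) rL(1)] mult_left_mono[OF rn(1) L2_norm_nonneg]])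
        moreover have "norm (L2_inner M r3 g) \<le> e * L2_norm M g"
          by (rule order_trans[OF L2_cauchy_schwarz[OF rL(3) fg(2)] mult_right_mono[OF rn(3) L2_norm_nonneg]])
        moreover have "norm (L2_inner M f' r2) \<le> L2_norm M f' * e"
          by (rule order_trans[OF L2_cauchy_schwarz[OF fg'(1) rL(2)] mult_left_mono[OF rn(2) L2_norm_nonneg]])
        moreover have "norm (L2_inner M r4 r1) \<le> e * 1"
          by (rule order_trans[OF L2_cauchy_schwarz[OF rL(4) rL(1)] mult_mono])
            (use rn e L2_norm_nonneg in \<open>auto intro: order_trans\<close>)
        moreover have "norm (L2_inner M r3 r2) \<le> e * 1"
          by (rule order_trans[OF L2_cauchy_schwarz[OF rL(3) rL(2)] mult_mono])
            (use rn e L2_norm_nonneg in \<open>auto intro: order_trans\<close>)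
        ultimately show ?thesis unfolding K_def by (simp add: algebra_simps)
      qed
      have "norm (L2_inner M g' f - L2_inner M f' g) \<le> 0 + e" if e: "e > 0" for e
      proof -
        have "norm (L2_inner M g' f - L2_inner M f' g) \<le> min 1 (e / K) * K"
          by (rule small) (use e K in auto)
        also have "\<dots> \<le> (e / K) * K" using K by (intro mult_right_mono) auto
        finally show ?thesis using K by simp
      qed
      then have "norm (L2_inner M g' f - L2_inner M f' g) \<le> 0" by (rule field_le_epsilon)
      then show ?thesis by simp
    qed
    then show "y \<in> graph_adjoint M G" unfolding y' graph_adjoint_def using fg by blast
  qed
  ultimately have "graph_adjoint M G = G" by blast
  then show ?thesis
    unfolding essentially_self_adjoint_def Let_def G_def[symmetric] using sub dense TL by blast
qed

section \<open>Density\<close>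

context alcove
begin

text \<open>If all weights agree, the difference of \<open>u\<close> and a Weyl image of
  \<open>v\<close> is \<open>2 * pi\<close> times an element of the dual of \<open>P\<close>, which
  is the coroot lattice. Then \<open>u\<close> and \<open>v\<close> are conjugate under the affine
  Weyl group, hence equal.\<close>

lemma weight_separates:
  assumes "u \<in> closure A" "v \<in> closure A" "u \<noteq> v" "w \<in> W" "w' \<in> W"
  shows "\<exists>\<mu>\<in>P. wave \<mu> (w u) \<noteq> wave \<mu> (w' v)"
proof (rule ccontr)
  assume "\<not> ?thesis"
  then have eq: "\<And>\<mu>. \<mu> \<in> P \<Longrightarrow> wave \<mu> (w u) = wave \<mu> (w' v)" by blast
  define x where "x = (1 / (2 * pi)) *\<^sub>R (u - inv w (w' v))"
  have "\<mu> \<bullet> x \<in> \<int>" if \<mu>: "\<mu> \<in> P" for \<mu>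
  proof -
    have "wave (w \<mu>) (w u) = wave (w \<mu>) (w' v)" using eq weyl_weight[OF assms(4) \<mu>] by blast
    moreover have "wave (w \<mu>) (w y) = wave \<mu> y" for y by (simp add: wave_def weyl_inner[OF assms(4)])
    moreover have "w' v = w (inv w (w' v))" using weyl_inv(2)[OF assms(4)] by simp
    ultimately have "wave \<mu> u = wave \<mu> (inv w (w' v))" by metis
    then have "exp (\<i> * of_real (\<mu> \<bullet> (u - inv w (w' v)))) = 1"
      by (simp add: wave_def inner_diff_right exp_diff right_diff_distrib)
    then obtain n :: int where "\<mu> \<bullet> (u - inv w (w' v)) = of_int (2 * n) * pi"
      unfolding exp_eq_1 by auto
    then have "\<mu> \<bullet> x = of_int n" by (simp add: x_def)
    then show ?thesis by simp
  qed
  then have x: "x \<in> coroot_lattice" by (rule coroot_lattice_dual)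
  have "u = (inv w \<circ> w') v + (2 * pi) *\<^sub>R x" by (simp add: x_def)
  then have "v = u"
    by (rule alcove_fundamental[OF assms(2,1) weyl_comp[OF weyl_inv(1)[OF assms(4)] assms(5)] x])
  then show False using assms(3) by simp
qed

text \<open>Two orbits are told apart by a trigonometric polynomial that is 1 on the first and 0 on
  the second; the Weyl sum then takes the values \<open>card W\<close> and 0.\<close>

lemma invariants_separate:
  assumes "u \<in> closure A" "v \<in> closure A" "u \<noteq> v"
  shows "\<exists>\<phi>\<in>trig_invariants R. \<phi> u \<noteq> \<phi> v"
proof -
  have "\<forall>w\<in>W. \<forall>w'\<in>W. \<exists>\<mu>\<in>P. wave \<mu> (w u) \<noteq> wave \<mu> (w' v)"
    using weight_separates[OF assms] by blast
  then obtain m where m: "\<And>w w'. w \<in> W \<Longrightarrow> w' \<in> W \<Longrightarrow> m w w' \<in> P"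
    "\<And>w w'. w \<in> W \<Longrightarrow> w' \<in> W \<Longrightarrow> wave (m w w') (w u) \<noteq> wave (m w w') (w' v)" by metis
  define c where "c = (\<lambda>w w'. 1 / (wave (m w w') (w u) - wave (m w w') (w' v)))"
  \<comment> \<open>Interpolation: \<open>h w\<close> is 1 at \<open>w u\<close> and 0 on the whole
    orbit of \<open>v\<close>. The complementary product in \<open>f\<close> gives 1 at every point
    of the orbit of \<open>u\<close>, whatever values the other factors take there.\<close>
  define h where "h = (\<lambda>w x. \<Prod>w'\<in>W. c w w' * (wave (m w w') x + (-1) * wave (m w w') (w' v)))"
  define f where "f = (\<lambda>x. 1 + (-1) * (\<Prod>w\<in>W. 1 + (-1) * h w x))"
  have hT: "h w \<in> TP" if "w \<in> W" for w
    unfolding h_def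
    by (rule TP_prod, rule TP_scale, rule TP_add[OF wave_TP TP_const]) (rule m(1)[OF that])
  have fT: "f \<in> TP"
    unfolding f_def
    by (rule TP_add[OF TP_const], rule TP_scale, rule TP_prod, rule TP_add[OF TP_const], rule TP_scale, rule hT)
  have h1: "h w (w u) = 1" if "w \<in> W" for w
    unfolding h_def by (rule prod.neutral) (use m(2)[OF that] in \<open>auto simp: c_def\<close>)
  have h0: "h w (w' v) = 0" if "w \<in> W" "w' \<in> W" for w w'
    unfolding h_def by (rule prod_zero[OF finite_weyl]) (use that in auto)
  have f1: "f (w u) = 1" if "w \<in> W" for w
  proof -
    have "(\<Prod>w'\<in>W. 1 + (-1) * h w' (w u)) = 0"
      by (rule prod_zero[OF finite_weyl]) (use h1 that in auto)
    then show ?thesis by (simp add: f_def)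
  qed
  have f0: "f (w v) = 0" if "w \<in> W" for w
    using h0 that by (simp add: f_def)
  show ?thesis
  proof (rule bexI[OF _ trig_invariants_average[OF fT]])
    show "(\<Sum>w\<in>W. f (w u)) \<noteq> (\<Sum>w\<in>W. f (w v))"
      using finite_weyl weyl_nonempty by (simp add: f1 f0)
  qed
qed

lemma compact_closure_alcove: "compact (closure A)"
  by (simp add: bounded_alcove)

text \<open>The real Stone-Weierstrass theorem, applied to the real-valued invariants. They still
  separate points because the invariants are closed under conjugation, so real and imaginary parts
  are available.\<close>

lemma approximate_continuous_real:
  assumes "continuous_on (closure A) g" "e > 0"
  shows "\<exists>h. (\<lambda>u. complex_of_real (h u)) \<in> trig_invariants R \<and> (\<forall>u\<in>closure A. \<bar>g u - h u\<bar> < e)"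
proof -
  define Q where "Q = {h. (\<lambda>u. complex_of_real (h u)) \<in> trig_invariants R}"
  interpret function_ring_on Q "closure A"
  proof
    show "compact (closure A)" by (rule compact_closure_alcove)
    show "continuous_on (closure A) h" if "h \<in> Q" for h
    proof -
      have "continuous_on (closure A) (\<lambda>u. Re (complex_of_real (h u)))"
        using that by (intro continuous_on_Re continuous_TP trig_invariants_TP) (simp add: Q_def)
      then show ?thesis by simp
    qed
    show "(\<lambda>x. f x + h x) \<in> Q" if "f \<in> Q" "h \<in> Q" for f h
      using that trig_invariants_add by (simp add: Q_def)
    show "(\<lambda>x. f x * h x) \<in> Q" if "f \<in> Q" "h \<in> Q" for f h
      using that trig_invariants_mult by (simp add: Q_def)
    show "(\<lambda>_. c) \<in> Q" for c using trig_invariants_const by (simp add: Q_def)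
    show "\<exists>f\<in>Q. f x \<noteq> f y" if xy: "x \<in> closure A" "y \<in> closure A" "x \<noteq> y" for x y
    proof -
      obtain \<phi> where \<phi>: "\<phi> \<in> trig_invariants R" "\<phi> x \<noteq> \<phi> y" using invariants_separate[OF xy] by blast
      have "(\<lambda>u. (1/2) * (\<phi> u + cnj (\<phi> u))) \<in> trig_invariants R"
        by (rule trig_invariants_scale[OF trig_invariants_add[OF \<phi>(1) trig_invariants_cnj[OF \<phi>(1)]]])
      moreover have "(1/2) * (\<phi> u + cnj (\<phi> u)) = of_real (Re (\<phi> u))" for u by (simp add: complex_eq_iff)
      ultimately have re: "(\<lambda>u. Re (\<phi> u)) \<in> Q" by (simp add: Q_def)
      have "(\<lambda>u. (1 / (2 * \<i>)) * (\<phi> u + (-1) * cnj (\<phi> u))) \<in> trig_invariants R"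
        by (rule trig_invariants_scale[OF trig_invariants_add[OF \<phi>(1) trig_invariants_scale[OF trig_invariants_cnj[OF \<phi>(1)]]]])
      moreover have "(1 / (2 * \<i>)) * (\<phi> u + (-1) * cnj (\<phi> u)) = of_real (Im (\<phi> u))" for u
        by (simp add: complex_eq_iff Re_divide Im_divide)
      ultimately have im: "(\<lambda>u. Im (\<phi> u)) \<in> Q" by (simp add: Q_def)
      have "Re (\<phi> x) \<noteq> Re (\<phi> y) \<or> Im (\<phi> x) \<noteq> Im (\<phi> y)" using \<phi>(2) by (auto simp: complex_eq_iff)
      then show ?thesis
      proof
        assume "Re (\<phi> x) \<noteq> Re (\<phi> y)"
        then show ?thesis by (rule bexI[OF _ re])
      next
        assume "Im (\<phi> x) \<noteq> Im (\<phi> y)"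
        then show ?thesis by (rule bexI[OF _ im])
      qed
    qed
  qed
  show ?thesis using Stone_Weierstrass_basic[OF assms] by (auto simp: Q_def)
qed

lemma approximate_continuous:
  assumes "continuous_on (closure A) g" "e > 0"
  shows "\<exists>\<phi>\<in>trig_invariants R. \<forall>u\<in>closure A. cmod (g u - \<phi> u) < e"
proof -
  have e2: "e / 2 > 0" using assms by simp
  obtain a where a: "(\<lambda>u. complex_of_real (a u)) \<in> trig_invariants R" "\<forall>u\<in>closure A. \<bar>Re (g u) - a u\<bar> < e / 2"
    using approximate_continuous_real[OF continuous_on_Re[OF assms(1)] e2] by blast
  obtain b where b: "(\<lambda>u. complex_of_real (b u)) \<in> trig_invariants R" "\<forall>u\<in>closure A. \<bar>Im (g u) - b u\<bar> < e / 2"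
    using approximate_continuous_real[OF continuous_on_Im[OF assms(1)] e2] by blast
  show ?thesis
  proof (rule bexI[of _ "\<lambda>u. of_real (a u) + \<i> * of_real (b u)"])
    show "(\<lambda>u. of_real (a u) + \<i> * of_real (b u)) \<in> trig_invariants R"
      by (rule trig_invariants_add[OF a(1) trig_invariants_scale[OF b(1)]])
    show "\<forall>u\<in>closure A. cmod (g u - (of_real (a u) + \<i> * of_real (b u))) < e"
    proof
      fix u assume u: "u \<in> closure A"
      have "cmod (g u - (of_real (a u) + \<i> * of_real (b u))) \<le> \<bar>Re (g u) - a u\<bar> + \<bar>Im (g u) - b u\<bar>"
        using cmod_le[of "g u - (of_real (a u) + \<i> * of_real (b u))"] by simp
      then show "cmod (g u - (of_real (a u) + \<i> * of_real (b u))) < e" using a(2) b(2) u by fastforce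
    qed
  qed
qed

text \<open>On the whole space this is the fourth power of the product of sines over the positive
  roots, which itself is invariant only up to sign. Squared sines have their exponents among 0 and
  the roots, hence in \<open>P\<close>.\<close>

definition root_product :: "'a \<Rightarrow> real" where
  "root_product u = (\<Prod>\<alpha>\<in>R. (sin (\<alpha> \<bullet> u / 2))\<^sup>2)"

lemma root_product_invariant: "(\<lambda>u. complex_of_real (root_product u)) \<in> trig_invariants R"
  unfolding trig_invariants_iff
proof (intro conjI ballI allI)
  have s: "complex_of_real ((sin (\<alpha> \<bullet> u / 2))\<^sup>2) = (1 / 2) + (- 1 / 4) * (wave \<alpha> u + wave (- \<alpha>) u)" for \<alpha> u :: 'a
  proof -
    have "wave \<alpha> u + wave (- \<alpha>) u = of_real (2 * cos (\<alpha> \<bullet> u))"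
      by (simp add: wave_def complex_eq_iff Re_exp Im_exp)
    moreover have "cos (\<alpha> \<bullet> u) = 1 - 2 * (sin (\<alpha> \<bullet> u / 2))\<^sup>2"
      using cos_double_sin[of "\<alpha> \<bullet> u / 2"] by simp
    ultimately have "wave \<alpha> u + wave (- \<alpha>) u = of_real (2 - 4 * (sin (\<alpha> \<bullet> u / 2))\<^sup>2)" by simp
    then show ?thesis by (simp add: diff_divide_distrib)
  qed
  have "(\<lambda>u. \<Prod>\<alpha>\<in>R. (1 / 2) + (- 1 / 4) * (wave \<alpha> u + wave (- \<alpha>) u)) \<in> TP"
    by (rule TP_prod, rule TP_add[OF TP_const], rule TP_scale, rule TP_add[OF wave_TP wave_TP])
      (use root_subset_weights weight_uminus in auto)
  then show "(\<lambda>u. complex_of_real (root_product u)) \<in> TP"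
    unfolding root_product_def of_real_prod s .
  fix w u assume w: "w \<in> W"
  have "root_product (w u) = (\<Prod>\<alpha>\<in>R. (sin (inv w \<alpha> \<bullet> u / 2))\<^sup>2)"
    by (simp add: root_product_def weyl_move[OF w])
  also have "\<dots> = root_product u"
    unfolding root_product_def
    by (rule prod.reindex_bij_betw[OF weyl_bij_R[OF weyl_inv(1)[OF w]]])
  finally show "complex_of_real (root_product (w u)) = of_real (root_product u)" by simp
qed

lemma root_product_alcove: "root_product u = (\<Prod>\<alpha>\<in>Rp. (sin (\<alpha> \<bullet> u / 2)) ^ 4)"
  unfolding root_product_def prod_roots by (intro prod.cong HOL.refl) (simp add: power4_eq_xxxx power2_eq_square)

text \<open>Each sine occurs with the exponent \<open>k (norm \<alpha>) + 4 * m\<close>, which is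
  nonnegative once \<open>m\<close> dominates the absolute values of \<open>k\<close> on the root
  lengths.\<close>

lemma damped_F:
  obtains m :: nat where "\<And>u. u \<in> A \<Longrightarrow> 0 < F_fun R C k u * root_product u ^ m"
    "\<And>u. u \<in> A \<Longrightarrow> F_fun R C k u * root_product u ^ m \<le> 1"
proof -
  obtain m :: nat where m: "(\<Sum>c\<in>root_lengths R. \<bar>k c\<bar>) \<le> real m" using real_arch_simple by blast
  have fin: "finite (root_lengths R)" using finite_R by (simp add: root_lengths_def)
  have km: "k (norm \<alpha>) + 4 * real m \<ge> 0" if "\<alpha> \<in> Rp" for \<alpha>
  proof -
    have "\<bar>k (norm \<alpha>)\<bar> \<le> (\<Sum>c\<in>root_lengths R. \<bar>k c\<bar>)"
      by (rule member_le_sum[OF _ _ fin]) (use positive_root[OF that] in \<open>auto simp: root_lengths_def\<close>)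
    then show ?thesis using m by linarith
  qed
  have eq: "F_fun R C k u * root_product u ^ m = (\<Prod>\<alpha>\<in>Rp. sin (\<alpha> \<bullet> u / 2) powr (k (norm \<alpha>) + 4 * real m))"
    if u: "u \<in> A" for u
    unfolding F_fun_alcove[OF u] root_product_alcove prod_power_distrib prod.distrib[symmetric]
  proof (rule prod.cong[OF HOL.refl])
    fix \<alpha> assume "\<alpha> \<in> Rp"
    then have s: "sin (\<alpha> \<bullet> u / 2) > 0" by (rule alcove_sin_pos[OF _ u])
    have "((sin (\<alpha> \<bullet> u / 2)) ^ 4) ^ m = sin (\<alpha> \<bullet> u / 2) powr (4 * real m)"
      using powr_realpow[OF s, of "4 * m"] by (simp add: power_mult)
    then show "sin (\<alpha> \<bullet> u / 2) powr k (norm \<alpha>) * ((sin (\<alpha> \<bullet> u / 2)) ^ 4) ^ m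
       = sin (\<alpha> \<bullet> u / 2) powr (k (norm \<alpha>) + 4 * real m)"
      by (simp add: powr_add)
  qed
  show ?thesis
  proof (rule that[of m])
    fix u assume u: "u \<in> A"
    show "0 < F_fun R C k u * root_product u ^ m"
      unfolding eq[OF u] by (rule prod_pos) (use alcove_sin_pos[OF _ u] in force)
    show "F_fun R C k u * root_product u ^ m \<le> 1"
      unfolding eq[OF u]
    proof (rule prod_le_1)
      fix \<alpha> assume a: "\<alpha> \<in> Rp"
      show "0 \<le> sin (\<alpha> \<bullet> u / 2) powr (k (norm \<alpha>) + 4 * real m) \<and> sin (\<alpha> \<bullet> u / 2) powr (k (norm \<alpha>) + 4 * real m) \<le> 1"
        using alcove_sin_pos[OF a u] powr_le1[OF km[OF a], of "sin (\<alpha> \<bullet> u / 2)"] by simp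
    qed
  qed
qed

lemma bounded_continuous_L2:
  assumes "continuous_on A f" "\<And>u. u \<in> A \<Longrightarrow> cmod (f u) \<le> B"
  shows "f \<in> L2 (lebesgue_on A)"
proof -
  interpret finite_measure "lebesgue_on A" by (rule finite_measure_alcove)
  have "(\<lambda>u. (cmod (f u))\<^sup>2) \<in> borel_measurable (lebesgue_on A)"
    by (rule continuous_measurable_alcove) (intro continuous_intros assms(1))
  moreover have "AE u in lebesgue_on A. norm ((cmod (f u))\<^sup>2) \<le> B\<^sup>2"
    by (rule AE_I2) (use assms(2) in \<open>auto intro!: power_mono\<close>)
  ultimately have "integrable (lebesgue_on A) (\<lambda>u. (cmod (f u))\<^sup>2)"
    by (rule integrable_const_bound[rotated])
  then show ?thesis using continuous_measurable_alcove[OF assms(1)] by (simp add: L2_def)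
qed

lemma F_trigI: "\<phi> \<in> trig_invariants R \<Longrightarrow> (\<lambda>u. complex_of_real (F_fun R C k u) * \<phi> u) \<in> F_trig R C k"
  by (auto simp: F_trig_def)

lemma F_trig_continuous: "f \<in> F_trig R C k \<Longrightarrow> continuous_on A f"
proof -
  assume "f \<in> F_trig R C k"
  then obtain \<phi> where \<phi>: "f = (\<lambda>u. complex_of_real (F_fun R C k u) * \<phi> u)" "\<phi> \<in> trig_invariants R"
    unfolding F_trig_def by blast
  show ?thesis
    unfolding \<phi>(1)
    by (intro continuous_on_mult continuous_on_of_real continuous_F_fun continuous_TP[OF trig_invariants_TP[OF \<phi>(2)]])
qed

text \<open>\<open>\<omega>\<close> is a bounded positive multiple of \<open>F\<close> by an invariant, so it suffices to approximate
  \<open>f / \<omega>\<close> uniformly after a truncation.\<close>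

theorem F_trig_dense: "L2_dense (lebesgue_on A) (F_trig R C k \<inter> L2 (lebesgue_on A))"
proof -
  let ?M = "lebesgue_on A"
  interpret M: finite_measure ?M by (rule finite_measure_alcove)
  obtain m where m: "\<And>u. u \<in> A \<Longrightarrow> 0 < F_fun R C k u * root_product u ^ m"
    "\<And>u. u \<in> A \<Longrightarrow> F_fun R C k u * root_product u ^ m \<le> 1" using damped_F[of k] by metis
  define \<omega> where "\<omega> = (\<lambda>u. F_fun R C k u * root_product u ^ m)"
  have \<omega>: "0 < \<omega> u" "\<omega> u \<le> 1" if "u \<in> A" for u using m that by (simp_all add: \<omega>_def)
  have cont\<omega>: "continuous_on A \<omega>"
    unfolding \<omega>_def root_product_def by (intro continuous_intros continuous_F_fun) auto
  have [measurable]: "\<omega> \<in> borel_measurable ?M" by (rule continuous_measurable_alcove[OF cont\<omega>])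
  have mem: "(\<lambda>u. of_real (\<omega> u) * \<phi> u) \<in> F_trig R C k \<inter> L2 ?M" if \<phi>: "\<phi> \<in> trig_invariants R" for \<phi>
  proof
    have pw: "(\<lambda>u. complex_of_real (root_product u) ^ j) \<in> trig_invariants R" for j
    proof (induction j)
      case 0
      show ?case using trig_invariants_const[of 1] by simp
    next
      case (Suc j)
      show ?case using trig_invariants_mult[OF root_product_invariant Suc] by simp
    qed
    have "(\<lambda>u. complex_of_real (root_product u) ^ m * \<phi> u) \<in> trig_invariants R"
      by (rule trig_invariants_mult[OF pw \<phi>])
    then have "(\<lambda>u. complex_of_real (F_fun R C k u) * (complex_of_real (root_product u) ^ m * \<phi> u)) \<in> F_trig R C k"
      by (rule F_trigI)
    then show F: "(\<lambda>u. of_real (\<omega> u) * \<phi> u) \<in> F_trig R C k" by (simp add: \<omega>_def mult.assoc)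
    obtain B where B: "\<And>u. cmod (\<phi> u) \<le> B" using bounded_TP[OF trig_invariants_TP[OF \<phi>]] by blast
    show "(\<lambda>u. of_real (\<omega> u) * \<phi> u) \<in> L2 ?M"
    proof (rule bounded_continuous_L2[OF F_trig_continuous[OF F]])
      fix u assume u: "u \<in> A"
      have "\<omega> u * cmod (\<phi> u) \<le> 1 * B" using \<omega>[OF u] B[of u] by (intro mult_mono) auto
      then show "cmod (of_real (\<omega> u) * \<phi> u) \<le> B" using \<omega>[OF u] by (simp add: norm_mult)
    qed
  qed
  have "\<exists>g\<in>F_trig R C k \<inter> L2 ?M. L2_norm ?M (\<lambda>x. f x - g x) < e" if f: "f \<in> L2 ?M" and e: "e > 0" for f e
  proof -
    have fm[measurable]: "f \<in> borel_measurable ?M" by (rule L2_measurable[OF f])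
    \<comment> \<open>Three errors have squared norm at most \<open>r\<close> each; the square of a
      sum of three terms costs the factor 3, and \<open>9 * r < e\<^sup>2\<close>.\<close>
    define r where "r = e\<^sup>2 / 10"
    have r: "r > 0" using e by (simp add: r_def)
    \<comment> \<open>This truncation makes the quotient of \<open>fn n\<close> by \<omega> bounded
      by \<open>n\<close>, although \<omega> may come arbitrarily close to 0.\<close>
    define fn where "fn = (\<lambda>n u. if cmod (f u) \<le> real n * \<omega> u then f u else 0)"
    have fnm[measurable]: "fn n \<in> borel_measurable ?M" for n unfolding fn_def by measurable
    have "(\<lambda>n. LINT u|?M. (cmod (f u - fn n u))\<^sup>2) \<longlonglongrightarrow> (LINT u|?M. (0::real))"
    proof (rule integral_dominated_convergence[where w = "\<lambda>u. (cmod (f u))\<^sup>2"])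
      show "integrable ?M (\<lambda>u. (cmod (f u))\<^sup>2)" by (rule L2_integrable[OF f])
      show "AE u in ?M. (\<lambda>n. (cmod (f u - fn n u))\<^sup>2) \<longlonglongrightarrow> 0"
      proof (rule AE_I2)
        fix u assume "u \<in> space ?M"
        then have u: "u \<in> A" by simp
        obtain N :: nat where N: "cmod (f u) / \<omega> u \<le> real N" using real_arch_simple by blast
        have "fn n u = f u" if "n \<ge> N" for n
        proof -
          have "cmod (f u) \<le> real N * \<omega> u" using N \<omega>[OF u] by (simp add: field_simps)
          also have "\<dots> \<le> real n * \<omega> u" using that \<omega>[OF u] by (intro mult_right_mono) auto
          finally show ?thesis by (simp add: fn_def)
        qed
        then have "eventually (\<lambda>n. (cmod (f u - fn n u))\<^sup>2 = 0) sequentially"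
          unfolding eventually_sequentially by (intro exI[of _ N]) simp
        then show "(\<lambda>n. (cmod (f u - fn n u))\<^sup>2) \<longlonglongrightarrow> 0" by (rule tendsto_eventually)
      qed
      show "AE u in ?M. norm ((cmod (f u - fn n u))\<^sup>2) \<le> (cmod (f u))\<^sup>2" for n
        by (rule AE_I2) (auto simp: fn_def)
    qed measurable
    then have "(\<lambda>n. LINT u|?M. (cmod (f u - fn n u))\<^sup>2) \<longlonglongrightarrow> 0" by simp
    then have "eventually (\<lambda>n. (LINT u|?M. (cmod (f u - fn n u))\<^sup>2) < r) sequentially"
      using r by (rule order_tendstoD)
    then obtain N0 where N0: "\<And>n. n \<ge> N0 \<Longrightarrow> (LINT u|?M. (cmod (f u - fn n u))\<^sup>2) < r"
      by (auto simp: eventually_sequentially)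
    define N where "N = Suc N0"
    have N: "(LINT u|?M. (cmod (f u - fn N u))\<^sup>2) < r" "real N > 0" using N0[of N] by (auto simp: N_def)
    define q where "q = (\<lambda>u. if u \<in> A then fn N u / of_real (\<omega> u) else 0)"
    have qb: "cmod (q u) \<le> real N" for u
    proof (cases "u \<in> A")
      case True
      have "cmod (fn N u) \<le> real N * \<omega> u" using \<omega>[OF True] by (auto simp: fn_def)
      then show ?thesis using True \<omega>[OF True] by (simp add: q_def norm_divide field_simps)
    qed (simp add: q_def)
    have "(\<lambda>u. fn N u / of_real (\<omega> u)) \<in> borel_measurable ?M" by measurable
    then have "q \<in> borel_measurable lebesgue"
      unfolding q_def by (rule borel_measurable_if_I[OF _ alcove_lebesgue(1)])
    then have "q measurable_on UNIV" by (rule lebesgue_measurable_imp_measurable_on) auto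
    then obtain Z g where Z: "negligible Z" "\<And>n. continuous_on UNIV (g n)"
      "\<And>x. x \<notin> Z \<Longrightarrow> (\<lambda>n. g n x) \<longlonglongrightarrow> q x" unfolding measurable_on_def by auto
    \<comment> \<open>The radial retraction to the disc of radius \<open>N\<close>. It fixes the
      values of \<open>q\<close> and makes the continuous approximations \<open>g n\<close>
      uniformly bounded.\<close>
    define c where "c = (\<lambda>z::complex. z * of_real (real N / max (real N) (cmod z)))"
    have cc: "continuous_on UNIV c" unfolding c_def using N(2) by (intro continuous_intros) auto
    have cb: "cmod (c z) \<le> real N" for z
      using N(2) by (auto simp: c_def norm_mult norm_divide max_def field_simps)
    have cq: "c (q u) = q u" for u using qb[of u] N(2) by (simp add: c_def max_def)
    define gc where "gc = (\<lambda>n u. c (g n u))"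
    have gcc: "continuous_on S (gc n)" for n S
      unfolding gc_def by (rule continuous_on_compose2[OF cc continuous_on_subset[OF Z(2)]]) auto
    have gcl: "(\<lambda>n. gc n u) \<longlonglongrightarrow> q u" if "u \<notin> Z" for u
    proof -
      have "isCont c (q u)" using cc by (simp add: continuous_on_eq_continuous_at)
      then have "(\<lambda>n. c (g n u)) \<longlonglongrightarrow> c (q u)" using Z(3)[OF that] by (rule isCont_tendsto_compose)
      then show ?thesis by (simp add: gc_def cq)
    qed
    have [measurable]: "gc n \<in> borel_measurable ?M" for n by (rule continuous_measurable_alcove[OF gcc])
    have fq: "fn N u = of_real (\<omega> u) * q u" if "u \<in> A" for u using that \<omega>[OF that] by (simp add: q_def)
    have "(\<lambda>n. LINT u|?M. (cmod (fn N u - of_real (\<omega> u) * gc n u))\<^sup>2) \<longlonglongrightarrow> (LINT u|?M. (0::real))"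
    proof (rule integral_dominated_convergence[where w = "\<lambda>u. (2 * real N)\<^sup>2"])
      have "AE u in lebesgue. u \<notin> Z" using Z(1) by (simp add: negligible_iff_null_sets AE_not_in)
      then have "AE u in ?M. u \<notin> Z"
        by (subst AE_restrict_space_iff) (use alcove_lebesgue in \<open>auto elim: eventually_mono\<close>)
      then show "AE u in ?M. (\<lambda>n. (cmod (fn N u - of_real (\<omega> u) * gc n u))\<^sup>2) \<longlonglongrightarrow> 0"
      proof (rule AE_mp, intro AE_I2 impI)
        fix u assume "u \<in> space ?M" "u \<notin> Z"
        then have u: "u \<in> A" "u \<notin> Z" by simp_all
        have "(\<lambda>n. (cmod (fn N u - of_real (\<omega> u) * gc n u))\<^sup>2) \<longlonglongrightarrow> (cmod (fn N u - of_real (\<omega> u) * q u))\<^sup>2"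
          by (intro tendsto_intros gcl u)
        then show "(\<lambda>n. (cmod (fn N u - of_real (\<omega> u) * gc n u))\<^sup>2) \<longlonglongrightarrow> 0" by (simp add: fq[OF u(1)])
      qed
      show "AE u in ?M. norm ((cmod (fn N u - of_real (\<omega> u) * gc n u))\<^sup>2) \<le> (2 * real N)\<^sup>2" for n
      proof (rule AE_I2)
        fix u assume "u \<in> space ?M"
        then have u: "u \<in> A" by simp
        have "cmod (fn N u - of_real (\<omega> u) * gc n u) = \<omega> u * cmod (q u - gc n u)"
          using \<omega>[OF u] by (simp add: fq[OF u] right_diff_distrib[symmetric] norm_mult)
        also have "\<dots> \<le> 1 * (real N + real N)"
          using \<omega>[OF u] qb[of u] cb[of "g n u"] norm_triangle_ineq4[of "q u" "gc n u"]
          by (intro mult_mono) (auto simp: gc_def)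
        finally have "cmod (fn N u - of_real (\<omega> u) * gc n u) \<le> 2 * real N" by simp
        from power_mono[OF this norm_ge_zero, of 2]
        show "norm ((cmod (fn N u - of_real (\<omega> u) * gc n u))\<^sup>2) \<le> (2 * real N)\<^sup>2" by simp
      qed
      show "(\<lambda>u. (cmod (fn N u - of_real (\<omega> u) * gc n u))\<^sup>2) \<in> borel_measurable ?M" for n by measurable
    qed simp_all
    then have "(\<lambda>n. LINT u|?M. (cmod (fn N u - of_real (\<omega> u) * gc n u))\<^sup>2) \<longlonglongrightarrow> 0" by simp
    then have "eventually (\<lambda>n. (LINT u|?M. (cmod (fn N u - of_real (\<omega> u) * gc n u))\<^sup>2) < r) sequentially"
      using r by (rule order_tendstoD)
    then obtain j where j: "(LINT u|?M. (cmod (fn N u - of_real (\<omega> u) * gc j u))\<^sup>2) < r"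
      by (auto simp: eventually_sequentially)
    define V where "V = measure ?M (space ?M)"
    have V: "V \<ge> 0" by (simp add: V_def)
    \<comment> \<open>Chosen so that the uniform error contributes at most \<open>r\<close> after
      integration over the volume \<open>V\<close>; \<open>V + 1\<close> keeps the denominator
      positive.\<close>
    define \<epsilon> where "\<epsilon> = sqrt (r / (V + 1))"
    have \<epsilon>: "\<epsilon> > 0" using r V by (simp add: \<epsilon>_def)
    have \<epsilon>2: "\<epsilon>\<^sup>2 * V \<le> r"
    proof -
      have "\<epsilon>\<^sup>2 * V = r * (V / (V + 1))" using r V by (simp add: \<epsilon>_def)
      also have "\<dots> \<le> r * 1" using r V by (intro mult_left_mono) auto
      finally show ?thesis by simp
    qed
    obtain \<phi> where \<phi>: "\<phi> \<in> trig_invariants R" "\<forall>u\<in>closure A. cmod (gc j u - \<phi> u) < \<epsilon>"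
      using approximate_continuous[OF gcc \<epsilon>] by blast
    define h where "h = (\<lambda>u. complex_of_real (\<omega> u) * \<phi> u)"
    have hmem: "h \<in> F_trig R C k \<inter> L2 ?M" unfolding h_def by (rule mem[OF \<phi>(1)])
    have i1: "integrable ?M (\<lambda>u. (cmod (f u - fn N u))\<^sup>2)"
      by (rule Bochner_Integration.integrable_bound[OF L2_integrable[OF f]], measurable) (auto intro!: AE_I2 simp: fn_def)
    have i2: "integrable ?M (\<lambda>u. (cmod (fn N u - of_real (\<omega> u) * gc j u))\<^sup>2)"
    proof (rule M.integrable_const_bound[where B = "(2 * real N)\<^sup>2"])
      show "AE u in ?M. norm ((cmod (fn N u - of_real (\<omega> u) * gc j u))\<^sup>2) \<le> (2 * real N)\<^sup>2"
      proof (rule AE_I2)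
        fix u assume "u \<in> space ?M"
        then have u: "u \<in> A" by simp
        have "cmod (fn N u - of_real (\<omega> u) * gc j u) = \<omega> u * cmod (q u - gc j u)"
          using \<omega>[OF u] by (simp add: fq[OF u] right_diff_distrib[symmetric] norm_mult)
        also have "\<dots> \<le> 1 * (real N + real N)"
          using \<omega>[OF u] qb[of u] cb[of "g j u"] norm_triangle_ineq4[of "q u" "gc j u"]
          by (intro mult_mono) (auto simp: gc_def)
        finally have "cmod (fn N u - of_real (\<omega> u) * gc j u) \<le> 2 * real N" by simp
        from power_mono[OF this norm_ge_zero, of 2]
        show "norm ((cmod (fn N u - of_real (\<omega> u) * gc j u))\<^sup>2) \<le> (2 * real N)\<^sup>2" by simp
      qed
    qed measurable
    have bound: "(cmod (f u - h u))\<^sup>2 \<le> 3 * (cmod (f u - fn N u))\<^sup>2 + 3 * (cmod (fn N u - of_real (\<omega> u) * gc j u))\<^sup>2 + 3 * \<epsilon>\<^sup>2"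
      if u: "u \<in> A" for u
    proof -
      let ?a = "cmod (f u - fn N u)" and ?b = "cmod (fn N u - of_real (\<omega> u) * gc j u)"
      let ?c = "cmod (of_real (\<omega> u) * gc j u - h u)"
      have "?c = \<omega> u * cmod (gc j u - \<phi> u)"
        using \<omega>[OF u] by (simp add: h_def right_diff_distrib[symmetric] norm_mult)
      also have "\<dots> \<le> 1 * \<epsilon>"
        using \<omega>[OF u] \<phi>(2) u closure_subset by (intro mult_mono) (auto intro: less_imp_le)
      finally have c: "?c \<le> \<epsilon>" by simp
      have "cmod (f u - h u) = cmod ((f u - fn N u) + (fn N u - of_real (\<omega> u) * gc j u) + (of_real (\<omega> u) * gc j u - h u))"
        by simp
      also have "\<dots> \<le> ?a + ?b + ?c"
        using norm_triangle_ineq[of "(f u - fn N u) + (fn N u - of_real (\<omega> u) * gc j u)" "of_real (\<omega> u) * gc j u - h u"]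
          norm_triangle_ineq[of "f u - fn N u" "fn N u - of_real (\<omega> u) * gc j u"] by linarith
      finally have "cmod (f u - h u) \<le> ?a + ?b + \<epsilon>" using c by linarith
      then have "(cmod (f u - h u))\<^sup>2 \<le> (?a + ?b + \<epsilon>)\<^sup>2" by (intro power_mono) auto
      also have "\<dots> \<le> 3 * ?a\<^sup>2 + 3 * ?b\<^sup>2 + 3 * \<epsilon>\<^sup>2"
      proof -
        have "(a + b + c)\<^sup>2 \<le> 3 * a\<^sup>2 + 3 * b\<^sup>2 + 3 * c\<^sup>2" for a b c :: real
        proof -
          have "0 \<le> (a - b)\<^sup>2 + (b - c)\<^sup>2 + (a - c)\<^sup>2" by simp
          then show ?thesis by (simp add: power2_eq_square algebra_simps)
        qed
        then show ?thesis .
      qed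
      finally show ?thesis .
    qed
    have "(LINT u|?M. (cmod (f u - h u))\<^sup>2) \<le>
        (LINT u|?M. 3 * (cmod (f u - fn N u))\<^sup>2 + 3 * (cmod (fn N u - of_real (\<omega> u) * gc j u))\<^sup>2 + 3 * \<epsilon>\<^sup>2)"
    proof (rule integral_mono)
      show "integrable ?M (\<lambda>u. (cmod (f u - h u))\<^sup>2)"
        using L2_integrable[OF L2_diff[OF f]] hmem by blast
      show "integrable ?M (\<lambda>u. 3 * (cmod (f u - fn N u))\<^sup>2 + 3 * (cmod (fn N u - of_real (\<omega> u) * gc j u))\<^sup>2 + 3 * \<epsilon>\<^sup>2)"
        by (intro Bochner_Integration.integrable_add integrable_mult_right i1 i2 M.integrable_const)
    qed (use bound in simp)
    also have "\<dots> = 3 * (LINT u|?M. (cmod (f u - fn N u))\<^sup>2)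
        + 3 * (LINT u|?M. (cmod (fn N u - of_real (\<omega> u) * gc j u))\<^sup>2) + 3 * \<epsilon>\<^sup>2 * V"
      using i1 i2 by (simp add: V_def)
    also have "\<dots> < 3 * r + 3 * r + 3 * r" using N(1) j \<epsilon>2 by linarith
    also have "\<dots> \<le> e\<^sup>2" by (simp add: r_def)
    finally have "L2_norm ?M (\<lambda>x. f x - h x) < e"
      unfolding L2_norm_def using e by (intro real_less_lsqrt) auto
    then show ?thesis using hmem by blast
  qed
  then show ?thesis unfolding L2_dense_def by blast
qed

end

section \<open>Essential self-adjointness of the Hamiltonian\<close>

lemma fspan_mult:
  "f \<in> fspan B \<Longrightarrow> (\<lambda>u. F u * f u) \<in> fspan ((\<lambda>b u. F u * b u) ` B)"
proof (induction rule: fspan.induct)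
  case fspan_zero
  show ?case by (simp add: fspan.fspan_zero)
next
  case (fspan_step f b c)
  have "(\<lambda>u. F u * f u + c * (F u * b u)) \<in> fspan ((\<lambda>b u. F u * b u) ` B)"
    by (rule fspan.fspan_step[OF fspan_step(3) imageI[OF fspan_step(2)]])
  then show ?case by (simp add: algebra_simps)
qed

lemma fspan_mult_cases:
  "d \<in> fspan ((\<lambda>b u. F u * b u) ` B) \<Longrightarrow> \<exists>f\<in>fspan B. d = (\<lambda>u. F u * f u)"
proof (induction rule: fspan.induct)
  case fspan_zero
  show ?case by (rule bexI[OF _ fspan.fspan_zero]) simp
next
  case (fspan_step d b c)
  then obtain f b' where f: "f \<in> fspan B" "d = (\<lambda>u. F u * f u)" "b' \<in> B" "b = (\<lambda>u. F u * b' u)" by blast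
  show ?case
    by (rule bexI[OF _ fspan.fspan_step[OF f(1,3), of c]]) (simp add: f(2,4) algebra_simps)
qed

context alcove
begin

text \<open>The coefficients of \<open>Lop\<close> are real. \<open>Lop_symmetric\<close> is a
  bilinear statement, and this converts it to the sesquilinear inner product.\<close>

lemma Lop_cnj:
  assumes f: "f \<in> TP"
  shows "Lop k (\<lambda>u. cnj (f u)) u = cnj (Lop k f u)"
proof -
  have c: "dderiv v (\<lambda>u. cnj (g u)) = (\<lambda>u. cnj (dderiv v g u))" if "g \<in> TP" for g v
    using has_dderiv_TP(1)[OF that, of v] bounded_linear.has_vector_derivative[OF bounded_linear_cnj]
    by (intro dderivI) (auto simp: has_dderiv_def)
  show ?thesis
    unfolding Lop_def c[OF f] c[OF has_dderiv_TP(2)[OF f]] by simp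
qed

lemma F_trig_L2:
  assumes "(\<lambda>u. complex_of_real (F_fun R C k u)) \<in> L2 (lebesgue_on A)"
  shows "F_trig R C k \<subseteq> L2 (lebesgue_on A)"
proof
  fix f assume f: "f \<in> F_trig R C k"
  then obtain \<phi> where \<phi>: "f = (\<lambda>u. complex_of_real (F_fun R C k u) * \<phi> u)" "\<phi> \<in> trig_invariants R"
    unfolding F_trig_def by blast
  obtain B where B: "\<And>u. cmod (\<phi> u) \<le> B" using bounded_TP[OF trig_invariants_TP[OF \<phi>(2)]] by blast
  have meas: "f \<in> borel_measurable (lebesgue_on A)"
    by (rule continuous_measurable_alcove[OF F_trig_continuous[OF f]])
  have "integrable (lebesgue_on A) (\<lambda>u. (cmod (f u))\<^sup>2)"
  proof (rule Bochner_Integration.integrable_bound)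
    show "integrable (lebesgue_on A) (\<lambda>u. B\<^sup>2 * (cmod (complex_of_real (F_fun R C k u)))\<^sup>2)"
      by (rule integrable_mult_right[OF L2_integrable[OF assms]])
    show "(\<lambda>u. (cmod (f u))\<^sup>2) \<in> borel_measurable (lebesgue_on A)" using meas by measurable
    show "AE u in lebesgue_on A. norm ((cmod (f u))\<^sup>2) \<le> norm (B\<^sup>2 * (cmod (complex_of_real (F_fun R C k u)))\<^sup>2)"
    proof (rule AE_I2)
      fix u
      have "(cmod (f u))\<^sup>2 = (cmod (\<phi> u))\<^sup>2 * (F_fun R C k u)\<^sup>2"
        by (simp add: \<phi>(1) norm_mult power_mult_distrib mult.commute)
      also have "\<dots> \<le> B\<^sup>2 * (F_fun R C k u)\<^sup>2" by (intro mult_right_mono power_mono B) auto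
      finally show "norm ((cmod (f u))\<^sup>2) \<le> norm (B\<^sup>2 * (cmod (complex_of_real (F_fun R C k u)))\<^sup>2)"
        by (simp add: abs_mult)
    qed
  qed
  then show "f \<in> L2 (lebesgue_on A)" using meas by (simp add: L2_def)
qed

lemma F_trig_subspace:
  assumes "(\<lambda>u. complex_of_real (F_fun R C k u)) \<in> L2 (lebesgue_on A)"
  shows "L2_subspace (lebesgue_on A) (F_trig R C k)"
  unfolding L2_subspace_def
proof (intro conjI ballI allI)
  show "F_trig R C k \<subseteq> L2 (lebesgue_on A)" by (rule F_trig_L2[OF assms])
  show "(\<lambda>x. 0) \<in> F_trig R C k" using F_trigI[OF trig_invariants_const[of 0], of k] by simp
  fix f assume "f \<in> F_trig R C k"
  then obtain \<phi> where \<phi>: "f = (\<lambda>u. complex_of_real (F_fun R C k u) * \<phi> u)" "\<phi> \<in> trig_invariants R"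
    unfolding F_trig_def by blast
  show "(\<lambda>x. z * f x) \<in> F_trig R C k" for z
    using F_trigI[OF trig_invariants_scale[OF \<phi>(2), of z], of k] by (simp add: \<phi>(1) mult.left_commute)
  fix g assume "g \<in> F_trig R C k"
  then obtain \<psi> where \<psi>: "g = (\<lambda>u. complex_of_real (F_fun R C k u) * \<psi> u)" "\<psi> \<in> trig_invariants R"
    unfolding F_trig_def by blast
  show "(\<lambda>x. f x + g x) \<in> F_trig R C k"
    using F_trigI[OF trig_invariants_add[OF \<phi>(2) \<psi>(2)], of k] by (simp add: \<phi>(1) \<psi>(1) distrib_left)
qed

lemma F_trig_dense_if_L2:
  assumes "(\<lambda>u. complex_of_real (F_fun R C k u)) \<in> L2 (lebesgue_on A)"
  shows "L2_dense (lebesgue_on A) (F_trig R C k)"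
  using F_trig_dense[of k] F_trig_L2[OF assms] by (simp add: Int_absorb2)

theorem hamiltonian_essentially_self_adjoint:
  assumes irr: "irreducible_root_system R" and k: "\<And>c. c \<in> root_lengths R \<Longrightarrow> k c \<ge> 0"
  shows "essentially_self_adjoint (lebesgue_on A) (hamiltonian R C k) (F_trig R C k)"
proof -
  let ?M = "lebesgue_on A"
  define F where "F = (\<lambda>u. complex_of_real (F_fun R C k u))"
  have F: "(\<lambda>u. complex_of_real (F_fun R C k u)) \<in> L2 ?M"
  proof (rule bounded_continuous_L2)
    show "continuous_on A (\<lambda>u. complex_of_real (F_fun R C k u))"
      by (rule continuous_on_of_real[OF continuous_F_fun])
    show "cmod (complex_of_real (F_fun R C k u)) \<le> 1" if "u \<in> A" for u
      using F_fun_le_1[OF k that] F_fun_pos[OF that, of k] by simp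
  qed
  have T: "\<exists>h\<in>low_degree r. (\<forall>u\<in>A. hamiltonian R C k (\<lambda>u. F u * \<phi> u) u = F u * h u) \<and>
      (\<forall>u\<in>A. h u = of_real (ground_energy k) * \<phi> u - Lop k \<phi> u)"
    if \<phi>: "\<phi> \<in> low_degree r" for \<phi> r
  proof -
    obtain h where h: "h \<in> low_degree r" "\<forall>u\<in>A. Lop k \<phi> u = h u" using Lop_low_degree[OF \<phi>] by blast
    have "(\<lambda>u. of_real (ground_energy k) * \<phi> u + (-1) * h u) \<in> low_degree r"
      using \<phi> h(1) unfolding low_degree_def by (intro fspan_add fspan_scale)
    moreover have "\<phi> \<in> trig_invariants R" using \<phi> low_degree_invariant by blast
    ultimately show ?thesis
      using hamiltonian_F[OF irr, of \<phi> _ k] h(2)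
      by (intro bexI[of _ "\<lambda>u. of_real (ground_energy k) * \<phi> u + (-1) * h u"]) (auto simp: F_def)
  qed
  show ?thesis
  proof (rule essentially_self_adjointI[OF F_trig_subspace[OF F] F_trig_dense_if_L2[OF F]])
    fix f g assume "f \<in> F_trig R C k" "g \<in> F_trig R C k"
    then obtain \<phi> \<psi> where \<phi>: "f = (\<lambda>u. F u * \<phi> u)" "\<phi> \<in> trig_invariants R"
      and \<psi>: "g = (\<lambda>u. F u * \<psi> u)" "\<psi> \<in> trig_invariants R"
      unfolding F_trig_def F_def by blast
    obtain r1 where r1: "\<phi> \<in> low_degree r1" using trig_invariants_low_degree[OF \<phi>(2)] by blast
    obtain r2 where r2: "\<psi> \<in> low_degree r2" using trig_invariants_low_degree[OF \<psi>(2)] by blast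
    show "\<exists>E. finite E \<and> E \<subseteq> F_trig R C k \<and> f \<in> fspan E \<and> g \<in> fspan E \<and>
        (\<forall>d\<in>fspan E. \<exists>h\<in>fspan E. \<forall>x\<in>space ?M. hamiltonian R C k d x = h x)"
    proof -
      define r where "r = max r1 r2"
      have lr: "\<phi> \<in> low_degree r" "\<psi> \<in> low_degree r"
        using r1 r2 low_degree_mono[of r1 r] low_degree_mono[of r2 r] by (auto simp: r_def)
      \<comment> \<open>One ball contains the weights of both functions, so a single
        finite-dimensional space serves \<open>f\<close> and \<open>g\<close>.\<close>
      define E where "E = (\<lambda>b u. F u * b u) ` orbit_sum ` (P \<inter> {\<mu>. norm \<mu> \<le> r})"
      have "finite E" unfolding E_def by (intro finite_imageI finite_weights_ball)
      moreover have "E \<subseteq> F_trig R C k"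
      proof
        fix d assume "d \<in> E"
        then obtain \<mu> where "\<mu> \<in> P" "d = (\<lambda>u. F u * orbit_sum \<mu> u)" by (auto simp: E_def)
        then show "d \<in> F_trig R C k" using F_trigI[OF orbit_sum_invariant, of \<mu> k] by (simp add: F_def)
      qed
      moreover have "f \<in> fspan E" "g \<in> fspan E"
        using lr unfolding \<phi>(1) \<psi>(1) E_def low_degree_def by (auto intro: fspan_mult)
      moreover have "\<exists>h\<in>fspan E. \<forall>x\<in>space ?M. hamiltonian R C k d x = h x" if d: "d \<in> fspan E" for d
      proof -
        obtain \<xi> where \<xi>: "\<xi> \<in> low_degree r" "d = (\<lambda>u. F u * \<xi> u)"
          using fspan_mult_cases[OF d[unfolded E_def]] by (auto simp: low_degree_def)
        obtain h where h: "h \<in> low_degree r" "\<forall>u\<in>A. hamiltonian R C k (\<lambda>u. F u * \<xi> u) u = F u * h u"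
          using T[OF \<xi>(1)] by blast
        have "(\<lambda>u. F u * h u) \<in> fspan E"
          using h(1) unfolding E_def low_degree_def by (rule fspan_mult)
        then show ?thesis using h(2) by (intro bexI[of _ "\<lambda>u. F u * h u"]) (auto simp: \<xi>(2))
      qed
      ultimately show ?thesis by blast
    qed
    obtain h1 where h1: "h1 \<in> low_degree r1" "\<And>u. u \<in> A \<Longrightarrow> hamiltonian R C k f u = F u * h1 u"
      "\<And>u. u \<in> A \<Longrightarrow> h1 u = of_real (ground_energy k) * \<phi> u - Lop k \<phi> u"
      using T[OF r1] unfolding \<phi>(1) by blast
    obtain h2 where h2: "h2 \<in> low_degree r2" "\<And>u. u \<in> A \<Longrightarrow> hamiltonian R C k g u = F u * h2 u"
      "\<And>u. u \<in> A \<Longrightarrow> h2 u = of_real (ground_energy k) * \<psi> u - Lop k \<psi> u"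
      using T[OF r2] unfolding \<psi>(1) by blast
    have L: "(\<lambda>u. F u * h u) \<in> L2 ?M" if "h \<in> trig_invariants R" for h
      using F_trigI[OF that, of k] F_trig_L2[OF F] by (auto simp: F_def)
    have hi: "h1 \<in> trig_invariants R" "h2 \<in> trig_invariants R"
      by (rule subsetD[OF low_degree_invariant h1(1)], rule subsetD[OF low_degree_invariant h2(1)])
    let ?\<xi> = "\<lambda>u. cnj (\<psi> u)"
    have "L2_inner ?M (hamiltonian R C k f) g - L2_inner ?M f (hamiltonian R C k g) =
        L2_inner ?M (\<lambda>u. F u * h1 u) (\<lambda>u. F u * \<psi> u) - L2_inner ?M (\<lambda>u. F u * \<phi> u) (\<lambda>u. F u * h2 u)"
      using h1(2) h2(2) by (intro arg_cong2[of _ _ _ _ "(-)"] L2_inner_cong) (auto simp: \<phi>(1) \<psi>(1))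
    also have "\<dots> = (LINT u|?M. (F u * h1 u) * cnj (F u * \<psi> u) - (F u * \<phi> u) * cnj (F u * h2 u))"
      unfolding L2_inner_def
      by (rule Bochner_Integration.integral_diff[symmetric]) (intro L2_mult_integrable L \<phi> \<psi> hi)+
    also have "\<dots> = (LINT u|?M. - (of_real ((F_fun R C k u)\<^sup>2) * (?\<xi> u * Lop k \<phi> u - \<phi> u * Lop k ?\<xi> u)))"
    proof (rule Bochner_Integration.integral_cong[OF HOL.refl])
      fix u assume "u \<in> space ?M"
      then have u: "u \<in> A" by simp
      show "(F u * h1 u) * cnj (F u * \<psi> u) - (F u * \<phi> u) * cnj (F u * h2 u) =
          - (of_real ((F_fun R C k u)\<^sup>2) * (?\<xi> u * Lop k \<phi> u - \<phi> u * Lop k ?\<xi> u))"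
        unfolding h1(3)[OF u] h2(3)[OF u] Lop_cnj[OF trig_invariants_TP[OF \<psi>(2)]]
        by (simp add: F_def power2_eq_square algebra_simps)
    qed
    also have "\<dots> = 0"
      using Lop_symmetric[OF k \<phi>(2) trig_invariants_cnj[OF \<psi>(2)]] by simp
    finally show "L2_inner ?M (hamiltonian R C k f) g = L2_inner ?M f (hamiltonian R C k g)" by simp
  qed
qed

end

text \<open>The constant 1 is an invariant, so the domain lies in \<open>L2\<close> exactly when
  \<open>F_fun\<close> is square integrable. For arbitrary real \<open>k\<close> this can fail;
  density is therefore asserted for the square-integrable elements, and for the full domain whenever
  it is contained in \<open>L2\<close>. Nonnegative multiplicities make \<open>F_fun\<close> bounded
  on the alcove.\<close>

theorem theorem2:
  fixes R C A :: "'a::euclidean_space set" and k :: "real \<Rightarrow> real"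
  assumes "irreducible_root_system R"
    and "weyl_chamber R C"
    and "fundamental_alcove R C A"
  shows "L2_dense (lebesgue_on A) (F_trig R C k \<inter> L2 (lebesgue_on A))
    \<and> ((\<lambda>u. complex_of_real (F_fun R C k u)) \<in> L2 (lebesgue_on A) \<longrightarrow>
         L2_subspace (lebesgue_on A) (F_trig R C k) \<and> L2_dense (lebesgue_on A) (F_trig R C k))
    \<and> ((\<forall>c\<in>root_lengths R. k c \<ge> 0) \<longrightarrow>
         essentially_self_adjoint (lebesgue_on A) (hamiltonian R C k) (F_trig R C k))"
proof -
  interpret alcove R C A
    using assms by unfold_locales (simp_all add: irreducible_root_system_def)
  show ?thesis
    using F_trig_dense F_trig_subspace F_trig_dense_if_L2 hamiltonian_essentially_self_adjoint[OF assms(1)]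
    by blast
qed

end
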